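(* Let $N\ge1$ be an integer and let $A$ be a Jacobi matrix with asymptotically $N$-periodic entries $(a_n)$, $(b_n)$, with associated $N$-periodic sequences $(\alpha_n)$, $(\beta_n)$. Suppose that there is an integer $r\ge1$ such that for every $i\in\{0,1,\ldots,N-1\}$, $$\Big(\frac{a_{kN+i-1}}{a_{kN+i}} : k\in\mathbb{N}\Big),\ \Big(\frac{b_{kN+i}}{a_{kN+i}} : k\in\mathbb{N}\Big),\ \Big(\frac{1}{a_{kN+i}} : k\in\mathbb{N}\Big) \in \mathcal{D}_r.$$ Let $K$ be a compact interval with non-empty interior contained in $\Lambda=\{x\in\mathbb{R} : |\operatorname{tr}\mathfrak{X}_0(x)|<2\}$. Then $$K_n(x,x)=\frac{\omega'(x)}{\mu'(x)}\rho_n+E_n(x) \qquad\text{with}\qquad \lim_{n\to\infty}\frac{1}{\rho_n}\sup_{x\in K}|E_n(x)|=0,$$ where $\omega$ is the equilibrium measure corresponding to $\sigma_{\mathrm{ess}}(\mathfrak{A})$, with $\mathfrak{A}$ being the Jacobi matrix associated to $(\alpha_n : n\in\mathbb{N}_0)$ and $(\beta_n : n\in\mathbb{N}_0)$, and $\rho_n=\sum_{j=0}^n\frac{\alpha_j}{a_j}$.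
   Context: $(a_n)_{n\ge 0}$ is a sequence of positive numbers and $(b_n)_{n\ge0}$ a sequence of real numbers. The Jacobi matrix $A$ associated to them is the closure in $\ell^2(\mathbb{N}_0)$ of the operator given on finitely supported sequences by the symmetric tridiagonal matrix with diagonal $b_0,b_1,\ldots$ and off-diagonal $a_0,a_1,\ldots$. The polynomials $(p_n)_{n\ge 0}$ are defined by $p_0(x)=1$, $p_1(x)=(x-b_0)/a_0$, and $x p_n(x) = a_n p_{n+1}(x)+b_n p_n(x)+a_{n-1}p_{n-1}(x)$ for $n\ge1$. The Christoffel–Darboux kernel is $K_n(x,y)=\sum_{j=0}^np_j(x)p_j(y)$. $A$ has asymptotically $N$-periodic entries if there are $N$-periodic sequences $(\alpha_n:n\in\mathbb{Z})$ of positive numbers and $(\beta_n:n\in\mathbb{Z})$ of real numbers with $\lim|a_n-\alpha_n|=0$ and $\lim|b_n-\beta_n|=0$. Since $(a_n)$ is bounded, there is a unique probability measure $\mu$ on $\mathbb{R}$ for which $(p_n)$ is orthonormal in $L^2(\mathbb{R},\mu)$. It is a known fact that, under the hypotheses of the claim, $\mu$ is purely absolutely continuous on $K$ with continuous positive density; $\mu'$ denotes this density. Set $\mathfrak{B}_j(x)=\begin{pmatrix}0&1\\ -\frac{\alpha_{j-1}}{\alpha_j}&\frac{x-\beta_j}{\alpha_j}\end{pmatrix}$ and $\mathfrak{X}_n(x)=\mathfrak{B}_{n+N-1}(x)\cdots\mathfrak{B}_n(x)$. Stolz class: a real sequence $(x_n)$ belongs to $\mathcal{D}_r$ if it is bounded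 and for each $j\in\{1,\ldots,r\}$, $\sum_{n}|\Delta^jx_n|^{r/j}<\infty$, where $\Delta^0x_n=x_n$, $\Delta^jx_n=\Delta^{j-1}x_{n+1}-\Delta^{j-1}x_n$. $\sigma_{\mathrm{ess}}$ is the essential spectrum; $\sigma_{\mathrm{ess}}(\mathfrak{A})$ is a finite union of compact intervals with non-empty interior. Equilibrium measure: for a compact set $F\subset\mathbb{R}$ with non-empty interior, its equilibrium measure is the unique probability measure minimizing $I(\nu)=-\iint\log|x-y|\,\nu(dx)\,\nu(dy)$ among probability measures $\nu$ supported on $F$. It is absolutely continuous with continuous density in the interior of $F$; $\omega'$ denotes the density of $\omega$. *)

theory Defs
  imports "HOL-Probability.Probability"
begin

section \<open>Jacobi matrices as operators on square-summable complex sequences\<close>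

definition ell2 :: "(nat \<Rightarrow> complex) set" where
  "ell2 = {f. summable (\<lambda>n. (cmod (f n))\<^sup>2)}"

definition ell2_norm :: "(nat \<Rightarrow> complex) \<Rightarrow> real" where
  "ell2_norm f = sqrt (\<Sum>n. (cmod (f n))\<^sup>2)"

definition tridiag :: "(nat \<Rightarrow> real) \<Rightarrow> (nat \<Rightarrow> real) \<Rightarrow> (nat \<Rightarrow> complex) \<Rightarrow> nat \<Rightarrow> complex" where
  "tridiag a b f n =
     (if n = 0 then 0 else of_real (a (n - 1)) * f (n - 1)) + of_real (b n) * f n
     + of_real (a n) * f (Suc n)"

text \<open>
  Operators are represented by their graphs. The Jacobi matrix is the closure in
  \<open>ell2 \<times> ell2\<close> of the graph of the tridiagonal action on finitely supported sequences.
\<close>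

definition jacobi_matrix ::
  "(nat \<Rightarrow> real) \<Rightarrow> (nat \<Rightarrow> real) \<Rightarrow> ((nat \<Rightarrow> complex) \<times> (nat \<Rightarrow> complex)) set" where
  "jacobi_matrix a b = {(f, g). f \<in> ell2 \<and> g \<in> ell2 \<and>
     (\<exists>F :: nat \<Rightarrow> nat \<Rightarrow> complex. (\<forall>k. finite {n. F k n \<noteq> 0}) \<and>
        (\<lambda>k. ell2_norm (\<lambda>n. F k n - f n)) \<longlonglongrightarrow> 0 \<and>
        (\<lambda>k. ell2_norm (\<lambda>n. tridiag a b (F k) n - g n)) \<longlonglongrightarrow> 0)}"

definition resolvent_set :: "((nat \<Rightarrow> complex) \<times> (nat \<Rightarrow> complex)) set \<Rightarrow> complex set" where
  "resolvent_set T = {z.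
     (\<forall>g\<in>ell2. \<exists>!f. (f, \<lambda>n. g n + z * f n) \<in> T) \<and>
     (\<exists>C. \<forall>(f, h)\<in>T. ell2_norm f \<le> C * ell2_norm (\<lambda>n. h n - z * f n))}"

definition spectrum :: "((nat \<Rightarrow> complex) \<times> (nat \<Rightarrow> complex)) set \<Rightarrow> complex set" where
  "spectrum T = - resolvent_set T"

definition eigenspace ::
  "((nat \<Rightarrow> complex) \<times> (nat \<Rightarrow> complex)) set \<Rightarrow> complex \<Rightarrow> (nat \<Rightarrow> complex) set" where
  "eigenspace T z = {f. (f, \<lambda>n. z * f n) \<in> T}"

definition finite_dimensional :: "(nat \<Rightarrow> complex) set \<Rightarrow> bool" where
  "finite_dimensional E \<longleftrightarrow>
     (\<exists>S. finite S \<and> (\<forall>f\<in>E. \<exists>c. \<forall>n. f n = (\<Sum>s\<in>S. c s * s n)))"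

text \<open>
  Essential spectrum of a self-adjoint operator: the spectrum without the isolated eigenvalues
  of finite multiplicity. Since the operator is self-adjoint, the set is real, and multiplicity
  is the dimension of the eigenspace.
\<close>

definition discrete_spectrum :: "((nat \<Rightarrow> complex) \<times> (nat \<Rightarrow> complex)) set \<Rightarrow> complex set" where
  "discrete_spectrum T = {z. z isolated_in spectrum T \<and>
     eigenspace T z \<noteq> {\<lambda>n. 0} \<and> finite_dimensional (eigenspace T z)}"

definition essential_spectrum :: "((nat \<Rightarrow> complex) \<times> (nat \<Rightarrow> complex)) set \<Rightarrow> real set" where
  "essential_spectrum T = {x. complex_of_real x \<in> spectrum T - discrete_spectrum T}"


section \<open>Orthogonal polynomials\<close>

fun orth_poly :: "(nat \<Rightarrow> real) \<Rightarrow> (nat \<Rightarrow> real) \<Rightarrow> nat \<Rightarrow> real \<Rightarrow> real" where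
  "orth_poly a b 0 x = 1"
| "orth_poly a b (Suc 0) x = (x - b 0) / a 0"
| "orth_poly a b (Suc (Suc n)) x =
     ((x - b (Suc n)) * orth_poly a b (Suc n) x - a n * orth_poly a b n x) / a (Suc n)"

definition CD_kernel :: "(nat \<Rightarrow> real) \<Rightarrow> (nat \<Rightarrow> real) \<Rightarrow> nat \<Rightarrow> real \<Rightarrow> real \<Rightarrow> real" where
  "CD_kernel a b n x y = (\<Sum>j\<le>n. orth_poly a b j x * orth_poly a b j y)"

definition orthonormality_measure ::
  "(nat \<Rightarrow> real) \<Rightarrow> (nat \<Rightarrow> real) \<Rightarrow> real measure \<Rightarrow> bool" where
  "orthonormality_measure a b \<mu> \<longleftrightarrow>
     prob_space \<mu> \<and> sets \<mu> = sets borel \<and>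
     (\<forall>m n. integrable \<mu> (\<lambda>x. orth_poly a b m x * orth_poly a b n x) \<and>
        (LINT x|\<mu>. orth_poly a b m x * orth_poly a b n x) = (if m = n then 1 else 0))"


section \<open>Asymptotically periodic entries\<close>

definition periodic_seq :: "nat \<Rightarrow> (int \<Rightarrow> real) \<Rightarrow> bool" where
  "periodic_seq N \<gamma> \<longleftrightarrow> (\<forall>n. \<gamma> (n + int N) = \<gamma> n)"

definition asymptotically_periodic ::
  "nat \<Rightarrow> (nat \<Rightarrow> real) \<Rightarrow> (nat \<Rightarrow> real) \<Rightarrow> (int \<Rightarrow> real) \<Rightarrow> (int \<Rightarrow> real) \<Rightarrow> bool" where
  "asymptotically_periodic N a b \<alpha> \<beta> \<longleftrightarrow>
     periodic_seq N \<alpha> \<and> (\<forall>n. \<alpha> n > 0) \<and> periodic_seq N \<beta> \<and>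
     (\<lambda>n. \<bar>a n - \<alpha> (int n)\<bar>) \<longlonglongrightarrow> 0 \<and> (\<lambda>n. \<bar>b n - \<beta> (int n)\<bar>) \<longlonglongrightarrow> 0"

definition transfer_matrix ::
  "(int \<Rightarrow> real) \<Rightarrow> (int \<Rightarrow> real) \<Rightarrow> int \<Rightarrow> real \<Rightarrow> real^2^2" where
  "transfer_matrix \<alpha> \<beta> j x =
     vector [vector [0, 1], vector [- \<alpha> (j - 1) / \<alpha> j, (x - \<beta> j) / \<alpha> j]]"

text \<open>\<open>transfer_prod \<alpha> \<beta> k n x\<close> is the product of the \<open>k\<close> transfer matrices with indices
  \<open>n + k - 1, \<dots>, n\<close>, in this order.\<close>

fun transfer_prod ::
  "(int \<Rightarrow> real) \<Rightarrow> (int \<Rightarrow> real) \<Rightarrow> nat \<Rightarrow> int \<Rightarrow> real \<Rightarrow> real^2^2" where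
  "transfer_prod \<alpha> \<beta> 0 n x = mat 1"
| "transfer_prod \<alpha> \<beta> (Suc k) n x =
     transfer_matrix \<alpha> \<beta> (n + int k) x ** transfer_prod \<alpha> \<beta> k n x"

fun fwd_diff :: "nat \<Rightarrow> (nat \<Rightarrow> real) \<Rightarrow> nat \<Rightarrow> real" where
  "fwd_diff 0 x n = x n"
| "fwd_diff (Suc j) x n = fwd_diff j x (Suc n) - fwd_diff j x n"

definition stolz_class :: "nat \<Rightarrow> (nat \<Rightarrow> real) set" where
  "stolz_class r = {x. bounded (range x) \<and>
     (\<forall>j\<in>{1..r}. summable (\<lambda>n. \<bar>fwd_diff j x n\<bar> powr (real r / real j)))}"


section \<open>Equilibrium measures and densities\<close>

text \<open>The logarithmic kernel has to be infinite on the diagonal, whereas \<open>ln 0 = 0\<close>.\<close>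

definition log_kernel :: "real \<Rightarrow> real \<Rightarrow> ereal" where
  "log_kernel x y = (if x = y then \<infinity> else ereal (- ln \<bar>x - y\<bar>))"

text \<open>The integral is taken as that of the positive part minus that of the negative part
  (the map \<open>e2ennreal\<close> truncates at 0); the latter is finite when \<open>\<nu>\<close> has compact support.\<close>

definition log_energy :: "real measure \<Rightarrow> ereal" where
  "log_energy \<nu> =
     enn2ereal (\<integral>\<^sup>+x. (\<integral>\<^sup>+y. e2ennreal (log_kernel x y) \<partial>\<nu>) \<partial>\<nu>)
     - enn2ereal (\<integral>\<^sup>+x. (\<integral>\<^sup>+y. e2ennreal (- log_kernel x y) \<partial>\<nu>) \<partial>\<nu>)"

text \<open>For closed \<open>F\<close>, these are the Borel probability measures with support in \<open>F\<close>.\<close>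

definition prob_measures_on :: "real set \<Rightarrow> real measure set" where
  "prob_measures_on F = {\<nu>. prob_space \<nu> \<and> sets \<nu> = sets borel \<and> emeasure \<nu> (- F) = 0}"

definition equilibrium_measure :: "real set \<Rightarrow> real measure \<Rightarrow> bool" where
  "equilibrium_measure F \<omega> \<longleftrightarrow>
     \<omega> \<in> prob_measures_on F \<and> (\<forall>\<nu>\<in>prob_measures_on F. log_energy \<omega> \<le> log_energy \<nu>)"

definition is_continuous_density :: "real measure \<Rightarrow> real set \<Rightarrow> (real \<Rightarrow> real) \<Rightarrow> bool" where
  "is_continuous_density \<mu> S f \<longleftrightarrow>
     continuous_on S f \<and> (\<forall>x\<in>S. f x \<ge> 0) \<and>
     (\<forall>B\<in>sets borel. B \<subseteq> S \<longrightarrow> emeasure \<mu> B = (\<integral>\<^sup>+x\<in>B. ennreal (f x) \<partial>lborel))"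

text \<open>If \<open>S\<close> is open or a non-degenerate interval, the values on \<open>S\<close> of a continuous density
  on \<open>S\<close> are unique, so that the choice is immaterial there.\<close>

definition continuous_density :: "real measure \<Rightarrow> real set \<Rightarrow> real \<Rightarrow> real" where
  "continuous_density \<mu> S = (SOME f. is_continuous_density \<mu> S f)"

end

theory Submission
 imports Defs "HOL-Computational_Algebra.Fundamental_Theorem_Algebra"
begin

text \<open>
 On the elliptic set the transfer recurrence over one period is conjugated to a rotation by an
 approximate fixed point of the associated Riccati map. Each Newton step gains one order of
 differences, so after \<open>r\<close> steps the Stolz condition makes the error summable. The rotation
 phases average out and \<open>K_n(x,x)/n\<close> converges uniformly to a positive function \<open>H\<close>.

 To identify \<open>H\<close>, compare moments. Those of \<open>K_n(x,x)/n \<mu>\<close> tend to the traces per period of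
 the powers of the periodic Jacobi matrix; via the diagonal Green function these are the moments of
 the density of states, the average over \<open>t\<close> of point masses at the solutions of \<open>D x = 2 cos t\<close>,
 where \<open>D\<close> is the discriminant. Hence \<open>H \<mu>' = w\<close> on \<open>K\<close> for its density \<open>w\<close>. Since \<open>D - 2 cos t\<close>
 factorises over the bands and \<open>ln (2 |s - cos t|)\<close> has mean zero for \<open>|s| \<le> 1\<close>, the logarithmic
 potential of the density of states is constant on the bands, so it is the equilibrium measure. The
 essential spectrum enters only up to a finite set, which carries no mass.
\<close>

subsection \<open>Uniform limits and averages\<close>

text \<open>With coefficients that vary from block to block there is no exact conjugation to a
  rotation. For a slope \<open>m\<close> carried along by the Riccati map of each block, however,
  \<open>v = w - m * u\<close> is multiplied by a scalar at every step and
  \<open>(cmod v)^2 * \<tau> / \<bar>Im m\<bar>\<close> is conserved. The fixed point of the map of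
  each single block is the first guess for \<open>m\<close>; its error is its own increment, which
  for \<open>r > 1\<close> need not be summable. Dividing the error by one minus the derivative of
  the Riccati map and subtracting leaves a square and the increment of the correction, both smaller
  by one factor of a weight whose \<open>r\<close>-th power is summable. Ellipticity enters three
  times: non-real slopes let \<open>v\<close> control \<open>u\<close> and \<open>w\<close>, the
  derivative of the Riccati map stays away from 1 so that the correction exists, and the same gap
  lets the squared phases cancel on average. The limit \<open>H\<close> is compared with the weak
  limit through continuous functions that vanish outside an interval of uniform convergence; hence
  that interval is taken slightly larger than \<open>K\<close>.\<close>

abbreviation evK :: "'x set \<Rightarrow> (nat \<Rightarrow> 'x \<Rightarrow> bool) \<Rightarrow> bool" where
 "evK K P \<equiv> \<forall>\<^sub>F k in sequentially. \<forall>x\<in>K. P k x"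

text \<open>The limit is required to be bounded because uniform convergence passes to products only
  for bounded limits.\<close>

definition ulim :: "'x set \<Rightarrow> (nat \<Rightarrow> 'x \<Rightarrow> 'b::real_normed_field) \<Rightarrow> ('x \<Rightarrow> 'b) \<Rightarrow> bool" where
 "ulim K f l \<longleftrightarrow> uniform_limit K f l sequentially \<and> bounded (l ` K)"

lemma ulim_uniform_limit: "ulim K f l \<Longrightarrow> uniform_limit K f l sequentially" by (simp add: ulim_def)

lemma ulim_bound:
 assumes "ulim K f l"
 obtains B where "B > 0" "\<And>x. x \<in> K \<Longrightarrow> norm (l x) \<le> B" "evK K (\<lambda>k x. norm (f k x) \<le> B)"
proof -
 from assms obtain B where B: "\<forall>x\<in>K. norm (l x) \<le> B" by (auto simp: ulim_def bounded_iff)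
 have ev: "evK K (\<lambda>k x. dist (f k x) (l x) < 1)" using assms unfolding ulim_def uniform_limit_iff by auto
 have "evK K (\<lambda>k x. norm (f k x) \<le> \<bar>B\<bar> + 1)" using ev
 proof eventually_elim
  case (elim k)
  show ?case
  proof
   fix x assume x: "x \<in> K"
   have "norm (f k x) \<le> norm (l x) + dist (f k x) (l x)" by (metis add.commute dist_norm norm_triangle_sub)
   with elim B x show "norm (f k x) \<le> \<bar>B\<bar> + 1" by fastforce
  qed
 qed
 moreover have "norm (l x) \<le> \<bar>B\<bar> + 1" if "x \<in> K" for x using B that by fastforce
 ultimately show thesis using that[of "\<bar>B\<bar> + 1"] by auto
qed

lemma ulim_bound_ev: "ulim K f l \<Longrightarrow> \<exists>B>0. evK K (\<lambda>k x. norm (f k x) \<le> B)" by (erule ulim_bound) blast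

lemma ulim_bound_limit: "ulim K f l \<Longrightarrow> \<exists>B>0. \<forall>x\<in>K. norm (l x) \<le> B" by (erule ulim_bound) blast

lemma ulim_cong_limit: "ulim K f l \<Longrightarrow> (\<And>x. x \<in> K \<Longrightarrow> l x = l' x) \<Longrightarrow> ulim K f l'"
 unfolding ulim_def uniform_limit_iff by auto

lemma ulim_cong:
 assumes "ulim K f l" "\<And>k x. x \<in> K \<Longrightarrow> g k x = f k x"
 shows "ulim K g l" using assms(1) uniform_limit_cong'[of K f g l l sequentially] assms(2) unfolding ulim_def by metis

lemma ulim_const: "bounded (l ` K) \<Longrightarrow> ulim K (\<lambda>_. l) l" by (simp add: ulim_def uniform_limit_const)

lemma ulim_constx: "f \<longlonglongrightarrow> l \<Longrightarrow> ulim K (\<lambda>k x. f k) (\<lambda>x. l)"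
 unfolding ulim_def uniform_limit_iff by (auto simp: tendsto_iff image_def bounded_iff elim!: eventually_mono)

lemma ulim_add: "ulim K f l \<Longrightarrow> ulim K g m \<Longrightarrow> ulim K (\<lambda>k x. f k x + g k x) (\<lambda>x. l x + m x)"
 unfolding ulim_def by (auto intro: uniform_limit_add bounded_plus_comp)

lemma ulim_minus: "ulim K f l \<Longrightarrow> ulim K g m \<Longrightarrow> ulim K (\<lambda>k x. f k x - g k x) (\<lambda>x. l x - m x)"
 unfolding ulim_def by (auto intro: uniform_limit_minus bounded_minus_comp)

lemma ulim_mult: "ulim K f l \<Longrightarrow> ulim K g m \<Longrightarrow> ulim K (\<lambda>k x. f k x * g k x) (\<lambda>x. l x * m x)"
proof -
 assume a: "ulim K f l" "ulim K g m"
 obtain B C where "\<And>x. x \<in> K \<Longrightarrow> norm (l x) \<le> B" "\<And>x. x \<in> K \<Longrightarrow> norm (m x) \<le> C"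
  using ulim_bound[OF a(1)] ulim_bound[OF a(2)] by metis
 hence "\<forall>y\<in>(\<lambda>x. l x * m x) ` K. norm y \<le> B * C"
  by (auto simp: norm_mult intro!: mult_mono order_trans[OF norm_ge_zero])
 hence "bounded ((\<lambda>x. l x * m x) ` K)" unfolding bounded_iff by blast
 thus ?thesis using a unfolding ulim_def by (auto intro: uniform_lim_mult)
qed

lemma ulim_inverse:
 assumes "ulim K f l" "c > 0" "\<And>x. x \<in> K \<Longrightarrow> norm (l x) \<ge> c"
 shows "ulim K (\<lambda>k x. inverse (f k x)) (\<lambda>x. inverse (l x))"
proof -
 have "\<forall>y\<in>(\<lambda>x. inverse (l x)) ` K. norm y \<le> inverse c"
  using assms by (auto simp: norm_inverse intro!: le_imp_inverse_le)
 thus ?thesis using assms uniform_lim_inverse[where S = K and f = f and l = l and b = c] unfolding ulim_def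
  by (force simp: bounded_iff comp_def)
qed

lemma ulim_divide:
 assumes "ulim K g m" "ulim K f l" "c > 0" "\<And>x. x \<in> K \<Longrightarrow> norm (l x) \<ge> c"
 shows "ulim K (\<lambda>k x. g k x / f k x) (\<lambda>x. m x / l x)"
 using ulim_mult[OF assms(1) ulim_inverse[OF assms(2-4)]] by (simp add: divide_inverse)

lemma ulim_power: "ulim K f l \<Longrightarrow> ulim K (\<lambda>k x. f k x ^ n) (\<lambda>x. l x ^ n)"
 by (induction n) (auto intro: ulim_mult ulim_constx)

lemma ulim_sum:
 "(\<And>i. i \<in> I \<Longrightarrow> ulim K (f i) (l i)) \<Longrightarrow> ulim K (\<lambda>k x. \<Sum>i\<in>I. f i k x) (\<lambda>x. \<Sum>i\<in>I. l i x)"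
 by (induction I rule: infinite_finite_induct) (auto intro: ulim_add ulim_constx)

lemma ulim_of_real:
 fixes f :: "nat \<Rightarrow> 'x \<Rightarrow> real"
 assumes "ulim K f l"
 shows "ulim K (\<lambda>k x. of_real (f k x) :: complex) (\<lambda>x. of_real (l x))"
 using assms unfolding ulim_def uniform_limit_iff bounded_iff by (auto simp: dist_of_real)

lemma ulim_Re: "ulim K f l \<Longrightarrow> ulim K (\<lambda>k x. Re (f k x)) (\<lambda>x. Re (l x))" unfolding ulim_def
 by (auto intro: bounded_linear_uniform_limit_intros simp: bounded_iff) (metis abs_Re_le_cmod order_trans)

lemma ulim_Im: "ulim K f l \<Longrightarrow> ulim K (\<lambda>k x. Im (f k x)) (\<lambda>x. Im (l x))" unfolding ulim_def
 by (auto intro: bounded_linear_uniform_limit_intros simp: bounded_iff) (metis abs_Im_le_cmod order_trans)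

lemma ulim_norm: "ulim K f l \<Longrightarrow> ulim K (\<lambda>k x. norm (f k x)) (\<lambda>x. norm (l x))"
 unfolding ulim_def by (auto intro: uniform_limit_norm simp: bounded_iff)

lemma ulim_abs: "ulim K f l \<Longrightarrow> ulim K (\<lambda>k x. \<bar>f k x :: real\<bar>) (\<lambda>x. \<bar>l x\<bar>)"
 using ulim_norm[of K f l] by simp

lemma ulim_sqrt:
 assumes "ulim K f l" "c > 0" "\<And>x. x \<in> K \<Longrightarrow> l x \<ge> c"
 shows "ulim K (\<lambda>k x. sqrt (f k x)) (\<lambda>x. sqrt (l x))"
proof -
 have "bounded ((\<lambda>x. sqrt (l x)) ` K)"
 proof -
  obtain B where B: "\<And>x. x \<in> K \<Longrightarrow> norm (l x) \<le> B" using ulim_bound[OF assms(1)] by metis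
  have "\<bar>sqrt (l x)\<bar> \<le> sqrt B" if "x \<in> K" for x using B[OF that] assms(2) assms(3)[OF that] by simp
  thus ?thesis by (auto simp: bounded_iff)
 qed
 moreover have "uniform_limit K (\<lambda>k x. sqrt (f k x)) (\<lambda>x. sqrt (l x)) sequentially"
 proof (rule uniform_limitI)
  fix e :: real assume e: "e > 0"
  \<comment> \<open>The bound \<open>c\<close> keeps \<open>f k x\<close> positive. The bound
    \<open>e * sqrt c\<close> accounts for the division by the sum of the two roots, which is at
    least \<open>sqrt c\<close>.\<close>
  have "evK K (\<lambda>k x. dist (f k x) (l x) < min c (e * sqrt c))"
   using uniform_limitD[OF ulim_uniform_limit[OF assms(1)], of "min c (e * sqrt c)"] assms(2) e by simp
  thus "evK K (\<lambda>k x. dist (sqrt (f k x)) (sqrt (l x)) < e)"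
  proof eventually_elim
   case (elim k)
   show ?case
   proof
    fix x assume x: "x \<in> K"
    have d: "\<bar>f k x - l x\<bar> < c" "\<bar>f k x - l x\<bar> < e * sqrt c" using elim x by (auto simp: dist_real_def)
    have p: "f k x > 0" "l x > 0" using d assms(3)[OF x] assms(2) by auto
    have eq: "(sqrt (f k x) - sqrt (l x)) * (sqrt (f k x) + sqrt (l x)) = f k x - l x" using p by (simp add: algebra_simps)
    have "sqrt c \<le> sqrt (f k x) + sqrt (l x)" using assms(3)[OF x] p by (simp add: add_increasing)
    hence "\<bar>sqrt (f k x) - sqrt (l x)\<bar> * sqrt c \<le> \<bar>f k x - l x\<bar>"
     unfolding eq[symmetric] abs_mult by (intro mult_left_mono) auto
    also have "\<dots> < e * sqrt c" by fact
    finally show "dist (sqrt (f k x)) (sqrt (l x)) < e" using assms(2) by (simp add: dist_real_def)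
   qed
  qed
 qed
 ultimately show ?thesis by (simp add: ulim_def)
qed

lemma ulim_lower_bound:
 assumes "ulim K f l" "\<And>x. x \<in> K \<Longrightarrow> norm (l x) \<ge> c" "d < c"
 shows "evK K (\<lambda>k x. norm (f k x) \<ge> d)"
proof -
 have "evK K (\<lambda>k x. dist (f k x) (l x) < c - d)" using assms unfolding ulim_def uniform_limit_iff by auto
 thus ?thesis
 proof eventually_elim
  case (elim k)
  show ?case
  proof
   fix x assume x: "x \<in> K"
   have "norm (l x) \<le> norm (f k x) + dist (f k x) (l x)" by (metis add.commute dist_commute dist_norm norm_triangle_sub)
   thus "d \<le> norm (f k x)" using elim x assms(2)[OF x] by force
  qed
 qed
qed

text \<open>Uniform convergence says nothing about the early terms, hence the hypothesis that each
  single \<open>f k\<close> is bounded. Their total is at most \<open>S\<close>, which the factor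
  \<open>1 / n\<close> dilutes once \<open>n > 2 * S / e\<close>.\<close>

lemma uniform_cesaro_null:
 fixes f :: "nat \<Rightarrow> 'x \<Rightarrow> 'b::real_normed_field"
 assumes "uniform_limit K f (\<lambda>_. 0) sequentially" "\<And>k. bounded (f k ` K)"
 shows "uniform_limit K (\<lambda>n x. (\<Sum>k<n. f k x) / of_nat n) (\<lambda>_. 0) sequentially"
proof (rule uniform_limitI)
 fix e :: real assume e: "e > 0"
 obtain n0 where n0: "\<And>n x. n \<ge> n0 \<Longrightarrow> x \<in> K \<Longrightarrow> norm (f n x) < e/2"
  using assms(1) e unfolding uniform_limit_sequentially_iff dist_norm by (metis diff_zero half_gt_zero)
 obtain B where B: "\<And>k x. x \<in> K \<Longrightarrow> norm (f k x) \<le> B k"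
  using assms(2) unfolding bounded_iff by (metis image_eqI)
 define S where "S = (\<Sum>k<n0. \<bar>B k\<bar>)"
 have "\<forall>\<^sub>F n in sequentially. real n > 2 * S / e" "\<forall>\<^sub>F n in sequentially. n \<ge> Suc n0"
  by (metis eventually_at_top_dense filterlim_real_sequentially filterlim_at_top_dense eventually_ge_at_top, rule eventually_ge_at_top)
 thus "\<forall>\<^sub>F n in sequentially. \<forall>x\<in>K. dist ((\<Sum>k<n. f k x) / of_nat n) 0 < e"
 proof eventually_elim
  case (elim n)
  show ?case
  proof
   fix x assume x: "x \<in> K"
   have "norm (\<Sum>k<n. f k x) \<le> (\<Sum>k<n. norm (f k x))" by (rule norm_sum)
   also have "\<dots> \<le> (\<Sum>k<n. (if k < n0 then \<bar>B k\<bar> else 0) + e/2)"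
   proof (intro sum_mono)
    fix k
    show "norm (f k x) \<le> (if k < n0 then \<bar>B k\<bar> else 0) + e/2"
     using B[OF x, of k] n0[of k, OF _ x] e by (cases "k < n0") auto
   qed
   also have "\<dots> = (\<Sum>k<n. if k < n0 then \<bar>B k\<bar> else 0) + real n * (e/2)" by (simp add: sum.distrib)
   also have "(\<Sum>k<n. if k < n0 then \<bar>B k\<bar> else 0) = S"
    unfolding S_def using elim by (simp add: sum.If_cases lessThan_def Int_def) (metis (no_types, lifting) Suc_leD less_le_trans)
   also have "S + real n * (e/2) < real n * e" using elim e by (simp add: field_simps)
   finally show "dist ((\<Sum>k<n. f k x) / of_nat n) 0 < e" using elim by (simp add: norm_divide field_simps)
  qed
 qed
qed

lemma uniform_cesaro:
 fixes f :: "nat \<Rightarrow> 'x \<Rightarrow> 'b::real_normed_field"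
 assumes "ulim K f l" "\<And>k. bounded (f k ` K)"
 shows "uniform_limit K (\<lambda>n x. (\<Sum>k<n. f k x) / of_nat n) l sequentially"
proof -
 have "uniform_limit K (\<lambda>k x. f k x - l x) (\<lambda>_. 0) sequentially"
  using assms(1) by (simp add: ulim_def uniform_limit_iff dist_norm)
 hence "uniform_limit K (\<lambda>n x. (\<Sum>k<n. f k x - l x) / of_nat n) (\<lambda>_. 0) sequentially"
  using assms by (intro uniform_cesaro_null bounded_minus_comp) (auto simp: ulim_def)
 hence "uniform_limit K (\<lambda>n x. (\<Sum>k<n. f k x - l x) / of_nat n + l x) (\<lambda>x. 0 + l x) sequentially"
  by (intro uniform_limit_add uniform_limit_const)
 thus ?thesis by (rule iffD1[OF uniform_limit_cong, rotated 2], intro eventually_mono[OF eventually_gt_at_top[of 0]])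
    (auto simp: sum_subtractf diff_divide_distrib)
qed

text \<open>Summing the approximate relation \<open>z (Suc k) = q * z k\<close> telescopes:
  \<open>1 - q\<close> times the sum of the \<open>z k\<close> is the sum of the errors minus
  \<open>z n - z 0\<close>. Both are of smaller order than \<open>n\<close>, and
  \<open>1 - q\<close> stays away from zero.\<close>

lemma uniform_rotation_average:
 fixes z :: "nat \<Rightarrow> 'x \<Rightarrow> 'b::real_normed_field"
 assumes "uniform_limit K (\<lambda>k x. z (Suc k) x - q x * z k x) (\<lambda>_. 0) sequentially"
  and zb: "\<And>k. bounded (z k ` K)" and qb: "bounded (q ` K)"
  and ub: "evK K (\<lambda>k x. norm (z k x) \<le> Z)"
  and c: "c > 0" "\<And>x. x \<in> K \<Longrightarrow> norm (1 - q x) \<ge> c"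
 shows "uniform_limit K (\<lambda>n x. (\<Sum>k<n. z k x) / of_nat n) (\<lambda>_. 0) sequentially"
proof -
 have qz: "bounded ((\<lambda>x. q x * z k x) ` K)" for k
 proof -
  obtain B C where "\<And>x. x \<in> K \<Longrightarrow> norm (q x) \<le> B" "\<And>x. x \<in> K \<Longrightarrow> norm (z k x) \<le> C"
   using qb zb[of k] unfolding bounded_iff by (metis image_eqI)
  hence "\<forall>y\<in>(\<lambda>x. q x * z k x) ` K. norm y \<le> B * C"
   by (auto simp: norm_mult intro!: mult_mono order_trans[OF norm_ge_zero])
  thus ?thesis by (auto simp: bounded_iff)
 qed
 have 1: "uniform_limit K (\<lambda>n x. (\<Sum>k<n. z (Suc k) x - q x * z k x) / of_nat n) (\<lambda>_. 0) sequentially"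
  using assms(1) zb qz by (intro uniform_cesaro_null bounded_minus_comp)
 obtain B0 where B0: "\<And>x. x \<in> K \<Longrightarrow> norm (z 0 x) \<le> B0" using zb[of 0] unfolding bounded_iff by (metis image_eqI)
 have 2: "uniform_limit K (\<lambda>n x. (z n x - z 0 x) / of_nat n) (\<lambda>_. 0) sequentially"
 proof (rule uniform_limit_null_comparison)
  show "uniform_limit K (\<lambda>n x. (\<bar>Z\<bar> + \<bar>B0\<bar>) / real n) (\<lambda>_. 0) sequentially"
   using ulim_constx[of "\<lambda>n. (\<bar>Z\<bar> + \<bar>B0\<bar>) / real n" 0 K] lim_const_over_n by (auto simp: ulim_def)
  show "\<forall>\<^sub>F n in sequentially. \<forall>x\<in>K. norm ((z n x - z 0 x) / of_nat n) \<le> (\<bar>Z\<bar> + \<bar>B0\<bar>) / real n"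
   using ub
  proof eventually_elim
   case (elim n)
   show ?case
   proof
    fix x assume "x \<in> K"
    hence "norm (z n x - z 0 x) \<le> \<bar>Z\<bar> + \<bar>B0\<bar>"
     using elim B0[of x] norm_triangle_ineq4[of "z n x" "z 0 x"] by fastforce
    thus "norm ((z n x - z 0 x) / of_nat n) \<le> (\<bar>Z\<bar> + \<bar>B0\<bar>) / real n"
     by (simp add: norm_divide divide_right_mono)
   qed
  qed
 qed
 have inv: "bounded ((\<lambda>x. inverse (1 - q x)) ` K)"
 proof -
  have "\<forall>y\<in>(\<lambda>x. inverse (1 - q x)) ` K. norm y \<le> inverse c"
   using c by (auto simp: norm_inverse intro!: le_imp_inverse_le)
  thus ?thesis by (auto simp: bounded_iff)
 qed
 have "uniform_limit K (\<lambda>n x. ((\<Sum>k<n. z (Suc k) x - q x * z k x) / of_nat n - (z n x - z 0 x) / of_nat n) * inverse (1 - q x))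
   (\<lambda>x. (0 - 0) * inverse (1 - q x)) sequentially"
  using inv by (intro uniform_lim_mult uniform_limit_minus 1 2 uniform_limit_const) (auto simp: image_constant_conv)
 thus ?thesis
 proof (rule iffD1[OF uniform_limit_cong', rotated 2])
  have cancel: "a * s / t * inverse a = s / t" if "a \<noteq> 0" for a s t :: 'b using that by (cases "t = 0") (auto simp: field_simps)
  fix n x assume x: "x \<in> K"
  have ne: "1 - q x \<noteq> 0" using c(2)[OF x] c(1) by auto
  have s: "(\<Sum>k<n. z (Suc k) x - q x * z k x) - (z n x - z 0 x) = (1 - q x) * (\<Sum>k<n. z k x)"
   by (induction n) (auto simp: algebra_simps)
  have "((\<Sum>k<n. z (Suc k) x - q x * z k x) / of_nat n - (z n x - z 0 x) / of_nat n)
    = (1 - q x) * (\<Sum>k<n. z k x) / of_nat n" unfolding s[symmetric] by (simp add: diff_divide_distrib)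
  thus "((\<Sum>k<n. z (Suc k) x - q x * z k x) / of_nat n - (z n x - z 0 x) / of_nat n) * inverse (1 - q x)
    = (\<Sum>k<n. z k x) / of_nat n" by (simp only: cancel[OF ne])
 qed auto
qed

text \<open>Summable relative errors keep \<open>g\<close> between two positive multiples of its
  value at a fixed index. The upper multiple turns the relative increments into absolutely summable
  ones, the lower one keeps the limit positive.\<close>

lemma almost_constant_limit:
 fixes g :: "nat \<Rightarrow> 'x \<Rightarrow> real"
 assumes ev: "evK K (\<lambda>k x. g k x > 0 \<and> \<bar>g (Suc k) x - g k x\<bar> \<le> \<eta> k * g k x)"
  and sm: "summable \<eta>" and eta0: "\<And>k. \<eta> k \<ge> 0"
  and bd: "\<forall>\<^sub>F k in sequentially. bounded (g k ` K)"
 obtains G where "ulim K g G" "\<And>x. x \<in> K \<Longrightarrow> G x > 0"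
proof -
 have e0: "\<eta> \<longlonglongrightarrow> 0" using sm by (rule summable_LIMSEQ_zero)
 \<comment> \<open>The lower bound for \<open>g\<close> needs
   \<open>1 - \<eta> k \<ge> exp (- 2 * \<eta> k)\<close>, which is available for
   \<open>\<eta> k < 1/2\<close>.\<close>
 have "\<forall>\<^sub>F k in sequentially. \<eta> k < 1/2" using order_tendstoD(2)[OF e0, of "1/2"] by simp
 hence "\<forall>\<^sub>F k in sequentially. (\<forall>x\<in>K. g k x > 0 \<and> \<bar>g (Suc k) x - g k x\<bar> \<le> \<eta> k * g k x) \<and> \<eta> k < 1/2 \<and> bounded (g k ` K)"
  using ev bd by eventually_elim auto
 then obtain n where n: "\<And>k x. k \<ge> n \<Longrightarrow> x \<in> K \<Longrightarrow> g k x > 0 \<and> \<bar>g (Suc k) x - g k x\<bar> \<le> \<eta> k * g k x"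
   "\<And>k. k \<ge> n \<Longrightarrow> \<eta> k < 1/2" and bn: "bounded (g n ` K)" unfolding eventually_sequentially by fastforce
 define S where "S = suminf \<eta>"
 have part: "(\<Sum>j<k. \<eta> (n + j)) \<le> S" for k
 proof -
  have "(\<Sum>j<k. \<eta> (n + j)) = (\<Sum>j\<in>{n..<n+k}. \<eta> j)"
   by (rule sum.reindex_bij_witness[of _ "\<lambda>j. j - n" "\<lambda>j. n + j"]) auto
  also have "\<dots> \<le> S" unfolding S_def by (rule sum_le_suminf[OF sm]) (use eta0 in auto)
  finally show ?thesis .
 qed
 obtain B where B: "\<And>x. x \<in> K \<Longrightarrow> \<bar>g n x\<bar> \<le> B" using bn unfolding bounded_iff by (metis image_eqI real_norm_def)
 have up: "g (n + k) x \<le> g n x * exp (\<Sum>j<k. \<eta> (n + j))" if x: "x \<in> K" for k x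
 proof (induction k)
  case (Suc k)
  have "g (n + Suc k) x \<le> g (n+k) x * (1 + \<eta> (n + k))" using n(1)[of "n+k" x] x by (auto simp: algebra_simps)
  also have "\<dots> \<le> g (n+k) x * exp (\<eta> (n+k))" using n(1)[of "n+k" x] x by (intro mult_left_mono) auto
  also have "\<dots> \<le> g n x * exp (\<Sum>j<k. \<eta> (n + j)) * exp (\<eta> (n+k))" using Suc by (intro mult_right_mono) auto
  finally show ?case by (simp add: exp_add mult_ac)
 qed simp
 have lo: "g (n + k) x \<ge> g n x * exp (- 2 * (\<Sum>j<k. \<eta> (n + j)))" if x: "x \<in> K" for k x
 proof (induction k)
  case (Suc k)
  have h: "exp (- 2 * t) \<le> 1 - t" if "0 \<le> t" "t < 1/2" for t :: real
  proof -
   have "exp (2 * t) * (1 - t) \<ge> (1 + 2 * t) * (1 - t)" using that by (intro mult_right_mono) auto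
   also have "(1 + 2 * t) * (1 - t) = 1 + t * (1 - 2 * t)" by (simp add: algebra_simps)
   finally have "exp (2 * t) * (1 - t) \<ge> 1" using that mult_nonneg_nonneg[of t "1 - 2 * t"] by linarith
   thus ?thesis by (simp add: exp_minus field_simps)
  qed
  have "g (n + Suc k) x \<ge> g (n+k) x * (1 - \<eta> (n + k))" using n(1)[of "n+k" x] x by (auto simp: algebra_simps)
  moreover have "g (n+k) x * (1 - \<eta> (n + k)) \<ge> g (n+k) x * exp (- 2 * \<eta> (n+k))"
   using n(1)[of "n+k" x] x h[of "\<eta> (n+k)"] n(2)[of "n+k"] eta0 by (intro mult_left_mono) auto
  moreover have "g (n+k) x * exp (- 2 * \<eta> (n+k)) \<ge> g n x * exp (- 2 * (\<Sum>j<k. \<eta> (n + j))) * exp (- 2 * \<eta> (n+k))"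
   using Suc by (intro mult_right_mono) auto
  ultimately show ?case by (simp add: exp_add[symmetric] algebra_simps mult.assoc)
 qed simp
 have upb: "g (n + k) x \<le> B * exp S" if x: "x \<in> K" for k x
  using up[OF x, of k] B[OF x] part[of k] by (meson abs_ge_self exp_le_cancel_iff exp_ge_zero mult_mono order_trans abs_ge_zero)
 have dsum: "summable (\<lambda>k. \<eta> (n + k) * (B * exp S))"
  using summable_ignore_initial_segment[OF sm, of n] by (intro summable_mult2) (simp add: add.commute)
 have unif: "uniformly_convergent_on K (\<lambda>m x. \<Sum>k<m. g (n + Suc k) x - g (n + k) x)"
 proof (rule Weierstrass_m_test'[OF _ dsum])
  fix k x assume x: "x \<in> K"
  have "\<bar>g (n + Suc k) x - g (n + k) x\<bar> \<le> \<eta> (n+k) * g (n+k) x" using n(1)[of "n+k" x] x by simp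
  also have "\<dots> \<le> \<eta> (n+k) * (B * exp S)" using upb[OF x] eta0 by (intro mult_left_mono)
  finally show "norm (g (n + Suc k) x - g (n + k) x) \<le> \<eta> (n + k) * (B * exp S)" by simp
 qed
 have "(\<Sum>k<m. g (n + Suc k) x - g (n + k) x) = g (n + m) x - g n x" for m x by (induction m) auto
 then obtain l where "uniform_limit K (\<lambda>m x. g (n + m) x - g n x) l sequentially"
  using unif by (auto simp: uniformly_convergent_on_def)
 hence "uniform_limit K (\<lambda>m x. (g (n + m) x - g n x) + g n x) (\<lambda>x. l x + g n x) sequentially"
  by (intro uniform_limit_add uniform_limit_const)
 hence ul': "uniform_limit K (\<lambda>m x. g (n + m) x) (\<lambda>x. l x + g n x) sequentially" by simp
 define G where "G x = l x + g n x" for x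
 have ul: "uniform_limit K g G sequentially"
 proof (rule uniform_limitI)
  fix e :: real assume "e > 0"
  hence "\<forall>\<^sub>F m in sequentially. \<forall>x\<in>K. dist (g (n + m) x) (G x) < e"
   using uniform_limitD[OF ul'] by (simp add: G_def)
  thus "evK K (\<lambda>k x. dist (g k x) (G x) < e)"
   using eventually_sequentially_seg[of "\<lambda>k. \<forall>x\<in>K. dist (g k x) (G x) < e" n] by (simp add: add.commute)
 qed
 have lim: "(\<lambda>k. g (n + k) x) \<longlonglongrightarrow> G x" if "x \<in> K" for x
  using tendsto_uniform_limitI[OF ul' that] by (simp add: G_def)
 have pos: "G x \<ge> g n x * exp (- 2 * S)" if x: "x \<in> K" for x
 proof (rule LIMSEQ_le_const[OF lim[OF x]], intro exI allI impI)
  fix k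
  have "g n x * exp (- 2 * S) \<le> g n x * exp (- 2 * (\<Sum>j<k. \<eta> (n + j)))"
   using n(1)[of n x] x part[of k] by (intro mult_left_mono) auto
  thus "g n x * exp (- 2 * S) \<le> g (n + k) x" using lo[OF x, of k] by simp
 qed
 have Gpos: "G x > 0" if x: "x \<in> K" for x using pos[OF x] n(1)[of n x] x by (smt (verit) exp_gt_zero mult_pos_pos order_refl)
 have "G x \<le> B * exp S" if x: "x \<in> K" for x by (rule LIMSEQ_le_const2[OF lim[OF x]]) (use upb[OF x] in auto)
 hence "bounded (G ` K)" using Gpos by (auto simp: bounded_iff intro!: exI[of _ "B * exp S"] less_imp_le[THEN abs_of_nonneg, THEN ord_eq_le_trans])
 thus thesis using that[of G] ul Gpos by (auto simp: ulim_def)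
qed

subsection \<open>Weighted difference classes\<close>

text \<open>For a small sequence \<open>\<epsilon>\<close>, \<open>wt d s f\<close> bounds the \<open>j\<close>-th difference of \<open>f\<close> in \<open>k\<close>
 by a multiple of \<open>\<epsilon> ^ (s + j)\<close> for all \<open>j \<le> d\<close>, uniformly on \<open>K\<close> and for large \<open>k\<close>.\<close>

locale diff_weight =
 fixes \<epsilon> :: "nat \<Rightarrow> real" and K :: "'x set"
 assumes eps_nonneg: "\<epsilon> k \<ge> 0" and eps_shift: "\<epsilon> (Suc k) \<le> 2 * \<epsilon> k" and eps_null: "\<epsilon> \<longlonglongrightarrow> 0"
begin

definition ow :: "nat \<Rightarrow> (nat \<Rightarrow> 'x \<Rightarrow> complex) \<Rightarrow> bool" where
 "ow s f \<longleftrightarrow> (\<exists>C\<ge>0. evK K (\<lambda>k x. cmod (f k x) \<le> C * \<epsilon> k ^ s))"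

primrec wt :: "nat \<Rightarrow> nat \<Rightarrow> (nat \<Rightarrow> 'x \<Rightarrow> complex) \<Rightarrow> bool" where
 "wt 0 s f = ow s f"
| "wt (Suc d) s f = (ow s f \<and> wt d (Suc s) (\<lambda>k x. f (Suc k) x - f k x))"

lemma ow_add: "ow s f \<Longrightarrow> ow s g \<Longrightarrow> ow s (\<lambda>k x. f k x + g k x)"
proof -
 assume "ow s f" "ow s g"
 then obtain C D where CD: "C \<ge> 0" "D \<ge> 0" "evK K (\<lambda>k x. cmod (f k x) \<le> C * \<epsilon> k ^ s)"
  "evK K (\<lambda>k x. cmod (g k x) \<le> D * \<epsilon> k ^ s)" unfolding ow_def by auto
 have "evK K (\<lambda>k x. cmod (f k x + g k x) \<le> (C + D) * \<epsilon> k ^ s)"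
  using CD(3,4) by eventually_elim (auto simp: algebra_simps intro: norm_triangle_mono)
 thus ?thesis using CD unfolding ow_def by (intro exI[of _ "C + D"]) auto
qed

lemma ow_mult: "ow s f \<Longrightarrow> ow t g \<Longrightarrow> ow (s + t) (\<lambda>k x. f k x * g k x)"
proof -
 assume "ow s f" "ow t g"
 then obtain C D where CD: "C \<ge> 0" "D \<ge> 0" "evK K (\<lambda>k x. cmod (f k x) \<le> C * \<epsilon> k ^ s)"
  "evK K (\<lambda>k x. cmod (g k x) \<le> D * \<epsilon> k ^ t)" unfolding ow_def by auto
 have "evK K (\<lambda>k x. cmod (f k x * g k x) \<le> (C * D) * \<epsilon> k ^ (s + t))" using CD(3,4)
 proof eventually_elim
  case (elim k)
  show ?case
  proof
   fix x assume "x \<in> K"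
   hence "cmod (f k x) * cmod (g k x) \<le> (C * \<epsilon> k ^ s) * (D * \<epsilon> k ^ t)"
    using elim CD eps_nonneg[of k] by (intro mult_mono) auto
   thus "cmod (f k x * g k x) \<le> (C * D) * \<epsilon> k ^ (s + t)" by (simp add: norm_mult power_add mult_ac)
  qed
 qed
 thus ?thesis using CD unfolding ow_def by (intro exI[of _ "C * D"]) auto
qed

lemma ow_mono: "ow t f \<Longrightarrow> s \<le> t \<Longrightarrow> ow s f"
proof -
 assume "ow t f" and st: "s \<le> t"
 then obtain C where C: "C \<ge> 0" "evK K (\<lambda>k x. cmod (f k x) \<le> C * \<epsilon> k ^ t)" unfolding ow_def by auto
 have "\<forall>\<^sub>F k in sequentially. \<epsilon> k < 1" using order_tendstoD(2)[OF eps_null, of 1] by simp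
 hence "evK K (\<lambda>k x. cmod (f k x) \<le> C * \<epsilon> k ^ s)" using C(2)
 proof eventually_elim
  case (elim k)
  have "C * \<epsilon> k ^ t \<le> C * \<epsilon> k ^ s"
   using C(1) st elim(1) eps_nonneg[of k] by (intro mult_left_mono power_decreasing) auto
  thus ?case using elim(2) by fastforce
 qed
 thus ?thesis using C(1) unfolding ow_def by blast
qed

text \<open>This is the purpose of \<open>eps_shift\<close>: a weight that at most doubles makes the
  classes closed under the shift that appears in the product rule.\<close>

lemma ow_shift: "ow s f \<Longrightarrow> ow s (\<lambda>k. f (Suc k))"
proof -
 assume "ow s f"
 then obtain C where C: "C \<ge> 0" "evK K (\<lambda>k x. cmod (f k x) \<le> C * \<epsilon> k ^ s)" unfolding ow_def by auto
 have "evK K (\<lambda>k x. cmod (f (Suc k) x) \<le> C * \<epsilon> (Suc k) ^ s)"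
  using C(2) by (simp add: eventually_sequentially_Suc[of "\<lambda>k. \<forall>x\<in>K. cmod (f k x) \<le> C * \<epsilon> k ^ s"])
 hence "evK K (\<lambda>k x. cmod (f (Suc k) x) \<le> (C * 2 ^ s) * \<epsilon> k ^ s)"
 proof eventually_elim
  case (elim k)
  have "\<epsilon> (Suc k) ^ s \<le> (2 * \<epsilon> k) ^ s" using eps_nonneg eps_shift by (intro power_mono)
  hence "C * \<epsilon> (Suc k) ^ s \<le> (C * 2 ^ s) * \<epsilon> k ^ s"
   using C(1) by (simp add: power_mult_distrib mult.assoc mult_left_mono)
  thus ?case using elim by fastforce
 qed
 thus ?thesis using C(1) unfolding ow_def by (intro exI[of _ "C * 2 ^ s"]) auto
qed

lemma ow_cong: "evK K (\<lambda>k x. f k x = g k x) \<Longrightarrow> ow s f \<Longrightarrow> ow s g"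
 unfolding ow_def by (force elim: eventually_elim2)

lemma ow_0_bounded:
 assumes "evK K (\<lambda>k x. cmod (f k x) \<le> B)"
 shows "ow 0 f" unfolding ow_def using assms by (intro exI[of _ "max B 0"]) (auto elim!: eventually_mono)

lemma ow_ulim0: "ow s f \<Longrightarrow> s > 0 \<Longrightarrow> ulim K f (\<lambda>_. 0)"
proof -
 assume "ow s f" "s > 0"
 hence "ow 1 f" using ow_mono[of s f 1] by simp
 then obtain C where C: "evK K (\<lambda>k x. cmod (f k x) \<le> C * \<epsilon> k)" unfolding ow_def by auto
 have "(\<lambda>k. C * \<epsilon> k) \<longlonglongrightarrow> 0" using tendsto_mult_left[OF eps_null, of C] by simp
 hence "uniform_limit K (\<lambda>k x. C * \<epsilon> k) (\<lambda>_. 0) sequentially"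
  using ulim_constx[of "\<lambda>k. C * \<epsilon> k" 0 K] by (simp add: ulim_def)
 with C have "uniform_limit K f (\<lambda>_. 0) sequentially" by (rule uniform_limit_null_comparison)
 thus ?thesis by (auto simp: ulim_def image_constant_conv)
qed

lemma wt_imp_ow: "wt d s f \<Longrightarrow> ow s f" by (cases d) auto

lemma wt_Suc_depth: "wt (Suc d) s f \<Longrightarrow> wt d s f"
proof (induction d arbitrary: s f)
 case (Suc d)
 have "wt d (Suc s) (\<lambda>k x. f (Suc k) x - f k x)" using Suc.prems by - (rule Suc.IH, simp_all)
 thus ?case using Suc.prems by simp
qed simp

lemma wt_mono: "wt d t f \<Longrightarrow> s \<le> t \<Longrightarrow> wt d s f"
proof (induction d arbitrary: s t f)
 case (Suc d)
 have "wt d (Suc s) (\<lambda>k x. f (Suc k) x - f k x)"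
  using Suc.prems by - (rule Suc.IH[of "Suc t" "\<lambda>k x. f (Suc k) x - f k x"], simp_all)
 thus ?case using Suc.prems ow_mono[of t f s] by simp
next
 case 0
 thus ?case using ow_mono[of t f s] by simp
qed

lemma wt_add: "wt d s f \<Longrightarrow> wt d s g \<Longrightarrow> wt d s (\<lambda>k x. f k x + g k x)"
proof (induction d arbitrary: s f g)
 case (Suc d)
 have "wt d (Suc s) (\<lambda>k x. (f (Suc k) x - f k x) + (g (Suc k) x - g k x))" using Suc.prems by - (rule Suc.IH, simp_all)
 hence "wt d (Suc s) (\<lambda>k x. f (Suc k) x + g (Suc k) x - (f k x + g k x))" by (simp only: add_diff_add)
 thus ?case using Suc.prems by (simp add: ow_add)
qed (auto intro: ow_add)

lemma wt_shift: "wt d s f \<Longrightarrow> wt d s (\<lambda>k. f (Suc k))"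
proof (induction d arbitrary: s f)
 case (Suc d)
 have "wt d (Suc s) (\<lambda>k x. f (Suc (Suc k)) x - f (Suc k) x)"
  using Suc.IH[of "Suc s" "\<lambda>k x. f (Suc k) x - f k x"] Suc.prems by simp
 thus ?case using Suc.prems by (simp add: ow_shift)
qed (simp add: ow_shift)

text \<open>Discrete Leibniz rule: the increment of a product is the sum of two products in which
  one factor is replaced by its increment, so each gains one power of the weight.\<close>

lemma wt_mult: "wt d s f \<Longrightarrow> wt d t g \<Longrightarrow> wt d (s + t) (\<lambda>k x. f k x * g k x)"
proof (induction d arbitrary: s t f g)
 case (Suc d)
 have eq: "(\<lambda>k x. f (Suc k) x * g (Suc k) x - f k x * g k x)
   = (\<lambda>k x. (f (Suc k) x - f k x) * g (Suc k) x + f k x * (g (Suc k) x - g k x))" by (simp add: algebra_simps)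
 have "wt d (Suc s + t) (\<lambda>k x. (f (Suc k) x - f k x) * g (Suc k) x)"
  using Suc.prems wt_shift[OF wt_Suc_depth[OF Suc.prems(2)]] by - (rule Suc.IH, auto)
 moreover have "wt d (s + Suc t) (\<lambda>k x. f k x * (g (Suc k) x - g k x))"
  using Suc.prems wt_Suc_depth[OF Suc.prems(1)] by - (rule Suc.IH, auto)
 ultimately have "wt d (Suc (s + t)) (\<lambda>k x. f (Suc k) x * g (Suc k) x - f k x * g k x)" unfolding eq by (intro wt_add) auto
 thus ?case using Suc.prems by (simp add: ow_mult)
qed (auto intro: ow_mult)

lemma wt_mult0: "wt d 0 f \<Longrightarrow> wt d t g \<Longrightarrow> wt d t (\<lambda>k x. f k x * g k x)"
 using wt_mult[of d 0 f t g] by simp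

lemma wt_zero: "wt d s (\<lambda>k x. 0)"
 by (induction d arbitrary: s) (auto simp: ow_def intro!: exI[of _ 1] zero_le_power eps_nonneg always_eventually)

lemma wt_constx:
 assumes "\<And>x. x \<in> K \<Longrightarrow> cmod (c x) \<le> B"
 shows "wt d 0 (\<lambda>k. c)"
proof -
 have "ow 0 (\<lambda>k. c)" by (rule ow_0_bounded[of _ B]) (use assms in auto)
 thus ?thesis by (cases d) (auto simp: wt_zero)
qed

lemma wt_const: "wt d 0 (\<lambda>k x. c)" by (rule wt_constx[of _ "cmod c"]) auto

lemma wt_uminus: "wt d s f \<Longrightarrow> wt d s (\<lambda>k x. - f k x)" using wt_mult0[OF wt_const[of d "-1"]] by simp

lemma wt_diff: "wt d s f \<Longrightarrow> wt d s g \<Longrightarrow> wt d s (\<lambda>k x. f k x - g k x)"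
 using wt_add[of d s f "\<lambda>k x. - g k x"] wt_uminus[of d s g] by simp

lemma wt_cong: "wt d s f \<Longrightarrow> evK K (\<lambda>k x. f k x = g k x) \<Longrightarrow> wt d s g"
proof (induction d arbitrary: s f g)
 case 0
 thus ?case by (auto intro: ow_cong)
next
 case (Suc d)
 have ev: "evK K (\<lambda>k x. f (Suc k) x = g (Suc k) x)"
  using Suc.prems(2) by (simp add: eventually_sequentially_Suc[of "\<lambda>k. \<forall>x\<in>K. f k x = g k x"])
 have "evK K (\<lambda>k x. f (Suc k) x - f k x = g (Suc k) x - g k x)" using ev Suc.prems(2) by eventually_elim auto
 hence "wt d (Suc s) (\<lambda>k x. g (Suc k) x - g k x)" using Suc.prems(1) by - (rule Suc.IH[of "Suc s" "\<lambda>k x. f (Suc k) x - f k x"], simp_all)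
 thus ?case using Suc.prems by (auto intro: ow_cong)
qed

text \<open>The increment of \<open>1 / f\<close> is minus the increment of \<open>f\<close> times
  two values of \<open>1 / f\<close>. The latter are needed at one level of differences less, which
  makes the induction on \<open>d\<close> work.\<close>

lemma wt_inverse:
 assumes "wt d 0 f" "c > 0" "evK K (\<lambda>k x. cmod (f k x) \<ge> c)"
 shows "wt d 0 (\<lambda>k x. inverse (f k x))" using assms(1)
proof (induction d)
 case 0
 have "ow 0 (\<lambda>k x. inverse (f k x))" by (rule ow_0_bounded[of _ "inverse c"], rule eventually_mono[OF assms(3)])
    (use assms(2) in \<open>auto simp: norm_inverse intro!: le_imp_inverse_le\<close>)
 thus ?case by simp
next
 case (Suc d)
 define h where "h = (\<lambda>k x. inverse (f k x))"
 have h: "wt d 0 h" using Suc.IH[OF wt_Suc_depth[OF Suc.prems]] by (simp add: h_def)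
 have ev: "evK K (\<lambda>k x. cmod (f (Suc k) x) \<ge> c)"
  using assms(3) by (simp add: eventually_sequentially_Suc[of "\<lambda>k. \<forall>x\<in>K. cmod (f k x) \<ge> c"])
 have "wt d 1 (\<lambda>k x. - (f (Suc k) x - f k x))" using Suc.prems by (intro wt_uminus) auto
 hence "wt d 1 (\<lambda>k x. h k x * (h (Suc k) x * - (f (Suc k) x - f k x)))" by (intro wt_mult0[OF h] wt_mult0[OF wt_shift[OF h]])
 moreover have "evK K (\<lambda>k x. h k x * (h (Suc k) x * - (f (Suc k) x - f k x)) = h (Suc k) x - h k x)" using ev assms(3)
 proof eventually_elim
  case (elim k)
  show ?case
  proof
   fix x assume "x \<in> K"
   hence "f k x \<noteq> 0" "f (Suc k) x \<noteq> 0" using elim assms(2) by fastforce+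
   thus "h k x * (h (Suc k) x * - (f (Suc k) x - f k x)) = h (Suc k) x - h k x" by (simp add: h_def field_simps)
  qed
 qed
 ultimately have "wt d 1 (\<lambda>k x. h (Suc k) x - h k x)" by (rule wt_cong)
 thus ?case using wt_imp_ow[OF h] by (simp add: h_def)
qed

text \<open>As for inverses: the increment of the root is the increment of \<open>f\<close> divided
  by a sum of two roots, and that sum is known one level lower and is bounded below.\<close>

lemma wt_sqrt:
 fixes f :: "nat \<Rightarrow> 'x \<Rightarrow> real"
 assumes "wt d 0 (\<lambda>k x. of_real (f k x))" "c > 0" "evK K (\<lambda>k x. f k x \<ge> c)"
 shows "wt d 0 (\<lambda>k x. of_real (sqrt (f k x)))" using assms(1)
proof (induction d)
 case 0
 obtain C where C: "C \<ge> 0" "evK K (\<lambda>k x. \<bar>f k x\<bar> \<le> C)" using 0 by (auto simp: ow_def)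
 have "ow 0 (\<lambda>k x. of_real (sqrt (f k x)))"
  by (rule ow_0_bounded[of _ "sqrt C"], rule eventually_mono[OF eventually_conj[OF C(2) assms(3)]])
    (use assms(2) in \<open>fastforce\<close>)
 thus ?case by simp
next
 case (Suc d)
 define h where "h = (\<lambda>k x. complex_of_real (sqrt (f k x)))"
 have h: "wt d 0 h" using Suc.IH[OF wt_Suc_depth[OF Suc.prems]] by (simp add: h_def)
 have ev: "evK K (\<lambda>k x. f (Suc k) x \<ge> c)"
  using assms(3) by (simp add: eventually_sequentially_Suc[of "\<lambda>k. \<forall>x\<in>K. f k x \<ge> c"])
 have lb: "evK K (\<lambda>k x. cmod (h (Suc k) x + h k x) \<ge> sqrt c)" using ev assms(3)
 proof eventually_elim
  case (elim k)
  show ?case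
  proof
   fix x assume x: "x \<in> K"
   have "h (Suc k) x + h k x = of_real (sqrt (f (Suc k) x) + sqrt (f k x))" by (simp add: h_def)
   moreover have "sqrt c \<le> sqrt (f (Suc k) x)" "0 \<le> sqrt (f k x)" using elim x assms(2) by fastforce+
   ultimately show "sqrt c \<le> cmod (h (Suc k) x + h k x)" by (simp only: norm_of_real)
  qed
 qed
 have "wt d 0 (\<lambda>k x. inverse (h (Suc k) x + h k x))"
  by (rule wt_inverse[OF wt_add[OF wt_shift[OF h] h], of "sqrt c"]) (use assms(2) lb in auto)
 hence "wt d 1 (\<lambda>k x. inverse (h (Suc k) x + h k x) * (of_real (f (Suc k) x) - of_real (f k x)))"
  using Suc.prems by (intro wt_mult0) auto
 moreover have "evK K (\<lambda>k x. inverse (h (Suc k) x + h k x) * (of_real (f (Suc k) x) - of_real (f k x)) = h (Suc k) x - h k x)"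
  using ev assms(3) lb
 proof eventually_elim
  case (elim k)
  show ?case
  proof
   fix x assume x: "x \<in> K"
   have p: "f k x > 0" "f (Suc k) x > 0" using elim x assms(2) by fastforce+
   have ne: "h (Suc k) x + h k x \<noteq> 0" using elim x assms(2) by (metis norm_zero not_less real_sqrt_gt_zero)
   have "of_real (f (Suc k) x) - of_real (f k x) = (h (Suc k) x + h k x) * (h (Suc k) x - h k x)"
    using p by (simp add: h_def algebra_simps flip: of_real_mult)
   thus "inverse (h (Suc k) x + h k x) * (of_real (f (Suc k) x) - of_real (f k x)) = h (Suc k) x - h k x"
    using ne by (simp add: mult.assoc[symmetric])
  qed
 qed
 ultimately have "wt d 1 (\<lambda>k x. h (Suc k) x - h k x)" by (rule wt_cong)
 thus ?case using wt_imp_ow[OF h] by (simp add: h_def)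
qed

text \<open>Exact Taylor formula for the Moebius map at \<open>m\<close>: the coefficient of
  \<open>- e\<close> is its derivative, determinant over \<open>(A + B * m)^2\<close>, and the
  remainder carries the factor \<open>e * e\<close>.\<close>

lemma moebius_perturb:
 fixes A B C D m e :: complex
 assumes "A + B * m \<noteq> 0" "A + B * (m - e) \<noteq> 0"
 shows "(C + D * (m - e)) / (A + B * (m - e)) - (C + D * m) / (A + B * m)
  = - ((A * D - B * C) * (inverse (A + B * m) * inverse (A + B * m))) * e
   - (A * D - B * C) * (inverse (A + B * m) * inverse (A + B * m)) * (B * (inverse (A + B * (m - e)) * (e * e)))"
proof -
 define y y' d where "y = A + B * m" and "y' = A + B * (m - e)" and "d = A * D - B * C"
 have ne: "y \<noteq> 0" "y' \<noteq> 0" using assms by (auto simp: y_def y'_def)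
 have "(C + D * (m - e)) * y - (C + D * m) * y' = - (d * e)" by (simp add: y_def y'_def d_def algebra_simps)
 hence L: "(C + D * (m - e)) / y' - (C + D * m) / y = - (d * e) / (y' * y)" by (simp only: diff_frac_eq[OF ne(2,1)])
 have yB: "B * e = y - y'" by (simp add: y_def y'_def algebra_simps)
 have i: "y' * inverse y' = 1" "y * inverse y = 1" using ne by auto
 have "- (d * (inverse y * inverse y)) * e - d * (inverse y * inverse y) * (B * (inverse y' * (e * e)))
   = - d * (inverse y * inverse y) * e * (1 + inverse y' * (B * e))" by (simp add: algebra_simps)
 also have "1 + inverse y' * (B * e) = inverse y' * y" unfolding yB using i(1) by (simp add: algebra_simps)
 also have "- d * (inverse y * inverse y) * e * (inverse y' * y) = - d * e * inverse y' * inverse y * (y * inverse y)"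
  by (simp only: ac_simps)
 also have "\<dots> = - (d * e) / (y' * y)" unfolding i(2) by (simp add: divide_inverse mult.assoc)
 finally show ?thesis using L unfolding y_def y'_def d_def by simp
qed

text \<open>Let \<open>ph\<close> be the derivative of the Riccati map at \<open>m\<close> and
  \<open>de = e / (1 - ph)\<close>. In the error of \<open>m - de\<close> the linear terms cancel up
  to the increment of \<open>de\<close>, which has order \<open>Suc s\<close>; the quadratic
  remainder has order \<open>s + s\<close>, at least \<open>Suc s\<close> as \<open>s > 0\<close>.
  Forming the increment uses up one level of differences. In the limit \<open>ph\<close> is the
  inverse square of a number of modulus one, so the \<open>gap\<close> hypothesis keeps
  \<open>1 - ph\<close> away from zero.\<close>

lemma riccati_newton_step:
 fixes A B C D m :: "nat \<Rightarrow> 'x \<Rightarrow> complex"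
 defines "e \<equiv> \<lambda>m k x. m (Suc k) x - (C k x + D k x * m k x) / (A k x + B k x * m k x)"
 assumes wABCD: "wt (Suc d) 0 A" "wt (Suc d) 0 B" "wt (Suc d) 0 C" "wt (Suc d) 0 D"
  and lim: "ulim K A a" "ulim K B b" "ulim K C c" "ulim K D dd" "ulim K m l"
  and det: "\<And>x. x \<in> K \<Longrightarrow> a x * dd x - b x * c x = 1"
  and one: "\<And>x. x \<in> K \<Longrightarrow> cmod (a x + b x * l x) = 1"
  and gap: "\<And>x. x \<in> K \<Longrightarrow> cmod (1 - (a x + b x * l x)^2) \<ge> \<delta>" "\<delta> > 0"
  and wm: "wt (Suc d) 0 m" and we: "wt (Suc d) s (e m)" and s: "s > 0"
 shows "\<exists>m'. wt d 0 m' \<and> ulim K m' l \<and> wt d (Suc s) (e m')"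
proof -
 define y where "y = (\<lambda>k x. A k x + B k x * m k x)"
 define y2 where "y2 = (\<lambda>k x. inverse (y k x) * inverse (y k x))"
 define dt where "dt = (\<lambda>k x. A k x * D k x - B k x * C k x)"
 define ph where "ph = (\<lambda>k x. dt k x * y2 k x)"
 have ly: "ulim K y (\<lambda>x. a x + b x * l x)" unfolding y_def by (intro ulim_add ulim_mult lim)
 have ldt: "ulim K dt (\<lambda>x. 1)"
 proof -
  have "ulim K dt (\<lambda>x. a x * dd x - b x * c x)" unfolding dt_def by (intro ulim_minus ulim_mult lim)
  thus ?thesis by (rule ulim_cong_limit) (rule det)
 qed
 have lph: "ulim K ph (\<lambda>x. 1 * (inverse (a x + b x * l x) * inverse (a x + b x * l x)))"
  unfolding ph_def y2_def by (intro ulim_mult ldt ulim_inverse[OF ly, of 1]) (use one in auto)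
 have ylb: "evK K (\<lambda>k x. cmod (y k x) \<ge> 1/2)" by (rule ulim_lower_bound[OF ly, of 1]) (use one in auto)
 have phlb: "evK K (\<lambda>k x. cmod (1 - ph k x) \<ge> \<delta>/2)"
 proof (rule ulim_lower_bound[of K "\<lambda>k x. 1 - ph k x" "\<lambda>x. 1 - 1 * (inverse (a x + b x * l x) * inverse (a x + b x * l x))" \<delta> "\<delta>/2"])
  show "ulim K (\<lambda>k x. 1 - ph k x) (\<lambda>x. 1 - 1 * (inverse (a x + b x * l x) * inverse (a x + b x * l x)))"
   by (intro ulim_minus ulim_constx[OF tendsto_const] lph)
  fix x assume x: "x \<in> K"
  define z where "z = a x + b x * l x"
  have z: "cmod z = 1" using one[OF x] by (simp add: z_def)
  hence "z \<noteq> 0" by auto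
  hence "1 - 1 * (inverse z * inverse z) = - ((1 - z^2) * (inverse z * inverse z))" by (simp add: field_simps power2_eq_square)
  hence "cmod (1 - 1 * (inverse z * inverse z)) = cmod (1 - z^2)" using z by (simp add: norm_mult norm_inverse)
  thus "\<delta> \<le> cmod (1 - 1 * (inverse (a x + b x * l x) * inverse (a x + b x * l x)))" using gap(1)[OF x] by (simp add: z_def)
 qed (use gap in auto)
 have wy: "wt (Suc d) 0 y" unfolding y_def by (intro wt_add wt_mult0 wABCD wm)
 have wyi: "wt (Suc d) 0 (\<lambda>k x. inverse (y k x))" by (rule wt_inverse[OF wy _ ylb]) simp
 have wdt: "wt (Suc d) 0 dt" unfolding dt_def by (intro wt_diff wt_mult0 wABCD)
 have wph: "wt (Suc d) 0 ph" unfolding ph_def y2_def by (intro wt_mult0 wdt wyi)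
 have w1ph: "wt (Suc d) 0 (\<lambda>k x. inverse (1 - ph k x))" by (rule wt_inverse[OF wt_diff[OF wt_const wph] _ phlb]) (use gap in auto)
 define de where "de = (\<lambda>k x. inverse (1 - ph k x) * e m k x)"
 have wde: "wt (Suc d) s de" unfolding de_def by (intro wt_mult0 w1ph we)
 have lde: "ulim K de (\<lambda>_. 0)" by (rule ow_ulim0[OF wt_imp_ow[OF wde] s])
 define m' where "m' = (\<lambda>k x. m k x - de k x)"
 have wm': "wt (Suc d) 0 m'" unfolding m'_def by (intro wt_diff wm wt_mono[OF wde]) simp
 have lm': "ulim K m' l" unfolding m'_def using ulim_minus[OF lim(5) lde] by simp
 define y' where "y' = (\<lambda>k x. A k x + B k x * m' k x)"
 have ly': "ulim K y' (\<lambda>x. a x + b x * l x)" unfolding y'_def by (intro ulim_add ulim_mult lim lm')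
 have ylb': "evK K (\<lambda>k x. cmod (y' k x) \<ge> 1/2)" by (rule ulim_lower_bound[OF ly', of 1]) (use one in auto)
 have wy': "wt (Suc d) 0 y'" unfolding y'_def by (intro wt_add wt_mult0 wABCD wm')
 have wyi': "wt (Suc d) 0 (\<lambda>k x. inverse (y' k x))" by (rule wt_inverse[OF wy' _ ylb']) simp
 have "wt (Suc d) (s + s) (\<lambda>k x. ph k x * (B k x * (inverse (y' k x) * (de k x * de k x))))"
  by (intro wt_mult0 wph wABCD wyi' wt_mult wde)
 hence "wt (Suc d) (Suc s) (\<lambda>k x. ph k x * (B k x * (inverse (y' k x) * (de k x * de k x))))" by (rule wt_mono) (use s in auto)
 from wt_Suc_depth[OF this] have "wt d (Suc s) (\<lambda>k x. ph k x * (B k x * (inverse (y' k x) * (de k x * de k x))) - (de (Suc k) x - de k x))"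
  using wde by (intro wt_diff[where g = "\<lambda>k x. de (Suc k) x - de k x"]) simp_all
 moreover have "evK K (\<lambda>k x. ph k x * (B k x * (inverse (y' k x) * (de k x * de k x))) - (de (Suc k) x - de k x) = e m' k x)"
  using phlb ylb ylb'
 proof eventually_elim
  case (elim k)
  show ?case
  proof
   fix x assume x: "x \<in> K"
   have ne: "1 - ph k x \<noteq> 0" "y k x \<noteq> 0" "y' k x \<noteq> 0"
    using elim(1)[rule_format, OF x] elim(2)[rule_format, OF x] elim(3)[rule_format, OF x] gap(2) by auto
   have ede: "e m k x = (1 - ph k x) * de k x" unfolding de_def mult.assoc[symmetric] right_inverse[OF ne(1)] by (rule mult_1[symmetric])
   have y'y: "y' k x = y k x - B k x * de k x" by (simp add: y'_def y_def m'_def algebra_simps)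
   have q: "(C k x + D k x * m' k x) / y' k x - (C k x + D k x * m k x) / y k x
     = - ph k x * de k x - ph k x * (B k x * (inverse (y' k x) * (de k x * de k x)))"
    using moebius_perturb[of "A k x" "B k x" "m k x" "de k x" "C k x" "D k x"] ne
    unfolding y_def y'_def m'_def ph_def y2_def dt_def by blast
   have "e m' k x = m (Suc k) x - de (Suc k) x - (C k x + D k x * m' k x) / y' k x" unfolding e_def y'_def by (simp only: m'_def)
   also have "\<dots> = e m k x - de (Suc k) x - ((C k x + D k x * m' k x) / y' k x - (C k x + D k x * m k x) / y k x)"
    unfolding e_def y_def by (simp only: algebra_simps)
   also have "\<dots> = ph k x * (B k x * (inverse (y' k x) * (de k x * de k x))) - (de (Suc k) x - de k x)"
    unfolding q ede by (simp add: algebra_simps)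
   finally show "ph k x * (B k x * (inverse (y' k x) * (de k x * de k x))) - (de (Suc k) x - de k x) = e m' k x" ..
  qed
 qed
 ultimately have "wt d (Suc s) (e m')" by (rule wt_cong)
 thus ?thesis using wt_Suc_depth[OF wm'] lm' by blast
qed

end

section \<open>Riccati maps of elliptic two-by-two recurrences\<close>

context diff_weight
begin

lemma wt_depth_mono: "wt d' s f \<Longrightarrow> d \<le> d' \<Longrightarrow> wt d s f"
 by (induction d' arbitrary: d) (auto simp: le_Suc_eq simp del: wt.simps dest: wt_Suc_depth)

text \<open>A fixed point \<open>m\<close> is the slope of an eigenvector \<open>(1, m)\<close> of
  the matrix with rows \<open>(A, B)\<close> and \<open>(C, D)\<close>, and \<open>A + B * m\<close>
  is the eigenvalue. The number \<open>s\<close> is the root of minus the discriminant of the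
  characteristic polynomial, so \<open>s > 0\<close> is the elliptic case.\<close>

lemma moebius_fixed_point:
 fixes A B C D s :: real and m :: complex
 assumes "B \<noteq> 0" "s > 0" "s^2 = 4 * (A * D - B * C) - (A + D)^2"
 defines "m \<equiv> (of_real (D - A) + \<i> * of_real s) / (2 * of_real B)"
 shows "A + B * m = (of_real (A + D) + \<i> * of_real s) / 2"
  and "(C + D * m) / (A + B * m) = m" and "Im m = s / (2 * B)"
proof -
 have B: "complex_of_real B \<noteq> 0" using assms by simp
 define t :: complex where "t = of_real (D - A) + \<i> * of_real s"
 have Bm: "2 * (B * m) = t" using B by (simp add: m_def t_def)
 show y: "A + B * m = (of_real (A + D) + \<i> * of_real s) / 2" using Bm by (simp add: t_def field_simps)
 have "Im (A + B * m) > 0" unfolding y using assms(2) by simp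
 hence ne: "A + B * m \<noteq> 0" by (metis less_irrefl zero_complex.sel(2))
 have "t^2 + 2 * (A - D) * t = - (of_real (s^2 + (A-D)^2))" by (simp add: t_def power2_eq_square algebra_simps)
 also have "s^2 + (A - D)^2 = - 4 * B * C" unfolding assms(3) by (simp add: power2_eq_square algebra_simps)
 finally have "t^2 + 2 * (A - D) * t = 4 * B * C" by simp
 hence "4 * B * (B * m^2 + (A - D) * m - C) = 0" unfolding Bm[symmetric] by (simp add: power2_eq_square algebra_simps)
 hence "B * m^2 + (A - D) * m - C = 0" using B by simp
 hence "C + D * m = m * (A + B * m)" by (simp add: power2_eq_square algebra_simps)
 thus "(C + D * m) / (A + B * m) = m" using ne by simp
 show "Im m = s / (2 * B)"
 proof -
  have "m = of_real ((D - A) / (2 * B)) + \<i> * of_real (s / (2 * B))" using B by (simp add: m_def field_simps)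
  thus ?thesis by simp
 qed
qed

text \<open>The blockwise fixed point \<open>m0\<close> has its own increment as error, which is of
  order 1 with \<open>r - 1\<close> levels of differences left. Every Newton step trades one level
  for one order, so \<open>r - 1\<close> steps end with order \<open>r\<close> and no
  differences.\<close>

lemma riccati_solution:
 fixes A B C D :: "nat \<Rightarrow> 'x \<Rightarrow> real" and a b c d :: "'x \<Rightarrow> real"
 assumes r: "r \<ge> 1"
  and w: "wt r 0 (\<lambda>k x. of_real (A k x))" "wt r 0 (\<lambda>k x. of_real (B k x))"
   "wt r 0 (\<lambda>k x. of_real (C k x))" "wt r 0 (\<lambda>k x. of_real (D k x))"
  and lim: "ulim K A a" "ulim K B b" "ulim K C c" "ulim K D d"
  and det: "\<And>x. x \<in> K \<Longrightarrow> a x * d x - b x * c x = 1"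
  and ell: "\<delta> > 0" "\<And>x. x \<in> K \<Longrightarrow> (a x + d x)^2 \<le> 4 - \<delta>"
 obtains m :: "nat \<Rightarrow> 'x \<Rightarrow> complex" and l :: "'x \<Rightarrow> complex" and \<kappa> where "ulim K m l" "\<kappa> > 0"
  "\<And>k x. x \<in> K \<Longrightarrow> \<bar>Im (m k x)\<bar> \<ge> \<kappa>" "\<And>x. x \<in> K \<Longrightarrow> \<bar>Im (l x)\<bar> \<ge> \<kappa>" "\<And>k. bounded (m k ` K)"
  "\<And>x. x \<in> K \<Longrightarrow> cmod (a x + b x * l x) = 1"
  "\<And>x. x \<in> K \<Longrightarrow> cmod (1 - (a x + b x * l x)^2) \<ge> \<kappa>"
  "ow r (\<lambda>k x. m (Suc k) x - (C k x + D k x * m k x) / (A k x + B k x * m k x))"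
proof -
 obtain r' where r': "r = Suc r'" using r by (cases r) auto
 obtain Cb where Cb: "Cb > 0" "\<And>x. x \<in> K \<Longrightarrow> \<bar>c x\<bar> \<le> Cb" using ulim_bound_limit[OF lim(3)] by auto
 obtain Bb where Bb: "Bb > 0" "\<And>x. x \<in> K \<Longrightarrow> \<bar>b x\<bar> \<le> Bb" using ulim_bound_limit[OF lim(2)] by auto
 define \<beta> where "\<beta> = \<delta> / (4 * Cb)"
 have \<beta>: "\<beta> > 0" using ell Cb by (simp add: \<beta>_def)
 \<comment> \<open>Ellipticity keeps the off-diagonal entry away from zero: with determinant one,
   \<open>(a - d)^2 + 4 * b * c = (a + d)^2 - 4 \<le> - \<delta>\<close>, so \<open>b * c\<close>
   cannot be small, and \<open>c\<close> is bounded.\<close>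
 have blb: "\<bar>b x\<bar> \<ge> \<beta>" if x: "x \<in> K" for x
 proof -
  have "0 \<le> (a x - d x)^2" by simp
  hence "\<delta> \<le> - 4 * (b x * c x)" using ell(2)[OF x] det[OF x] by (simp add: power2_eq_square algebra_simps)
  also have "\<dots> \<le> 4 * \<bar>b x * c x\<bar>" by linarith
  also have "\<bar>b x * c x\<bar> \<le> \<bar>b x\<bar> * Cb" unfolding abs_mult using Cb(2)[OF x] by (intro mult_left_mono) auto
  finally have "\<delta> \<le> 4 * Cb * \<bar>b x\<bar>" by (simp add: algebra_simps)
  thus ?thesis using Cb(1) by (simp add: \<beta>_def field_simps)
 qed
 define disc where "disc = (\<lambda>k x. 4 * (A k x * D k x - B k x * C k x) - (A k x + D k x)^2)"
 define sq where "sq = (\<lambda>k x. sqrt (disc k x))"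
 define sl where "sl = (\<lambda>x. sqrt (4 - (a x + d x)^2))"
 define m0 where "m0 = (\<lambda>k x. (of_real (D k x - A k x) + \<i> * of_real (sq k x)) / (2 * of_real (B k x)))"
 define l where "l = (\<lambda>x. (of_real (d x - a x) + \<i> * of_real (sl x)) / (2 * of_real (b x)))"
 define e where "e = (\<lambda>(m :: nat \<Rightarrow> 'x \<Rightarrow> complex) k x. m (Suc k) x - (C k x + D k x * m k x) / (A k x + B k x * m k x))"
 have dl: "ulim K disc (\<lambda>x. 4 - (a x + d x)^2)"
 proof -
  have "ulim K disc (\<lambda>x. 4 * (a x * d x - b x * c x) - (a x + d x)^2)"
   unfolding disc_def by (intro ulim_minus ulim_mult ulim_power ulim_add lim ulim_constx[OF tendsto_const])
  thus ?thesis by (rule ulim_cong_limit) (simp add: det)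
 qed
 have dlb: "4 - (a x + d x)^2 \<ge> \<delta>" if "x \<in> K" for x using ell(2)[OF that] by simp
 have "evK K (\<lambda>k x. dist (disc k x) (4 - (a x + d x)^2) < \<delta>/2)"
  using uniform_limitD[OF ulim_uniform_limit[OF dl], of "\<delta>/2"] ell(1) by simp
 hence discev: "evK K (\<lambda>k x. disc k x \<ge> \<delta>/2)"
 proof eventually_elim
  case (elim k)
  show ?case
  proof
   fix x assume "x \<in> K"
   hence "\<bar>disc k x - (4 - (a x + d x)^2)\<bar> < \<delta>/2" "4 - (a x + d x)^2 \<ge> \<delta>"
    using elim dlb by (auto simp: dist_real_def)
   thus "\<delta>/2 \<le> disc k x" by linarith
  qed
 qed
 have sql: "ulim K sq sl" unfolding sq_def sl_def by (rule ulim_sqrt[OF dl ell(1) dlb])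
 have sl: "sl x > 0" "(sl x)^2 = 4 - (a x + d x)^2" "sl x \<ge> sqrt \<delta>" if "x \<in> K" for x
  using dlb[OF that] ell(1) by (auto simp: sl_def)
 have lm0: "ulim K m0 l" unfolding m0_def l_def
 proof (rule ulim_divide[where c = "2 * \<beta>"])
  show "ulim K (\<lambda>k x. 2 * complex_of_real (B k x)) (\<lambda>x. 2 * of_real (b x))"
   by (intro ulim_mult ulim_of_real lim ulim_constx[OF tendsto_const])
  show "ulim K (\<lambda>k x. complex_of_real (D k x - A k x) + \<i> * of_real (sq k x)) (\<lambda>x. of_real (d x - a x) + \<i> * of_real (sl x))"
   by (intro ulim_add ulim_mult ulim_of_real ulim_minus lim sql ulim_constx[OF tendsto_const])
 qed (use \<beta> blb in \<open>auto simp: norm_mult\<close>)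
 have Bev: "evK K (\<lambda>k x. \<bar>B k x\<bar> \<ge> \<beta>/2)"
  using ulim_lower_bound[OF lim(2), of \<beta> "\<beta>/2"] blb \<beta> by simp
 have wdisc: "wt r 0 (\<lambda>k x. of_real (disc k x))"
  unfolding disc_def of_real_diff of_real_mult of_real_power of_real_add power2_eq_square
  by (intro wt_diff wt_mult0 wt_add w) (rule wt_const)
 have wsq: "wt r 0 (\<lambda>k x. of_real (sq k x))" unfolding sq_def by (rule wt_sqrt[OF wdisc _ discev]) (use ell in auto)
 have wm0: "wt r 0 m0" unfolding m0_def divide_inverse of_real_diff
  by (intro wt_mult0 wt_add wt_diff wsq w wt_const wt_inverse[of _ _ \<beta>])
    (use \<beta> in \<open>auto intro!: eventually_mono[OF Bev] simp: norm_mult\<close>)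
 have em0: "evK K (\<lambda>k x. m0 (Suc k) x - m0 k x = e m0 k x)" using discev Bev
 proof eventually_elim
  case (elim k)
  show ?case
  proof
   fix x assume x: "x \<in> K"
   have 1: "B k x \<noteq> 0" "disc k x > 0" using elim x \<beta> ell(1) by fastforce+
   hence "(C k x + D k x * m0 k x) / (A k x + B k x * m0 k x) = m0 k x"
    unfolding m0_def by (intro moebius_fixed_point(2)) (auto simp: sq_def disc_def)
   thus "m0 (Suc k) x - m0 k x = e m0 k x" by (simp add: e_def)
  qed
 qed
 have we0: "wt r' 1 (e m0)" by (rule wt_cong[OF _ em0]) (use wm0 r' in auto)
 have fl: "a x + b x * l x = (of_real (a x + d x) + \<i> * of_real (sl x)) / 2" "Im (l x) = sl x / (2 * b x)" if x: "x \<in> K" for x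
  using moebius_fixed_point(1,3)[where A = "a x" and B = "b x" and C = "c x" and D = "d x" and s = "sl x"] sl[OF x] blb[OF x] \<beta> det[OF x]
  unfolding l_def by auto
 have one: "cmod (a x + b x * l x) = 1" if x: "x \<in> K" for x
 proof -
  have "(cmod (a x + b x * l x))^2 = ((a x + d x)/2)^2 + (sl x/2)^2" unfolding fl(1)[OF x] cmod_power2 by simp
  also have "\<dots> = 1" unfolding power_divide sl(2)[OF x] by (simp add: field_simps)
  finally show ?thesis using norm_ge_zero[of "a x + b x * l x"] by (auto simp: power2_eq_1_iff)
 qed
 \<comment> \<open>For a number \<open>z\<close> of modulus one,
   \<open>1 - z^2 = z * (cnj z - z)\<close>, so the distance of \<open>z^2\<close> from 1 is twice
   \<open>\<bar>Im z\<bar>\<close>, here the root \<open>sl\<close>.\<close>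
 have gap: "cmod (1 - (a x + b x * l x)^2) \<ge> sqrt \<delta>" if x: "x \<in> K" for x
 proof -
  define z where "z = a x + b x * l x"
  have "z * cnj z = 1" using one[OF x] complex_norm_square[of z] by (simp add: z_def)
  hence "1 - z^2 = z * (cnj z - z)" by (simp add: algebra_simps power2_eq_square)
  hence "cmod (1 - z^2) = cmod (cnj z - z)" using one[OF x] by (simp add: norm_mult z_def)
  also have "cnj z - z = - \<i> * of_real (2 * Im z)" by (simp add: complex_eq_iff)
  also have "2 * Im z = sl x" unfolding z_def fl(1)[OF x] by simp
  also have "cmod (- \<i> * of_real (sl x)) = \<bar>sl x\<bar>" by (simp add: norm_mult)
  finally show ?thesis using sl[OF x] by (simp add: z_def)
 qed
 have "\<exists>m. wt (r' - j) 0 m \<and> ulim K m l \<and> wt (r' - j) (Suc j) (e m)" if "j \<le> r'" for j using that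
 proof (induction j)
  case 0
  thus ?case using wt_Suc_depth[of r' 0 m0] wm0 we0 lm0 r' by (intro exI[of _ m0]) simp
 next
  case (Suc j)
  then obtain m where m: "wt (r' - j) 0 m" "ulim K m l" "wt (r' - j) (Suc j) (e m)" by auto
  define q where "q = r' - Suc j"
  have q: "r' - j = Suc q" using Suc.prems by (simp add: q_def)
  have wq: "wt (Suc q) 0 (\<lambda>k x. of_real (A k x))" "wt (Suc q) 0 (\<lambda>k x. of_real (B k x))"
   "wt (Suc q) 0 (\<lambda>k x. of_real (C k x))" "wt (Suc q) 0 (\<lambda>k x. of_real (D k x))"
   using Suc.prems by (auto intro!: wt_depth_mono[of r] w simp: r' q_def simp del: wt.simps)
  have "\<exists>m'. wt q 0 m' \<and> ulim K m' l \<and> wt q (Suc (Suc j)) (e m')" unfolding e_def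
   by (rule riccati_newton_step[OF wq ulim_of_real[OF lim(1)] ulim_of_real[OF lim(2)] ulim_of_real[OF lim(3)] ulim_of_real[OF lim(4)] m(2),
     where \<delta> = "sqrt \<delta>"])
     (use det one gap ell m q in \<open>auto simp flip: of_real_mult of_real_diff simp: e_def simp del: wt.simps\<close>)
  thus ?case unfolding q_def .
 qed
 from this[of r'] obtain m where m: "ulim K m l" "ow r (e m)" by (auto simp: r')
 define \<kappa> where "\<kappa> = min (sqrt \<delta>) (sqrt \<delta> / (2 * Bb))"
 have Iml: "\<bar>Im (l x)\<bar> \<ge> \<kappa>" if x: "x \<in> K" for x
 proof -
  have "sqrt \<delta> / (2 * Bb) \<le> sl x / (2 * \<bar>b x\<bar>)" using sl[OF x] Bb(2)[OF x] blb[OF x] \<beta> by (intro frac_le) auto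
  thus ?thesis using sl[OF x] by (simp add: fl(2)[OF x] \<kappa>_def abs_mult)
 qed
 have \<kappa>: "\<kappa> > 0" using ell Bb by (simp add: \<kappa>_def)
 obtain Mb where Mb: "evK K (\<lambda>k x. cmod (m k x) \<le> Mb)" using ulim_bound_ev[OF m(1)] by blast
 have "evK K (\<lambda>k x. \<bar>Im (m k x)\<bar> \<ge> \<kappa>/2)"
  using ulim_lower_bound[OF ulim_Im[OF m(1)], of \<kappa> "\<kappa>/2"] Iml \<kappa> by simp
 hence "evK K (\<lambda>k x. \<bar>Im (m k x)\<bar> \<ge> \<kappa>/2 \<and> cmod (m k x) \<le> Mb)" using Mb by eventually_elim auto
 then obtain k0 where k0: "\<And>k x. k \<ge> k0 \<Longrightarrow> x \<in> K \<Longrightarrow> \<bar>Im (m k x)\<bar> \<ge> \<kappa>/2 \<and> cmod (m k x) \<le> Mb"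
  unfolding eventually_sequentially by auto
 \<comment> \<open>Finitely many early slopes are replaced by the limit. The bounds then hold for
   all \<open>k\<close>, while order and limit, being asymptotic, do not change.\<close>
 define m' where "m' = (\<lambda>k x. if k < k0 then l x else m k x)"
 have evm: "evK K (\<lambda>k x. m k x = m' k x)" using eventually_ge_at_top[of k0] by eventually_elim (auto simp: m'_def)
 have 1: "ulim K m' l" using m(1) uniform_limit_cong[OF evm, of l l] unfolding ulim_def by simp
 have 2: "ow r (e m')" by (rule ow_cong[OF _ m(2)], rule eventually_mono[OF eventually_ge_at_top[of k0]]) (auto simp: m'_def e_def)
 have 3: "\<bar>Im (m' k x)\<bar> \<ge> \<kappa>/2" if "x \<in> K" for k x
  using k0[of k x] that Iml[OF that] \<kappa> by (auto simp: m'_def)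
 have 4: "bounded (m' k ` K)" for k
 proof (cases "k < k0")
  case True
  hence "m' k = l" by (auto simp: m'_def)
  thus ?thesis using m(1) by (simp add: ulim_def)
 next
  case False
  thus ?thesis using k0[of k] by (auto simp: m'_def bounded_iff)
 qed
 show thesis
 proof (rule that[OF 1, of "\<kappa>/2"])
  fix x assume x: "x \<in> K"
  show "\<kappa>/2 \<le> \<bar>Im (l x)\<bar>" using Iml[OF x] \<kappa> by linarith
  show "\<kappa>/2 \<le> cmod (1 - (a x + b x * l x)^2)"
   using gap[OF x] \<kappa> min.cobounded1[of "sqrt \<delta>" "sqrt \<delta> / (2 * Bb)"] unfolding \<kappa>_def[symmetric] by linarith
 qed (use \<kappa> 2 3 4 one in \<open>auto simp: e_def\<close>)
qed

text \<open>If \<open>m\<close> followed the Riccati map exactly, then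
  \<open>v (Suc k) = (dt / y) * v k\<close> and
  \<open>Im (m (Suc k)) = dt * Im (m k) / (cmod y)^2\<close>. As
  \<open>dt = \<tau> k / \<tau> (Suc k)\<close>, the flux
  \<open>g = (cmod v)^2 * \<tau> / \<bar>Im m\<bar>\<close> would be constant. The summable error of
  \<open>m\<close> makes it almost constant, whence the limit \<open>G\<close>. The squares of
  \<open>v\<close> are multiplied by nearly \<open>q\<close>, a number of modulus one away from 1,
  so their averages vanish.\<close>

lemma riccati_orbit:
 fixes A B C D u w :: "nat \<Rightarrow> 'x \<Rightarrow> real" and a b c d :: "'x \<Rightarrow> real"
  and m v :: "nat \<Rightarrow> 'x \<Rightarrow> complex" and l :: "'x \<Rightarrow> complex"
 assumes sme: "summable (\<lambda>k. \<epsilon> k ^ r)" and r: "r \<ge> 1"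
  and lim: "ulim K A a" "ulim K B b" "ulim K C c" "ulim K D d"
  and step: "\<And>k x. x \<in> K \<Longrightarrow> u (Suc k) x = A k x * u k x + B k x * w k x"
   "\<And>k x. x \<in> K \<Longrightarrow> w (Suc k) x = C k x * u k x + D k x * w k x"
  and nz: "\<And>k x. x \<in> K \<Longrightarrow> u k x \<noteq> 0 \<or> w k x \<noteq> 0"
  and bd: "\<And>k. bounded (u k ` K)" "\<And>k. bounded (w k ` K)"
  and det: "\<And>k x. x \<in> K \<Longrightarrow> (A k x * D k x - B k x * C k x) * \<tau> (Suc k) = \<tau> k"
  and tau: "\<And>k. \<tau> k > 0" "\<tau> \<longlonglongrightarrow> t" "t > 0"
  and m: "ulim K m l" "\<kappa> > 0"
   "\<And>k x. x \<in> K \<Longrightarrow> \<bar>Im (m k x)\<bar> \<ge> \<kappa>" "\<And>x. x \<in> K \<Longrightarrow> \<bar>Im (l x)\<bar> \<ge> \<kappa>" "\<And>k. bounded (m k ` K)"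
   "\<And>x. x \<in> K \<Longrightarrow> cmod (a x + b x * l x) = 1"
   "\<And>x. x \<in> K \<Longrightarrow> cmod (1 - (a x + b x * l x)^2) \<ge> \<kappa>"
   "ow r (\<lambda>k x. m (Suc k) x - (C k x + D k x * m k x) / (A k x + B k x * m k x))"
  and v_def: "v = (\<lambda>k x. complex_of_real (w k x) - m k x * complex_of_real (u k x))"
 obtains G where "ulim K (\<lambda>k x. (cmod (v k x))^2) G" "\<And>x. x \<in> K \<Longrightarrow> G x > 0" "\<And>k. bounded (v k ` K)"
  "uniform_limit K (\<lambda>n x. (\<Sum>k<n. (v k x)^2) / of_nat n) (\<lambda>_. 0) sequentially"
proof -
 define e where "e = (\<lambda>k x. m (Suc k) x - (C k x + D k x * m k x) / (A k x + B k x * m k x))"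
 define y where "y = (\<lambda>k x. A k x + B k x * m k x)"
 define dt where "dt = (\<lambda>k x. A k x * D k x - B k x * C k x)"
 define ga where "ga = (\<lambda>k x. complex_of_real (dt k x) / y k x)"
 have ly: "ulim K y (\<lambda>x. a x + b x * l x)" unfolding y_def by (intro ulim_add ulim_mult ulim_of_real lim m)
 have dtt: "dt k x = \<tau> k / \<tau> (Suc k)" if "x \<in> K" for k x 
  using det[OF that, of k] tau(1)[of "Suc k"] nonzero_eq_divide_eq[of "\<tau> (Suc k)"] unfolding dt_def by (metis less_irrefl)
 have ldt: "ulim K dt (\<lambda>x. 1)"
 proof -
  have "(\<lambda>k. \<tau> k / \<tau> (Suc k)) \<longlonglongrightarrow> t / t"
   using tau(3) by (intro tendsto_divide[OF tau(2) LIMSEQ_Suc[OF tau(2)]]) simp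
  hence "ulim K (\<lambda>k x. \<tau> k / \<tau> (Suc k)) (\<lambda>x. 1)" using ulim_constx[of _ "t / t" K] tau(3) by simp
  thus ?thesis by (rule ulim_cong) (rule dtt)
 qed
 have lga: "ulim K ga (\<lambda>x. of_real 1 / (a x + b x * l x))"
  unfolding ga_def by (rule ulim_divide[OF ulim_of_real[OF ldt] ly, of 1]) (use m(6) in auto)
 obtain M1 where M1: "M1 > 0" "evK K (\<lambda>k x. cmod (m k x) \<le> M1)" using ulim_bound_ev[OF m(1)] by blast
 obtain M2 where M2: "M2 > 0" "evK K (\<lambda>k x. norm (A k x) \<le> M2)" using ulim_bound_ev[OF lim(1)] by blast
 obtain M3 where M3: "M3 > 0" "evK K (\<lambda>k x. norm (B k x) \<le> M3)" using ulim_bound_ev[OF lim(2)] by blast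
 obtain M4 where M4: "M4 > 0" "evK K (\<lambda>k x. cmod (ga k x) \<le> M4)" using ulim_bound_ev[OF lga] by blast
 have ylb: "evK K (\<lambda>k x. cmod (y k x) \<ge> 1/2)" by (rule ulim_lower_bound[OF ly, of 1]) (use m(6) in auto)
 have dlb: "evK K (\<lambda>k x. norm (dt k x) \<ge> 1/2)" by (rule ulim_lower_bound[OF ldt, of 1]) auto
 obtain E where E: "E \<ge> 0" "evK K (\<lambda>k x. cmod (e k x) \<le> E * \<epsilon> k ^ r)" using m(8) unfolding ow_def e_def by auto
 have le: "ulim K e (\<lambda>_. 0)" using m(8) r unfolding e_def by (intro ow_ulim0[of r]) auto
 have e1: "evK K (\<lambda>k x. cmod (e k x) \<le> 1)"
  using uniform_limitD[OF ulim_uniform_limit[OF le], of 1] by (auto elim!: eventually_mono simp: less_imp_le)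
 \<comment> \<open>\<open>C1\<close> bounds \<open>u (Suc k)\<close> by \<open>cmod (v k)\<close>,
   \<open>C2\<close> is the resulting constant for the increments of the squares, and
   \<open>C3\<close> the one for the relative increment of the flux \<open>g\<close>.\<close>
 define C1 where "C1 = M2 * (1/\<kappa>) + M3 * (1 + M1 * (1/\<kappa>))"
 define C2 where "C2 = C1 * (2 * M4 + C1)"
 define C3 where "C3 = C2 * (2 * M1) * (1/\<kappa>) + 1/\<kappa>"
 have C1: "C1 \<ge> 0" unfolding C1_def using M1 M2 M3 m(2) by simp
 have C2: "C2 \<ge> 0" unfolding C2_def using C1 M4 by simp
 have C3: "C3 \<ge> 0" unfolding C3_def using C2 M1 m(2) by simp
 \<comment> \<open>Since \<open>u\<close> and \<open>w\<close> are real, the imaginary part of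
   \<open>v\<close> recovers \<open>u\<close>; this is why slopes away from the real axis let
   \<open>v\<close> control the whole orbit.\<close>
 have uv: "\<bar>u k x\<bar> \<le> (1/\<kappa>) * cmod (v k x)" if x: "x \<in> K" for k x
 proof -
  have "Im (v k x) = - Im (m k x) * u k x" by (simp add: v_def)
  hence "\<bar>Im (m k x)\<bar> * \<bar>u k x\<bar> \<le> cmod (v k x)" using abs_Im_le_cmod[of "v k x"] by (simp add: abs_mult)
  moreover have "\<kappa> * \<bar>u k x\<bar> \<le> \<bar>Im (m k x)\<bar> * \<bar>u k x\<bar>" using m(3)[OF x] by (intro mult_right_mono) auto
  ultimately show ?thesis using m(2) by (simp add: field_simps)
 qed
 have vpos: "cmod (v k x) > 0" if x: "x \<in> K" for k x
 proof -
  have "v k x \<noteq> 0"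
  proof
   assume v0: "v k x = 0"
   hence "u k x = 0" using uv[OF x, of k] by simp
   with v0 nz[OF x, of k] show False by (simp add: v_def)
  qed
  thus ?thesis by simp
 qed
 have rec: "v (Suc k) x = ga k x * v k x - e k x * u (Suc k) x" if x: "x \<in> K" and y0: "y k x \<noteq> 0" for k x
 proof -
  define M where "M = (C k x + D k x * m k x) / y k x"
  have My: "M * y k x = C k x + D k x * m k x" using y0 by (simp add: M_def)
  have "(w (Suc k) x - M * u (Suc k) x) * y k x = of_real (w (Suc k) x) * y k x - (M * y k x) * of_real (u (Suc k) x)"
   by (simp add: algebra_simps)
  also have "\<dots> = dt k x * v k x" unfolding My step[OF x] by (simp add: dt_def v_def y_def algebra_simps)
  finally have "w (Suc k) x - M * u (Suc k) x = ga k x * v k x" unfolding ga_def times_divide_eq_left nonzero_eq_divide_eq[OF y0] .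
  moreover have "m (Suc k) x = M + e k x" by (simp add: M_def e_def y_def)
  ultimately show ?thesis by (simp add: v_def algebra_simps)
 qed
 have main: "evK K (\<lambda>k x. cmod (v (Suc k) x - ga k x * v k x) \<le> C1 * cmod (e k x) * cmod (v k x)
   \<and> cmod ((v (Suc k) x)^2 - (ga k x * v k x)^2) \<le> C2 * cmod (e k x) * (cmod (v k x))^2
   \<and> \<bar>(cmod (v (Suc k) x))^2 - (cmod (ga k x * v k x))^2\<bar> \<le> C2 * cmod (e k x) * (cmod (v k x))^2)"
  using M1(2) M2(2) M3(2) M4(2) ylb e1
 proof eventually_elim
  case (elim k)
  show ?case
  proof
   fix x assume x: "x \<in> K"
   have y0: "y k x \<noteq> 0" using elim(5)[rule_format, OF x] by auto
   have w: "\<bar>w k x\<bar> \<le> (1 + M1 * (1/\<kappa>)) * cmod (v k x)"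
   proof -
    have "of_real (w k x) = v k x + m k x * of_real (u k x)" by (simp add: v_def)
    hence "cmod (of_real (w k x)) \<le> cmod (v k x) + cmod (m k x * of_real (u k x))" by (metis norm_triangle_ineq)
    also have "cmod (m k x * of_real (u k x)) \<le> M1 * ((1/\<kappa>) * cmod (v k x))"
     unfolding norm_mult using elim(1) x uv[OF x, of k] M1 by (intro mult_mono) auto
    finally show ?thesis by (simp add: algebra_simps)
   qed
   have "\<bar>u (Suc k) x\<bar> \<le> \<bar>A k x\<bar> * \<bar>u k x\<bar> + \<bar>B k x\<bar> * \<bar>w k x\<bar>"
    unfolding step(1)[OF x] by (metis abs_mult abs_triangle_ineq)
   also have "\<dots> \<le> M2 * ((1/\<kappa>) * cmod (v k x)) + M3 * ((1 + M1 * (1/\<kappa>)) * cmod (v k x))"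
    using elim(2,3) x uv[OF x, of k] w M2 M3 by (intro add_mono mult_mono) auto
   also have "\<dots> = C1 * cmod (v k x)" by (simp add: C1_def algebra_simps)
   finally have u': "\<bar>u (Suc k) x\<bar> \<le> C1 * cmod (v k x)" .
   have 1: "cmod (v (Suc k) x - ga k x * v k x) \<le> C1 * cmod (e k x) * cmod (v k x)"
    using mult_left_mono[OF u', of "cmod (e k x)"] by (simp add: rec[OF x y0] norm_mult mult_ac)
   have e: "cmod (e k x) \<le> 1" using elim(6) x by auto
   have gv: "cmod (ga k x * v k x) \<le> M4 * cmod (v k x)" unfolding norm_mult using elim(4) x by (intro mult_right_mono) auto
   have 2: "cmod (v (Suc k) x - ga k x * v k x) * (cmod (v (Suc k) x) + cmod (ga k x * v k x)) \<le> C2 * cmod (e k x) * (cmod (v k x))^2"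
   proof -
    have "cmod (v (Suc k) x) \<le> cmod (ga k x * v k x) + cmod (v (Suc k) x - ga k x * v k x)" by (metis add.commute norm_triangle_sub)
    moreover have "C1 * cmod (e k x) * cmod (v k x) \<le> C1 * 1 * cmod (v k x)"
     using e C1 by (intro mult_right_mono mult_left_mono) auto
    ultimately have s: "cmod (v (Suc k) x) + cmod (ga k x * v k x) \<le> (2 * M4 + C1) * cmod (v k x)"
     using 1 gv by (simp add: algebra_simps)
    have "cmod (v (Suc k) x - ga k x * v k x) * (cmod (v (Suc k) x) + cmod (ga k x * v k x))
      \<le> (C1 * cmod (e k x) * cmod (v k x)) * ((2 * M4 + C1) * cmod (v k x))" using 1 s C1 by (intro mult_mono) auto
    thus ?thesis by (simp add: C2_def power2_eq_square mult_ac)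
   qed
   have 3: "cmod ((v (Suc k) x)^2 - (ga k x * v k x)^2) \<le> C2 * cmod (e k x) * (cmod (v k x))^2"
   proof -
    have "(v (Suc k) x)^2 - (ga k x * v k x)^2 = (v (Suc k) x - ga k x * v k x) * (v (Suc k) x + ga k x * v k x)"
     by (simp add: power2_eq_square algebra_simps)
    hence "cmod ((v (Suc k) x)^2 - (ga k x * v k x)^2) \<le> cmod (v (Suc k) x - ga k x * v k x) * (cmod (v (Suc k) x) + cmod (ga k x * v k x))"
     using mult_left_mono[OF norm_triangle_ineq[of "v (Suc k) x" "ga k x * v k x"], of "cmod (v (Suc k) x - ga k x * v k x)"]
     by (metis norm_ge_zero norm_mult)
    thus ?thesis using 2 by linarith
   qed
   have "\<bar>(cmod (v (Suc k) x))^2 - (cmod (ga k x * v k x))^2\<bar> \<le> cmod ((v (Suc k) x)^2 - (ga k x * v k x)^2)"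
    using norm_triangle_ineq3[of "(v (Suc k) x)^2" "(ga k x * v k x)^2"] by (simp add: norm_power)
   with 1 3 show "cmod (v (Suc k) x - ga k x * v k x) \<le> C1 * cmod (e k x) * cmod (v k x)
   \<and> cmod ((v (Suc k) x)^2 - (ga k x * v k x)^2) \<le> C2 * cmod (e k x) * (cmod (v k x))^2
   \<and> \<bar>(cmod (v (Suc k) x))^2 - (cmod (ga k x * v k x))^2\<bar> \<le> C2 * cmod (e k x) * (cmod (v k x))^2" by linarith
  qed
 qed
 define g where "g = (\<lambda>k x. (cmod (v k x))^2 * \<tau> k / \<bar>Im (m k x)\<bar>)"
 have gpos: "g k x > 0" if x: "x \<in> K" for k x
  using vpos[OF x, of k] tau(1)[of k] m(3)[OF x, of k] m(2) by (auto simp: g_def intro!: divide_pos_pos mult_pos_pos)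
 have gstep: "evK K (\<lambda>k x. g k x > 0 \<and> \<bar>g (Suc k) x - g k x\<bar> \<le> (C3 * E * \<epsilon> k ^ r) * g k x)"
  using main ylb dlb M1(2) E(2)
 proof eventually_elim
  case (elim k)
  show ?case
  proof
   fix x assume x: "x \<in> K"
   define M where "M = (C k x + D k x * m k x) / y k x"
   have dtp: "dt k x > 0" using dtt[OF x, of k] tau(1) by simp
   define im im' where "im = \<bar>Im (m k x)\<bar>" and "im' = \<bar>Im (m (Suc k) x)\<bar>"
   have im: "im \<ge> \<kappa>" "im' \<ge> \<kappa>" "im > 0" "im' > 0" using m(3)[OF x, of k] m(3)[OF x, of "Suc k"] m(2) by (auto simp: im_def im'_def)
   have imM: "im \<le> M1" using elim(4)[rule_format, OF x] abs_Im_le_cmod[of "m k x"] by (simp add: im_def)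
   have ImM: "\<bar>Im M\<bar> = dt k x * im / (cmod (y k x))^2"
   proof -
    have "M = (C k x + D k x * m k x) * cnj (y k x) / of_real ((cmod (y k x))^2)" unfolding M_def by (subst complex_div_cnj) simp
    also have "Im \<dots> = Im ((C k x + D k x * m k x) * cnj (y k x)) / (cmod (y k x))^2" by (subst Im_divide_of_real) simp
    also have "Im ((C k x + D k x * m k x) * cnj (y k x)) = dt k x * Im (m k x)" by (simp add: y_def dt_def algebra_simps)
    finally show ?thesis using dtp by (simp add: im_def abs_mult)
   qed
   have tk: "\<tau> k = dt k x * \<tau> (Suc k)" using dtt[OF x, of k] tau(1)[of "Suc k"] by simp
   have mid: "(cmod (ga k x * v k x))^2 * \<tau> (Suc k) / im' = g k x * (\<bar>Im M\<bar> / im')"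
   proof -
    have "(cmod (ga k x))^2 = (dt k x)^2 / (cmod (y k x))^2" by (simp add: ga_def norm_divide power_divide)
    hence "(cmod (ga k x * v k x))^2 * \<tau> (Suc k) / im' = (dt k x)^2 / (cmod (y k x))^2 * (cmod (v k x))^2 * \<tau> (Suc k) / im'"
     by (simp add: norm_mult power_mult_distrib)
    also have "\<dots> = g k x * (\<bar>Im M\<bar> / im')"
     unfolding ImM g_def tk im_def[symmetric] using im(3) by (simp add: power2_eq_square)
    finally show ?thesis .
   qed
   have Me: "m (Suc k) x = M + e k x" by (simp add: M_def e_def y_def)
   have p1: "\<bar>\<bar>Im M\<bar> / im' - 1\<bar> \<le> cmod (e k x) * (1/\<kappa>)"
   proof -
    have "\<bar>\<bar>Im M\<bar> - im'\<bar> \<le> \<bar>Im (e k x)\<bar>" unfolding im'_def Me by simp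
    also have "\<dots> \<le> cmod (e k x)" by (rule abs_Im_le_cmod)
    finally have "\<bar>\<bar>Im M\<bar> - im'\<bar> / im' \<le> cmod (e k x) / \<kappa>" using im m(2) by (intro frac_le) auto
    moreover have "\<bar>\<bar>Im M\<bar> / im' - 1\<bar> = \<bar>\<bar>Im M\<bar> - im'\<bar> / im'" 
    proof -
     have "\<bar>Im M\<bar> / im' - 1 = (\<bar>Im M\<bar> - im') / im'" using im(4) by (simp add: diff_divide_distrib)
     thus ?thesis using im(4) by (simp add: abs_divide)
    qed
    ultimately show ?thesis by simp
   qed
   have p2: "\<bar>g (Suc k) x - (cmod (ga k x * v k x))^2 * \<tau> (Suc k) / im'\<bar> \<le> C2 * cmod (e k x) * (2 * M1) * (1/\<kappa>) * g k x"
   proof -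
    have "g (Suc k) x - (cmod (ga k x * v k x))^2 * \<tau> (Suc k) / im'
      = ((cmod (v (Suc k) x))^2 - (cmod (ga k x * v k x))^2) * (\<tau> (Suc k) / im')"
     by (simp add: g_def im'_def diff_divide_distrib left_diff_distrib)
    also have "\<bar>\<dots>\<bar> \<le> C2 * cmod (e k x) * (cmod (v k x))^2 * (\<tau> (Suc k) / im')"
     unfolding abs_mult using elim(1) x tau(1)[of "Suc k"] im by (intro mult_mono) auto
    also have "\<dots> = C2 * cmod (e k x) * (g k x * (im / dt k x) * (1 / im'))"
     unfolding g_def im_def[symmetric] tk using dtp im tau(1)[of "Suc k"] by simp
    also have "\<dots> \<le> C2 * cmod (e k x) * (g k x * (M1 * 2) * (1 / \<kappa>))"
    proof -
     have "dt k x \<ge> 1/2" using elim(3)[rule_format, OF x] dtp by simp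
     hence "im / dt k x \<le> M1 / (1/2)" using imM im M1 by (intro frac_le) auto
     thus ?thesis using C2 im m(2) gpos[OF x, of k] M1 dtp by (intro mult_left_mono mult_mono divide_left_mono) auto
    qed
    finally show ?thesis by (simp add: mult_ac)
   qed
   have "\<bar>g (Suc k) x - g k x\<bar> \<le> \<bar>g (Suc k) x - (cmod (ga k x * v k x))^2 * \<tau> (Suc k) / im'\<bar> + \<bar>g k x * (\<bar>Im M\<bar> / im' - 1)\<bar>"
    unfolding mid right_diff_distrib mult_1_right by linarith
   also have "\<dots> \<le> C2 * cmod (e k x) * (2 * M1) * (1/\<kappa>) * g k x + g k x * (cmod (e k x) * (1/\<kappa>))"
    using add_mono[OF p2 mult_left_mono[OF p1 less_imp_le[OF gpos[OF x, of k]]]] gpos[OF x, of k] by (simp add: abs_mult)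
   also have "\<dots> = C3 * cmod (e k x) * g k x" by (simp add: C3_def algebra_simps)
   also have "\<dots> \<le> (C3 * E * \<epsilon> k ^ r) * g k x"
    using elim(5)[rule_format, OF x] C3 gpos[OF x, of k] by (intro mult_right_mono) (auto simp: mult.assoc intro!: mult_left_mono)
   finally show "g k x > 0 \<and> \<bar>g (Suc k) x - g k x\<bar> \<le> (C3 * E * \<epsilon> k ^ r) * g k x" using gpos[OF x] by auto
  qed
 qed
 have vb: "bounded (v k ` K)" for k
 proof -
  obtain b1 b2 b3 where b: "\<And>x. x \<in> K \<Longrightarrow> \<bar>u k x\<bar> \<le> b1" "\<And>x. x \<in> K \<Longrightarrow> \<bar>w k x\<bar> \<le> b2" "\<And>x. x \<in> K \<Longrightarrow> cmod (m k x) \<le> b3"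
   using bd(1)[of k] bd(2)[of k] m(5)[of k] unfolding bounded_iff by (metis image_eqI real_norm_def)
  have "cmod (v k x) \<le> b2 + b3 * b1" if x: "x \<in> K" for x
  proof -
   have "cmod (v k x) \<le> \<bar>w k x\<bar> + cmod (m k x) * \<bar>u k x\<bar>"
    unfolding v_def by (rule order_trans[OF norm_triangle_ineq4]) (simp add: norm_mult)
   also have "\<dots> \<le> b2 + b3 * b1" using b[OF x] by (intro add_mono mult_mono) (auto intro: order_trans[OF norm_ge_zero])
   finally show ?thesis .
  qed
  thus ?thesis by (auto simp: bounded_iff)
 qed
 have gb: "bounded (g k ` K)" for k
 proof -
  obtain b1 where b1: "\<And>x. x \<in> K \<Longrightarrow> cmod (v k x) \<le> b1" using vb[of k] unfolding bounded_iff by (metis image_eqI)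
  have "\<bar>g k x\<bar> \<le> b1^2 * \<tau> k / \<kappa>" if x: "x \<in> K" for x
  proof -
   have "g k x \<le> b1^2 * \<tau> k / \<kappa>" unfolding g_def
   proof (rule frac_le)
    show "(cmod (v k x))^2 * \<tau> k \<le> b1^2 * \<tau> k" using b1[OF x] tau(1)[of k] by (intro mult_right_mono power_mono) auto
   qed (use tau(1)[of k] m(2) m(3)[OF x, of k] in auto)
   thus ?thesis using gpos[OF x, of k] by simp
  qed
  thus ?thesis by (auto simp: bounded_iff)
 qed
 obtain G0 where G0: "ulim K g G0" "\<And>x. x \<in> K \<Longrightarrow> G0 x > 0"
 proof (rule almost_constant_limit[OF gstep])
  show "summable (\<lambda>k. C3 * E * \<epsilon> k ^ r)" by (intro summable_mult sme)
  show "0 \<le> C3 * E * \<epsilon> k ^ r" for k using C3 E eps_nonneg by simp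
 qed (use gb in auto)
 define G where "G = (\<lambda>x. G0 x * \<bar>Im (l x)\<bar> / t)"
 have lv: "ulim K (\<lambda>k x. (cmod (v k x))^2) G"
 proof -
  have "ulim K (\<lambda>k x. g k x * \<bar>Im (m k x)\<bar> / \<tau> k) G"
   unfolding G_def by (rule ulim_divide[OF ulim_mult[OF G0(1) ulim_abs[OF ulim_Im[OF m(1)]]] ulim_constx[OF tau(2)], of t])
    (use tau in auto)
  thus ?thesis
  proof (rule ulim_cong)
   fix k x assume "x \<in> K"
   thus "(cmod (v k x))^2 = g k x * \<bar>Im (m k x)\<bar> / \<tau> k" using tau(1)[of k] m(3)[of x k] m(2) by (auto simp: g_def)
  qed
 qed
 have Gpos: "G x > 0" if "x \<in> K" for x
  using G0(2)[OF that] m(4)[OF that] m(2) tau(3) by (auto simp: G_def intro!: divide_pos_pos mult_pos_pos)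
 obtain Gb where Gb: "Gb > 0" "evK K (\<lambda>k x. norm ((cmod (v k x))^2) \<le> Gb)" using ulim_bound_ev[OF lv] by blast
 define q where "q = (\<lambda>x. (1 / (a x + b x * l x))^2)"
 have qn: "cmod (q x) = 1" if "x \<in> K" for x using m(6)[OF that] by (simp add: q_def norm_power norm_divide)
 have "uniform_limit K (\<lambda>n x. (\<Sum>k<n. (v k x)^2) / of_nat n) (\<lambda>_. 0) sequentially"
 proof (rule uniform_rotation_average)
  show "evK K (\<lambda>k x. cmod ((v k x)^2) \<le> Gb)" using Gb(2) by (simp add: norm_power)
  show "bounded ((\<lambda>x. (v k x)^2) ` K)" for k
  proof -
   obtain b1 where b1: "\<And>x. x \<in> K \<Longrightarrow> cmod (v k x) \<le> b1" using vb[of k] unfolding bounded_iff by (metis image_eqI)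
   have "\<forall>y\<in>(\<lambda>x. (v k x)^2) ` K. norm y \<le> b1^2" using b1 by (auto simp: norm_power intro!: power_mono)
   thus ?thesis by (auto simp: bounded_iff)
  qed
  show "bounded (q ` K)" using qn by (auto simp: bounded_iff intro!: exI[of _ 1])
  show "\<kappa> > 0" by fact
  show "\<kappa> \<le> cmod (1 - q x)" if x: "x \<in> K" for x
  proof -
   define z where "z = a x + b x * l x"
   have z: "cmod z = 1" using m(6)[OF x] by (simp add: z_def)
   hence "z \<noteq> 0" by auto
   hence "1 - (1/z)^2 = - (1 - z^2) * (1/z)^2" by (simp add: field_simps)
   hence "cmod (1 - (1/z)^2) = cmod (1 - z^2)" using z by (simp only: norm_mult norm_minus_cancel norm_power norm_divide) simp
   thus ?thesis using m(7)[OF x] by (simp add: q_def z_def)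
  qed
  have lim0: "ulim K (\<lambda>k x. Gb * cmod ((ga k x)^2 - q x) + Gb * (C2 * cmod (e k x))) (\<lambda>x. Gb * cmod ((of_real 1 / (a x + b x * l x))^2 - q x) + Gb * (C2 * cmod 0))"
   using qn by (intro ulim_add ulim_mult ulim_norm ulim_minus ulim_power lga le ulim_constx[OF tendsto_const] ulim_const) (auto simp: bounded_iff)
  show "uniform_limit K (\<lambda>k x. (v (Suc k) x)^2 - q x * (v k x)^2) (\<lambda>_. 0) sequentially"
  proof (rule uniform_limit_null_comparison)
   show "uniform_limit K (\<lambda>k x. Gb * cmod ((ga k x)^2 - q x) + Gb * (C2 * cmod (e k x))) (\<lambda>_. 0) sequentially"
    by (rule ulim_uniform_limit[OF ulim_cong_limit[OF lim0]]) (simp add: q_def)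
   show "evK K (\<lambda>k x. cmod ((v (Suc k) x)^2 - q x * (v k x)^2) \<le> Gb * cmod ((ga k x)^2 - q x) + Gb * (C2 * cmod (e k x)))"
    using main Gb(2)
   proof eventually_elim
    case (elim k)
    show ?case
    proof
     fix x assume x: "x \<in> K"
     have vG: "(cmod (v k x))^2 \<le> Gb" using elim(2) x by auto
     have "(v (Suc k) x)^2 - q x * (v k x)^2 = ((v (Suc k) x)^2 - (ga k x * v k x)^2) + ((ga k x)^2 - q x) * (v k x)^2"
      by (simp add: power_mult_distrib algebra_simps)
     hence "cmod ((v (Suc k) x)^2 - q x * (v k x)^2) \<le> cmod ((v (Suc k) x)^2 - (ga k x * v k x)^2) + cmod ((ga k x)^2 - q x) * (cmod (v k x))^2"
      by (metis norm_mult norm_power norm_triangle_ineq)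
     also have "\<dots> \<le> C2 * cmod (e k x) * (cmod (v k x))^2 + cmod ((ga k x)^2 - q x) * (cmod (v k x))^2"
      using elim(1) x by auto
     also have "\<dots> \<le> C2 * cmod (e k x) * Gb + cmod ((ga k x)^2 - q x) * Gb"
      using vG C2 by (intro add_mono mult_left_mono) auto
     finally show "cmod ((v (Suc k) x)^2 - q x * (v k x)^2) \<le> Gb * cmod ((ga k x)^2 - q x) + Gb * (C2 * cmod (e k x))"
      by (simp add: mult_ac)
    qed
   qed
  qed
 qed
 thus thesis using that[OF lv Gpos vb] by blast
qed

end

lemma bounded_mult_image:
 fixes f g :: "'x \<Rightarrow> 'b::real_normed_field"
 assumes "bounded (f ` K)" "bounded (g ` K)"
 shows "bounded ((\<lambda>x. f x * g x) ` K)"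
proof -
 obtain b c where "\<forall>x\<in>K. norm (f x) \<le> b" "\<forall>x\<in>K. norm (g x) \<le> c" using assms unfolding bounded_iff by auto
 hence "\<forall>x\<in>K. norm (f x * g x) \<le> b * c" by (auto simp: norm_mult intro!: mult_mono intro: order_trans[OF norm_ge_zero])
 thus ?thesis unfolding bounded_iff by blast
qed

lemma bounded_of_real_image: "bounded (f ` K) \<Longrightarrow> bounded ((\<lambda>x. complex_of_real (f x)) ` K)"
 unfolding bounded_iff by auto

context diff_weight
begin

text \<open>A real combination of \<open>u\<close> and \<open>w\<close> equals
  \<open>Re (ka * v)\<close>, and the square of a real part is half of
  \<open>(cmod z)^2 + Re (z^2)\<close>. The first part averages to \<open>(cmod kl)^2 * G\<close>,
  the second to zero. For \<open>\<rho> = 0\<close> and \<open>\<sigma> = 1\<close> one has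
  \<open>Re kl = 1\<close>, which makes the limit positive.\<close>

lemma riccati_average:
 fixes A B C D u w R S :: "nat \<Rightarrow> 'x \<Rightarrow> real" and a b c d \<rho> \<sigma> :: "'x \<Rightarrow> real"
 assumes sme: "summable (\<lambda>k. \<epsilon> k ^ r)" and r: "r \<ge> 1"
  and wt: "wt r 0 (\<lambda>k x. of_real (A k x))" "wt r 0 (\<lambda>k x. of_real (B k x))"
   "wt r 0 (\<lambda>k x. of_real (C k x))" "wt r 0 (\<lambda>k x. of_real (D k x))"
  and lim: "ulim K A a" "ulim K B b" "ulim K C c" "ulim K D d"
  and detl: "\<And>x. x \<in> K \<Longrightarrow> a x * d x - b x * c x = 1"
  and ell: "\<delta> > 0" "\<And>x. x \<in> K \<Longrightarrow> (a x + d x)^2 \<le> 4 - \<delta>"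
  and step: "\<And>k x. x \<in> K \<Longrightarrow> u (Suc k) x = A k x * u k x + B k x * w k x"
   "\<And>k x. x \<in> K \<Longrightarrow> w (Suc k) x = C k x * u k x + D k x * w k x"
  and nz: "\<And>k x. x \<in> K \<Longrightarrow> u k x \<noteq> 0 \<or> w k x \<noteq> 0"
  and bd: "\<And>k. bounded (u k ` K)" "\<And>k. bounded (w k ` K)"
  and det: "\<And>k x. x \<in> K \<Longrightarrow> (A k x * D k x - B k x * C k x) * \<tau> (Suc k) = \<tau> k"
  and tau: "\<And>k. \<tau> k > 0" "\<tau> \<longlonglongrightarrow> t" "t > 0"
  and RS: "ulim K R \<rho>" "ulim K S \<sigma>" "\<And>k. bounded (R k ` K)" "\<And>k. bounded (S k ` K)"
 obtains H where "ulim K (\<lambda>n x. (\<Sum>k<n. (R k x * u k x + S k x * w k x)^2) / real n) H"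
  "\<And>x. x \<in> K \<Longrightarrow> H x \<ge> 0" "\<And>x. x \<in> K \<Longrightarrow> \<rho> x = 0 \<Longrightarrow> \<sigma> x = 1 \<Longrightarrow> H x > 0"
proof (rule riccati_solution[OF r wt lim detl ell])
 fix m :: "nat \<Rightarrow> 'x \<Rightarrow> complex" and l :: "'x \<Rightarrow> complex" and \<kappa>
 assume m: "ulim K m l" "\<kappa> > 0"
  "\<And>k x. x \<in> K \<Longrightarrow> \<bar>Im (m k x)\<bar> \<ge> \<kappa>" "\<And>x. x \<in> K \<Longrightarrow> \<bar>Im (l x)\<bar> \<ge> \<kappa>" "\<And>k. bounded (m k ` K)"
  "\<And>x. x \<in> K \<Longrightarrow> cmod (a x + b x * l x) = 1"
  "\<And>x. x \<in> K \<Longrightarrow> cmod (1 - (a x + b x * l x)^2) \<ge> \<kappa>"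
  "ow r (\<lambda>k x. m (Suc k) x - (C k x + D k x * m k x) / (A k x + B k x * m k x))"
 define v where "v = (\<lambda>k x. complex_of_real (w k x) - m k x * complex_of_real (u k x))"
 show thesis
 proof (rule riccati_orbit[OF sme r lim step nz bd det tau m v_def])
 fix G assume G: "ulim K (\<lambda>k x. (cmod (v k x))^2) G" "\<And>x. x \<in> K \<Longrightarrow> G x > 0" "\<And>k. bounded (v k ` K)"
  "uniform_limit K (\<lambda>n x. (\<Sum>k<n. (v k x)^2) / of_nat n) (\<lambda>_. 0) sequentially"
 \<comment> \<open>Comparing the coefficients of \<open>w\<close> in
   \<open>R * u + S * w = Re (ka * v)\<close> gives \<open>Re ka = S\<close>; those of
   \<open>u\<close> then determine \<open>Im ka\<close>.\<close>
 define ka where "ka = (\<lambda>k x. complex_of_real (S k x) + \<i> * complex_of_real ((R k x + S k x * Re (m k x)) / Im (m k x)))"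
 define kl where "kl = (\<lambda>x. complex_of_real (\<sigma> x) + \<i> * complex_of_real ((\<rho> x + \<sigma> x * Re (l x)) / Im (l x)))"
 have lka: "ulim K ka kl" unfolding ka_def kl_def
  by (intro ulim_add ulim_mult ulim_of_real RS ulim_constx[OF tendsto_const] ulim_divide[OF _ ulim_Im[OF m(1)] m(2)] ulim_Re m(1))
    (use m(4) in auto)
 have bka: "bounded (ka k ` K)" for k
 proof -
  have "\<forall>x\<in>K. norm (inverse (Im (m k x))) \<le> inverse \<kappa>"
   using m(2,3) by (auto simp: norm_inverse intro!: le_imp_inverse_le)
  hence 1: "bounded ((\<lambda>x. inverse (Im (m k x))) ` K)" unfolding bounded_iff by blast
  have 2: "bounded ((\<lambda>x. Re (m k x)) ` K)" using m(5)[of k] unfolding bounded_iff by (auto intro: order_trans[OF abs_Re_le_cmod])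
  show ?thesis unfolding ka_def divide_inverse
   by (intro bounded_plus_comp bounded_mult_image bounded_of_real_image RS 1 2) (auto simp: image_constant_conv)
 qed
 have pk: "R k x * u k x + S k x * w k x = Re (ka k x * v k x)" if x: "x \<in> K" for k x
 proof -
  have ne: "Im (m k x) \<noteq> 0" using m(2) m(3)[OF x, of k] by auto
  have "Re (ka k x * v k x) = S k x * (w k x - Re (m k x) * u k x) + (R k x + S k x * Re (m k x)) / Im (m k x) * Im (m k x) * u k x"
   by (simp add: ka_def v_def)
  also have "(R k x + S k x * Re (m k x)) / Im (m k x) * Im (m k x) = R k x + S k x * Re (m k x)" using ne by simp
  finally show ?thesis by (simp add: algebra_simps)
 qed
 have sq: "(Re z)^2 = ((cmod z)^2 + Re (z^2)) / 2" for z unfolding cmod_power2 by (simp add: power2_eq_square)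
 have 1: "uniform_limit K (\<lambda>n x. (\<Sum>k<n. (cmod (ka k x))^2 * (cmod (v k x))^2) / real n) (\<lambda>x. (cmod (kl x))^2 * G x) sequentially"
 proof (rule uniform_cesaro)
  show "ulim K (\<lambda>k x. (cmod (ka k x))^2 * (cmod (v k x))^2) (\<lambda>x. (cmod (kl x))^2 * G x)"
   by (intro ulim_mult ulim_power ulim_norm lka G)
  show "bounded ((\<lambda>x. (cmod (ka k x))^2 * (cmod (v k x))^2) ` K)" for k unfolding power2_eq_square using bka[of k] G(3)[of k]
   by (intro bounded_mult_image) (auto simp: bounded_iff)
 qed
 have 2: "uniform_limit K (\<lambda>n x. (\<Sum>k<n. (ka k x * v k x)^2) / of_nat n) (\<lambda>_. 0) sequentially"
 proof -
  have bkl: "bounded (kl ` K)" using lka by (simp add: ulim_def)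
  have "uniform_limit K (\<lambda>n x. (\<Sum>k<n. ((ka k x)^2 - (kl x)^2) * (v k x)^2) / of_nat n) (\<lambda>_. 0) sequentially"
  proof (rule uniform_cesaro_null)
   obtain Gb where Gb: "Gb > 0" "evK K (\<lambda>k x. norm ((cmod (v k x))^2) \<le> Gb)" using ulim_bound_ev[OF G(1)] by blast
   have z: "ulim K (\<lambda>k x. cmod ((ka k x)^2 - (kl x)^2) * Gb) (\<lambda>x. cmod ((kl x)^2 - (kl x)^2) * Gb)"
    by (intro ulim_mult ulim_norm ulim_minus ulim_power lka ulim_const[OF bkl] ulim_constx[OF tendsto_const])
   show "uniform_limit K (\<lambda>k x. ((ka k x)^2 - (kl x)^2) * (v k x)^2) (\<lambda>_. 0) sequentially"
   proof (rule uniform_limit_null_comparison)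
    show "uniform_limit K (\<lambda>k x. cmod ((ka k x)^2 - (kl x)^2) * Gb) (\<lambda>_. 0) sequentially"
     using ulim_uniform_limit[OF z] by simp
    show "evK K (\<lambda>k x. cmod (((ka k x)^2 - (kl x)^2) * (v k x)^2) \<le> cmod ((ka k x)^2 - (kl x)^2) * Gb)"
     using Gb(2) by eventually_elim (auto simp: norm_mult norm_power intro!: mult_left_mono)
   qed
   show "bounded ((\<lambda>x. ((ka k x)^2 - (kl x)^2) * (v k x)^2) ` K)" for k
    unfolding power2_eq_square by (intro bounded_mult_image bounded_minus_comp bka bkl G)
  qed
  moreover have "uniform_limit K (\<lambda>n x. (kl x)^2 * ((\<Sum>k<n. (v k x)^2) / of_nat n)) (\<lambda>x. (kl x)^2 * 0) sequentially"
   by (intro uniform_lim_mult uniform_limit_const G)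
     (use bkl in \<open>auto simp: power2_eq_square image_constant_conv intro: bounded_mult_image\<close>)
  ultimately have "uniform_limit K (\<lambda>n x. (\<Sum>k<n. ((ka k x)^2 - (kl x)^2) * (v k x)^2) / of_nat n + (kl x)^2 * ((\<Sum>k<n. (v k x)^2) / of_nat n)) (\<lambda>x. 0 + (kl x)^2 * 0) sequentially"
   by (intro uniform_limit_add)
  thus ?thesis by (rule iffD1[OF uniform_limit_cong', rotated 2])
    (auto simp: power_mult_distrib left_diff_distrib sum_subtractf sum_distrib_left diff_divide_distrib)
 qed
 define H where "H = (\<lambda>x. (cmod (kl x))^2 * G x / 2)"
 have "uniform_limit K (\<lambda>n x. (1/2) * ((\<Sum>k<n. (cmod (ka k x))^2 * (cmod (v k x))^2) / real n) + (1/2) * Re ((\<Sum>k<n. (ka k x * v k x)^2) / of_nat n))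
   (\<lambda>x. (1/2) * ((cmod (kl x))^2 * G x) + (1/2) * Re 0) sequentially"
  using bounded_linear.uniform_limit[OF bounded_linear_mult_right[of "1/2::real"] 1]
   bounded_linear.uniform_limit[OF bounded_linear_mult_right[of "1/2::real"] bounded_linear.uniform_limit[OF bounded_linear_Re 2]]
  by (rule uniform_limit_add)
 hence "uniform_limit K (\<lambda>n x. (\<Sum>k<n. (R k x * u k x + S k x * w k x)^2) / real n) H sequentially"
 proof (rule iffD1[OF uniform_limit_cong', rotated 2])
  fix n x assume x: "x \<in> K"
  have "(\<Sum>k<n. (R k x * u k x + S k x * w k x)^2)
    = (\<Sum>k<n. (1/2) * ((cmod (ka k x))^2 * (cmod (v k x))^2) + (1/2) * Re ((ka k x * v k x)^2))"
   unfolding pk[OF x] sq by (intro sum.cong) (auto simp: norm_mult power_mult_distrib)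
  thus "(1/2) * ((\<Sum>k<n. (cmod (ka k x))^2 * (cmod (v k x))^2) / real n) + (1/2) * Re ((\<Sum>k<n. (ka k x * v k x)^2) / of_nat n)
    = (\<Sum>k<n. (R k x * u k x + S k x * w k x)^2) / real n"
   by (simp add: sum.distrib sum_divide_distrib[symmetric] sum_distrib_left[symmetric] add_divide_distrib Re_divide_of_nat)
 qed (simp add: H_def)
 moreover have "bounded (H ` K)"
  using ulim_mult[OF ulim_mult[OF ulim_power[OF ulim_norm[OF lka], of 2] G(1)] ulim_constx[OF tendsto_const[of "1/2"]]]
  unfolding ulim_def H_def by simp
 moreover have "H x > 0" if "x \<in> K" "\<rho> x = 0" "\<sigma> x = 1" for x
 proof -
  have "Re (kl x) = 1" using that by (simp add: kl_def)
  hence "kl x \<noteq> 0" by auto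
  thus ?thesis using G(2)[OF that(1)] by (simp add: H_def)
 qed
 ultimately show thesis using that[of H] G(2) by (auto simp: H_def ulim_def less_imp_le)
 qed assumption+
qed assumption+

end

section \<open>Averages along residue classes\<close>

lemma ulim_average_shift:
 fixes g :: "nat \<Rightarrow> 'x \<Rightarrow> real"
 assumes "ulim K (\<lambda>n x. (\<Sum>k<n. g (Suc k) x) / real n) L" "bounded (g 0 ` K)"
 shows "ulim K (\<lambda>n x. (\<Sum>k<n. g k x) / real n) L"
proof -
 have f: "(\<lambda>n. 1 / real (Suc n)) \<longlonglongrightarrow> 0" by (rule LIMSEQ_Suc[OF lim_1_over_n])
 have f2: "(\<lambda>n. real n / real (Suc n)) \<longlonglongrightarrow> 1" using LIMSEQ_n_over_Suc_n[where 'a = real] by simp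
 have "ulim K (\<lambda>n x. (1 / real (Suc n)) * g 0 x + (real n / real (Suc n)) * ((\<Sum>k<n. g (Suc k) x) / real n)) (\<lambda>x. 0 * g 0 x + 1 * L x)"
  by (intro ulim_add ulim_mult ulim_constx[OF f] ulim_constx[OF f2] ulim_const assms)
 moreover have "(\<Sum>k<Suc n. g k x) / real (Suc n) = (1 / real (Suc n)) * g 0 x + (real n / real (Suc n)) * ((\<Sum>k<n. g (Suc k) x) / real n)" for n x
  unfolding sum.lessThan_Suc_shift by (simp add: add_divide_distrib)
 ultimately have "ulim K (\<lambda>n x. (\<Sum>k<Suc n. g k x) / real (Suc n)) L" by simp
 hence "uniform_limit K (\<lambda>n x. (\<Sum>k<Suc n. g k x) / real (Suc n)) L sequentially" "bounded (L ` K)" by (auto simp: ulim_def)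
 thus ?thesis unfolding ulim_def
  using filterlim_sequentially_Suc[of "\<lambda>n x. (\<Sum>k<n. g k x) / real n" "uniformly_on K L"] by simp
qed

lemma ulim_compose:
 assumes "ulim K f l" "filterlim g sequentially sequentially"
 shows "ulim K (\<lambda>n. f (g n)) l"
 using assms filterlim_compose[of f "uniformly_on K l" sequentially g sequentially] unfolding ulim_def by simp

text \<open>Nonnegative terms make the partial sums monotone, so the sum up to \<open>n\<close> lies
  between the sums over \<open>q\<close> and \<open>q + 1\<close> full blocks with
  \<open>q = Suc n div N\<close>. After division by \<open>Suc n\<close> both have the same
  limit.\<close>

lemma block_average:
 fixes f :: "nat \<Rightarrow> 'x \<Rightarrow> real"
 assumes N: "N \<ge> 1" and f0: "\<And>n x. x \<in> K \<Longrightarrow> f n x \<ge> 0"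
  and H: "\<And>i. i < N \<Longrightarrow> ulim K (\<lambda>n x. (\<Sum>k<n. f (k * N + i) x) / real n) (H i)"
 shows "ulim K (\<lambda>n x. (\<Sum>j\<le>n. f j x) / real (Suc n)) (\<lambda>x. (\<Sum>i<N. H i x) / real N)"
proof -
 define T where "T = (\<lambda>q x. \<Sum>j<q * N. f j x)"
 define L where "L = (\<lambda>x. (\<Sum>i<N. H i x))"
 have Ts: "T q x = (\<Sum>i<N. \<Sum>k<q. f (k * N + i) x)" for q x
 proof (induction q)
  case (Suc q)
  have "T (Suc q) x = T q x + (\<Sum>j\<in>{q*N..<q*N+N}. f j x)"
   unfolding T_def by (simp add: add.commute lessThan_atLeast0 sum.atLeastLessThan_concat)
  also have "(\<Sum>j\<in>{q*N..<q*N+N}. f j x) = (\<Sum>i<N. f (q * N + i) x)"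
   by (rule sum.reindex_bij_witness[of _ "\<lambda>i. q * N + i" "\<lambda>j. j - q * N"]) auto
  finally show ?case using Suc by (simp add: sum.distrib)
 qed (simp add: T_def)
 have lT: "ulim K (\<lambda>q x. T q x / real q) L"
  unfolding Ts sum_divide_distrib L_def by (intro ulim_sum H[unfolded sum_divide_distrib]) auto
 define q where "q = (\<lambda>n. Suc n div N)"
 have qnat: "Suc n < Suc (q n) * N" "q n * N \<le> Suc n" for n
  using N dividend_less_div_times[of N "Suc n"] by (auto simp: q_def add.commute)
 have qlow: "real (Suc n) < (real (q n) + 1) * real N" "real (q n) * real N \<le> real (Suc n)" for n
 proof -
  show "real (Suc n) < (real (q n) + 1) * real N" using qnat(1)[of n] by (metis of_nat_less_iff of_nat_mult of_nat_Suc add.commute)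
  show "real (q n) * real N \<le> real (Suc n)" using qnat(2)[of n] by (metis of_nat_le_iff of_nat_mult)
 qed
 have qr: "(\<lambda>n. real (q n) / real (Suc n)) \<longlonglongrightarrow> 1 / real N"
 proof (rule tendsto_sandwich)
  show "(\<lambda>n. 1 / real N - 1 / real (Suc n)) \<longlonglongrightarrow> 1 / real N"
   using tendsto_diff[OF tendsto_const[of "1 / real N"] LIMSEQ_Suc[OF lim_1_over_n[where 'a = real]]] by simp
  show "(\<lambda>n. 1 / real N) \<longlonglongrightarrow> 1 / real N" by simp
  show "\<forall>\<^sub>F n in sequentially. 1 / real N - 1 / real (Suc n) \<le> real (q n) / real (Suc n)"
  proof (intro always_eventually allI)
   fix n
   have "(1 / real N - 1 / real (Suc n)) * (real N * real (Suc n)) = real (Suc n) - real N" using N by (simp add: left_diff_distrib)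
   also have "\<dots> \<le> real (q n) * real N" using qlow(1)[of n] by (simp add: algebra_simps)
   also have "\<dots> = real (q n) / real (Suc n) * (real N * real (Suc n))" by simp
   finally show "1 / real N - 1 / real (Suc n) \<le> real (q n) / real (Suc n)" by (rule mult_right_le_imp_le) (use N in simp)
  qed
  show "\<forall>\<^sub>F n in sequentially. real (q n) / real (Suc n) \<le> 1 / real N"
   using qlow(2) N by (intro always_eventually allI) (simp add: field_simps)
 qed
 have qr1: "(\<lambda>n. real (Suc (q n)) / real (Suc n)) \<longlonglongrightarrow> 1 / real N"
  using tendsto_add[OF qr LIMSEQ_Suc[OF lim_1_over_n[where 'a = real]]] by (simp add: add_divide_distrib add.commute)
 have qinf: "filterlim q sequentially sequentially" unfolding filterlim_at_top
 proof
  fix Z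
  show "\<forall>\<^sub>F n in sequentially. Z \<le> q n" using eventually_ge_at_top[of "Z * N"]
  proof eventually_elim
   case (elim n)
   thus ?case unfolding q_def using N by (simp add: less_eq_div_iff_mult_less_eq)
  qed
 qed
 have qinf1: "filterlim (\<lambda>n. Suc (q n)) sequentially sequentially" by (rule filterlim_compose[OF filterlim_Suc qinf])
 have 1: "ulim K (\<lambda>n x. (real (q n) / real (Suc n)) * (T (q n) x / real (q n))) (\<lambda>x. 1 / real N * L x)"
  by (intro ulim_mult ulim_constx[OF qr] ulim_compose[OF lT qinf])
 have 2: "ulim K (\<lambda>n x. (real (Suc (q n)) / real (Suc n)) * (T (Suc (q n)) x / real (Suc (q n)))) (\<lambda>x. 1 / real N * L x)"
  by (intro ulim_mult ulim_constx[OF qr1] ulim_compose[OF lT qinf1])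
 have bL: "bounded ((\<lambda>x. 1 / real N * L x) ` K)" using 1 by (simp add: ulim_def)
 have "uniform_limit K (\<lambda>n x. (\<Sum>j\<le>n. f j x) / real (Suc n)) (\<lambda>x. 1 / real N * L x) sequentially"
 proof (rule uniform_limitI)
  fix e :: real assume e: "e > 0"
  have T0: "T 0 x = 0" for x by (simp add: T_def)
  from uniform_limitD[OF ulim_uniform_limit[OF 1] e] uniform_limitD[OF ulim_uniform_limit[OF 2] e]
  show "\<forall>\<^sub>F n in sequentially. \<forall>x\<in>K. dist ((\<Sum>j\<le>n. f j x) / real (Suc n)) (1 / real N * L x) < e"
  proof eventually_elim
   case (elim n)
   show ?case
   proof
    fix x assume x: "x \<in> K"
    have lo: "T (q n) x \<le> (\<Sum>j\<le>n. f j x)" unfolding T_def using f0[OF x] qnat(2)[of n] by (intro sum_mono2) auto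
    have up: "(\<Sum>j\<le>n. f j x) \<le> T (Suc (q n)) x" unfolding T_def using f0[OF x] qnat(1)[of n] by (intro sum_mono2) auto
    have e1: "(real (q n) / real (Suc n)) * (T (q n) x / real (q n)) = T (q n) x / real (Suc n)" by (cases "q n = 0") (auto simp: T0)
    have e2: "(real (Suc (q n)) / real (Suc n)) * (T (Suc (q n)) x / real (Suc (q n))) = T (Suc (q n)) x / real (Suc n)" by simp
    have "\<bar>T (q n) x / real (Suc n) - 1 / real N * L x\<bar> < e" "\<bar>T (Suc (q n)) x / real (Suc n) - 1 / real N * L x\<bar> < e"
     using elim(1)[rule_format, OF x] elim(2)[rule_format, OF x] unfolding e1 e2 dist_real_def by auto
    moreover have "T (q n) x / real (Suc n) \<le> (\<Sum>j\<le>n. f j x) / real (Suc n)" "(\<Sum>j\<le>n. f j x) / real (Suc n) \<le> T (Suc (q n)) x / real (Suc n)"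
     using lo up by (auto intro!: divide_right_mono)
    ultimately show "dist ((\<Sum>j\<le>n. f j x) / real (Suc n)) (1 / real N * L x) < e" unfolding dist_real_def by linarith
   qed
  qed
 qed
 thus ?thesis using bL unfolding ulim_def L_def by simp
qed

subsection \<open>Second-order linear recurrences\<close>

text \<open>The ring is left general so that one recursion serves real and complex arguments as well
  as the polynomials of \<open>sol_poly\<close>.\<close>

fun rsol :: "(nat \<Rightarrow> 'a) \<Rightarrow> (nat \<Rightarrow> 'a) \<Rightarrow> 'a \<Rightarrow> 'a \<Rightarrow> nat \<Rightarrow> 'a::comm_ring_1" where
 "rsol p q c d 0 = c"
| "rsol p q c d (Suc 0) = d"
| "rsol p q c d (Suc (Suc n)) = p n * rsol p q c d (Suc n) - q n * rsol p q c d n"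

lemma rsol_linear: "rsol p q c d n = c * rsol p q 1 0 n + d * rsol p q 0 1 n"
 by (induction n rule: induct_nat_012) (auto simp: algebra_simps)

lemma rsol_scale: "rsol p q (s * c) (s * d) n = s * rsol p q c d n" by (induction n rule: induct_nat_012) (auto simp: algebra_simps)

lemma rsol_unique:
 assumes "f 0 = c" "f (Suc 0) = d" "\<And>n. n < m \<Longrightarrow> f (Suc (Suc n)) = p n * f (Suc n) - q n * f n" "n \<le> Suc m"
 shows "f n = rsol p q c d n" using assms(4) by (induction n rule: induct_nat_012) (auto simp: assms)

lemma rsol_shift: "rsol p q c d (n + k) = rsol (\<lambda>i. p (i + k)) (\<lambda>i. q (i + k)) (rsol p q c d k) (rsol p q c d (Suc k)) n"
 by (induction n rule: induct_nat_012) auto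

lemma rsol_wronskian:
 "rsol p q 1 0 n * rsol p q 0 1 (Suc n) - rsol p q 0 1 n * rsol p q 1 0 (Suc n) = (\<Prod>i<n. q i)"
 by (induction n) (auto simp: algebra_simps)

lemma rsol_of_real:
 "rsol (\<lambda>i. of_real (p i)) (\<lambda>i. of_real (q i)) (of_real c) (of_real d) n = of_real (rsol p q c d n)"
 by (induction n rule: induct_nat_012) auto

lemma prod_ratio_telescope:
 fixes g :: "nat \<Rightarrow> real"
 assumes "\<And>i. g i \<noteq> 0"
 shows "(\<Prod>i<n. g i / g (Suc i)) = g 0 / g n" using assms by (induction n) auto

lemma orth_poly_rec:
 assumes "n > 0"
 shows "orth_poly a b (Suc n) x = (x - b n) / a n * orth_poly a b n x - a (n - 1) / a n * orth_poly a b (n - 1) x"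
 using assms by (cases n) (auto simp: diff_divide_distrib left_diff_distrib)

lemma orth_poly_not_both_zero:
 assumes "\<And>n. a n > 0"
 shows "orth_poly a b n x \<noteq> 0 \<or> orth_poly a b (Suc n) x \<noteq> 0"
proof (induction n)
 case (Suc n)
 have "a n \<noteq> 0" "a (Suc n) \<noteq> 0" using assms by (metis less_irrefl)+
 with Suc show ?case by auto
qed simp

lemma continuous_orth_poly: "continuous_on S (orth_poly a b n)"
 by (induction n rule: induct_nat_012) (auto simp: divide_inverse intro!: continuous_intros)

text \<open>Add up all \<open>\<bar>fwd_diff j x k\<bar> powr (r / j)\<close> to a summable
  \<open>e\<close>. Its convolution \<open>\<eta>\<close> with the powers of 1/2 still dominates
  \<open>e\<close> and is summable, but satisfies in addition
  \<open>\<eta> (Suc k) \<le> 2 * \<eta> k\<close>. The weight is the \<open>r\<close>-th root of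
  \<open>\<eta>\<close>, so that a \<open>j\<close>-th difference is bounded by its
  \<open>j\<close>-th power.\<close>

lemma stolz_weight:
 assumes fin: "finite X" and X: "X \<subseteq> stolz_class r" and r: "r \<ge> 1"
 obtains \<epsilon> :: "nat \<Rightarrow> real" where "\<And>k. \<epsilon> k \<ge> 0" "\<And>k. \<epsilon> (Suc k) \<le> 2 * \<epsilon> k" "\<epsilon> \<longlonglongrightarrow> 0"
  "summable (\<lambda>k. \<epsilon> k ^ r)"
  "\<And>x j k. x \<in> X \<Longrightarrow> j \<in> {1..r} \<Longrightarrow> \<bar>fwd_diff j x k\<bar> \<le> \<epsilon> k ^ j"
proof -
 define e where "e = (\<lambda>k. \<Sum>x\<in>X. \<Sum>j\<in>{1..r}. \<bar>fwd_diff j x k\<bar> powr (real r / real j))"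
 have e0: "e k \<ge> 0" for k by (auto simp: e_def intro!: sum_nonneg)
 have se: "summable e" unfolding e_def using X by (intro summable_sum) (auto simp: stolz_class_def)
 obtain M where M: "\<And>k. e k \<le> M"
  using summable_LIMSEQ_zero[OF se] by (metis convergentI convergent_imp_Bseq BseqE abs_le_D1 real_norm_def)
 define \<eta> where "\<eta> = (\<lambda>k. \<Sum>i. (1/2)^i * e (i + k))"
 have sg: "summable (\<lambda>i. (1/2::real)^i * e (i + k))" for k
  by (rule summable_comparison_test'[of "\<lambda>i. (1/2::real)^i * M" 0])
    (use e0 M in \<open>auto intro!: summable_mult2 summable_geometric mult_left_mono simp: abs_mult\<close>)
 have rec: "\<eta> k = e k + \<eta> (Suc k) / 2" for k
 proof -
  have "\<eta> k = (\<Sum>i. (1/2)^(Suc i) * e (Suc i + k)) + e k" unfolding \<eta>_def using suminf_split_head[OF sg[of k]] by simp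
  also have "(\<Sum>i. (1/2)^(Suc i) * e (Suc i + k)) = (\<Sum>i. (1/2) * ((1/2)^i * e (i + Suc k)))" by (simp add: mult.assoc)
  also have "\<dots> = \<eta> (Suc k) / 2" unfolding \<eta>_def by (subst suminf_mult[OF sg[of "Suc k"]]) simp
  finally show ?thesis by simp
 qed
 have eta0: "\<eta> k \<ge> 0" for k unfolding \<eta>_def by (intro suminf_nonneg sg) (use e0 in auto)
 have eta_e: "e k \<le> \<eta> k" for k using rec[of k] eta0[of "Suc k"] by simp
 have etaM: "\<eta> k \<le> 2 * M" for k
 proof -
  have "\<eta> k \<le> (\<Sum>i. (1/2::real)^i * M)" unfolding \<eta>_def
   by (intro suminf_le sg summable_mult2 summable_geometric) (use M in \<open>auto intro!: mult_left_mono\<close>)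
  also have "\<dots> = (\<Sum>i. (1/2::real)^i) * M" by (rule suminf_mult2[symmetric]) (auto intro: summable_geometric)
  also have "(\<Sum>i. (1/2::real)^i) = 2" by (subst suminf_geometric) auto
  finally show ?thesis .
 qed
 \<comment> \<open>Twice \<open>rec\<close>, summed over \<open>k < n\<close>, telescopes; this
   bounds the partial sums of \<open>\<eta>\<close> by those of \<open>e\<close>.\<close>
 have part: "(\<Sum>k<n. \<eta> k) = 2 * (\<Sum>k<n. e k) - \<eta> 0 + \<eta> n" for n
 proof (induction n)
  case (Suc n)
  thus ?case using rec[of n] by simp
 qed simp
 have "(\<Sum>k<n. \<eta> k) \<le> 2 * suminf e + 2 * M" for n
  using part[of n] eta0[of 0] etaM[of n] sum_le_suminf[OF se, of "{..<n}"] e0 by simp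
 hence seta: "summable \<eta>" by (intro summableI_nonneg_bounded[OF eta0])
 define \<epsilon> where "\<epsilon> = (\<lambda>k. root r (\<eta> k))"
 have er: "\<epsilon> k ^ r = \<eta> k" for k unfolding \<epsilon>_def using r eta0 by simp
 have eps0: "\<epsilon> k \<ge> 0" for k unfolding \<epsilon>_def using r eta0 by simp
 have sh: "\<epsilon> (Suc k) \<le> 2 * \<epsilon> k" for k
 proof (rule power_le_imp_le_base)
  have "\<epsilon> (Suc k) ^ r \<le> 2 * \<eta> k" using rec[of k] e0[of k] by (simp add: er)
  also have "\<dots> \<le> 2 ^ r * \<eta> k" using r eta0[of k] self_le_power[of "2::real" r] by (intro mult_right_mono) auto
  also have "\<dots> = (2 * \<epsilon> k) ^ r" by (simp add: power_mult_distrib er)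
  finally show "\<epsilon> (Suc k) ^ Suc (r - 1) \<le> (2 * \<epsilon> k) ^ Suc (r - 1)" using r by simp
 qed (use eps0 in simp)
 have lim: "\<epsilon> \<longlonglongrightarrow> 0"
  unfolding \<epsilon>_def using tendsto_real_root[OF summable_LIMSEQ_zero[OF seta], of r] by simp
 have bnd: "\<bar>fwd_diff j x k\<bar> \<le> \<epsilon> k ^ j" if x: "x \<in> X" and j: "j \<in> {1..r}" for x j k
 proof -
  define y where "y = \<bar>fwd_diff j x k\<bar>"
  have "y powr (real r / real j) \<le> (\<Sum>j\<in>{1..r}. \<bar>fwd_diff j x k\<bar> powr (real r / real j))"
   unfolding y_def using j by (intro member_le_sum) auto
  also have "\<dots> \<le> e k" unfolding e_def using fin x by (intro member_le_sum) (auto intro: sum_nonneg)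
  also have "\<dots> \<le> \<epsilon> k ^ r" using eta_e er by simp
  finally have 1: "y powr (real r / real j) \<le> \<epsilon> k ^ r" .
  have "y ^ r = (y powr (real r / real j)) ^ j"
  proof (cases "y = 0")
   case True
   thus ?thesis using r j by (simp add: power_0_left)
  next
   case False
   hence "y > 0" by (simp add: y_def)
   hence "(y powr (real r / real j)) ^ j = y powr (real r / real j * real j)" by (simp add: powr_powr flip: powr_realpow)
   thus ?thesis using j \<open>y > 0\<close> by (simp add: powr_realpow)
  qed
  also have "\<dots> \<le> (\<epsilon> k ^ r) ^ j" using 1 by (intro power_mono) auto
  also have "\<dots> = (\<epsilon> k ^ j) ^ r" by (simp add: power_mult[symmetric] mult.commute)
  finally have "y ^ Suc (r - 1) \<le> (\<epsilon> k ^ j) ^ Suc (r - 1)" using r by simp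
  hence "y \<le> \<epsilon> k ^ j" by (rule power_le_imp_le_base) (use eps0 in simp)
  thus ?thesis by (simp add: y_def)
 qed
 show thesis by (rule that[OF eps0 sh lim _ bnd]) (use seta er in auto)
qed

context diff_weight
begin

text \<open>At order 0 the bound comes from boundedness of the sequence, at higher order from the
  weight; \<open>d\<close> counts the differences still available below \<open>r\<close>.\<close>

lemma wt_fwd_diff:
 assumes "\<And>j k. j \<in> {1..r} \<Longrightarrow> \<bar>fwd_diff j s k\<bar> \<le> \<epsilon> k ^ j" "bounded (range s)"
 shows "j + d \<le> r \<Longrightarrow> wt d j (\<lambda>k x. of_real (fwd_diff j s k))"
proof (induction d arbitrary: j)
 case 0
 show ?case
 proof (cases "j = 0")
  case True
  obtain B where "\<And>k. \<bar>s k\<bar> \<le> B" using assms(2) unfolding bounded_iff by auto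
  thus ?thesis using True by (auto intro!: ow_0_bounded[of _ B] always_eventually)
 next
  case False
  hence "evK K (\<lambda>k x. cmod (complex_of_real (fwd_diff j s k)) \<le> 1 * \<epsilon> k ^ j)"
   using assms(1)[of j] 0 by (intro always_eventually) auto
  hence "ow j (\<lambda>k x. of_real (fwd_diff j s k))" unfolding ow_def by (intro exI[of _ 1]) simp
  thus ?thesis by simp
 qed
next
 case (Suc d)
 have "wt d (Suc j) (\<lambda>k x. of_real (fwd_diff (Suc j) s k))" using Suc.IH[of "Suc j"] Suc.prems by (simp del: fwd_diff.simps)
 hence 1: "wt d (Suc j) (\<lambda>k x. of_real (fwd_diff j s (Suc k)) - of_real (fwd_diff j s k))" by simp
 have "wt d j (\<lambda>k x. of_real (fwd_diff j s k))" using Suc.IH[of j] Suc.prems by simp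
 from wt_imp_ow[OF this] 1 show ?case by simp
qed

lemma wt_rsol:
 fixes p q :: "nat \<Rightarrow> nat \<Rightarrow> 'x \<Rightarrow> real"
 assumes "\<And>i. i < m \<Longrightarrow> wt r 0 (\<lambda>k x. of_real (p i k x))" "\<And>i. i < m \<Longrightarrow> wt r 0 (\<lambda>k x. of_real (q i k x))"
 shows "n \<le> Suc m \<Longrightarrow> wt r 0 (\<lambda>k x. of_real (rsol (\<lambda>i. p i k x) (\<lambda>i. q i k x) c d n))"
 by (induction n rule: induct_nat_012) (auto intro!: wt_const wt_diff wt_mult0 assms)

end

lemma ulim_rsol:
 fixes p q :: "nat \<Rightarrow> nat \<Rightarrow> 'x \<Rightarrow> real"
 assumes "\<And>i. i < m \<Longrightarrow> ulim K (p i) (p' i)" "\<And>i. i < m \<Longrightarrow> ulim K (q i) (q' i)"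
 shows "n \<le> Suc m \<Longrightarrow> ulim K (\<lambda>k x. rsol (\<lambda>i. p i k x) (\<lambda>i. q i k x) c d n) (\<lambda>x. rsol (\<lambda>i. p' i x) (\<lambda>i. q' i x) c d n)"
 by (induction n rule: induct_nat_012) (auto intro!: ulim_constx[OF tendsto_const] ulim_minus ulim_mult assms)

lemma continuous_rsol:
 fixes p q :: "nat \<Rightarrow> real \<Rightarrow> real"
 assumes "\<And>i. continuous_on S (p i)" "\<And>i. continuous_on S (q i)"
 shows "continuous_on S (\<lambda>x. rsol (\<lambda>i. p i x) (\<lambda>i. q i x) c d n)"
 by (induction n rule: induct_nat_012) (auto intro!: continuous_intros assms)

section \<open>Solutions of the periodic recurrence\<close>

definition per_p :: "(int \<Rightarrow> real) \<Rightarrow> (int \<Rightarrow> real) \<Rightarrow> int \<Rightarrow> 'a \<Rightarrow> nat \<Rightarrow> 'a::real_normed_field" where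
 "per_p \<alpha> \<beta> j x n = (x - of_real (\<beta> (j + int n))) / of_real (\<alpha> (j + int n))"

definition per_q :: "(int \<Rightarrow> real) \<Rightarrow> int \<Rightarrow> nat \<Rightarrow> 'a::real_normed_field" where
 "per_q \<alpha> j n = of_real (\<alpha> (j + int n - 1)) / of_real (\<alpha> (j + int n))"

definition per_sol :: "(int \<Rightarrow> real) \<Rightarrow> (int \<Rightarrow> real) \<Rightarrow> int \<Rightarrow> 'a \<Rightarrow> 'a \<Rightarrow> 'a \<Rightarrow> nat \<Rightarrow> 'a::real_normed_field" where
 "per_sol \<alpha> \<beta> j x c d = rsol (per_p \<alpha> \<beta> j x) (per_q \<alpha> j) c d"

text \<open>\<open>per_sol \<alpha> \<beta> j x c d n\<close> is the value at index \<open>j - 1 + n\<close> of the solution with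
 values \<open>c, d\<close> at \<open>j - 1, j\<close>; \<open>discr\<close> is the trace of the monodromy matrix.\<close>

definition discr :: "(int \<Rightarrow> real) \<Rightarrow> (int \<Rightarrow> real) \<Rightarrow> nat \<Rightarrow> int \<Rightarrow> 'a \<Rightarrow> 'a::real_normed_field" where
 "discr \<alpha> \<beta> N j x = per_sol \<alpha> \<beta> j x 1 0 N + per_sol \<alpha> \<beta> j x 0 1 (Suc N)"

lemma transfer_prod_per_sol:
 "transfer_prod \<alpha> \<beta> k j x = vector [vector [per_sol \<alpha> \<beta> j x 1 0 k, per_sol \<alpha> \<beta> j x 0 1 k],
   vector [per_sol \<alpha> \<beta> j x 1 0 (Suc k), per_sol \<alpha> \<beta> j x 0 1 (Suc k)]]"
proof (induction k)
 case 0
 show ?case by (simp add: per_sol_def vec_eq_iff forall_2 vector_2 mat_def)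
next
 case (Suc k)
 show ?case unfolding transfer_prod.simps Suc transfer_matrix_def
  by (simp add: vec_eq_iff forall_2 matrix_matrix_mult_def sum_2 vector_2 per_sol_def per_p_def per_q_def)
qed

lemma trace_transfer_prod: "trace (transfer_prod \<alpha> \<beta> N j x) = discr \<alpha> \<beta> N j x"
 by (simp add: transfer_prod_per_sol trace_def sum_2 vector_2 discr_def)

lemma continuous_discr: "continuous_on S (discr \<alpha> \<beta> N j :: real \<Rightarrow> real)"
 unfolding discr_def per_sol_def per_p_def[abs_def] per_q_def[abs_def] divide_inverse by (intro continuous_intros continuous_rsol)

lemma periodic_seq_mult: "periodic_seq N \<gamma> \<Longrightarrow> \<gamma> (n + int k * int N) = \<gamma> n"
proof (induction k)
 case (Suc k)
 hence "\<gamma> (n + int k * int N + int N) = \<gamma> (n + int k * int N)" unfolding periodic_seq_def by blast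
 with Suc show ?case by (simp add: algebra_simps)
qed simp

text \<open>One step of the Riccati recurrence is one block of length \<open>N\<close>, acting on
  the two consecutive polynomial values \<open>u\<close>, \<open>w\<close> at its start. Every
  polynomial inside the block is a combination of \<open>u\<close> and \<open>w\<close> whose
  coefficients are polynomial in Stolz sequences, so \<open>riccati_average\<close> applies to each
  residue class. Positivity is read off from the class where the combination is \<open>w\<close>
  itself, and the others contribute nonnegative terms.\<close>

lemma CD_kernel_uniform_limit:
 assumes N: "N \<ge> 1" and a: "\<And>n. a n > 0" and ap: "asymptotically_periodic N a b \<alpha> \<beta>" and r: "r \<ge> 1"
  and D1: "\<And>i. i < N \<Longrightarrow> (\<lambda>k. a (Suc k * N + i - 1) / a (Suc k * N + i)) \<in> stolz_class r"
  and D2: "\<And>i. i < N \<Longrightarrow> (\<lambda>k. b (Suc k * N + i) / a (Suc k * N + i)) \<in> stolz_class r"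
  and D3: "\<And>i. i < N \<Longrightarrow> (\<lambda>k. 1 / a (Suc k * N + i)) \<in> stolz_class r"
  and K: "compact K" "\<And>x. x \<in> K \<Longrightarrow> \<bar>trace (transfer_prod \<alpha> \<beta> N 0 x)\<bar> < 2"
 obtains H where "uniform_limit K (\<lambda>n x. CD_kernel a b n x x / real (Suc n)) H sequentially"
  "\<And>x. x \<in> K \<Longrightarrow> H x > 0"
proof -
 have per: "periodic_seq N \<alpha>" "periodic_seq N \<beta>" "\<And>n. \<alpha> n > 0"
  and la: "(\<lambda>n. a n - \<alpha> (int n)) \<longlonglongrightarrow> 0" and lb: "(\<lambda>n. b n - \<beta> (int n)) \<longlonglongrightarrow> 0"
  using ap by (auto simp: asymptotically_periodic_def tendsto_rabs_zero_iff)
 define X where "X = (\<Union>i<N. {(\<lambda>k. a (Suc k * N + i - 1) / a (Suc k * N + i)), (\<lambda>k. b (Suc k * N + i) / a (Suc k * N + i)), (\<lambda>k. 1 / a (Suc k * N + i))})"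
 have "finite X" "X \<subseteq> stolz_class r" using D1 D2 D3 by (auto simp: X_def)
 then obtain \<epsilon> :: "nat \<Rightarrow> real" where eps: "\<And>k. \<epsilon> k \<ge> 0" "\<And>k. \<epsilon> (Suc k) \<le> 2 * \<epsilon> k" "\<epsilon> \<longlonglongrightarrow> 0"
  "summable (\<lambda>k. \<epsilon> k ^ r)"
  "\<And>x j k. x \<in> X \<Longrightarrow> j \<in> {1..r} \<Longrightarrow> \<bar>fwd_diff j x k\<bar> \<le> \<epsilon> k ^ j"
  using stolz_weight[OF _ _ r] by metis
 interpret diff_weight \<epsilon> K by unfold_locales (use eps in auto)
 have wX: "wt r 0 (\<lambda>k x. of_real (s k))" if "s \<in> X" for s
  using wt_fwd_diff[of r s 0 r] eps(5)[OF that] \<open>X \<subseteq> stolz_class r\<close> that by (auto simp: stolz_class_def)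
 have bdK: "bounded (f ` K)" if "continuous_on K f" for f :: "real \<Rightarrow> real"
  using compact_imp_bounded[OF compact_continuous_image[OF that K(1)]] .
 define p where "p = (\<lambda>i k x. (x - b (Suc k * N + i)) / a (Suc k * N + i))"
 define q where "q = (\<lambda>i k (x::real). a (Suc k * N + i - 1) / a (Suc k * N + i))"
 obtain BK where BK: "\<And>x. x \<in> K \<Longrightarrow> \<bar>x\<bar> \<le> BK"
  using bdK[of "\<lambda>x. x"] unfolding bounded_iff by auto
 have wq: "wt r 0 (\<lambda>k x. of_real (q i k x))" if "i < N" for i
  unfolding q_def by (rule wX) (use that in \<open>auto simp: X_def\<close>)
 have wp: "wt r 0 (\<lambda>k x. of_real (p i k x))" if "i < N" for i
 proof -
  have 1: "wt r 0 (\<lambda>k x. of_real (1 / a (Suc k * N + i)))"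
   by (rule wX[of "\<lambda>k. 1 / a (Suc k * N + i)"]) (use that in \<open>auto simp: X_def\<close>)
  have 2: "wt r 0 (\<lambda>k x. of_real (b (Suc k * N + i) / a (Suc k * N + i)))"
   by (rule wX[of "\<lambda>k. b (Suc k * N + i) / a (Suc k * N + i)"]) (use that in \<open>auto simp: X_def\<close>)
  have "wt r 0 (\<lambda>k x. of_real x * of_real (1 / a (Suc k * N + i)) - of_real (b (Suc k * N + i) / a (Suc k * N + i)))"
   by (intro wt_diff wt_mult0 1 2 wt_constx[of _ BK]) (use BK in auto)
  thus ?thesis by (simp add: p_def diff_divide_distrib)
 qed
 have lan: "(\<lambda>k. a (Suc k * N + i)) \<longlonglongrightarrow> \<alpha> (int i)" for i
 proof -
  have "strict_mono (\<lambda>k. Suc k * N + i)" using N by (auto simp: strict_mono_def)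
  from LIMSEQ_subseq_LIMSEQ[OF la this] have "(\<lambda>k. a (Suc k * N + i) - \<alpha> (int (Suc k * N + i))) \<longlonglongrightarrow> 0" by (simp add: o_def)
  moreover have "\<alpha> (int (Suc k * N + i)) = \<alpha> (int i)" for k
   using periodic_seq_mult[OF per(1), of "int i" "Suc k"] by (simp add: algebra_simps)
  ultimately show ?thesis by (simp add: LIM_zero_iff)
 qed
 have lbn: "(\<lambda>k. b (Suc k * N + i)) \<longlonglongrightarrow> \<beta> (int i)" for i
 proof -
  have "strict_mono (\<lambda>k. Suc k * N + i)" using N by (auto simp: strict_mono_def)
  from LIMSEQ_subseq_LIMSEQ[OF lb this] have "(\<lambda>k. b (Suc k * N + i) - \<beta> (int (Suc k * N + i))) \<longlonglongrightarrow> 0" by (simp add: o_def)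
  moreover have "\<beta> (int (Suc k * N + i)) = \<beta> (int i)" for k
   using periodic_seq_mult[OF per(2), of "int i" "Suc k"] by (simp add: algebra_simps)
  ultimately show ?thesis by (simp add: LIM_zero_iff)
 qed
 have lan1: "(\<lambda>k. a (Suc k * N + i - 1)) \<longlonglongrightarrow> \<alpha> (int i - 1)" for i
 proof (cases i)
  case 0
  have "(\<lambda>k. a (k * N + N - 1)) \<longlonglongrightarrow> \<alpha> (int (N - 1))"
  proof -
   have "strict_mono (\<lambda>k. k * N + N - 1)" using N by (auto simp: strict_mono_def intro!: diff_less_mono)
   from LIMSEQ_subseq_LIMSEQ[OF la this] have "(\<lambda>k. a (k * N + N - 1) - \<alpha> (int (k * N + N - 1))) \<longlonglongrightarrow> 0" by (simp add: o_def)
   moreover have "\<alpha> (int (k * N + N - 1)) = \<alpha> (int (N - 1))" for k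
    using periodic_seq_mult[OF per(1), of "int (N - 1)" k] N by (simp add: algebra_simps of_nat_diff)
   ultimately show ?thesis by (simp add: LIM_zero_iff)
  qed
  moreover have "\<alpha> (int (N - 1)) = \<alpha> (-1)" using periodic_seq_mult[OF per(1), of "-1" 1] N by (simp add: of_nat_diff)
  ultimately show ?thesis using 0 by (simp add: add.commute)
 next
  case (Suc j)
  thus ?thesis using lan[of j] by simp
 qed
 have lq: "ulim K (q i) (\<lambda>x. per_q \<alpha> 0 i)" for i unfolding q_def per_q_def of_real_eq_id id_apply add_0
  by (intro ulim_constx tendsto_divide lan lan1) (metis per(3) less_irrefl)
 have lp: "ulim K (p i) (\<lambda>x. per_p \<alpha> \<beta> 0 x i)" for i unfolding p_def per_p_def unfolding of_real_eq_id id_apply add_0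
 proof (rule ulim_divide[where c = "\<alpha> (int i)"])
  have "bounded ((\<lambda>x. x) ` K)" by (intro bdK continuous_on_id)
  thus "ulim K (\<lambda>k x. x - b (Suc k * N + i)) (\<lambda>x. x - \<beta> (int i))"
   by (intro ulim_minus ulim_constx[OF lbn[of i]] ulim_const)
  show "ulim K (\<lambda>k x. a (Suc k * N + i)) (\<lambda>x. \<alpha> (int i))" by (rule ulim_constx[OF lan[of i]])
 qed (use per(3)[of "int i"] in auto)
 define sol where "sol = (\<lambda>k (x::real) c d n. rsol (\<lambda>i. p i k x) (\<lambda>i. q i k x) c d n)"
 define sl where "sl = (\<lambda>x c d n. per_sol \<alpha> \<beta> 0 (x::real) c d n)"
 \<comment> \<open>Blocks are numbered from \<open>Suc k\<close> so that the index just before a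
   block is a natural number; the Stolz hypotheses start at the same place.\<close>
 define u where "u = (\<lambda>k x. orth_poly a b (Suc k * N - 1) x)"
 define w where "w = (\<lambda>k x. orth_poly a b (Suc k * N) x)"
 have psol: "orth_poly a b (Suc k * N - 1 + n) x = sol k x (u k x) (w k x) n" for k x n unfolding sol_def
 proof (rule rsol_unique[of "\<lambda>n. orth_poly a b (Suc k * N - 1 + n) x" _ _ n])
  fix n
  have "Suc k * N - 1 + Suc n = Suc k * N + n" "Suc k * N + n > 0" "Suc k * N + n - 1 = Suc k * N - 1 + n" using N by auto
  thus "orth_poly a b (Suc k * N - 1 + Suc (Suc n)) x = p n k x * orth_poly a b (Suc k * N - 1 + Suc n) x - q n k x * orth_poly a b (Suc k * N - 1 + n) x"
   using orth_poly_rec[of "Suc k * N + n" a b x] by (simp add: p_def q_def)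
 qed (use N in \<open>auto simp: u_def w_def\<close>)
 have psol2: "orth_poly a b (Suc k * N - 1 + n) x = sol k x 1 0 n * u k x + sol k x 0 1 n * w k x" for k x n
  unfolding psol sol_def by (subst rsol_linear) (simp add: mult.commute)
 have ws: "wt r 0 (\<lambda>k x. of_real (sol k x c d n))" if "n \<le> Suc N" for c d n
  unfolding sol_def by (rule wt_rsol[of N]) (use wp wq that in auto)
 have ls: "ulim K (\<lambda>k x. sol k x c d n) (\<lambda>x. sl x c d n)" if "n \<le> Suc N" for c d n
  unfolding sol_def sl_def per_sol_def by (rule ulim_rsol[of N]) (use lp lq that in auto)
 have cs: "continuous_on K (\<lambda>x. sol k x c d n)" for k c d n unfolding sol_def p_def q_def
  by (rule continuous_rsol) (auto simp: divide_inverse intro!: continuous_intros)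
 \<comment> \<open>The determinant of a block transfer matrix is a telescoping product of quotients
   of neighbouring \<open>a\<close>, namely \<open>\<tau> k / \<tau> (Suc k)\<close>; its limit 1
   reflects that the periodic monodromy matrix has determinant one.\<close>
 define \<tau> where "\<tau> = (\<lambda>k. a (Suc k * N - 1))"
 have lt: "\<tau> \<longlonglongrightarrow> \<alpha> (-1)" unfolding \<tau>_def using lan1[of 0] by simp
 have det: "(sol k x 1 0 N * sol k x 0 1 (Suc N) - sol k x 0 1 N * sol k x 1 0 (Suc N)) * \<tau> (Suc k) = \<tau> k" for k x
 proof -
  have "(\<Prod>i<N. q i k x) = (\<Prod>i<N. a (Suc k * N - 1 + i) / a (Suc k * N - 1 + Suc i))"
   using N by (intro prod.cong) (auto simp: q_def)
  also have "\<dots> = a (Suc k * N - 1 + 0) / a (Suc k * N - 1 + N)" by (rule prod_ratio_telescope) (metis a less_irrefl)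
  finally have "(\<Prod>i<N. q i k x) = \<tau> k / \<tau> (Suc k)" using N by (simp add: \<tau>_def add.commute)
  thus ?thesis unfolding sol_def rsol_wronskian using a[of "Suc (Suc k) * N - 1"] by (simp add: \<tau>_def)
 qed
 have detl: "sl x 1 0 N * sl x 0 1 (Suc N) - sl x 0 1 N * sl x 1 0 (Suc N) = 1" for x
 proof -
  have "(\<Prod>i<N. per_q \<alpha> 0 i :: real) = (\<Prod>i<N. \<alpha> (int i - 1) / \<alpha> (int (Suc i) - 1))"
   by (intro prod.cong) (auto simp: per_q_def)
  also have "\<dots> = \<alpha> (int 0 - 1) / \<alpha> (int N - 1)" by (rule prod_ratio_telescope) (metis per(3) less_irrefl)
  also have "\<alpha> (int N - 1) = \<alpha> (int 0 - 1)" using periodic_seq_mult[OF per(1), of "-1" 1] by simp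
  finally show ?thesis unfolding sl_def per_sol_def rsol_wronskian using per(3)[of "-1"] by simp
 qed
 have tr: "sl x 1 0 N + sl x 0 1 (Suc N) = discr \<alpha> \<beta> N 0 x" for x by (simp add: sl_def discr_def)
 obtain \<delta> where \<delta>: "\<delta> > 0" "\<And>x. x \<in> K \<Longrightarrow> (sl x 1 0 N + sl x 0 1 (Suc N))^2 \<le> 4 - \<delta>"
 proof (cases "K = {}")
  case True
  thus ?thesis using that[of 1] by auto
 next
  case False
  obtain x0 where x0: "x0 \<in> K" "\<And>x. x \<in> K \<Longrightarrow> (discr \<alpha> \<beta> N 0 x)^2 \<le> (discr \<alpha> \<beta> N 0 x0)^2"
   using continuous_attains_sup[OF K(1) False, of "\<lambda>x. (discr \<alpha> \<beta> N 0 x)^2"] continuous_discr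
   by (metis continuous_on_power)
  have "\<bar>discr \<alpha> \<beta> N 0 x0\<bar> < 2" using K(2)[OF x0(1)] by (simp add: trace_transfer_prod)
  hence "(discr \<alpha> \<beta> N 0 x0)^2 < 2^2" by (intro power2_strict_mono) auto
  thus ?thesis using that[of "4 - (discr \<alpha> \<beta> N 0 x0)^2"] x0(2) unfolding tr by simp
 qed
 have avg: "\<exists>H. ulim K (\<lambda>n x. (\<Sum>k<n. (orth_poly a b (Suc k * N - 1 + j) x)^2) / real n) H \<and> (\<forall>x\<in>K. H x \<ge> 0)
    \<and> (j = 1 \<longrightarrow> (\<forall>x\<in>K. H x > 0))" if j: "j \<le> Suc N" for j
 proof (rule riccati_average[where r = r and A = "\<lambda>k x. sol k x 1 0 N" and B = "\<lambda>k x. sol k x 0 1 N"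
    and C = "\<lambda>k x. sol k x 1 0 (Suc N)" and D = "\<lambda>k x. sol k x 0 1 (Suc N)"
    and a = "\<lambda>x. sl x 1 0 N" and b = "\<lambda>x. sl x 0 1 N" and c = "\<lambda>x. sl x 1 0 (Suc N)" and d = "\<lambda>x. sl x 0 1 (Suc N)"
    and \<delta> = \<delta> and u = u and w = w and \<tau> = \<tau> and t = "\<alpha> (-1)"
    and R = "\<lambda>k x. sol k x 1 0 j" and S = "\<lambda>k x. sol k x 0 1 j" and \<rho> = "\<lambda>x. sl x 1 0 j" and \<sigma> = "\<lambda>x. sl x 0 1 j"])
  show "u (Suc k) x = sol k x 1 0 N * u k x + sol k x 0 1 N * w k x" for k x using psol2[of k N x] N by (simp add: u_def add.commute)
  show "w (Suc k) x = sol k x 1 0 (Suc N) * u k x + sol k x 0 1 (Suc N) * w k x" for k x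
   using psol2[of k "Suc N" x] N by (simp add: w_def add.commute)
  show "u k x \<noteq> 0 \<or> w k x \<noteq> 0" for k x
   using orth_poly_not_both_zero[OF a, where b = b and n = "Suc k * N - 1" and x = x] N by (simp add: u_def w_def)
  show "bounded (u k ` K)" "bounded (w k ` K)" for k unfolding u_def w_def by (intro bdK continuous_orth_poly)+
  fix H assume H: "ulim K (\<lambda>n x. (\<Sum>k<n. (sol k x 1 0 j * u k x + sol k x 0 1 j * w k x)^2) / real n) H"
   "\<And>x. x \<in> K \<Longrightarrow> 0 \<le> H x" "\<And>x. x \<in> K \<Longrightarrow> sl x 1 0 j = 0 \<Longrightarrow> sl x 0 1 j = 1 \<Longrightarrow> 0 < H x"
  show "\<exists>H. ulim K (\<lambda>n x. (\<Sum>k<n. (orth_poly a b (Suc k * N - 1 + j) x)^2) / real n) H \<and> (\<forall>x\<in>K. H x \<ge> 0)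
    \<and> (j = 1 \<longrightarrow> (\<forall>x\<in>K. H x > 0))"
   unfolding psol2 using H by (intro exI[of _ H]) (auto simp: sl_def per_sol_def)
 qed (use eps r a per \<delta> det detl lt in \<open>auto intro!: ws ls bdK cs j simp: \<tau>_def\<close>)
 define P where "P = (\<lambda>i H. ulim K (\<lambda>n x. (\<Sum>k<n. (orth_poly a b (k * N + i) x)^2) / real n) H \<and> (\<forall>x\<in>K. H x \<ge> 0)
    \<and> (i = 0 \<longrightarrow> (\<forall>x\<in>K. H x > 0)))"
 have ex: "\<exists>H. P i H" if i: "i < N" for i
 proof -
  obtain H where H: "ulim K (\<lambda>n x. (\<Sum>k<n. (orth_poly a b (Suc k * N - 1 + Suc i) x)^2) / real n) H" "\<forall>x\<in>K. H x \<ge> 0" "Suc i = 1 \<longrightarrow> (\<forall>x\<in>K. H x > 0)"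
   using avg[of "Suc i"] i by auto
  \<comment> \<open>The averages obtained so far begin with block 1; prepending block 0 does not
    affect the limit.\<close>
  have "ulim K (\<lambda>n x. (\<Sum>k<n. (orth_poly a b (k * N + i) x)^2) / real n) H"
  proof (rule ulim_average_shift)
   have eq: "Suc k * N - 1 + Suc i = Suc k * N + i" for k using N by auto
   show "ulim K (\<lambda>n x. (\<Sum>k<n. (orth_poly a b (Suc k * N + i) x)^2) / real n) H" using H(1) unfolding eq .
  qed (intro bdK continuous_intros continuous_orth_poly)
  thus ?thesis unfolding P_def using H by auto
 qed
 then obtain H where HP: "\<forall>i\<in>{..<N}. P i (H i)" using bchoice[of "{..<N}" P] by auto
 hence H: "ulim K (\<lambda>n x. (\<Sum>k<n. (orth_poly a b (k * N + i) x)^2) / real n) (H i)"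
  "x \<in> K \<Longrightarrow> H i x \<ge> 0" "i = 0 \<Longrightarrow> x \<in> K \<Longrightarrow> H i x > 0" if "i < N" for i x
  using that by (auto simp: P_def)
 have "ulim K (\<lambda>n x. (\<Sum>j\<le>n. (orth_poly a b j x)^2) / real (Suc n)) (\<lambda>x. (\<Sum>i<N. H i x) / real N)"
  by (rule block_average[OF N]) (use H(1) in auto)
 moreover have "(\<Sum>i<N. H i x) / real N > 0" if "x \<in> K" for x
 proof -
  have "0 < H 0 x" using H(3)[of 0 x] N that by auto
  also have "H 0 x \<le> (\<Sum>i<N. H i x)" using H(2) N that by (intro member_le_sum) auto
  finally show ?thesis using N by simp
 qed
 ultimately show thesis using that[of "\<lambda>x. (\<Sum>i<N. H i x) / real N"] by (simp add: ulim_def CD_kernel_def power2_eq_square)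
qed

subsection \<open>The discriminant of a periodic Jacobi matrix\<close>

lemma per_sol_simps [simp]:
 "per_sol \<alpha> \<beta> j x c d 0 = c" "per_sol \<alpha> \<beta> j x c d (Suc 0) = d" by (simp_all add: per_sol_def)

lemma per_sol_rec:
 "per_sol \<alpha> \<beta> j x c d (Suc (Suc n)) = per_p \<alpha> \<beta> j x n * per_sol \<alpha> \<beta> j x c d (Suc n) - per_q \<alpha> j n * per_sol \<alpha> \<beta> j x c d n"
 by (simp add: per_sol_def)

lemma per_p_shift: "per_p \<alpha> \<beta> j x (n + k) = per_p \<alpha> \<beta> (j + int k) x n" by (simp add: per_p_def algebra_simps)

lemma per_q_shift: "per_q \<alpha> j (n + k) = per_q \<alpha> (j + int k) n" by (simp add: per_q_def algebra_simps)

lemma per_sol_shift: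
 "per_sol \<alpha> \<beta> j x c d (n + k) = per_sol \<alpha> \<beta> (j + int k) x (per_sol \<alpha> \<beta> j x c d k) (per_sol \<alpha> \<beta> j x c d (Suc k)) n"
 unfolding per_sol_def by (subst rsol_shift) (simp add: per_p_shift per_q_shift)

lemma per_sol_linear: "per_sol \<alpha> \<beta> j x c d n = c * per_sol \<alpha> \<beta> j x 1 0 n + d * per_sol \<alpha> \<beta> j x 0 1 n"
 unfolding per_sol_def by (rule rsol_linear)

lemma per_sol_scale: "per_sol \<alpha> \<beta> j x (s * c) (s * d) n = s * per_sol \<alpha> \<beta> j x c d n"
 unfolding per_sol_def by (rule rsol_scale)

lemma per_sol_of_real:
 "per_sol \<alpha> \<beta> j (of_real x :: 'a::real_normed_field) (of_real c) (of_real d) n = of_real (per_sol \<alpha> \<beta> j x c d n)"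
proof -
 have "per_p \<alpha> \<beta> j (of_real x :: 'a) = (\<lambda>i. of_real (per_p \<alpha> \<beta> j x i))" "(per_q \<alpha> j :: _ \<Rightarrow> 'a) = (\<lambda>i. of_real (per_q \<alpha> j i))"
  by (auto simp: per_p_def per_q_def fun_eq_iff)
 thus ?thesis unfolding per_sol_def rsol_of_real[symmetric] by simp
qed

lemma discr_of_real: "discr \<alpha> \<beta> N j (of_real x :: 'a::real_normed_field) = of_real (discr \<alpha> \<beta> N j x)"
 using per_sol_of_real[where 'a = 'a, of \<alpha> \<beta> j x 1 0] per_sol_of_real[where 'a = 'a, of \<alpha> \<beta> j x 0 1] by (simp add: discr_def)

definition sol_poly :: "(int \<Rightarrow> real) \<Rightarrow> (int \<Rightarrow> real) \<Rightarrow> int \<Rightarrow> 'a \<Rightarrow> 'a \<Rightarrow> nat \<Rightarrow> 'a::real_normed_field poly" where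
 "sol_poly \<alpha> \<beta> j c d = rsol (\<lambda>i. [:- of_real (\<beta> (j + int i)) / of_real (\<alpha> (j + int i)), 1 / of_real (\<alpha> (j + int i)):])
   (\<lambda>i. [:per_q \<alpha> j i:]) [:c:] [:d:]"

definition discr_poly :: "(int \<Rightarrow> real) \<Rightarrow> (int \<Rightarrow> real) \<Rightarrow> nat \<Rightarrow> 'a::real_normed_field poly" where
 "discr_poly \<alpha> \<beta> N = sol_poly \<alpha> \<beta> 0 1 0 N + sol_poly \<alpha> \<beta> 0 0 1 (Suc N)"

lemma poly_sol_poly: "poly (sol_poly \<alpha> \<beta> j c d n) x = per_sol \<alpha> \<beta> j x c d n" by (induction n rule: induct_nat_012)
   (auto simp: sol_poly_def per_sol_def per_p_def diff_divide_distrib add_divide_distrib algebra_simps)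

lemma poly_discr_poly: "poly (discr_poly \<alpha> \<beta> N) x = discr \<alpha> \<beta> N 0 x"
 by (simp add: discr_poly_def discr_def poly_sol_poly)

locale periodic_jacobi =
 fixes N :: nat and \<alpha> \<beta> :: "int \<Rightarrow> real"
 assumes N: "N \<ge> 1" and per: "periodic_seq N \<alpha>" "periodic_seq N \<beta>" and pos: "\<And>n. \<alpha> n > 0"
begin

abbreviation "S j x \<equiv> per_sol \<alpha> \<beta> j x 0 1"
abbreviation "R j x \<equiv> per_sol \<alpha> \<beta> j x 1 0"
abbreviation "sol \<equiv> per_sol \<alpha> \<beta>"
abbreviation "Dis \<equiv> discr \<alpha> \<beta> N 0"

lemma nz: "\<alpha> n \<noteq> 0" using pos[of n] by simp

lemma perN: "\<alpha> (n + int N) = \<alpha> n" "\<beta> (n + int N) = \<beta> n" using per by (auto simp: periodic_seq_def)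

lemma per_pN: "per_p \<alpha> \<beta> (j + int N) x n = per_p \<alpha> \<beta> j x n"
 using perN[of "j + int n"] by (simp add: per_p_def algebra_simps)

lemma per_qN: "per_q \<alpha> (j + int N) n = per_q \<alpha> j n"
 using perN[of "j + int n"] perN[of "j + int n - 1"] by (simp add: per_q_def algebra_simps)

lemma per_solN: "sol (j + int N) x c d n = sol j x c d n"
 unfolding per_sol_def by (simp add: per_pN[abs_def] per_qN[abs_def])

lemma per_qn: "per_q \<alpha> j N = per_q \<alpha> j 0" "per_p \<alpha> \<beta> j x N = per_p \<alpha> \<beta> j x 0"
 using per_q_shift[of \<alpha> j 0 N] per_p_shift[of \<alpha> \<beta> j x 0 N] by (simp_all add: per_pN per_qN)

lemma per_q_nz: "per_q \<alpha> j n \<noteq> 0" by (simp add: per_q_def nz)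

lemma S_Suc: "S j x (Suc n) = R (j + 1) x n + per_p \<alpha> \<beta> j x 0 * S (j + 1) x n"
 using per_sol_shift[of \<alpha> \<beta> j x 0 1 n 1] per_sol_linear[of \<alpha> \<beta> "j + 1" x 1 "per_p \<alpha> \<beta> j x 0" n]
 by (simp add: per_sol_rec)

lemma R_Suc: "R j x (Suc n) = - per_q \<alpha> j 0 * S (j + 1) x n"
 using per_sol_shift[of \<alpha> \<beta> j x 1 0 n 1] per_sol_linear[of \<alpha> \<beta> "j + 1" x 0 "- per_q \<alpha> j 0" n]
 by (simp add: per_sol_rec)

lemma wronskian: "R j x N * S j x (Suc N) - S j x N * R j x (Suc N) = (1 :: 'a::real_normed_field)"
proof -
 have "(\<Prod>i<n. per_q \<alpha> j i :: 'a) = of_real (\<alpha> (j - 1)) / of_real (\<alpha> (j + int n - 1))" for n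
  by (induction n) (auto simp: per_q_def nz)
 from this[of N] show ?thesis unfolding per_sol_def rsol_wronskian using perN[of "j - 1"] nz[of "j - 1"] by (simp add: algebra_simps)
qed

text \<open>The monodromy matrices at \<open>j\<close> and \<open>j + 1\<close> are conjugate by a
  transfer matrix. In terms of entries this is the recurrence for \<open>R\<close> at the end of the
  period.\<close>

lemma discr_Suc: "discr \<alpha> \<beta> N (j + 1) x = discr \<alpha> \<beta> N j (x :: 'a::real_normed_field)"
proof -
 define p q where "p = per_p \<alpha> \<beta> j x 0" and "q = (per_q \<alpha> j 0 :: 'a)"
 have "R j x (Suc (Suc N)) = p * R j x (Suc N) - q * R j x N" by (simp add: per_sol_rec per_qn p_def q_def)
 hence "- q * S (j + 1) x (Suc N) = - q * (p * S (j + 1) x N + R j x N)" unfolding R_Suc by (simp add: p_def q_def algebra_simps)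
 hence "S (j + 1) x (Suc N) = p * S (j + 1) x N + R j x N" using per_q_nz[where 'a = 'a, of j 0] by (simp add: q_def)
 thus ?thesis using S_Suc[of j x N] by (simp add: discr_def p_def)
qed

lemma discr_eq: "discr \<alpha> \<beta> N j x = Dis x"
proof (induction j rule: int_induct[of _ 0])
 case (step1 i)
 thus ?case by (simp add: discr_Suc)
next
 case (step2 i)
 thus ?case using discr_Suc[of "i - 1" x] by simp
qed simp

text \<open>Because the determinant is one, \<open>discr^2 - 4\<close> is a square plus four times
  the product of the off-diagonal entries of the monodromy matrix. In the elliptic case this product
  is therefore negative, and by \<open>R_Suc\<close> one of its factors is a negative multiple of
  \<open>S (j + 1) x N\<close>.\<close>

lemma S_sign:
 fixes x :: real
 assumes "\<bar>Dis x\<bar> < 2"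
 shows "S j x N * S (j + 1) x N > 0"
proof -
 have "(discr \<alpha> \<beta> N j x)^2 < 4"
  using assms power2_strict_mono[of "Dis x" 2] unfolding discr_eq[of j] by simp
 moreover have "(R j x N - S j x (Suc N))^2 + 4 * (S j x N * R j x (Suc N)) = (discr \<alpha> \<beta> N j x)^2 - 4"
  using wronskian[of j x] by (simp add: discr_def power2_eq_square algebra_simps)
 ultimately have "S j x N * R j x (Suc N) < 0" using zero_le_power2[of "R j x N - S j x (Suc N)"] by linarith
 hence "per_q \<alpha> j 0 * (S j x N * S (j + 1) x N) > 0" unfolding R_Suc by (simp add: mult_ac)
 moreover have "(per_q \<alpha> j 0 :: real) > 0" using pos by (simp add: per_q_def)
 ultimately show ?thesis by (simp add: zero_less_mult_iff)
qed

lemma S_same_sign: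
 fixes x :: real
 assumes "\<bar>Dis x\<bar> < 2"
 shows "S 0 x N * S (int k) x N > 0"
proof (induction k)
 case 0
 show ?case using S_sign[OF assms, of 0] by (auto simp: zero_less_mult_iff)
next
 case (Suc k)
 thus ?case using S_sign[OF assms, of "int k"] by (auto simp: zero_less_mult_iff add.commute)
qed

text \<open>This is the derivative of the discriminant, see \<open>discr_deriv\<close>; divided by
  \<open>\<nu> - 1 / \<nu>\<close> it is also the trace of the Green function over one period, see
  \<open>trace_resolvent\<close>.\<close>

definition dsum :: "'a \<Rightarrow> 'a::real_normed_field" where
 "dsum x = (\<Sum>j<N. S (int j + 1) x N / of_real (\<alpha> (int j)))"

text \<open>For \<open>\<bar>Dis x\<bar> < 2\<close> all summands have the sign of
  \<open>S 0 x N\<close>, so nothing cancels. Hence the discriminant has no critical point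
  there.\<close>

lemma dsum_nonzero:
 fixes x :: real
 assumes "\<bar>Dis x\<bar> < 2"
 shows "dsum x \<noteq> 0"
proof -
 have "S 0 x N * dsum x = (\<Sum>j<N. (S 0 x N * S (int (Suc j)) x N) / \<alpha> (int j))"
  by (simp add: dsum_def sum_distrib_left add.commute)
 also have "\<dots> > 0" using N by (intro sum_pos divide_pos_pos S_same_sign[OF assms] pos) (auto simp: lessThan_empty_iff)
 finally show ?thesis by auto
qed

text \<open>Variation of constants: the derivative in \<open>x\<close> solves the same recurrence
  with the solution divided by \<open>\<alpha>\<close> as source, and
  \<open>S (i + int j + 1)\<close> propagates a unit source placed at index
  \<open>i + int j\<close>.\<close>

lemma per_sol_deriv:
 fixes x :: "'a::real_normed_field"
 shows "((\<lambda>x. sol i x c d n) has_field_derivative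
  (\<Sum>j<n-1. S (i + int j + 1) x (n - 1 - j) * sol i x c d (Suc j) / of_real (\<alpha> (i + int j)))) (at x)"
proof (induction n rule: induct_nat_012)
 case (ge2 n)
 define T where "T n = (\<Sum>j<n-1. S (i + int j + 1) x (n - 1 - j) * sol i x c d (Suc j) / of_real (\<alpha> (i + int j)))" for n
 define p q where "p = per_p \<alpha> \<beta> i x n" and "q = (per_q \<alpha> i n :: 'a)"
 have Tn: "T n = (\<Sum>j<n. S (i + int j + 1) x (n - 1 - j) * sol i x c d (Suc j) / of_real (\<alpha> (i + int j)))"
  by (cases n) (auto simp: T_def)
 have "T (Suc (Suc n)) = (\<Sum>j<n. S (i + int j + 1) x (Suc n - j) * sol i x c d (Suc j) / of_real (\<alpha> (i + int j)))
   + sol i x c d (Suc n) / of_real (\<alpha> (i + int n))" by (simp add: T_def)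
 also have "(\<Sum>j<n. S (i + int j + 1) x (Suc n - j) * sol i x c d (Suc j) / of_real (\<alpha> (i + int j)))
   = (\<Sum>j<n. p * (S (i + int j + 1) x (n - j) * sol i x c d (Suc j) / of_real (\<alpha> (i + int j)))
    - q * (S (i + int j + 1) x (n - 1 - j) * sol i x c d (Suc j) / of_real (\<alpha> (i + int j))))"
 proof (rule sum.cong)
  fix j assume "j \<in> {..<n}"
  then obtain m where m: "n = Suc (j + m)" using less_imp_Suc_add[of j n] by auto
  have "S (i + int j + 1) x (Suc (Suc m)) = p * S (i + int j + 1) x (Suc m) - q * S (i + int j + 1) x m"
   using per_p_shift[of \<alpha> \<beta> i x m "Suc j"] per_q_shift[where 'a = 'a, of \<alpha> i m "Suc j"]
   by (simp add: per_sol_rec p_def q_def m algebra_simps)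
  thus "S (i + int j + 1) x (Suc n - j) * sol i x c d (Suc j) / of_real (\<alpha> (i + int j))
   = p * (S (i + int j + 1) x (n - j) * sol i x c d (Suc j) / of_real (\<alpha> (i + int j)))
    - q * (S (i + int j + 1) x (n - 1 - j) * sol i x c d (Suc j) / of_real (\<alpha> (i + int j)))"
   by (simp add: m diff_divide_distrib left_diff_distrib mult.assoc)
 qed simp
 also have "\<dots> = p * T (Suc n) - q * T n" unfolding Tn by (simp add: T_def sum_subtractf sum_distrib_left)
 finally have T2: "T (Suc (Suc n)) = p * T (Suc n) - q * T n + sol i x c d (Suc n) / of_real (\<alpha> (i + int n))" .
 have 1: "((\<lambda>x. sol i x c d n) has_field_derivative T n) (at x)"
  "((\<lambda>x. sol i x c d (Suc n)) has_field_derivative T (Suc n)) (at x)" using ge2 by (simp_all add: T_def)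
 have 2: "((\<lambda>x. per_p \<alpha> \<beta> i x n) has_field_derivative 1 / of_real (\<alpha> (i + int n))) (at x)"
  unfolding per_p_def by (rule DERIV_cdivide) (auto intro!: derivative_eq_intros)
 have "((\<lambda>x. sol i x c d (Suc (Suc n))) has_field_derivative T (Suc (Suc n))) (at x)"
  unfolding per_sol_rec using DERIV_diff[OF DERIV_mult'[OF 2 1(2)] DERIV_cmult[OF 1(1), of q]] by (simp add: T2 p_def q_def diff_add_eq)
 thus ?case by (simp only: T_def)
qed auto

text \<open>The two diagonal entries contribute the sums of \<open>f\<close> and \<open>g\<close>.
  Continuing \<open>S (int j + 1)\<close> beyond the end of the period and expanding it there in the
  basis \<open>R 0\<close>, \<open>S 0\<close> shows that they merge term by term.\<close>

lemma discr_deriv: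
 fixes x :: "'a::real_normed_field"
 shows "(Dis has_field_derivative dsum x) (at x)"
proof -
 define f where "f j = S (int j + 1) x (N - 1 - j) * R 0 x (Suc j) / of_real (\<alpha> (int j))" for j
 define g where "g j = S (int j + 1) x (N - j) * S 0 x (Suc j) / of_real (\<alpha> (int j))" for j
 have "(Dis has_field_derivative (\<Sum>j<N-1. f j) + (\<Sum>j<N. g j)) (at x)"
  unfolding discr_def[abs_def] f_def g_def using DERIV_add[OF per_sol_deriv[of 0 1 0 N x] per_sol_deriv[of 0 0 1 "Suc N" x]] by simp
 moreover have "(\<Sum>j<N-1. f j) = (\<Sum>j<N. f j)" using N by (cases N) (auto simp: f_def)
 moreover have "(\<Sum>j<N. f j) + (\<Sum>j<N. g j) = dsum x" unfolding dsum_def sum.distrib[symmetric]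
 proof (rule sum.cong)
  fix j assume "j \<in> {..<N}"
  then obtain m where m: "N = Suc (j + m)" using less_imp_Suc_add[of j N] by auto
  have "S (int j + 1) x (Suc j + m) = sol (0 + int N) x (S (int j + 1) x m) (S (int j + 1) x (Suc m)) (Suc j)"
   by (subst per_sol_shift) (simp add: m algebra_simps)
  also have "\<dots> = S (int j + 1) x m * R 0 x (Suc j) + S (int j + 1) x (Suc m) * S 0 x (Suc j)"
   unfolding per_solN by (rule per_sol_linear)
  finally show "f j + g j = S (int j + 1) x N / of_real (\<alpha> (int j))" by (simp add: f_def g_def m add_divide_distrib)
 qed simp
 ultimately show ?thesis by simp
qed

section \<open>Degree and zeros of the discriminant\<close>

lemma degree_sol_poly_S:
 "degree (sol_poly \<alpha> \<beta> j 0 (1::'a::real_normed_field) (Suc n)) = n \<and>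
  coeff (sol_poly \<alpha> \<beta> j 0 (1::'a) (Suc n)) n = (\<Prod>i<n. 1 / of_real (\<alpha> (j + int i)))"
proof (induction n rule: less_induct)
 case (less n)
 show ?case
 proof (cases n)
  case 0
  thus ?thesis by (simp add: sol_poly_def)
 next
  case (Suc m)
  define P where "P = (sol_poly \<alpha> \<beta> j 0 (1::'a))"
  have P2: "P (Suc (Suc m)) = [:- of_real (\<beta> (j + int m)) / of_real (\<alpha> (j + int m)), 1 / of_real (\<alpha> (j + int m)):] * P (Suc m) - smult (per_q \<alpha> j m) (P m)"
   by (simp add: P_def sol_poly_def)
  have IH: "degree (P (Suc m)) = m" "coeff (P (Suc m)) m = (\<Prod>i<m. 1 / of_real (\<alpha> (j + int i)))"
   using less[of m] Suc by (auto simp: P_def)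
  have dm: "degree (P m) \<le> m"
  proof (cases m)
   case 0
   thus ?thesis by (simp add: P_def sol_poly_def)
  next
   case (Suc l)
   thus ?thesis using less[of l] \<open>n = Suc m\<close> by (auto simp: P_def)
  qed
  have c: "coeff (P (Suc (Suc m))) (Suc m) = (\<Prod>i<Suc m. 1 / of_real (\<alpha> (j + int i)))"
   unfolding P2 using dm IH by (simp add: coeff_eq_0 coeff_pCons)
  have "degree (P (Suc (Suc m))) \<le> Suc m" unfolding P2 using dm IH
   by (intro degree_diff_le order_trans[OF degree_mult_le] order_trans[OF degree_smult_le]) auto
  moreover have "coeff (P (Suc (Suc m))) (Suc m) \<noteq> 0" unfolding c by (simp add: nz)
  ultimately have "degree (P (Suc (Suc m))) = Suc m" using le_degree by (metis le_antisym)
  thus ?thesis using c Suc by (simp add: P_def)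
 qed
qed

lemma degree_sol_poly_R: "degree (sol_poly \<alpha> \<beta> j 1 (0::'a::real_normed_field) (Suc n)) \<le> n - 1"
proof (induction n rule: less_induct)
 case (less n)
 define P where "P = (sol_poly \<alpha> \<beta> j 1 (0::'a))"
 consider "n = 0" | "n = 1" | m where "n = Suc (Suc m)" by (cases n; cases "n - 1") auto
 thus ?case
 proof cases
  case 3
  have P2: "P (Suc n) = [:- of_real (\<beta> (j + int (Suc m))) / of_real (\<alpha> (j + int (Suc m))), 1 / of_real (\<alpha> (j + int (Suc m))):] * P (Suc (Suc m)) - smult (per_q \<alpha> j (Suc m)) (P (Suc m))"
   by (simp add: P_def sol_poly_def 3)
  have "degree (P (Suc (Suc m))) \<le> m" "degree (P (Suc m)) \<le> m" using less[of "Suc m"] less[of m] 3 by (auto simp: P_def)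
  thus ?thesis unfolding P_def[symmetric] P2
   using 3 by (intro degree_diff_le order_trans[OF degree_mult_le] order_trans[OF degree_smult_le]) auto
 qed (auto simp: sol_poly_def)
qed

lemma degree_discr_poly: "degree (discr_poly \<alpha> \<beta> N :: 'a::real_normed_field poly) = N"
 and coeff_discr_poly: "coeff (discr_poly \<alpha> \<beta> N :: 'a poly) N = (\<Prod>i<N. 1 / of_real (\<alpha> (int i)))"
proof -
 have R: "degree (sol_poly \<alpha> \<beta> 0 1 (0::'a) N) < N" using N degree_sol_poly_R[of 0 "N - 1", where 'a = 'a] by (cases N) auto
 have S: "degree (sol_poly \<alpha> \<beta> 0 0 (1::'a) (Suc N)) = N" using degree_sol_poly_S by blast
 show "degree (discr_poly \<alpha> \<beta> N :: 'a poly) = N"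
  unfolding discr_poly_def using R S degree_add_eq_right[of "sol_poly \<alpha> \<beta> 0 1 (0::'a) N" "sol_poly \<alpha> \<beta> 0 0 1 (Suc N)"] by simp
 show "coeff (discr_poly \<alpha> \<beta> N :: 'a poly) N = (\<Prod>i<N. 1 / of_real (\<alpha> (int i)))"
  unfolding discr_poly_def using R degree_sol_poly_S[of 0 N, where 'a = 'a] by (simp add: coeff_eq_0)
qed

text \<open>The hypothesis says that \<open>\<mu>\<close> is an eigenvalue of the monodromy matrix,
  since its trace is \<open>Dis z\<close> and its determinant is one; an eigenvector provides the
  initial values \<open>c\<close>, \<open>d\<close>.\<close>

lemma floquet_solution:
 fixes z \<mu> :: "'a::real_normed_field"
 assumes "\<mu>^2 - Dis z * \<mu> + 1 = 0"
 obtains c d where "c \<noteq> 0 \<or> d \<noteq> 0" "\<And>n. sol 0 z c d (n + N) = \<mu> * sol 0 z c d n"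
proof -
 define A B C D where "A = R 0 z N" and "B = S 0 z N" and "C = R 0 z (Suc N)" and "D = S 0 z (Suc N)"
 have det: "A * D - B * C = 1" using wronskian[of 0 z] by (simp add: A_def B_def C_def D_def)
 have ch: "(A - \<mu>) * (D - \<mu>) = B * C" using assms det by (simp add: discr_def A_def D_def power2_eq_square algebra_simps)
 have "\<exists>c d. (c \<noteq> 0 \<or> d \<noteq> 0) \<and> c * A + d * B = \<mu> * c \<and> c * C + d * D = \<mu> * d"
 proof (cases "B = 0 \<and> C = 0")
  case True
  hence "A = \<mu> \<or> D = \<mu>" using ch by simp
  thus ?thesis
  proof
   assume "A = \<mu>"
   thus ?thesis using True by (intro exI[of _ 1] exI[of _ 0]) simp
  next
   assume "D = \<mu>"
   thus ?thesis using True by (intro exI[of _ 0] exI[of _ 1]) simp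
  qed
 next
  case False
  then consider "B \<noteq> 0" | "B = 0" "C \<noteq> 0" by auto
  thus ?thesis
  proof cases
   case 1
   have "B * A + (\<mu> - A) * B = \<mu> * B" by (simp add: algebra_simps)
   moreover have "B * C + (\<mu> - A) * D = \<mu> * (\<mu> - A)" unfolding ch[symmetric] by (simp add: algebra_simps)
   ultimately show ?thesis using 1 by blast
  next
   case 2
   have "(\<mu> - D) * A + C * B = \<mu> * (\<mu> - D)" using ch 2(1) by (simp add: algebra_simps)
   moreover have "(\<mu> - D) * C + C * D = \<mu> * C" by (simp add: algebra_simps)
   ultimately show ?thesis using 2 by blast
  qed
 qed
 then obtain c d where cd: "c \<noteq> 0 \<or> d \<noteq> 0" "c * A + d * B = \<mu> * c" "c * C + d * D = \<mu> * d" by blast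
 have "sol 0 z c d (n + N) = \<mu> * sol 0 z c d n" for n
 proof -
  have e: "sol 0 z c d N = \<mu> * c" "sol 0 z c d (Suc N) = \<mu> * d"
   using cd by (subst per_sol_linear, simp add: A_def B_def C_def D_def)+
  have "sol 0 z c d (n + N) = sol (0 + int N) z (sol 0 z c d N) (sol 0 z c d (Suc N)) n"
   by (subst per_sol_shift) simp
  thus ?thesis unfolding per_solN e per_sol_scale .
 qed
 thus thesis using that cd(1) by blast
qed

lemma per_sol_alpha:
 "of_real (\<alpha> (int n)) * sol 0 z c d (Suc (Suc n))
  = (z - of_real (\<beta> (int n))) * sol 0 z c d (Suc n) - of_real (\<alpha> (int n - 1)) * sol 0 z c d n"
 by (simp add: per_sol_rec per_p_def per_q_def nz right_diff_distrib)

text \<open>A Floquet solution with multiplier of modulus one has equal flux at both ends of a period,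
 whereas for non-real \<open>z\<close> the flux is strictly monotone.\<close>

lemma discr_zero_real:
 fixes z :: complex
 assumes "Dis z = 0"
 shows "Im z = 0"
proof (rule ccontr)
 assume iz: "Im z \<noteq> 0"
 \<comment> \<open>At a zero of the discriminant the multipliers are \<open>\<i>\<close> and
   \<open>- \<i>\<close>, of modulus one.\<close>
 have "\<i>^2 - Dis z * \<i> + 1 = 0" using assms by simp
 then obtain c d where cd: "c \<noteq> 0 \<or> d \<noteq> 0" "\<And>n. sol 0 z c d (n + N) = \<i> * sol 0 z c d n"
  by (rule floquet_solution) blast
 define u where "u = sol 0 z c d"
 define J where "J n = \<alpha> (int n - 1) * Im (u (Suc n) * cnj (u n))" for n
 have step: "J (Suc n) - J n = Im z * (cmod (u (Suc n)))^2" for n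
 proof -
  have "Im (of_real (\<alpha> (int n)) * u (Suc (Suc n)) * cnj (u (Suc n)))
    = Im (((z - of_real (\<beta> (int n))) * u (Suc n) - of_real (\<alpha> (int n - 1)) * u n) * cnj (u (Suc n)))"
   unfolding u_def per_sol_alpha ..
  also have "\<dots> = Im z * (cmod (u (Suc n)))^2 - \<alpha> (int n - 1) * Im (u n * cnj (u (Suc n)))"
   unfolding cmod_power2 by (simp add: power2_eq_square algebra_simps)
  also have "Im (u n * cnj (u (Suc n))) = - Im (u (Suc n) * cnj (u n))" by simp
  finally show ?thesis by (simp add: J_def mult.assoc algebra_simps)
 qed
 have tel: "J n - J 0 = (\<Sum>k<n. Im z * (cmod (u (Suc k)))^2)" for n
 proof (induction n)
  case (Suc n)
  thus ?case using step[of n] by simp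
 qed simp
 have uN: "u (n + N) = \<i> * u n" for n using cd(2) by (simp add: u_def)
 have "J N = J 0" using uN[of 0] uN[of 1] perN(1)[of "-1"] by (simp add: J_def)
 hence "Im z * (\<Sum>k<N. (cmod (u (Suc k)))^2) = 0" using tel[of N] by (simp add: sum_distrib_left)
 hence "(\<Sum>k<N. (cmod (u (Suc k)))^2) = 0" using iz by simp
 hence z0: "u (Suc k) = 0" if "k < N" for k using that by (subst (asm) sum_nonneg_eq_0_iff) auto
 have "d = 0" using z0[of 0] N by (simp add: u_def)
 moreover have "c = 0" using z0[of "N - 1"] uN[of 0] N by (simp add: u_def)
 ultimately show False using cd by simp
qed

text \<open>Over the complex numbers the discriminant has degree \<open>N\<close>. Its zeros are
  real by the flux argument and simple by \<open>dsum_nonzero\<close>, so there are \<open>N\<close>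
  of them on the line.\<close>

lemma card_discr_zeros: "card {x::real. Dis x = 0} = N" and finite_discr_zeros: "finite {x::real. Dis x = 0}"
proof -
 define P where "P = (discr_poly \<alpha> \<beta> N :: complex poly)"
 have Pz: "poly P z = Dis z" for z by (simp add: P_def poly_discr_poly)
 have P0: "P \<noteq> 0" using degree_discr_poly[where 'a = complex] N by (auto simp: P_def)
 have zeros: "{z. poly P z = 0} = complex_of_real ` {x. Dis x = 0}"
 proof (intro set_eqI iffI; (elim imageE)?)
  fix z assume "z \<in> {z. poly P z = 0}"
  hence z: "Dis z = 0" by (simp add: Pz)
  hence "z = of_real (Re z)" using discr_zero_real[OF z] by (simp add: complex_eq_iff)
  with z show "z \<in> complex_of_real ` {x. Dis x = 0}"
   using discr_of_real[of \<alpha> \<beta> N 0 "Re z", where 'a = complex] by (intro image_eqI[of _ _ "Re z"]) auto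
 qed (auto simp: Pz discr_of_real)
 have "rsquarefree P" unfolding rsquarefree_roots
 proof (intro allI notI)
  fix z assume z: "poly P z = 0 \<and> poly (pderiv P) z = 0"
  then obtain x where x: "z = of_real x" "Dis x = 0" using zeros by auto
  have "(poly P has_field_derivative dsum z) (at z)" using discr_deriv[of z] by (simp add: Pz[abs_def])
  hence "poly (pderiv P) z = dsum z" by (rule DERIV_unique[OF poly_DERIV])
  also have "dsum z = of_real (dsum x)" using per_sol_of_real[where 'a = complex, of \<alpha> \<beta> _ x 0 1] by (simp add: dsum_def x)
  finally show False using z dsum_nonzero[of x] x by simp
 qed
 from complex_poly_decompose_rsquarefree[OF this]
 have "degree P = degree (smult (lead_coeff P) (\<Prod>z|poly P z = 0. [:-z, 1:]))" by simp
 also have "\<dots> = (\<Sum>z|poly P z = 0. degree [:-z, 1:])" using P0 by (simp add: degree_prod_eq_sum_degree)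
 also have "\<dots> = card {z. poly P z = 0}" by simp
 finally have "card {z. poly P z = 0} = N" using degree_discr_poly[where 'a = complex] by (simp add: P_def)
 thus c: "card {x::real. Dis x = 0} = N" unfolding zeros by (subst (asm) card_image) (auto simp: inj_on_def)
 show "finite {x::real. Dis x = 0}" using c N by (intro card_ge_0_finite) simp
qed

end

subsection \<open>Square-summable sequences\<close>

definition sqsum :: "(nat \<Rightarrow> complex) \<Rightarrow> real" where "sqsum f = (\<Sum>n. (cmod (f n))^2)"

lemma ell2_norm_sqsum: "ell2_norm f = sqrt (sqsum f)" by (simp add: ell2_norm_def sqsum_def)

lemma sqsum_nonneg: "f \<in> ell2 \<Longrightarrow> sqsum f \<ge> 0" unfolding sqsum_def ell2_def by (intro suminf_nonneg) auto

lemma ell2_comparison: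
 assumes "summable g" "\<And>n. (cmod (f n))^2 \<le> g n"
 shows "f \<in> ell2" "sqsum f \<le> suminf g"
proof -
 show "f \<in> ell2" unfolding ell2_def mem_Collect_eq by (rule summable_comparison_test'[OF assms(1), of 0]) (use assms(2) in auto)
 thus "sqsum f \<le> suminf g" unfolding sqsum_def ell2_def by (intro suminf_le assms) auto
qed

lemma ell2_finite_support:
 assumes "finite {n. f n \<noteq> 0}"
 shows "f \<in> ell2" "sqsum f = (\<Sum>n | f n \<noteq> 0. (cmod (f n))^2)"
proof -
 have "(\<lambda>n. (cmod (f n))^2) sums (\<Sum>n | f n \<noteq> 0. (cmod (f n))^2)" by (rule sums_finite[OF assms]) auto
 thus "f \<in> ell2" "sqsum f = (\<Sum>n | f n \<noteq> 0. (cmod (f n))^2)" by (auto simp: ell2_def sqsum_def sums_iff)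
qed

lemma cmod_add_sq: "(cmod (x + y))^2 \<le> 2 * (cmod x)^2 + 2 * (cmod y)^2"
proof -
 have "(cmod (x + y))^2 \<le> (cmod x + cmod y)^2" by (intro power_mono norm_triangle_ineq) auto
 also have "\<dots> \<le> 2 * (cmod x)^2 + 2 * (cmod y)^2"
  using zero_le_power2[of "cmod x - cmod y"] by (simp add: power2_eq_square algebra_simps)
 finally show ?thesis .
qed

lemma ell2_add:
 assumes "f \<in> ell2" "g \<in> ell2"
 shows "(\<lambda>n. f n + g n) \<in> ell2" "sqsum (\<lambda>n. f n + g n) \<le> 2 * sqsum f + 2 * sqsum g"
proof -
 have s: "summable (\<lambda>n. (cmod (f n))^2)" "summable (\<lambda>n. (cmod (g n))^2)" using assms by (auto simp: ell2_def)
 have s2: "summable (\<lambda>n. 2 * (cmod (f n))^2 + 2 * (cmod (g n))^2)" by (intro summable_add summable_mult s)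
 show "(\<lambda>n. f n + g n) \<in> ell2" by (rule ell2_comparison(1)[OF s2]) (rule cmod_add_sq)
 have "sqsum (\<lambda>n. f n + g n) \<le> (\<Sum>n. 2 * (cmod (f n))^2 + 2 * (cmod (g n))^2)"
  by (rule ell2_comparison(2)[OF s2]) (rule cmod_add_sq)
 also have "\<dots> = 2 * sqsum f + 2 * sqsum g" unfolding sqsum_def using s by (simp add: suminf_add[symmetric] suminf_mult summable_mult)
 finally show "sqsum (\<lambda>n. f n + g n) \<le> 2 * sqsum f + 2 * sqsum g" .
qed

lemma ell2_scale:
 assumes "f \<in> ell2"
 shows "(\<lambda>n. c * f n) \<in> ell2" "sqsum (\<lambda>n. c * f n) = (cmod c)^2 * sqsum f"
proof -
 have s: "summable (\<lambda>n. (cmod (f n))^2)" using assms by (auto simp: ell2_def)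
 have e: "(\<lambda>n. (cmod (c * f n))^2) = (\<lambda>n. (cmod c)^2 * (cmod (f n))^2)" by (simp add: norm_mult power_mult_distrib)
 show "(\<lambda>n. c * f n) \<in> ell2" unfolding ell2_def mem_Collect_eq e by (rule summable_mult[OF s])
 show "sqsum (\<lambda>n. c * f n) = (cmod c)^2 * sqsum f" unfolding sqsum_def e by (rule suminf_mult[OF s])
qed

lemma ell2_diff: "f \<in> ell2 \<Longrightarrow> g \<in> ell2 \<Longrightarrow> (\<lambda>n. f n - g n) \<in> ell2"
 using ell2_add(1)[of f "\<lambda>n. -1 * g n"] ell2_scale(1)[of g "-1"] by simp

lemma ell2_point: "f \<in> ell2 \<Longrightarrow> cmod (f n) \<le> ell2_norm f"
proof -
 assume f: "f \<in> ell2"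
 have "(\<Sum>k\<in>{n}. (cmod (f k))^2) \<le> sqsum f" unfolding sqsum_def using f by (intro sum_le_suminf) (auto simp: ell2_def)
 thus ?thesis unfolding ell2_norm_sqsum by (simp add: real_le_rsqrt)
qed

lemma ell2_LIMSEQ_0: "f \<in> ell2 \<Longrightarrow> f \<longlonglongrightarrow> 0"
proof -
 assume "f \<in> ell2"
 hence "(\<lambda>n. (cmod (f n))^2) \<longlonglongrightarrow> 0" by (auto simp: ell2_def dest: summable_LIMSEQ_zero)
 hence "(\<lambda>n. sqrt ((cmod (f n))^2)) \<longlonglongrightarrow> sqrt 0" by (intro tendsto_real_sqrt)
 thus ?thesis by (simp add: tendsto_norm_zero_iff)
qed

lemma sum_weight_sq:
 fixes w y :: "'i \<Rightarrow> real"
 assumes "\<And>i. i \<in> I \<Longrightarrow> w i \<ge> 0"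
 shows "(\<Sum>i\<in>I. w i * y i)^2 \<le> (\<Sum>i\<in>I. w i) * (\<Sum>i\<in>I. w i * (y i)^2)"
proof -
 have "(\<Sum>i\<in>I. sqrt (w i) * (sqrt (w i) * y i))^2 \<le> (\<Sum>i\<in>I. (sqrt (w i))^2) * (\<Sum>i\<in>I. (sqrt (w i) * y i)^2)"
  by (rule Cauchy_Schwarz_ineq_sum)
 thus ?thesis using assms by (simp add: power_mult_distrib mult.assoc[symmetric] cong: sum.cong)
qed

lemma geometric_partial_le:
 fixes q :: real
 assumes "0 \<le> q" "q < 1"
 shows "(\<Sum>i<n. q ^ i) \<le> 1 / (1 - q)"
 using sum_le_suminf[of "\<lambda>i. q ^ i" "{..<n}"] assms by (simp add: suminf_geometric summable_geometric)

text \<open>Young's inequality for a geometric kernel: Cauchy-Schwarz with the kernel as weight,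
  followed by the Cauchy product of two absolutely convergent series.\<close>

lemma convolution_past:
 fixes g :: "nat \<Rightarrow> real"
 assumes q: "0 \<le> q" "q < 1" and s: "summable (\<lambda>n. (g n)^2)"
 shows "summable (\<lambda>n. (\<Sum>m\<le>n. q ^ (n - m) * g m)^2)"
  "(\<Sum>n. (\<Sum>m\<le>n. q ^ (n - m) * g m)^2) \<le> (1 / (1 - q))^2 * (\<Sum>n. (g n)^2)"
proof -
 have sg: "summable (\<lambda>i. norm (q ^ i))" using q by (simp add: summable_geometric)
 have sn: "summable (\<lambda>n. norm ((g n)^2))" using s by simp
 define c where "c = (\<lambda>n. \<Sum>m\<le>n. (g m)^2 * q ^ (n - m))"
 have sc: "summable c" and ec: "suminf c = (\<Sum>n. (g n)^2) * (1 / (1 - q))"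
  using summable_Cauchy_product[OF sn sg] Cauchy_product[OF sn sg] q unfolding c_def by (simp_all add: suminf_geometric)
 have le: "(\<Sum>m\<le>n. q ^ (n - m) * g m)^2 \<le> 1 / (1 - q) * c n" for n
 proof -
  have "(\<Sum>m\<le>n. q ^ (n - m) * g m)^2 \<le> (\<Sum>m\<le>n. q ^ (n - m)) * (\<Sum>m\<le>n. q ^ (n - m) * (g m)^2)"
   using q by (intro sum_weight_sq) auto
  also have "(\<Sum>m\<le>n. q ^ (n - m)) = (\<Sum>i<Suc n. q ^ i)"
   by (rule sum.reindex_bij_witness[of _ "\<lambda>i. n - i" "\<lambda>m. n - m"]) auto
  also have "(\<Sum>i<Suc n. q ^ i) * (\<Sum>m\<le>n. q ^ (n - m) * (g m)^2) \<le> 1 / (1 - q) * (\<Sum>m\<le>n. q ^ (n - m) * (g m)^2)"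
   using geometric_partial_le[OF q, of "Suc n"] q by (intro mult_right_mono sum_nonneg) auto
  finally show ?thesis by (simp add: c_def mult.commute)
 qed
 have sc': "summable (\<lambda>n. 1 / (1 - q) * c n)" by (rule summable_mult[OF sc])
 show sm: "summable (\<lambda>n. (\<Sum>m\<le>n. q ^ (n - m) * g m)^2)" by (rule summable_comparison_test'[OF sc', of 0]) (use le in auto)
 have "(\<Sum>n. (\<Sum>m\<le>n. q ^ (n - m) * g m)^2) \<le> (\<Sum>n. 1 / (1 - q) * c n)" by (rule suminf_le[OF le sm sc'])
 also have "\<dots> = (1 / (1 - q))^2 * (\<Sum>n. (g n)^2)" by (subst suminf_mult[OF sc]) (simp add: ec power2_eq_square)
 finally show "(\<Sum>n. (\<Sum>m\<le>n. q ^ (n - m) * g m)^2) \<le> (1 / (1 - q))^2 * (\<Sum>n. (g n)^2)" .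
qed

text \<open>The same estimate for sums over later indices. The inner sum is now infinite, so
  Cauchy-Schwarz is applied to partial sums and the order of summation is exchanged for finitely
  many outer terms.\<close>

lemma convolution_future:
 fixes g :: "nat \<Rightarrow> real"
 assumes q: "0 \<le> q" "q < 1" and s: "summable (\<lambda>n. (g n)^2)" and g0: "\<And>n. g n \<ge> 0"
 shows "summable (\<lambda>i. q ^ i * g (n + i))" "summable (\<lambda>n. (\<Sum>i. q ^ i * g (n + i))^2)"
  "(\<Sum>n. (\<Sum>i. q ^ i * g (n + i))^2) \<le> (1 / (1 - q))^2 * (\<Sum>n. (g n)^2)"
proof -
 define S where "S = (\<Sum>n. (g n)^2)"
 have gS: "g n \<le> sqrt S" for n
 proof -
  have "(\<Sum>k\<in>{n}. (g k)^2) \<le> S" unfolding S_def by (intro sum_le_suminf s) auto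
  thus ?thesis by (simp add: real_le_rsqrt)
 qed
 have sm1: "summable (\<lambda>i. q ^ i * g (n + i))" for n by (rule summable_comparison_test'[of "\<lambda>i. q ^ i * sqrt S" 0])
    (use q g0 gS in \<open>auto intro!: summable_mult2 summable_geometric mult_left_mono simp: abs_mult\<close>)
 thus "summable (\<lambda>i. q ^ i * g (n + i))" .
 have g2S: "(g n)^2 \<le> S" for n using sum_le_suminf[OF s, of "{n}"] by (simp add: S_def)
 have sm2: "summable (\<lambda>i. q ^ i * (g (n + i))^2)" for n by (rule summable_comparison_test'[of "\<lambda>i. q ^ i * S" 0])
    (use q g2S in \<open>auto intro!: summable_mult2 summable_geometric mult_left_mono simp: abs_mult\<close>)
 have le: "(\<Sum>i. q ^ i * g (n + i))^2 \<le> 1 / (1 - q) * (\<Sum>i. q ^ i * (g (n + i))^2)" for n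
 proof (rule LIMSEQ_le_const2)
  show "(\<lambda>m. (\<Sum>i<m. q ^ i * g (n + i))^2) \<longlonglongrightarrow> (\<Sum>i. q ^ i * g (n + i))^2"
   by (intro tendsto_power summable_LIMSEQ sm1)
  show "\<exists>M. \<forall>m\<ge>M. (\<Sum>i<m. q ^ i * g (n + i))^2 \<le> 1 / (1 - q) * (\<Sum>i. q ^ i * (g (n + i))^2)"
  proof (intro exI allI impI)
   fix m
   have "(\<Sum>i<m. q ^ i * g (n + i))^2 \<le> (\<Sum>i<m. q ^ i) * (\<Sum>i<m. q ^ i * (g (n + i))^2)"
    using q by (intro sum_weight_sq) auto
   also have "\<dots> \<le> 1 / (1 - q) * (\<Sum>i. q ^ i * (g (n + i))^2)"
    using geometric_partial_le[OF q] q by (intro mult_mono sum_le_suminf sm2 sum_nonneg) auto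
   finally show "(\<Sum>i<m. q ^ i * g (n + i))^2 \<le> 1 / (1 - q) * (\<Sum>i. q ^ i * (g (n + i))^2)" .
  qed
 qed
 have part: "(\<Sum>n<M. (\<Sum>i. q ^ i * g (n + i))^2) \<le> (1 / (1 - q))^2 * S" for M
 proof -
  have "(\<Sum>n<M. (\<Sum>i. q ^ i * g (n + i))^2) \<le> (\<Sum>n<M. 1 / (1 - q) * (\<Sum>i. q ^ i * (g (n + i))^2))"
   by (intro sum_mono le)
  also have "\<dots> = 1 / (1 - q) * (\<Sum>i. \<Sum>n<M. q ^ i * (g (n + i))^2)"
   by (subst suminf_sum[OF sm2]) (simp add: sum_distrib_left)
  also have "\<dots> \<le> 1 / (1 - q) * (\<Sum>i. q ^ i * S)"
  proof (intro mult_left_mono suminf_le)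
   show "(\<Sum>n<M. q ^ i * (g (n + i))^2) \<le> q ^ i * S" for i
   proof -
    have "(\<Sum>n<M. (g (n + i))^2) = (\<Sum>n\<in>{i..<M+i}. (g n)^2)"
     by (rule sum.reindex_bij_witness[of _ "\<lambda>n. n - i" "\<lambda>n. n + i"]) auto
    also have "\<dots> \<le> S" unfolding S_def by (intro sum_le_suminf s) auto
    finally show ?thesis unfolding sum_distrib_left[symmetric] using q by (intro mult_left_mono) auto
   qed
  qed (use q in \<open>auto intro!: summable_sum sm2 summable_mult2 summable_geometric\<close>)
  also have "(\<Sum>i. q ^ i * S) = 1 / (1 - q) * S"
   using q by (subst suminf_mult2[symmetric]) (auto simp: suminf_geometric intro: summable_geometric)
  finally show ?thesis by (simp add: power2_eq_square mult.assoc)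
 qed
 show sm3: "summable (\<lambda>n. (\<Sum>i. q ^ i * g (n + i))^2)" by (rule summableI_nonneg_bounded[OF _ part]) auto
 show "(\<Sum>n. (\<Sum>i. q ^ i * g (n + i))^2) \<le> (1 / (1 - q))^2 * (\<Sum>n. (g n)^2)"
  unfolding S_def[symmetric] by (rule suminf_le_const[OF sm3 part])
qed

subsection \<open>Bounded Jacobi matrices\<close>

text \<open>The constant 9 is the factor 3 from squaring a sum of three terms, times the three
  shifted copies of the norm.\<close>

lemma tridiag_bounded:
 assumes M: "\<And>n. \<bar>a n\<bar> \<le> M" "\<And>n. \<bar>b n\<bar> \<le> M" and f: "f \<in> ell2"
 shows "tridiag a b f \<in> ell2" "sqsum (tridiag a b f) \<le> 9 * M^2 * sqsum f"
proof -
 define u where "u = (\<lambda>n. (cmod (f n))^2)"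
 have su: "summable u" using f by (simp add: u_def ell2_def)
 define u' where "u' = (\<lambda>n. if n = 0 then 0 else u (n - 1))"
 have su': "summable u'" and eu': "suminf u' = suminf u"
 proof -
  have "summable (\<lambda>n. u' (Suc n))" using su by (simp add: u'_def)
  thus s: "summable u'" by (simp add: summable_Suc_iff)
  show "suminf u' = suminf u" using suminf_split_head[OF s] by (simp add: u'_def)
 qed
 have su2: "summable (\<lambda>n. u (Suc n))" and eu2: "(\<Sum>n. u (Suc n)) \<le> suminf u"
  using summable_ignore_initial_segment[OF su, of 1] suminf_split_head[OF su] by (auto simp: u_def)
 have le: "(cmod (tridiag a b f n))^2 \<le> 3 * M^2 * (u' n + u n + u (Suc n))" for n
 proof -
  define x y z where "x = (if n = 0 then 0 else of_real (a (n - 1)) * f (n - 1))" and "y = of_real (b n) * f n"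
   and "z = of_real (a n) * f (Suc n)"
  have sq: "(of_real c * w) \<in> {v. (cmod v)^2 \<le> M^2 * (cmod w)^2}" if "\<bar>c\<bar> \<le> M" for c w
   using that by (auto simp: norm_mult power_mult_distrib intro!: mult_right_mono abs_le_square_iff[THEN iffD1] order_trans[OF _ abs_ge_self])
  have xs: "(cmod x)^2 \<le> M^2 * u' n" using sq[OF M(1)[of "n - 1"], of "f (n - 1)"] by (simp add: x_def u'_def u_def)
  have ys: "(cmod y)^2 \<le> M^2 * u n" using sq[OF M(2)[of n], of "f n"] by (simp add: y_def u_def)
  have zs: "(cmod z)^2 \<le> M^2 * u (Suc n)" using sq[OF M(1)[of n], of "f (Suc n)"] by (simp add: z_def u_def)
  have "(cmod (x + y + z))^2 \<le> (cmod x + cmod y + cmod z)^2"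
   by (intro power_mono order_trans[OF norm_triangle_ineq add_right_mono[OF norm_triangle_ineq]]) auto
  also have "\<dots> \<le> 3 * ((cmod x)^2 + (cmod y)^2 + (cmod z)^2)"
   using zero_le_power2[of "cmod x - cmod y"] zero_le_power2[of "cmod x - cmod z"] zero_le_power2[of "cmod y - cmod z"]
   by (simp add: power2_eq_square algebra_simps)
  also have "\<dots> \<le> 3 * M^2 * (u' n + u n + u (Suc n))" using xs ys zs by (simp add: algebra_simps)
  finally show ?thesis by (simp add: tridiag_def x_def y_def z_def)
 qed
 have s3: "summable (\<lambda>n. 3 * M^2 * (u' n + u n + u (Suc n)))" by (intro summable_mult summable_add su' su su2)
 show "tridiag a b f \<in> ell2" by (rule ell2_comparison(1)[OF s3 le])
 have "sqsum (tridiag a b f) \<le> (\<Sum>n. 3 * M^2 * (u' n + u n + u (Suc n)))" by (rule ell2_comparison(2)[OF s3 le])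
 also have "\<dots> = 3 * M^2 * (suminf u' + suminf u + (\<Sum>n. u (Suc n)))"
  by (subst suminf_mult) (auto simp: suminf_add summable_add su' su su2)
 also have "\<dots> \<le> 3 * M^2 * (suminf u + suminf u + suminf u)" unfolding eu' using eu2 by (intro mult_left_mono) auto
 finally show "sqsum (tridiag a b f) \<le> 9 * M^2 * sqsum f" by (simp add: sqsum_def u_def)
qed

lemma tridiag_diff: "tridiag a b (\<lambda>n. f n - g n) n = tridiag a b f n - tridiag a b g n" by (simp add: tridiag_def algebra_simps)

text \<open>Bounded entries make the closure an everywhere defined operator: norm limits are
  coordinatewise limits, which identifies the image, and conversely truncation approximates every
  vector in the graph norm.\<close>

lemma jacobi_matrix_iff:
 assumes M: "\<And>n. \<bar>a n\<bar> \<le> M" "\<And>n. \<bar>b n\<bar> \<le> M"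
 shows "(f, h) \<in> jacobi_matrix a b \<longleftrightarrow> f \<in> ell2 \<and> h = tridiag a b f"
proof
 assume "(f, h) \<in> jacobi_matrix a b"
 then obtain F where F: "f \<in> ell2" "h \<in> ell2" "\<And>k. finite {n. F k n \<noteq> 0}"
  "(\<lambda>k. ell2_norm (\<lambda>n. F k n - f n)) \<longlonglongrightarrow> 0" "(\<lambda>k. ell2_norm (\<lambda>n. tridiag a b (F k) n - h n)) \<longlonglongrightarrow> 0"
  by (auto simp: jacobi_matrix_def)
 have Fe: "F k \<in> ell2" for k by (rule ell2_finite_support(1)[OF F(3)])
 have p: "(\<lambda>k. F k n) \<longlonglongrightarrow> f n" for n
 proof -
  have "(\<lambda>k. F k n - f n) \<longlonglongrightarrow> 0"
   by (rule Lim_null_comparison[OF always_eventually F(4)]) (use ell2_point[OF ell2_diff[OF Fe F(1)]] in auto)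
  thus ?thesis by (simp add: LIM_zero_iff)
 qed
 have p2: "(\<lambda>k. tridiag a b (F k) n) \<longlonglongrightarrow> h n" for n
 proof -
  have "(\<lambda>k. tridiag a b (F k) n - h n) \<longlonglongrightarrow> 0"
   by (rule Lim_null_comparison[OF always_eventually F(5)]) (use ell2_point[OF ell2_diff[OF tridiag_bounded(1)[OF M Fe] F(2)]] in auto)
  thus ?thesis by (simp add: LIM_zero_iff)
 qed
 have "(\<lambda>k. tridiag a b (F k) n) \<longlonglongrightarrow> tridiag a b f n" for n
  unfolding tridiag_def by (cases "n = 0") (auto intro!: tendsto_intros p)
 hence "h = tridiag a b f" using p2 LIMSEQ_unique by blast
 thus "f \<in> ell2 \<and> h = tridiag a b f" using F(1) by simp
next
 assume fh: "f \<in> ell2 \<and> h = tridiag a b f"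
 hence f: "f \<in> ell2" and s: "summable (\<lambda>n. (cmod (f n))^2)" by (auto simp: ell2_def)
 define F where "F = (\<lambda>k n. if n < k then f n else 0)"
 have fin: "finite {n. F k n \<noteq> 0}" for k by (rule finite_subset[of _ "{..<k}"]) (auto simp: F_def split: if_splits)
 have Fe: "F k \<in> ell2" for k by (rule ell2_finite_support(1)[OF fin])
 have e: "sqsum (\<lambda>n. F k n - f n) = (\<Sum>n. (cmod (f (n + k)))^2)" for k
 proof -
  have s': "summable (\<lambda>n. (cmod (F k n - f n))^2)" using ell2_diff[OF Fe f] by (simp add: ell2_def)
  have "sqsum (\<lambda>n. F k n - f n) = (\<Sum>n. (cmod (F k (n + k) - f (n + k)))^2) + (\<Sum>n<k. (cmod (F k n - f n))^2)"
   unfolding sqsum_def by (rule suminf_split_initial_segment[OF s'])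
  thus ?thesis by (simp add: F_def)
 qed
 have lim: "(\<lambda>k. sqsum (\<lambda>n. F k n - f n)) \<longlonglongrightarrow> 0" unfolding e using suminf_exist_split2[OF s] .
 have l1: "(\<lambda>k. ell2_norm (\<lambda>n. F k n - f n)) \<longlonglongrightarrow> 0"
  unfolding ell2_norm_sqsum using tendsto_real_sqrt[OF lim] by simp
 have l2: "(\<lambda>k. ell2_norm (\<lambda>n. tridiag a b (F k) n - h n)) \<longlonglongrightarrow> 0"
 proof -
  have te: "(\<lambda>n. tridiag a b (F k) n - h n) = tridiag a b (\<lambda>n. F k n - f n)" for k
   using fh by (simp add: tridiag_diff fun_eq_iff)
  have "(\<lambda>k. sqsum (\<lambda>n. tridiag a b (F k) n - h n)) \<longlonglongrightarrow> 0"
  proof (rule tendsto_sandwich[OF always_eventually always_eventually tendsto_const])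
   show "(\<lambda>k. 9 * M^2 * sqsum (\<lambda>n. F k n - f n)) \<longlonglongrightarrow> 0" using tendsto_mult_left[OF lim, of "9 * M^2"] by simp
  qed (use tridiag_bounded[OF M ell2_diff[OF Fe f]] sqsum_nonneg in \<open>auto simp: te\<close>)
  thus ?thesis unfolding ell2_norm_sqsum using tendsto_real_sqrt by fastforce
 qed
 have "h \<in> ell2" using fh tridiag_bounded(1)[OF M f] by simp
 thus "(f, h) \<in> jacobi_matrix a b" unfolding jacobi_matrix_def using f fin l1 l2 by auto
qed

subsection \<open>The essential spectrum of a periodic Jacobi matrix\<close>

lemma periodic_finite_range_bound:
 fixes \<gamma> :: "int \<Rightarrow> real"
 assumes "periodic_seq N \<gamma>" "N \<ge> 1"
 shows "\<exists>M. \<forall>n. \<bar>\<gamma> (int n)\<bar> \<le> M"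
proof -
 define M where "M = (\<Sum>i<N. \<bar>\<gamma> (int i)\<bar>)"
 have "\<bar>\<gamma> (int n)\<bar> \<le> M" for n
 proof -
  have "int n = int (n mod N) + int (n div N) * int N" by (metis add.commute div_mult_mod_eq of_nat_add of_nat_mult)
  hence "\<gamma> (int n) = \<gamma> (int (n mod N))" using periodic_seq_mult[OF assms(1)] by metis
  moreover have "\<bar>\<gamma> (int (n mod N))\<bar> \<le> M" unfolding M_def using assms(2) by (intro member_le_sum) auto
  ultimately show ?thesis by simp
 qed
 thus ?thesis by blast
qed

text \<open>A bound over one full period becomes a geometric bound at every index, with a constant
  that absorbs the values inside the first period.\<close>

lemma floquet_growth:
 fixes u :: "nat \<Rightarrow> 'a::real_normed_vector"
 assumes "\<And>n. norm (u (n + N)) \<le> q ^ N * norm (u n)" "q > 0" "N \<ge> 1"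
 shows "\<exists>C. \<forall>n. norm (u n) \<le> C * q ^ n"
proof -
 define C where "C = (\<Sum>i<N. norm (u i) / q ^ i)"
 have "norm (u n) \<le> C * q ^ n" for n
 proof (induction n rule: less_induct)
  case (less n)
  show ?case
  proof (cases "n < N")
   case True
   have "norm (u n) / q ^ n \<le> C" unfolding C_def using True assms(2) by (intro member_le_sum) auto
   thus ?thesis using assms(2) by (simp add: field_simps)
  next
   case False
   hence "norm (u n) \<le> q ^ N * norm (u (n - N))" using assms(1)[of "n - N"] by simp
   also have "\<dots> \<le> q ^ N * (C * q ^ (n - N))" using less[of "n - N"] False assms by (intro mult_left_mono) auto
   also have "\<dots> = C * q ^ n" using False by (simp add: power_add[symmetric])
   finally show ?thesis .
  qed
 qed
 thus ?thesis by blast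
qed

context periodic_jacobi
begin

abbreviation "Jop \<equiv> jacobi_matrix (\<lambda>n. \<alpha> (int n)) (\<lambda>n. \<beta> (int n))"
abbreviation "tri \<equiv> tridiag (\<lambda>n. \<alpha> (int n)) (\<lambda>n. \<beta> (int n))"

lemma entries_bound: obtains M where "\<And>n. \<bar>\<alpha> (int n)\<bar> \<le> M" "\<And>n. \<bar>\<beta> (int n)\<bar> \<le> M" "M \<ge> 0"
proof -
 obtain A B where AB: "\<And>n. \<bar>\<alpha> (int n)\<bar> \<le> A" "\<And>n. \<bar>\<beta> (int n)\<bar> \<le> B"
  using periodic_finite_range_bound[OF per(1) N] periodic_finite_range_bound[OF per(2) N] by blast
 show thesis
 proof (rule that[of "max A B"])
  show "\<bar>\<alpha> (int n)\<bar> \<le> max A B" "\<bar>\<beta> (int n)\<bar> \<le> max A B" for n using AB[of n] by auto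
  show "0 \<le> max A B" using AB(1)[of 0] by auto
 qed
qed

lemma Jop_iff: "(f, h) \<in> Jop \<longleftrightarrow> f \<in> ell2 \<and> h = tri f"
proof -
 obtain M where M: "\<And>n. \<bar>\<alpha> (int n)\<bar> \<le> M" "\<And>n. \<bar>\<beta> (int n)\<bar> \<le> M" using entries_bound by metis
 show ?thesis by (rule jacobi_matrix_iff[of _ M, OF M])
qed

lemma tri_shift_eq:
 "tri (\<lambda>n. u (Suc n)) n = of_real (\<alpha> (int n - 1)) * u n + of_real (\<beta> (int n)) * u (Suc n)
   + of_real (\<alpha> (int n)) * u (Suc (Suc n)) - (if n = 0 then of_real (\<alpha> (- 1)) * u 0 else 0)"
 by (cases n) (auto simp: tridiag_def)

text \<open>Truncated bounded Floquet solutions form a Weyl sequence.\<close>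

lemma in_spectrum:
 assumes x: "\<bar>Dis x\<bar> \<le> 2"
 shows "complex_of_real x \<in> spectrum Jop"
proof (rule ccontr)
 assume "complex_of_real x \<notin> spectrum Jop"
 then obtain C where C: "\<And>f h. (f, h) \<in> Jop \<Longrightarrow> ell2_norm f \<le> C * ell2_norm (\<lambda>n. h n - of_real x * f n)"
  unfolding spectrum_def resolvent_set_def by fastforce
 define \<Delta> where "\<Delta> = Dis x"
 have \<Delta>2: "\<Delta>^2 \<le> 4" using x abs_le_square_iff[of \<Delta> 2] by (simp add: \<Delta>_def)
 define \<mu> where "\<mu> = Complex (\<Delta> / 2) (sqrt (4 - \<Delta>^2) / 2)"
 have "(cmod \<mu>)^2 = 1" using \<Delta>2 unfolding cmod_power2 by (simp add: \<mu>_def power_divide add_divide_distrib[symmetric])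
 hence \<mu>1: "cmod \<mu> = 1" using power2_eq_1_iff[of "cmod \<mu>"] norm_ge_zero[of \<mu>] by linarith
 have ch: "\<mu>^2 - Dis (of_real x) * \<mu> + 1 = 0"
  using \<Delta>2 unfolding discr_of_real \<Delta>_def[symmetric] by (simp add: complex_eq_iff \<mu>_def power2_eq_square field_simps)
 obtain c d where cd: "c \<noteq> 0 \<or> d \<noteq> 0" "\<And>n. sol 0 (of_real x) c d (n + N) = \<mu> * sol 0 (of_real x) c d n"
  using floquet_solution[OF ch] by blast
 define u where "u = sol 0 (complex_of_real x) c d"
 have uN: "cmod (u (n + N)) = cmod (u n)" for n using cd(2)[of n] \<mu>1 by (simp add: u_def norm_mult)
 have ukN: "cmod (u (n + k * N)) = cmod (u n)" for n k
 proof (induction k)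
  case (Suc k)
  thus ?case using uN[of "n + k * N"] by (simp add: algebra_simps)
 qed simp
 have rec: "of_real (\<alpha> (int n - 1)) * u n + of_real (\<beta> (int n)) * u (Suc n) + of_real (\<alpha> (int n)) * u (Suc (Suc n)) = of_real x * u (Suc n)" for n
  using per_sol_alpha[of n "complex_of_real x" c d] by (simp add: u_def algebra_simps)
 obtain B where B: "\<And>n. cmod (u n) \<le> B"
 proof -
  have "\<exists>C. \<forall>n. cmod (u n) \<le> C * 1 ^ n" by (rule floquet_growth[of _ N]) (use uN N in auto)
  thus ?thesis using that by auto
 qed
 obtain M where M: "\<And>n. \<bar>\<alpha> (int n)\<bar> \<le> M" "\<And>n. \<bar>\<beta> (int n)\<bar> \<le> M" "M \<ge> 0" using entries_bound by metis
 define M' where "M' = max M \<bar>\<alpha> (-1)\<bar>"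
 have B0: "B \<ge> 0" using B[of 0] norm_ge_zero order_trans by blast
 define s where "s = (\<Sum>n<N. (cmod (u (Suc n)))^2)"
 have "s > 0"
 proof (rule ccontr)
  assume "\<not> s > 0"
  hence "s = 0" unfolding s_def by (meson not_less sum_nonneg zero_le_power2 order_antisym)
  hence z: "u (Suc n) = 0" if "n < N" for n using that unfolding s_def by (subst (asm) sum_nonneg_eq_0_iff) auto
  have "d = 0" using z[of 0] N by (simp add: u_def)
  moreover have "cmod (u (0 + N)) = cmod (u 0)" by (rule uN)
  hence "c = 0" using z[of "N - 1"] N by (simp add: u_def)
  ultimately show False using cd(1) by simp
 qed
 \<comment> \<open>Slot \<open>Suc n\<close> of a solution with base 0 belongs to site
   \<open>n\<close>; slot 0 is the site \<open>-1\<close>, which the half-line matrix does not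
   have.\<close>
 define f where "f = (\<lambda>k n. if n < k * N then u (Suc n) else 0)"
 define g where "g = (\<lambda>k n. tri (f k) n - of_real x * f k n)"
 have ffin: "finite {n. f k n \<noteq> 0}" for k by (rule finite_subset[of _ "{..<k * N}"]) (auto simp: f_def split: if_splits)
 have fe: "f k \<in> ell2" for k by (rule ell2_finite_support(1)[OF ffin])
 have sf: "sqsum (f k) = real k * s" for k
 proof -
  have "sqsum (f k) = (\<Sum>n<k * N. (cmod (f k n))^2)"
   unfolding ell2_finite_support(2)[OF ffin] by (rule sum.mono_neutral_left) (auto simp: f_def split: if_splits)
  also have "\<dots> = (\<Sum>n<k * N. (cmod (u (Suc n)))^2)" by (intro sum.cong) (auto simp: f_def)
  also have "\<dots> = real k * s"
  proof (induction k)
   case (Suc k)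
   have "(\<Sum>n<Suc k * N. (cmod (u (Suc n)))^2) = (\<Sum>n<k * N. (cmod (u (Suc n)))^2) + (\<Sum>n\<in>{k*N..<k*N+N}. (cmod (u (Suc n)))^2)"
    by (simp add: add.commute lessThan_atLeast0 sum.atLeastLessThan_concat)
   also have "(\<Sum>n\<in>{k*N..<k*N+N}. (cmod (u (Suc n)))^2) = (\<Sum>n<N. (cmod (u (Suc n + k * N)))^2)"
    by (rule sum.reindex_bij_witness[of _ "\<lambda>n. n + k * N" "\<lambda>n. n - k * N"]) auto
   also have "\<dots> = s" unfolding ukN s_def ..
   finally show ?case using Suc by (simp add: algebra_simps)
  qed simp
  finally show ?thesis .
 qed
 \<comment> \<open>The defect of the truncated solution sits only at the boundary site and at the
   two sites of the cut. Its norm therefore stays bounded in \<open>k\<close>, while the squared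
   norm of \<open>f k\<close> grows linearly.\<close>
 have g0: "g k n = 0" if "n \<noteq> 0" "n \<noteq> k * N - 1" "n \<noteq> k * N" for k n
 proof -
  have "Suc n < k * N \<or> k * N < n" using that by (cases "n < k * N") auto
  then consider "Suc n < k * N" | "k * N < n" by blast
  thus ?thesis
  proof cases
   case 1
   hence "tri (f k) n = tri (\<lambda>n. u (Suc n)) n" using that by (auto simp: tridiag_def f_def)
   thus ?thesis using 1 that rec[of n] by (simp add: g_def f_def tri_shift_eq)
  next
   case 2
   thus ?thesis using that by (auto simp: g_def f_def tridiag_def)
  qed
 qed
 have gb: "cmod (g k n) \<le> (3 * M + \<bar>x\<bar>) * B" for k n
 proof -
  have fb: "cmod (f k n) \<le> B" for n using B B0 by (simp add: f_def)
  have "cmod (g k n) \<le> cmod (if n = 0 then 0 else of_real (\<alpha> (int (n - 1))) * f k (n - 1)) + cmod (of_real (\<beta> (int n)) * f k n)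
    + cmod (of_real (\<alpha> (int n)) * f k (Suc n)) + cmod (of_real x * f k n)" unfolding g_def tridiag_def
   by (rule order_trans[OF norm_triangle_ineq4 add_right_mono[OF order_trans[OF norm_triangle_ineq add_right_mono[OF norm_triangle_ineq]]]])
  also have "\<dots> \<le> M * B + M * B + M * B + \<bar>x\<bar> * B"
  proof (intro add_mono)
   show "cmod (if n = 0 then 0 else of_real (\<alpha> (int (n - 1))) * f k (n - 1)) \<le> M * B"
    using M(1)[of "n - 1"] M(3) fb[of "n - 1"] B0 by (auto simp: norm_mult simp del: of_nat_diff intro!: mult_mono)
  qed (use M fb B0 in \<open>auto simp: norm_mult intro!: mult_mono\<close>)
  finally show ?thesis by (simp add: algebra_simps)
 qed
 define E where "E = (3 * M + \<bar>x\<bar>) * B"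
 have sg: "sqsum (g k) \<le> 3 * E^2" for k
 proof -
  have sub: "{n. g k n \<noteq> 0} \<subseteq> {0, k * N - 1, k * N}" using g0 by auto
  hence fin: "finite {n. g k n \<noteq> 0}" using finite_subset by blast
  have "sqsum (g k) = (\<Sum>n | g k n \<noteq> 0. (cmod (g k n))^2)" by (rule ell2_finite_support(2)[OF fin])
  also have "\<dots> \<le> (\<Sum>n | g k n \<noteq> 0. E^2)" using gb by (intro sum_mono power_mono) (auto simp: E_def)
  also have "\<dots> = real (card {n. g k n \<noteq> 0}) * E^2" by simp
  also have "\<dots> \<le> 3 * E^2"
  proof (intro mult_right_mono)
   have "card {n. g k n \<noteq> 0} \<le> card {0, k * N - 1, k * N}" by (rule card_mono[OF _ sub]) simp
   also have "\<dots> \<le> 3" by (simp add: card_insert_if)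
   finally show "real (card {n. g k n \<noteq> 0}) \<le> 3" by simp
  qed simp
  finally show ?thesis .
 qed
 have "real k * s \<le> C^2 * (3 * E^2)" for k
 proof -
  have "(f k, tri (f k)) \<in> Jop" using fe Jop_iff by simp
  from C[OF this] have le: "sqrt (real k * s) \<le> C * sqrt (sqsum (g k))" by (simp add: ell2_norm_sqsum sf g_def)
  have ge: "g k \<in> ell2" by (rule ell2_finite_support(1), rule finite_subset[of _ "{0, k * N - 1, k * N}"]) (use g0 in auto)
  have "real k * s = (sqrt (real k * s))^2" using \<open>s > 0\<close> by simp
  also have "\<dots> \<le> (C * sqrt (sqsum (g k)))^2" using le \<open>s > 0\<close> by (intro power_mono) auto
  also have "\<dots> = C^2 * sqsum (g k)" using sqsum_nonneg[OF ge] by (simp add: power_mult_distrib)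
  also have "\<dots> \<le> C^2 * (3 * E^2)" by (intro mult_left_mono sg) auto
  finally show ?thesis .
 qed
 moreover obtain k where "real k > C^2 * (3 * E^2) / s" using reals_Archimedean2 by blast
 ultimately show False using \<open>s > 0\<close> by (metis not_less pos_divide_less_eq)
qed

lemma per_sol_cayley_hamilton:
 fixes x :: "'a::real_normed_field"
 shows "sol j x c d (N + N) = Dis x * sol j x c d N - c"
proof -
 define u v where "u = sol j x c d N" and "v = sol j x c d (Suc N)"
 define r s r' s' where "r = R j x N" and "s = S j x N" and "r' = R j x (Suc N)" and "s' = S j x (Suc N)"
 have "sol j x c d (N + N) = u * r + v * s"
  unfolding u_def v_def r_def s_def per_sol_shift[of \<alpha> \<beta> j x c d N N] per_solN by (rule per_sol_linear)
 moreover have u: "u = c * r + d * s" unfolding u_def r_def s_def by (rule per_sol_linear)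
 moreover have "v = c * r' + d * s'" unfolding v_def r'_def s'_def by (rule per_sol_linear)
 moreover have "Dis x = r + s'" using discr_eq[of j x] by (simp add: discr_def r_def s'_def)
 moreover have "r * s' - s * r' = 1" unfolding r_def s_def r'_def s'_def by (rule wronskian)
 ultimately have "sol j x c d (N + N) = (r + s') * u - c * (r * s' - s * r')" by (simp add: algebra_simps)
 thus ?thesis using \<open>Dis x = r + s'\<close> \<open>r * s' - s * r' = 1\<close> by (simp add: u_def)
qed

text \<open>The multipliers are real here, one inside and one outside the unit circle. The Green
  function is built from the solution \<open>\<phi>\<close> vanishing at site \<open>-1\<close> and
  the Floquet solution \<open>\<psi>\<close> that decays; the two convolution estimates bound it on
  square-summable sequences. The hypothesis on \<open>S 0 x N\<close> keeps \<open>\<phi>\<close>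
  and \<open>\<psi>\<close> independent, hence the Wronskian \<open>W\<close> nonzero; where it
  fails, \<open>\<phi>\<close> is itself a Floquet solution and \<open>x\<close> may be an
  eigenvalue.\<close>

lemma resolvent_outside:
 assumes x: "\<bar>Dis x\<bar> > 2" and Sx: "S 0 x N \<noteq> 0"
 shows "complex_of_real x \<in> resolvent_set Jop"
proof -
 define z where "z = complex_of_real x"
 define \<Delta> where "\<Delta> = Dis x"
 have "\<Delta>^2 > 2^2" using x power2_strict_mono[of 2 \<Delta>] by (simp add: \<Delta>_def)
 hence rpos: "\<Delta>^2 - 4 > 0" by simp
 obtain s where s: "s^2 = \<Delta>^2 - 4" "s > 0" using rpos that[of "sqrt (\<Delta>^2 - 4)"] by simp
 define \<nu> where "\<nu> = (if \<Delta> > 0 then (\<Delta> + s) / 2 else (\<Delta> - s) / 2)"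
 have n2: "\<nu>^2 - \<Delta> * \<nu> + 1 = 0"
 proof -
  have "4 * (\<nu>^2 - \<Delta> * \<nu> + 1) = s^2 - \<Delta>^2 + 4" by (simp add: \<nu>_def power2_eq_square field_simps)
  thus ?thesis using s by simp
 qed
 have n1: "\<bar>\<nu>\<bar> > 1"
 proof (cases "\<Delta> > 0")
  case True
  hence "\<Delta> > 2" "\<nu> = (\<Delta> + s) / 2" using x by (auto simp: \<nu>_def \<Delta>_def)
  hence "\<nu> > 1" using s(2) by simp
  thus ?thesis by simp
 next
  case False
  hence "\<Delta> < -2" "\<nu> = (\<Delta> - s) / 2" using x by (auto simp: \<nu>_def \<Delta>_def)
  hence "\<nu> < -1" using s(2) by simp
  thus ?thesis by simp
 qed
 define \<mu> where "\<mu> = 1 / \<nu>"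
 have nz: "\<nu> \<noteq> 0" using n1 by auto
 have m2: "\<mu>^2 - \<Delta> * \<mu> + 1 = 0" using n2 nz by (simp add: \<mu>_def field_simps power2_eq_square)
 have sum: "\<nu> + \<mu> = \<Delta>" and prod: "\<nu> * \<mu> = 1" using n2 nz by (simp_all add: \<mu>_def field_simps power2_eq_square)
 define q where "q = root N \<bar>\<mu>\<bar>"
 have m1: "0 < \<bar>\<mu>\<bar>" "\<bar>\<mu>\<bar> < 1" using n1 nz by (auto simp: \<mu>_def)
 have qN: "q ^ N = \<bar>\<mu>\<bar>" unfolding q_def using N by simp
 have q: "0 < q" "q < 1" using m1 N unfolding q_def by (auto simp: real_root_lt_1_iff)
 have "(complex_of_real \<mu>)^2 - Dis z * of_real \<mu> + 1 = of_real (\<mu>^2 - \<Delta> * \<mu> + 1)"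
  by (simp add: z_def discr_of_real \<Delta>_def)
 hence "(complex_of_real \<mu>)^2 - Dis z * of_real \<mu> + 1 = 0" using m2 by simp
 then obtain c d where cd: "c \<noteq> 0 \<or> d \<noteq> 0" "\<And>n. sol 0 z c d (n + N) = of_real \<mu> * sol 0 z c d n"
  using floquet_solution by blast
 define \<psi> where "\<psi> = sol 0 z c d"
 define \<phi> where "\<phi> = sol 0 z 0 1"
 have SN: "\<phi> N \<noteq> 0" using Sx per_sol_of_real[where 'a = complex, of \<alpha> \<beta> 0 x 0 1 N] by (simp add: \<phi>_def z_def)
 have c0: "c \<noteq> 0"
 proof
  assume c: "c = 0"
  have "\<psi> N = d * \<phi> N" unfolding \<psi>_def \<phi>_def c by (subst per_sol_linear) simp
  moreover have "\<psi> N = 0" using cd(2)[of 0] c by (simp add: \<psi>_def)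
  ultimately show False using SN cd(1) c by simp
 qed
 obtain C1 where C1: "\<And>n. cmod (\<psi> n) \<le> C1 * q ^ n"
  using floquet_growth[of \<psi> N q] cd(2) q N qN by (auto simp: \<psi>_def norm_mult)
 have per2: "\<phi> (n + N + N) = of_real \<Delta> * \<phi> (n + N) - \<phi> n" for n
  using per_sol_cayley_hamilton[of "int n" z "\<phi> n" "\<phi> (Suc n)"] per_sol_shift[of \<alpha> \<beta> 0 z 0 1 "N + N" n]
   per_sol_shift[of \<alpha> \<beta> 0 z 0 1 N n] discr_of_real[of \<alpha> \<beta> N 0 x, where 'a = complex]
  by (simp add: \<phi>_def \<Delta>_def z_def add_ac)
 \<comment> \<open>Subtracting \<open>\<mu>\<close> times \<open>\<phi>\<close> from its translate
   removes the decaying component, so \<open>y\<close> is a Floquet solution with multiplier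
   \<open>\<nu>\<close>. Its growth is explicit, and solving back for \<open>\<phi>\<close> bounds
   \<open>\<phi>\<close>.\<close>
 define y where "y = (\<lambda>n. \<phi> (n + N) - of_real \<mu> * \<phi> n)"
 have yN: "y (n + N) = of_real \<nu> * y n" for n
 proof -
  have "y (n + N) = (of_real \<Delta> - of_real \<mu>) * \<phi> (n + N) - \<phi> n"
   using per2[of n] by (simp add: y_def left_diff_distrib)
  also have "of_real \<Delta> - of_real \<mu> = complex_of_real \<nu>" unfolding sum[symmetric] by simp
  also have "\<phi> n = complex_of_real (\<nu> * \<mu>) * \<phi> n" by (simp add: prod)
  finally show ?thesis by (simp add: y_def algebra_simps)
 qed
 have qi: "(1 / q) ^ N = \<bar>\<nu>\<bar>" using qN by (simp add: power_one_over \<mu>_def power_divide)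
 obtain Cy where Cy: "\<And>n. cmod (y n) \<le> Cy * (1 / q) ^ n" using floquet_growth[of y N "1 / q"] yN q N qi by (auto simp: norm_mult)
 have Cy0: "Cy \<ge> 0" using order_trans[OF norm_ge_zero[of "y 0"] Cy[of 0]] by simp
 obtain C2 where C2: "\<And>n. cmod (\<phi> n) \<le> C2 * (1 / q) ^ n"
 proof -
  \<comment> \<open>The second summand makes \<open>Cy + \<bar>\<mu>\<bar> * C \<le> C\<close>,
    which closes the induction from \<open>n - N\<close> to \<open>n\<close>; the first covers the
    initial period.\<close>
  define C where "C = (\<Sum>i<N. cmod (\<phi> i) / (1 / q) ^ i) + Cy / (1 - \<bar>\<mu>\<bar>)"
  have Cge: "C \<ge> Cy / (1 - \<bar>\<mu>\<bar>)" unfolding C_def using q by (auto intro!: sum_nonneg)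
  have C0: "C \<ge> 0" using Cge Cy0 m1 by (meson divide_nonneg_pos diff_gt_0_iff_gt order_trans)
  have "cmod (\<phi> n) \<le> C * (1 / q) ^ n" for n
  proof (induction n rule: less_induct)
   case (less n)
   show ?case
   proof (cases "n < N")
    case True
    have "cmod (\<phi> n) / (1 / q) ^ n \<le> (\<Sum>i<N. cmod (\<phi> i) / (1 / q) ^ i)" using True q by (intro member_le_sum) auto
    also have "\<dots> \<le> C" unfolding C_def using Cy0 m1 by simp
    finally show ?thesis using q by (simp add: field_simps)
   next
    case False
    define m where "m = n - N"
    have nm: "n = m + N" using False by (simp add: m_def)
    have "\<phi> n = y m + of_real \<mu> * \<phi> m" by (simp add: nm y_def)
    hence "cmod (\<phi> n) \<le> cmod (y m) + \<bar>\<mu>\<bar> * cmod (\<phi> m)" by (metis norm_mult norm_of_real norm_triangle_ineq)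
    also have "\<dots> \<le> Cy * (1 / q) ^ m + \<bar>\<mu>\<bar> * (C * (1 / q) ^ m)"
     using Cy[of m] less[of m] N by (intro add_mono mult_left_mono) (auto simp: nm)
    also have "\<dots> = (Cy + \<bar>\<mu>\<bar> * C) * (1 / q) ^ m" by (simp add: algebra_simps)
    also have "\<dots> \<le> C * (1 / q) ^ m" using Cge m1 q by (intro mult_right_mono) (auto simp: field_simps)
    also have "\<dots> \<le> C * (1 / q) ^ n" using q C0 by (intro mult_left_mono power_increasing) (auto simp: nm)
    finally show ?thesis .
   qed
  qed
  thus ?thesis using that by blast
 qed
 have C10: "C1 \<ge> 0" "C2 \<ge> 0" using order_trans[OF norm_ge_zero[of "\<psi> 0"] C1[of 0]] order_trans[OF norm_ge_zero[of "\<phi> 0"] C2[of 0]] by auto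
 have rec: "of_real (\<alpha> (int n)) * v (Suc (Suc n)) = (z - of_real (\<beta> (int n))) * v (Suc n) - of_real (\<alpha> (int n - 1)) * v n"
  if "v = \<psi> \<or> v = \<phi>" for v n using that per_sol_alpha[of n z] by (auto simp: \<psi>_def \<phi>_def)
 define W where "W = of_real (\<alpha> (-1)) * c"
 have W0: "W \<noteq> 0" using c0 pos[of "-1"] by (simp add: W_def)
 have wr: "of_real (\<alpha> (int n - 1)) * (\<phi> (Suc n) * \<psi> n - \<phi> n * \<psi> (Suc n)) = W" for n
 proof (induction n)
  case 0
  show ?case by (simp add: W_def \<phi>_def \<psi>_def)
 next
  case (Suc n)
  have "of_real (\<alpha> (int n)) * (\<phi> (Suc (Suc n)) * \<psi> (Suc n) - \<phi> (Suc n) * \<psi> (Suc (Suc n)))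
    = (of_real (\<alpha> (int n)) * \<phi> (Suc (Suc n))) * \<psi> (Suc n) - \<phi> (Suc n) * (of_real (\<alpha> (int n)) * \<psi> (Suc (Suc n)))"
   by (simp add: algebra_simps)
  also have "\<dots> = of_real (\<alpha> (int n - 1)) * (\<phi> (Suc n) * \<psi> n - \<phi> n * \<psi> (Suc n))"
   unfolding rec[of \<phi>, simplified] rec[of \<psi>, simplified] by (simp add: algebra_simps)
  finally show ?case using Suc by simp
 qed
 obtain M where M: "\<And>n. \<bar>\<alpha> (int n)\<bar> \<le> M" "\<And>n. \<bar>\<beta> (int n)\<bar> \<le> M" "M \<ge> 0" using entries_bound by metis
 \<comment> \<open>A square-summable solution is a multiple of \<open>\<phi>\<close>. If it were
   nonzero, both \<open>\<phi>\<close> and \<open>\<psi>\<close> would tend to zero, contradicting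
   the constant nonzero Wronskian.\<close>
 have uniq: "h = (\<lambda>n. 0)" if h: "h \<in> ell2" "\<And>n. tri h n = z * h n" for h
 proof -
  have hphi: "h n = h 0 * \<phi> (Suc n)" for n
  proof (induction n rule: induct_nat_012)
   case 1
   have "of_real (\<alpha> 0) * h 1 = (z - of_real (\<beta> 0)) * h 0" using h(2)[of 0] by (simp add: tridiag_def algebra_simps)
   also have "z - of_real (\<beta> 0) = of_real (\<alpha> 0) * \<phi> (Suc (Suc 0))" using rec[of \<phi> 0] by (simp add: \<phi>_def)
   also have "of_real (\<alpha> 0) * \<phi> (Suc (Suc 0)) * h 0 = of_real (\<alpha> 0) * (h 0 * \<phi> (Suc (Suc 0)))" by (simp only: mult_ac)
   finally show ?case using nz pos[of 0] by (simp add: order_less_irrefl)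
  next
   case (ge2 n)
   have "of_real (\<alpha> (int (Suc n))) * h (Suc (Suc n)) = (z - of_real (\<beta> (int (Suc n)))) * h (Suc n) - of_real (\<alpha> (int n)) * h n"
    using h(2)[of "Suc n"] by (simp add: tridiag_def algebra_simps)
   also have "\<dots> = h 0 * ((z - of_real (\<beta> (int (Suc n)))) * \<phi> (Suc (Suc n)) - of_real (\<alpha> (int n)) * \<phi> (Suc n))"
    unfolding ge2 by (simp add: algebra_simps)
   also have "(z - of_real (\<beta> (int (Suc n)))) * \<phi> (Suc (Suc n)) - of_real (\<alpha> (int n)) * \<phi> (Suc n)
     = of_real (\<alpha> (int (Suc n))) * \<phi> (Suc (Suc (Suc n)))" using rec[of \<phi> "Suc n"] by simp
   also have "h 0 * (of_real (\<alpha> (int (Suc n))) * \<phi> (Suc (Suc (Suc n)))) = of_real (\<alpha> (int (Suc n))) * (h 0 * \<phi> (Suc (Suc (Suc n))))"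
    by (rule mult.left_commute)
   finally show ?case using pos[of "int (Suc n)"] by (simp add: order_less_irrefl)
  qed (simp add: \<phi>_def)
  have h0: "h 0 = 0"
  proof (rule ccontr)
   assume h0: "h 0 \<noteq> 0"
   have "(\<lambda>n. h n / h 0) \<longlonglongrightarrow> 0 / h 0" by (intro tendsto_divide ell2_LIMSEQ_0 h tendsto_const h0)
   moreover have "(\<lambda>n. h n / h 0) = (\<lambda>n. \<phi> (Suc n))" proof
    fix n
    show "h n / h 0 = \<phi> (Suc n)" unfolding hphi[of n] using h0 by simp
   qed
   ultimately have p1: "(\<lambda>n. \<phi> (Suc n)) \<longlonglongrightarrow> 0" by simp
   have qlim: "(\<lambda>n. C1 * q ^ n) \<longlonglongrightarrow> 0" using tendsto_mult_right_zero[OF LIMSEQ_power_zero[of q]] q by (simp add: tendsto_mult_right_zero LIMSEQ_power_zero)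
   have s1: "\<psi> \<longlonglongrightarrow> 0" by (rule Lim_null_comparison[OF always_eventually qlim]) (use C1 in auto)
   have prod0: "(\<lambda>n. \<phi> (Suc (Suc n)) * \<psi> (Suc n) - \<phi> (Suc n) * \<psi> (Suc (Suc n))) \<longlonglongrightarrow> 0 * 0 - 0 * 0"
    by (intro tendsto_diff tendsto_mult LIMSEQ_Suc[OF p1] p1 LIMSEQ_Suc[OF s1] LIMSEQ_Suc[OF LIMSEQ_Suc[OF s1]])
   have "(\<lambda>n. of_real (\<alpha> (int n)) * (\<phi> (Suc (Suc n)) * \<psi> (Suc n) - \<phi> (Suc n) * \<psi> (Suc (Suc n)))) \<longlonglongrightarrow> 0"
   proof (rule Lim_null_comparison[OF always_eventually])
    show "(\<lambda>n. M * cmod (\<phi> (Suc (Suc n)) * \<psi> (Suc n) - \<phi> (Suc n) * \<psi> (Suc (Suc n)))) \<longlonglongrightarrow> 0"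
     using tendsto_mult_right_zero[OF tendsto_norm_zero[of _ sequentially]] prod0 by (simp add: tendsto_mult_right_zero tendsto_norm_zero)
    show "\<forall>n. cmod (of_real (\<alpha> (int n)) * (\<phi> (Suc (Suc n)) * \<psi> (Suc n) - \<phi> (Suc n) * \<psi> (Suc (Suc n)))) \<le> M * cmod (\<phi> (Suc (Suc n)) * \<psi> (Suc n) - \<phi> (Suc n) * \<psi> (Suc (Suc n)))"
     unfolding norm_mult norm_of_real using M by (intro allI mult_right_mono) auto
   qed
   moreover have "of_real (\<alpha> (int n)) * (\<phi> (Suc (Suc n)) * \<psi> (Suc n) - \<phi> (Suc n) * \<psi> (Suc (Suc n))) = W" for n
    using wr[of "Suc n"] by simp
   ultimately have "(\<lambda>n::nat. W) \<longlonglongrightarrow> 0" by simp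
   thus False using W0 LIMSEQ_unique tendsto_const by blast
  qed
  show ?thesis using hphi h0 by (simp add: fun_eq_iff)
 qed
 define K where "K = (C1 * C2 / cmod W * (1 / q + 1 / q))^2 * (4 * (1 / (1 - q))^2)"
 have solve: "\<exists>f. f \<in> ell2 \<and> (\<forall>n. tri f n = g n + z * f n) \<and> sqsum f \<le> K * sqsum g" if g: "g \<in> ell2" for g
 proof -
  define ga where "ga = (\<lambda>n. cmod (g n))"
  have sg: "summable (\<lambda>n. (ga n)^2)" using g by (simp add: ga_def ell2_def)
  have q': "0 \<le> q" "q < 1" using q by auto
  have ga0: "\<And>n. ga n \<ge> 0" by (simp add: ga_def)
  note fut = convolution_future[OF q' sg ga0]
  note past = convolution_past[OF q' sg]
  have st: "summable (\<lambda>i. \<psi> (Suc (n + i)) * g (n + i))" for n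
  proof (rule summable_comparison_test'[of "\<lambda>i. C1 * q ^ Suc n * (q ^ i * ga (n + i))" 0])
   show "summable (\<lambda>i. C1 * q ^ Suc n * (q ^ i * ga (n + i)))" by (intro summable_mult fut(1))
   fix i
   have "cmod (\<psi> (Suc (n + i))) * cmod (g (n + i)) \<le> (C1 * q ^ Suc (n + i)) * ga (n + i)"
    unfolding ga_def by (intro mult_right_mono C1) auto
   thus "cmod (\<psi> (Suc (n + i)) * g (n + i)) \<le> C1 * q ^ Suc n * (q ^ i * ga (n + i))" by (simp add: norm_mult power_add mult_ac)
  qed
  define t where "t = (\<lambda>n. \<Sum>i. \<psi> (Suc (n + i)) * g (n + i))"
  define s where "s = (\<lambda>n. \<Sum>m<n. \<phi> (Suc m) * g m)"
  have tS: "t n = \<psi> (Suc n) * g n + t (Suc n)" for n using suminf_split_head[OF st[of n]] by (simp add: t_def)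
  have sS: "s (Suc n) = s n + \<phi> (Suc n) * g n" for n by (simp add: s_def)
  \<comment> \<open>This applies the Green kernel, which is \<open>- \<psi> * \<phi> / W\<close>
    with \<open>\<phi>\<close> at the smaller and \<open>\<psi>\<close> at the larger site;
    \<open>s\<close> collects the sites before \<open>n\<close> and \<open>t\<close> those from
    \<open>n\<close> on.\<close>
  define f where "f = (\<lambda>n. - (\<psi> (Suc n) * s n + \<phi> (Suc n) * t n) / W)"
  have eq: "tri f n = g n + z * f n" for n
  proof -
   have fW: "W * f n = - (\<psi> (Suc n) * s n + \<phi> (Suc n) * t n)" for n using W0 by (simp add: f_def)
   have f1: "W * f (Suc n) = - (\<psi> (Suc (Suc n)) * s n + \<phi> (Suc (Suc n)) * t n)
     + (\<phi> (Suc (Suc n)) * \<psi> (Suc n) - \<phi> (Suc n) * \<psi> (Suc (Suc n))) * g n" for n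
    unfolding fW sS using tS[of n] by (simp add: algebra_simps)
   define fm where "fm = (if n = 0 then 0 else W * f (n - 1))"
   have fm: "of_real (\<alpha> (int n - 1)) * fm = - of_real (\<alpha> (int n - 1)) * (\<psi> n * s n + \<phi> n * t n)"
   proof (cases n)
    case 0
    thus ?thesis by (simp add: fm_def s_def \<phi>_def)
   next
    case (Suc k)
    hence "fm = - (\<psi> (Suc k) * s k + \<phi> (Suc k) * t k)" by (simp add: fm_def fW)
    also have "\<dots> = - (\<psi> n * s n + \<phi> n * t n)" using tS[of k] unfolding Suc sS by (simp add: algebra_simps)
    finally have e: "fm = - (\<psi> n * s n + \<phi> n * t n)" .
    show ?thesis unfolding e by (simp only: mult_minus_left mult_minus_right)
   qed
   have gen: "- A * (p0 * u + q0 * v) + B * (- (p1 * u + q1 * v)) + C * (- (p2 * u + q2 * v) + (q2 * p1 - q1 * p2) * w)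
     = - u * (A * p0 + B * p1 + C * p2) - v * (A * q0 + B * q1 + C * q2) + C * (q2 * p1 - q1 * p2) * w"
    for A B C p0 p1 p2 q0 q1 q2 u v w :: complex by (simp add: algebra_simps)
   have "W * tri f n = of_real (\<alpha> (int n - 1)) * fm + of_real (\<beta> (int n)) * (W * f n) + of_real (\<alpha> (int n)) * (W * f (Suc n))"
    by (cases n) (auto simp: tridiag_def fm_def algebra_simps)
   also have "\<dots> = - s n * (of_real (\<alpha> (int n - 1)) * \<psi> n + of_real (\<beta> (int n)) * \<psi> (Suc n) + of_real (\<alpha> (int n)) * \<psi> (Suc (Suc n)))
     - t n * (of_real (\<alpha> (int n - 1)) * \<phi> n + of_real (\<beta> (int n)) * \<phi> (Suc n) + of_real (\<alpha> (int n)) * \<phi> (Suc (Suc n)))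
     + of_real (\<alpha> (int n)) * (\<phi> (Suc (Suc n)) * \<psi> (Suc n) - \<phi> (Suc n) * \<psi> (Suc (Suc n))) * g n"
    unfolding fm f1[of n] fW[of n] by (rule gen)
   also have "of_real (\<alpha> (int n - 1)) * \<psi> n + of_real (\<beta> (int n)) * \<psi> (Suc n) + of_real (\<alpha> (int n)) * \<psi> (Suc (Suc n)) = z * \<psi> (Suc n)"
    unfolding rec[of \<psi>, simplified] by (simp add: algebra_simps)
   also have "of_real (\<alpha> (int n - 1)) * \<phi> n + of_real (\<beta> (int n)) * \<phi> (Suc n) + of_real (\<alpha> (int n)) * \<phi> (Suc (Suc n)) = z * \<phi> (Suc n)"
    unfolding rec[of \<phi>, simplified] by (simp add: algebra_simps)
   also have "of_real (\<alpha> (int n)) * (\<phi> (Suc (Suc n)) * \<psi> (Suc n) - \<phi> (Suc n) * \<psi> (Suc (Suc n))) = W"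
    using wr[of "Suc n"] by simp
   also have "- s n * (z * \<psi> (Suc n)) - t n * (z * \<phi> (Suc n)) + W * g n = W * (g n + z * f n)"
    proof -
    have "- u * (z * p) - v * (z * q) + W * c = W * c + z * (- (p * u + q * v))" for u v p q c :: complex by (simp add: algebra_simps)
    thus ?thesis unfolding distrib_left mult.left_commute[of W z] fW .
   qed
   finally show ?thesis using W0 by simp
  qed
  define P where "P = (\<lambda>n. \<Sum>m\<le>n. q ^ (n - m) * ga m)"
  define Q where "Q = (\<lambda>n. \<Sum>i. q ^ i * ga (n + i))"
  define E where "E = C1 * C2 / cmod W"
  have fle: "cmod (f n) \<le> E * (P n + Q n)" for n
  proof -
   have e1: "cmod (\<psi> (Suc n) * s n) \<le> C1 * C2 * P n"
   proof -
    have "cmod (s n) \<le> (\<Sum>m<n. cmod (\<phi> (Suc m) * g m))" unfolding s_def by (rule norm_sum)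
    also have "\<dots> \<le> (\<Sum>m<n. C2 * (1 / q) ^ Suc m * ga m)"
     unfolding norm_mult ga_def by (intro sum_mono mult_right_mono C2) auto
    finally have "cmod (\<psi> (Suc n) * s n) \<le> (C1 * q ^ Suc n) * (\<Sum>m<n. C2 * (1 / q) ^ Suc m * ga m)"
     unfolding norm_mult using C1[of "Suc n"] C10 q by (intro mult_mono) auto
    also have "\<dots> = (\<Sum>m<n. C1 * C2 * (q ^ (n - m) * ga m))" unfolding sum_distrib_left
    proof (rule sum.cong)
     fix m assume "m \<in> {..<n}"
     then obtain k where k: "n = m + k" using less_imp_add_positive by auto
     have "q ^ Suc n * (1 / q) ^ Suc m = q ^ (n - m)" using q by (simp add: k power_add power_one_over)
     moreover have "a * b * (c * d * e) = a * c * ((b * d) * e)" for a b c d e :: real by simp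
     ultimately show "C1 * q ^ Suc n * (C2 * (1 / q) ^ Suc m * ga m) = C1 * C2 * (q ^ (n - m) * ga m)" by metis
    qed simp
    also have "\<dots> = C1 * C2 * (\<Sum>m<n. q ^ (n - m) * ga m)" by (simp add: sum_distrib_left)
    also have "\<dots> \<le> C1 * C2 * P n" unfolding P_def using C10 q by (intro mult_left_mono sum_mono2) (auto simp: ga_def)
    finally show ?thesis .
   qed
   have e2: "cmod (\<phi> (Suc n) * t n) \<le> C1 * C2 * Q n"
   proof -
    have sn: "summable (\<lambda>i. C1 * q ^ Suc n * (q ^ i * ga (n + i)))" by (intro summable_mult fut(1))
    have le: "cmod (\<psi> (Suc (n + i)) * g (n + i)) \<le> C1 * q ^ Suc n * (q ^ i * ga (n + i))" for i
    proof -
     have "cmod (\<psi> (Suc (n + i))) * cmod (g (n + i)) \<le> (C1 * q ^ Suc (n + i)) * ga (n + i)"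
      unfolding ga_def by (intro mult_right_mono C1) auto
     thus ?thesis by (simp add: norm_mult power_add mult_ac)
    qed
    have sn2: "summable (\<lambda>i. cmod (\<psi> (Suc (n + i)) * g (n + i)))"
     by (rule summable_comparison_test'[OF sn, of 0]) (use le in auto)
    have "cmod (t n) \<le> (\<Sum>i. cmod (\<psi> (Suc (n + i)) * g (n + i)))" unfolding t_def by (rule summable_norm[OF sn2])
    also have "\<dots> \<le> (\<Sum>i. C1 * q ^ Suc n * (q ^ i * ga (n + i)))" by (rule suminf_le[OF le sn2 sn])
    also have "\<dots> = C1 * q ^ Suc n * Q n" unfolding Q_def by (rule suminf_mult[OF fut(1)])
    finally have "cmod (\<phi> (Suc n) * t n) \<le> (C2 * (1 / q) ^ Suc n) * (C1 * q ^ Suc n * Q n)"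
     unfolding norm_mult using C2[of "Suc n"] C10 q by (intro mult_mono) auto
    also have "\<dots> = C1 * C2 * Q n * ((1 / q) ^ Suc n * q ^ Suc n)" by (simp only: mult_ac)
    also have "(1 / q) ^ Suc n * q ^ Suc n = 1" using q by (simp add: power_mult_distrib[symmetric] del: power_Suc)
    finally show ?thesis by simp
   qed
   have "cmod (f n) = cmod (\<psi> (Suc n) * s n + \<phi> (Suc n) * t n) / cmod W" unfolding f_def norm_divide norm_minus_cancel ..
   also have "\<dots> \<le> (C1 * C2 * P n + C1 * C2 * Q n) / cmod W" using e1 e2 by (intro divide_right_mono norm_triangle_mono) auto
   also have "\<dots> = E * (P n + Q n)" by (simp add: E_def algebra_simps add_divide_distrib)
   finally show ?thesis .
  qed
  have sP: "summable (\<lambda>n. (P n)^2)" unfolding P_def by (rule past(1))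
  have sQ: "summable (\<lambda>n. (Q n)^2)" unfolding Q_def by (rule fut(2))
  have lP: "(\<Sum>n. (P n)^2) \<le> (1 / (1 - q))^2 * (\<Sum>n. (ga n)^2)" unfolding P_def by (rule past(2))
  have lQ: "(\<Sum>n. (Q n)^2) \<le> (1 / (1 - q))^2 * (\<Sum>n. (ga n)^2)" unfolding Q_def by (rule fut(3))
  have sPQ: "summable (\<lambda>n. E^2 * (2 * (P n)^2 + 2 * (Q n)^2))" by (intro summable_mult summable_add sP sQ)
  have le: "(cmod (f n))^2 \<le> E^2 * (2 * (P n)^2 + 2 * (Q n)^2)" for n
  proof -
   have "(cmod (f n))^2 \<le> (E * (P n + Q n))^2" using fle by (intro power_mono) auto
   also have "\<dots> = E^2 * (P n + Q n)^2" by (simp add: power_mult_distrib)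
   also have "\<dots> \<le> E^2 * (2 * (P n)^2 + 2 * (Q n)^2)"
    using zero_le_power2[of "P n - Q n"] by (intro mult_left_mono) (auto simp: power2_eq_square algebra_simps)
   finally show ?thesis .
  qed
  have fe: "f \<in> ell2" by (rule ell2_comparison(1)[OF sPQ le])
  have "sqsum f \<le> (\<Sum>n. E^2 * (2 * (P n)^2 + 2 * (Q n)^2))" by (rule ell2_comparison(2)[OF sPQ le])
  also have "\<dots> = E^2 * (2 * (\<Sum>n. (P n)^2) + 2 * (\<Sum>n. (Q n)^2))"
   using sP sQ by (simp add: suminf_mult suminf_add[symmetric] summable_mult summable_add)
  also have "\<dots> \<le> E^2 * (2 * ((1 / (1 - q))^2 * sqsum g) + 2 * ((1 / (1 - q))^2 * sqsum g))"
   using lP lQ by (intro mult_left_mono add_mono) (auto simp: sqsum_def ga_def)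
  also have "\<dots> = E^2 * (4 * (1 / (1 - q))^2) * sqsum g" by simp
  also have "\<dots> \<le> K * sqsum g"
  proof (intro mult_right_mono sqsum_nonneg g)
   have "1 \<le> 1 / q" using q by simp
   hence "1 \<le> \<bar>1 / q + 1 / q\<bar>" by linarith
   hence "\<bar>E\<bar> * 1 \<le> \<bar>E\<bar> * \<bar>1 / q + 1 / q\<bar>" by (intro mult_left_mono) auto
   hence "E^2 \<le> (E * (1 / q + 1 / q))^2" by (simp add: abs_le_square_iff[symmetric] abs_mult)
   thus "E^2 * (4 * (1 / (1 - q))^2) \<le> K" unfolding K_def E_def by (intro mult_right_mono) auto
  qed
  finally show ?thesis using fe eq by blast
 qed
 have tri_uniq: "f1 = f2" if "f1 \<in> ell2" "f2 \<in> ell2" "\<And>n. tri f1 n = g n + z * f1 n" "\<And>n. tri f2 n = g n + z * f2 n" for f1 f2 g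
 proof -
  have "(\<lambda>n. f1 n - f2 n) = (\<lambda>n. 0)"
   by (rule uniq[OF ell2_diff[OF that(1,2)]]) (simp add: tridiag_diff that(3,4) algebra_simps)
  thus ?thesis by (simp add: fun_eq_iff)
 qed
 have 1: "\<exists>!f. (f, \<lambda>n. g n + z * f n) \<in> Jop" if g: "g \<in> ell2" for g
 proof -
  obtain f where f: "f \<in> ell2" "\<And>n. tri f n = g n + z * f n" using solve[OF g] by blast
  show ?thesis
  proof (rule ex1I[of _ f])
   show "(f, \<lambda>n. g n + z * f n) \<in> Jop" using f by (simp add: Jop_iff fun_eq_iff)
   fix f' assume "(f', \<lambda>n. g n + z * f' n) \<in> Jop"
   hence f': "f' \<in> ell2" "\<And>n. tri f' n = g n + z * f' n" unfolding Jop_iff by (auto simp: fun_eq_iff)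
   show "f' = f" by (rule tri_uniq[OF f'(1) f(1) f'(2) f(2)])
  qed
 qed
 have 2: "ell2_norm f \<le> sqrt K * ell2_norm (\<lambda>n. h n - z * f n)" if "(f, h) \<in> Jop" for f h
 proof -
  have f: "f \<in> ell2" "h = tri f" using that Jop_iff by auto
  define g where "g = (\<lambda>n. h n - z * f n)"
  have g: "g \<in> ell2" unfolding g_def f(2) using tridiag_bounded(1)[of "\<lambda>n. \<alpha> (int n)" M "\<lambda>n. \<beta> (int n)", OF M(1,2) f(1)]
   by (intro ell2_diff ell2_scale f(1))
  obtain f' where f': "f' \<in> ell2" "\<And>n. tri f' n = g n + z * f' n" "sqsum f' \<le> K * sqsum g" using solve[OF g] by blast
  have "f = f'" by (rule tri_uniq[OF f(1) f'(1) _ f'(2)]) (simp add: g_def f(2))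
  hence "sqrt (sqsum f) \<le> sqrt (K * sqsum g)" using f'(3) by simp
  thus ?thesis by (simp add: ell2_norm_sqsum g_def real_sqrt_mult)
 qed
 show ?thesis unfolding resolvent_set_def z_def[symmetric] using 1 2 by blast
qed

text \<open>Points in the closure of the open set \<open>\<bar>Dis x\<bar> < 2\<close> lie in the
  spectrum and are accumulated by it, so they are not isolated. Outside
  \<open>\<bar>Dis x\<bar> \<le> 2\<close> only zeros of the nonzero polynomial
  \<open>S 0 x N\<close> can remain. Such a finite discrepancy is harmless for an equilibrium
  measure, so the eigenvalues need not be located.\<close>

lemma essential_spectrum_bounds:
 obtains V where "finite V" "closure {x. \<bar>Dis x\<bar> < 2} \<subseteq> essential_spectrum Jop"
  "essential_spectrum Jop \<subseteq> {x. \<bar>Dis x\<bar> \<le> 2} \<union> V"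
proof -
 define Lm where "Lm = {x. \<bar>Dis (x::real)\<bar> < 2}"
 define V where "V = {x. S 0 (x::real) N = 0}"
 have cont: "continuous_on UNIV (\<lambda>x::real. \<bar>Dis x\<bar>)" using continuous_discr by (intro continuous_intros)
 have op: "open Lm" unfolding Lm_def by (rule open_Collect_less[OF cont continuous_on_const])
 have cl: "closure Lm \<subseteq> {x. \<bar>Dis x\<bar> \<le> 2}"
  by (rule closure_minimal) (auto simp: Lm_def intro!: closed_Collect_le[OF cont continuous_on_const])
 have "sol_poly \<alpha> \<beta> 0 0 (1::real) N \<noteq> 0"
 proof -
  have "coeff (sol_poly \<alpha> \<beta> 0 0 (1::real) (Suc (N - 1))) (N - 1) \<noteq> 0"
   using degree_sol_poly_S[of 0 "N - 1", where 'a = real] by (simp add: nz)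
  thus ?thesis using N by auto
 qed
 hence fin: "finite V" unfolding V_def using poly_roots_finite[of "sol_poly \<alpha> \<beta> 0 0 (1::real) N"] by (simp add: poly_sol_poly)
 have "closure Lm \<subseteq> essential_spectrum Jop"
 proof
  fix x assume x: "x \<in> closure Lm"
  have sp: "complex_of_real x \<in> spectrum Jop" using x cl by (intro in_spectrum) auto
  have "\<not> complex_of_real x isolated_in spectrum Jop"
  proof
   assume "complex_of_real x isolated_in spectrum Jop"
   then obtain T where T: "open T" "T \<inter> spectrum Jop = {complex_of_real x}" by (auto simp: isolated_in_def)
   have "open (complex_of_real -` T)" by (rule continuous_open_vimage[OF T(1)]) (intro continuous_intros)
   moreover have "x \<in> complex_of_real -` T" using T by auto
   ultimately have "Lm \<inter> complex_of_real -` T \<noteq> {}" using x by (meson closure_iff_nhds_not_empty order_refl)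
   moreover have opT: "open (Lm \<inter> complex_of_real -` T)" using op \<open>open (complex_of_real -` T)\<close> by (rule open_Int)
   moreover have "Lm \<inter> complex_of_real -` T \<subseteq> {x}"
   proof
    fix y assume y: "y \<in> Lm \<inter> complex_of_real -` T"
    hence "complex_of_real y \<in> spectrum Jop" by (intro in_spectrum) (auto simp: Lm_def)
    hence "complex_of_real y \<in> T \<inter> spectrum Jop" using y by auto
    thus "y \<in> {x}" using T(2) by simp
   qed
   ultimately have "Lm \<inter> complex_of_real -` T = {x}" by blast
   thus False using opT not_open_singleton[of x] by simp
  qed
  thus "x \<in> essential_spectrum Jop" using sp by (simp add: essential_spectrum_def discrete_spectrum_def)
 qed
 moreover have "essential_spectrum Jop \<subseteq> {x. \<bar>Dis x\<bar> \<le> 2} \<union> V"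
 proof
  fix x assume "x \<in> essential_spectrum Jop"
  hence "complex_of_real x \<notin> resolvent_set Jop" by (simp add: essential_spectrum_def spectrum_def)
  thus "x \<in> {x. \<bar>Dis x\<bar> \<le> 2} \<union> V" using resolvent_outside[of x]
   by (cases "\<bar>Dis x\<bar> \<le> 2") (auto simp: V_def not_le)
 qed
 ultimately show thesis using that[OF fin] by (simp add: Lm_def)
qed

end

subsection \<open>Band structure of a discriminant polynomial\<close>

lemma first_crossing:
 fixes f :: "real \<Rightarrow> real"
 assumes cont: "continuous_on UNIV f" and r: "f r < c" and R: "r < R" "f R \<ge> c"
 obtains u where "r < u" "u \<le> R" "f u = c" "\<And>x. r \<le> x \<Longrightarrow> x < u \<Longrightarrow> f x < c"
proof -
 define T where "T = {x \<in> {r..R}. f x = c}"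
 have cr: "continuous_on A f" for A using cont continuous_on_subset by blast
 have ex: "\<exists>x\<in>{r..y}. f x = c" if "y \<le> R" "f y \<ge> c" "r \<le> y" for y
 proof -
  have "f r \<le> c" using r by simp
  from IVT'[OF this that(2,3) cr] show ?thesis using that(1) by auto
 qed
 have "compact T"
 proof -
  have "closed {x. f x = c}" by (rule closed_Collect_eq[OF cont continuous_on_const])
  moreover have "T = {r..R} \<inter> {x. f x = c}" by (auto simp: T_def)
  ultimately show ?thesis by (simp add: compact_Int_closed)
 qed
 moreover have "T \<noteq> {}" using ex[of R] R by (auto simp: T_def)
 ultimately obtain u where u: "u \<in> T" "\<And>x. x \<in> T \<Longrightarrow> u \<le> x"
  using continuous_attains_inf[of T "\<lambda>x. x"] by auto
 show thesis
 proof (rule that[of u])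
  show "r < u" using u(1) r by (auto simp: T_def order_less_le)
  show "u \<le> R" "f u = c" using u(1) by (auto simp: T_def)
  fix x assume x: "r \<le> x" "x < u"
  show "f x < c"
  proof (rule ccontr)
   assume "\<not> f x < c"
   then obtain y where "y \<in> {r..x}" "f y = c" using ex[of x] x u(1) by (auto simp: T_def)
   hence "y \<in> T" using x u(1) by (auto simp: T_def)
   from u(2)[OF this] show False using \<open>y \<in> {r..x}\<close> x by simp
  qed
 qed
qed

text \<open>The properties of a discriminant from which the band structure and the potential theory
  follow: \<open>N\<close> distinct real zeros, and no critical point where the modulus is below
  2.\<close>

locale discriminant_poly =
 fixes D :: "real poly" and N :: nat and L :: real
 assumes N: "N \<ge> 1" and deg: "degree D = N" and lead: "coeff D N = L" and L: "L > 0"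
  and card_zeros: "card {x. poly D x = 0} = N"
  and deriv_nonzero: "\<And>x. \<bar>poly D x\<bar> < 2 \<Longrightarrow> poly (pderiv D) x \<noteq> 0"
begin

definition Z :: "real set" where "Z = {x. poly D x = 0}"

definition is_band :: "real \<Rightarrow> real \<Rightarrow> real \<Rightarrow> bool" where
 "is_band r l u \<longleftrightarrow> l < r \<and> r < u \<and> \<bar>poly D l\<bar> = 2 \<and> \<bar>poly D u\<bar> = 2 \<and> (\<forall>x. l < x \<longrightarrow> x < u \<longrightarrow> \<bar>poly D x\<bar> < 2)"

text \<open>Bands are labelled by the zero of \<open>D\<close> they contain. Both end points are
  components of one chosen pair, so that they belong together.\<close>

definition lo :: "real \<Rightarrow> real" where "lo r = fst (SOME p. is_band r (fst p) (snd p))"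
definition hi :: "real \<Rightarrow> real" where "hi r = snd (SOME p. is_band r (fst p) (snd p))"
definition band :: "real \<Rightarrow> real set" where "band r = {lo r<..<hi r}"
definition xi :: "real \<Rightarrow> real \<Rightarrow> real" where "xi r = the_inv_into {lo r..hi r} (poly D)"
definition Lam :: "real set" where "Lam = {x. \<bar>poly D x\<bar> < 2}"

lemma finite_Z: "finite Z" and card_Z: "card Z = N" using card_zeros N card_ge_0_finite[of Z] by (auto simp: Z_def)

lemma large_outside: "\<exists>R>0. \<forall>x. R \<le> \<bar>x\<bar> \<longrightarrow> \<bar>poly D x\<bar> > c"
proof -
 obtain a p where Dp: "D = pCons a p" by (cases D) auto
 have "p \<noteq> 0" using deg N Dp by auto
 from poly_infinity[OF this, of "c + 1" a] obtain r where "\<forall>x. r \<le> norm x \<longrightarrow> c + 1 \<le> norm (poly D x)"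
  unfolding Dp by auto
 hence r: "c + 1 \<le> \<bar>poly D x\<bar>" if "r \<le> \<bar>x\<bar>" for x using that by simp
 have "c < \<bar>poly D x\<bar>" if "\<bar>r\<bar> + 1 \<le> \<bar>x\<bar>" for x using r[of x] that by linarith
 thus ?thesis by (intro exI[of _ "\<bar>r\<bar> + 1"]) simp
qed

lemma ex_band: "r \<in> Z \<Longrightarrow> \<exists>l u. is_band r l u"
proof -
 assume r: "r \<in> Z"
 obtain R where R: "R > 0" "\<And>x. R \<le> \<bar>x\<bar> \<Longrightarrow> \<bar>poly D x\<bar> > 2" using large_outside[of 2] by auto
 have c: "continuous_on UNIV (\<lambda>x. \<bar>poly D x\<bar>)" "continuous_on UNIV (\<lambda>x. \<bar>poly D (-x)\<bar>)"
  by (intro continuous_intros)+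
 have r0: "\<bar>poly D r\<bar> < 2" using r by (simp add: Z_def)
 obtain u where u: "r < u" "\<bar>poly D u\<bar> = 2" "\<And>x. r \<le> x \<Longrightarrow> x < u \<Longrightarrow> \<bar>poly D x\<bar> < 2"
 proof (rule first_crossing[OF c(1) r0, of "R + \<bar>r\<bar> + 1"])
  show "2 \<le> \<bar>poly D (R + \<bar>r\<bar> + 1)\<bar>" using R(2)[of "R + \<bar>r\<bar> + 1"] R(1) by auto
 qed (use R that in auto)
 \<comment> \<open>The left end point is the first crossing of the reflected function.\<close>
 obtain l where l: "-r < l" "\<bar>poly D (-l)\<bar> = 2" "\<And>x. -r \<le> x \<Longrightarrow> x < l \<Longrightarrow> \<bar>poly D (-x)\<bar> < 2"
 proof (rule first_crossing[OF c(2), of "-r" 2 "R + \<bar>r\<bar> + 1"])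
  show "2 \<le> \<bar>poly D (- (R + \<bar>r\<bar> + 1))\<bar>" using R(2)[of "- (R + \<bar>r\<bar> + 1)"] R(1) by auto
 qed (use R that r0 in auto)
 have "\<bar>poly D x\<bar> < 2" if "- l < x" "x < u" for x using u(3)[of x] l(3)[of "-x"] that by (cases "r \<le> x") auto
 thus ?thesis unfolding is_band_def using u l by (intro exI[of _ "-l"] exI[of _ u]) auto
qed

lemma band:
 assumes "r \<in> Z"
 shows "lo r < r" "r < hi r" "\<bar>poly D (lo r)\<bar> = 2" "\<bar>poly D (hi r)\<bar> = 2"
  "\<And>x. x \<in> band r \<Longrightarrow> \<bar>poly D x\<bar> < 2"
proof -
 have "\<exists>p. is_band r (fst p) (snd p)" using ex_band[OF assms] by auto
 hence "is_band r (lo r) (hi r)" unfolding lo_def hi_def by (rule someI_ex)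
 thus "lo r < r" "r < hi r" "\<bar>poly D (lo r)\<bar> = 2" "\<bar>poly D (hi r)\<bar> = 2"
  "\<And>x. x \<in> band r \<Longrightarrow> \<bar>poly D x\<bar> < 2" by (auto simp: is_band_def band_def)
qed

lemma no_rolle:
 assumes "x < y" "poly D x = poly D y" "\<And>z. x < z \<Longrightarrow> z < y \<Longrightarrow> \<bar>poly D z\<bar> < 2"
 shows False
proof -
 obtain z where z: "x < z" "z < y" "poly D y - poly D x = (y - x) * poly (pderiv D) z" using poly_MVT[OF assms(1)] by blast
 hence "poly (pderiv D) z = 0" using assms by simp
 thus False using deriv_nonzero[OF assms(3)[OF z(1,2)]] by simp
qed

lemma inj_band:
 assumes "r \<in> Z"
 shows "inj_on (poly D) {lo r..hi r}"
proof (rule linorder_inj_onI)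
 fix x y assume xy: "x < y" "x \<in> {lo r..hi r}" "y \<in> {lo r..hi r}"
 show "poly D x \<noteq> poly D y"
 proof
  assume "poly D x = poly D y"
  thus False using xy by (intro no_rolle[of x y]) (auto intro!: band(5)[OF assms] simp: band_def)
 qed
qed auto

lemma cont_D: "continuous_on A (poly D)" by (intro continuous_intros)

lemma image_band_closed:
 assumes r: "r \<in> Z"
 shows "poly D ` {lo r..hi r} = {-2..2}"
proof
 note b = band[OF r]
 show "poly D ` {lo r..hi r} \<subseteq> {-2..2}"
 proof
  fix y assume "y \<in> poly D ` {lo r..hi r}"
  then obtain x where x: "x \<in> {lo r..hi r}" "y = poly D x" by auto
  hence "x = lo r \<or> x = hi r \<or> x \<in> band r" by (auto simp: band_def)
  hence "\<bar>poly D x\<bar> \<le> 2" using b(3,4) b(5)[of x] by auto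
  thus "y \<in> {-2..2}" using x by (simp add: abs_le_iff)
 qed
 have ne: "poly D (lo r) \<noteq> poly D (hi r)" using inj_onD[OF inj_band[OF r], of "lo r" "hi r"] b(1,2) by auto
 show "{-2..2} \<subseteq> poly D ` {lo r..hi r}"
 proof
  fix y :: real assume y: "y \<in> {-2..2}"
  consider "poly D (lo r) = -2" "poly D (hi r) = 2" | "poly D (lo r) = 2" "poly D (hi r) = -2"
   using b(3,4) ne by (auto simp: abs_if split: if_splits)
  thus "y \<in> poly D ` {lo r..hi r}"
  proof cases
   case 1
   then obtain x where "lo r \<le> x" "x \<le> hi r" "poly D x = y" using IVT'[of "poly D" "lo r" y "hi r"] y b(1,2) cont_D by auto
   thus ?thesis by (intro image_eqI[of _ _ x]) auto
  next
   case 2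
   then obtain x where "lo r \<le> x" "x \<le> hi r" "poly D x = y" using IVT2'[of "poly D" "hi r" y "lo r"] y b(1,2) cont_D by auto
   thus ?thesis by (intro image_eqI[of _ _ x]) auto
  qed
 qed
qed

lemma xi:
 assumes r: "r \<in> Z" and w: "w \<in> {-2..2}"
 shows "xi r w \<in> {lo r..hi r}" "poly D (xi r w) = w"
 using the_inv_into_into[OF inj_band[OF r], of w "{lo r..hi r}"] f_the_inv_into_f[OF inj_band[OF r], of w] w
 unfolding xi_def image_band_closed[OF r] by auto

lemma xi_band:
 assumes r: "r \<in> Z" and w: "w \<in> {-2<..<2}"
 shows "xi r w \<in> band r"
proof -
 have w': "w \<in> {-2..2}" using w by auto
 have "xi r w \<noteq> lo r" "xi r w \<noteq> hi r" using xi(2)[OF r w'] w band(3,4)[OF r] by auto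
 thus ?thesis using xi(1)[OF r w'] by (auto simp: band_def)
qed

lemma xi_D: "r \<in> Z \<Longrightarrow> x \<in> {lo r..hi r} \<Longrightarrow> xi r (poly D x) = x"
 unfolding xi_def by (rule the_inv_into_f_f[OF inj_band])

lemma continuous_xi:
 assumes r: "r \<in> Z"
 shows "continuous_on {-2..2} (xi r)" using continuous_on_inv[of "{lo r..hi r}" "poly D" "xi r"] xi_D[OF r] cont_D
 unfolding image_band_closed[OF r] by auto

text \<open>If two bands met, the modulus of \<open>D\<close> would stay below 2 between two of its
  zeros, and Rolle's theorem would produce a forbidden critical point.\<close>

lemma bands_disjoint:
 assumes "r \<in> Z" "r' \<in> Z" "r \<noteq> r'"
 shows "band r \<inter> band r' = {}"
proof -
 have *: False if r: "r \<in> Z" "r' \<in> Z" "r < r'" and x: "x \<in> band r" "x \<in> band r'" for r r' x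
 proof (rule no_rolle[OF r(3)])
  show "poly D r = poly D r'" using r by (simp add: Z_def)
  fix z assume z: "r < z" "z < r'"
  have "z \<in> band r \<or> z \<in> band r'" using z x band(1,2)[OF r(1)] band(1,2)[OF r(2)] by (auto simp: band_def)
  thus "\<bar>poly D z\<bar> < 2" using band(5) r by auto
 qed
 show ?thesis using *[of r r'] *[of r' r] assms by (cases r r' rule: linorder_cases) auto
qed

text \<open>Each of the \<open>N\<close> disjoint bands supplies one root; the degree leaves room
  for no other.\<close>

lemma roots_eq:
 assumes w: "w \<in> {-2<..<2}"
 shows "{x. poly D x = w} = (\<lambda>r. xi r w) ` Z" and "inj_on (\<lambda>r. xi r w) Z"
proof -
 show inj: "inj_on (\<lambda>r. xi r w) Z"
 proof (rule inj_onI, rule ccontr)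
  fix r r' assume r: "r \<in> Z" "r' \<in> Z" "xi r w = xi r' w" "r \<noteq> r'"
  have "xi r w \<in> band r" "xi r w \<in> band r'" using xi_band[OF r(1) w] xi_band[OF r(2) w] r(3) by auto
  thus False using bands_disjoint[OF r(1,2,4)] by auto
 qed
 have sub: "(\<lambda>r. xi r w) ` Z \<subseteq> {x. poly D x = w}" using xi(2) w by auto
 define p where "p = D - [:w:]"
 have "p \<noteq> 0" using deg N by (auto simp: p_def)
 have pD: "{x. poly p x = 0} = {x. poly D x = w}" by (auto simp: p_def)
 have "degree p \<le> N" unfolding p_def using deg by (intro degree_diff_le) auto
 hence c: "card {x. poly D x = w} \<le> N" "finite {x. poly D x = w}"
  using card_poly_roots_bound[OF \<open>p \<noteq> 0\<close>] poly_roots_finite[OF \<open>p \<noteq> 0\<close>] unfolding pD by auto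
 show "{x. poly D x = w} = (\<lambda>r. xi r w) ` Z"
  using card_subset_eq[OF c(2) sub] card_image[OF inj] card_Z c card_mono[OF c(2) sub] by simp
qed

lemma Lam_eq: "Lam = (\<Union>r\<in>Z. band r)"
proof
 show "Lam \<subseteq> (\<Union>r\<in>Z. band r)"
 proof
  fix x assume "x \<in> Lam"
  hence w: "poly D x \<in> {-2<..<2}" by (auto simp: Lam_def abs_less_iff)
  hence "x \<in> (\<lambda>r. xi r (poly D x)) ` Z" using roots_eq(1)[OF w] by blast
  thus "x \<in> (\<Union>r\<in>Z. band r)" using xi_band[OF _ w] by force
 qed
qed (auto simp: Lam_def dest: band(5))

text \<open>Both sides have degree at most \<open>N\<close> and the same coefficient there, so their
  difference has smaller degree; it vanishes at the \<open>N\<close> roots and is therefore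
  zero.\<close>

lemma factorization:
 assumes w: "w \<in> {-2<..<2}"
 shows "poly D x - w = L * (\<Prod>r\<in>Z. x - xi r w)"
proof -
 define p where "p = D - [:w:]"
 define q where "q = smult L (\<Prod>r\<in>Z. [:- xi r w, 1:])"
 have dprod: "degree (\<Prod>r\<in>Z. [:- xi r w, 1:]) = N" using card_Z by (subst degree_prod_eq_sum_degree) auto
 have cp: "coeff p N = L" using lead N by (auto simp: p_def coeff_pCons split: nat.splits)
 have dp: "degree p \<le> N" unfolding p_def using deg by (intro degree_diff_le) auto
 have lc: "lead_coeff (\<Prod>r\<in>Z. [:- xi r w, 1:]) = 1" by (simp add: lead_coeff_prod)
 hence cq: "coeff q N = L" using dprod by (simp add: q_def)
 have dq: "degree q \<le> N" using dprod by (simp add: q_def)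
 have qx: "poly q x = L * (\<Prod>r\<in>Z. x - xi r w)" for x by (simp add: q_def poly_prod)
 have "p = q"
 proof (rule ccontr)
  assume "p \<noteq> q"
  hence ne: "p - q \<noteq> 0" by simp
  have "degree (p - q) \<le> N" using dp dq by (intro degree_diff_le)
  moreover have "degree (p - q) \<noteq> N" using cp cq ne by (metis coeff_diff diff_self leading_coeff_0_iff)
  ultimately have "degree (p - q) < N" by simp
  moreover have "{x. poly D x = w} \<subseteq> {x. poly (p - q) x = 0}"
  proof
   fix y assume "y \<in> {x. poly D x = w}"
   hence "poly p y = 0" "y \<in> (\<lambda>r. xi r w) ` Z" using roots_eq(1)[OF w] by (auto simp: p_def)
   thus "y \<in> {x. poly (p - q) x = 0}" using finite_Z by (auto simp: qx)
  qed
  hence "card {x. poly D x = w} \<le> card {x. poly (p - q) x = 0}" by (intro card_mono poly_roots_finite ne)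
  moreover have "card {x. poly D x = w} = N" using roots_eq[OF w] card_Z by (simp add: card_image)
  ultimately show False using card_poly_roots_bound[OF ne] by linarith
 qed
 hence "poly p x = poly q x" by simp
 thus ?thesis by (simp add: qx) (simp add: p_def)
qed

end

subsection \<open>The regularised logarithmic kernel\<close>

text \<open>For \<open>X = cos s\<close> and \<open>Y = cos t\<close> this is the product of the
  squared distances of 1 from the points of modulus \<open>\<rho>\<close> with arguments
  \<open>s - t\<close> and \<open>s + t\<close>, see \<open>kq_cos\<close>. The polynomial form
  avoids angles; at \<open>\<rho> = 1\<close> it equals \<open>4 * (X - Y)^2\<close>, so that
  \<open>kr\<close> regularises \<open>- ln (2 * \<bar>X - Y\<bar>)\<close>.\<close>

definition kq :: "real \<Rightarrow> real \<Rightarrow> real \<Rightarrow> real" where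
 "kq \<rho> X Y = (1 + \<rho>^2)^2 - 4 * \<rho> * (1 + \<rho>^2) * X * Y + 4 * \<rho>^2 * (X^2 + Y^2 - 1)"

definition kr :: "real \<Rightarrow> real \<Rightarrow> real \<Rightarrow> real" where "kr \<rho> X Y = - ln (kq \<rho> X Y) / 2"

fun cheb :: "nat \<Rightarrow> real \<Rightarrow> real" where
 "cheb 0 x = 1"
| "cheb (Suc 0) x = x"
| "cheb (Suc (Suc n)) x = 2 * x * cheb (Suc n) x - cheb n x"

lemma cheb_cos: "cheb n (cos t) = cos (real n * t)"
proof (induction n rule: induct_nat_012)
 case (ge2 n)
 have "cos (real (Suc n) * t + t) + cos (real (Suc n) * t - t) = 2 * cos t * cos (real (Suc n) * t)" by (simp add: cos_add cos_diff)
 moreover have "real (Suc n) * t + t = real (Suc (Suc n)) * t" "real (Suc n) * t - t = real n * t" by (simp_all add: algebra_simps)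
 ultimately show ?case using ge2 by simp
qed auto

lemma cheb_abs: "\<bar>x\<bar> \<le> 1 \<Longrightarrow> \<bar>cheb n x\<bar> \<le> 1"
 using cheb_cos[of n "arccos x"] by (simp add: cos_arccos_abs)

lemma continuous_cheb: "continuous_on S (cheb n)" by (induction n rule: induct_nat_012) (auto intro!: continuous_intros)

text \<open>Real part of the power series of \<open>- ln (1 - z)\<close> at the point of modulus
  \<open>\<rho>\<close> and argument \<open>\<phi>\<close>. The term for \<open>n = 0\<close>
  vanishes because division by zero gives zero.\<close>

lemma log_cos_series:
 assumes "0 \<le> \<rho>" "\<rho> < 1"
 shows "(\<lambda>n. \<rho> ^ n / real n * cos (real n * \<phi>)) sums (- ln (1 - 2 * \<rho> * cos \<phi> + \<rho>^2) / 2)"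
proof -
 define z where "z = - (of_real \<rho> * cis \<phi>)"
 have nz: "cmod z = \<rho>" using assms by (simp add: z_def norm_mult)
 have "(\<lambda>n. (-1)^Suc n / of_nat n * z^n) sums ln (1 + z)" by (rule Ln_series) (use nz assms in simp)
 hence A: "(\<lambda>n. Re ((-1)^Suc n / of_nat n * z^n)) sums Re (ln (1 + z))" by (rule sums_Re)
 have e1: "Re ((-1)^Suc n / of_nat n * z^n) = - (\<rho> ^ n / real n * cos (real n * \<phi>))" for n
 proof -
  have "(-1)^Suc n * z ^ n = - (of_real (\<rho> ^ n) * cis (real n * \<phi>))"
   by (simp add: z_def power_minus[of "of_real \<rho> * cis \<phi>"] power_mult_distrib Complex.DeMoivre)
  hence "((-1)^Suc n * z^n) / of_nat n = - (of_real (\<rho> ^ n) * cis (real n * \<phi>)) / of_nat n" by (simp only:)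
  also have "\<dots> = of_real (- (\<rho> ^ n / real n)) * cis (real n * \<phi>)" by simp
  finally have eqn: "(-1)^Suc n / of_nat n * z^n = of_real (- (\<rho> ^ n / real n)) * cis (real n * \<phi>)"
   by (simp only: times_divide_eq_left)
  show ?thesis unfolding eqn by simp
 qed
 have e2: "Re (ln (1 + z)) = ln (1 - 2 * \<rho> * cos \<phi> + \<rho>^2) / 2"
 proof -
  have ne: "1 + z \<noteq> 0" using nz assms by (metis add_eq_0_iff norm_minus_cancel norm_one less_irrefl)
  have "(cmod (1 + z))^2 = (1 - \<rho> * cos \<phi>)^2 + (\<rho> * sin \<phi>)^2" unfolding cmod_power2 by (simp add: z_def)
  also have "\<dots> = 1 - 2 * \<rho> * cos \<phi> + \<rho>^2 * ((sin \<phi>)^2 + (cos \<phi>)^2)"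
   by (simp only: power2_diff power_mult_distrib distrib_left) simp
  finally have "(cmod (1 + z))^2 = 1 - 2 * \<rho> * cos \<phi> + \<rho>^2" by simp
  moreover have "ln (cmod (1 + z)) = ln ((cmod (1 + z))^2) / 2" using ne by (simp add: ln_realpow)
  ultimately show ?thesis using ne by simp
 qed
 have "(\<lambda>n. - (\<rho> ^ n / real n * cos (real n * \<phi>))) sums (ln (1 - 2 * \<rho> * cos \<phi> + \<rho>^2) / 2)"
  using A unfolding e1 e2 .
 from sums_minus[OF this] show ?thesis by simp
qed

lemma kq_cos:
 "kq \<rho> (cos s) (cos t) = (1 - 2 * \<rho> * cos (s - t) + \<rho>^2) * (1 - 2 * \<rho> * cos (s + t) + \<rho>^2)"
proof -
 have "cos (s - t) * cos (s + t) = (cos s)^2 * (cos t)^2 - (sin s)^2 * (sin t)^2"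
  by (simp add: cos_add cos_diff power2_eq_square algebra_simps)
 also have "\<dots> = (cos s)^2 + (cos t)^2 - 1" unfolding sin_squared_eq by (simp add: algebra_simps)
 finally have p: "cos (s - t) * cos (s + t) = (cos s)^2 + (cos t)^2 - 1" .
 have q: "cos (s - t) + cos (s + t) = 2 * cos s * cos t" by (simp add: cos_add cos_diff)
 have "(1 - 2 * \<rho> * cos (s - t) + \<rho>^2) * (1 - 2 * \<rho> * cos (s + t) + \<rho>^2)
   = (1 + \<rho>^2)^2 - 2 * \<rho> * (1 + \<rho>^2) * (cos (s - t) + cos (s + t)) + 4 * \<rho>^2 * (cos (s - t) * cos (s + t))"
  by (simp add: power2_eq_square algebra_simps)
 thus ?thesis unfolding p q by (simp add: kq_def)
qed

lemma kr_series:
 assumes "0 \<le> \<rho>" "\<rho> < 1" "\<bar>X\<bar> \<le> 1" "\<bar>Y\<bar> \<le> 1"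
 shows "(\<lambda>n. 2 * \<rho> ^ n / real n * cheb n X * cheb n Y) sums kr \<rho> X Y"
proof -
 obtain s where s: "0 \<le> s" "s \<le> pi" "X = cos s" using assms by (metis arccos_lbound arccos_ubound cos_arccos_abs abs_le_iff minus_le_iff)
 obtain t where t: "0 \<le> t" "t \<le> pi" "Y = cos t" using assms by (metis arccos_lbound arccos_ubound cos_arccos_abs abs_le_iff minus_le_iff)
 have pos: "1 - 2 * \<rho> * cos \<phi> + \<rho>^2 > 0" for \<phi>
 proof -
  have "\<rho> * cos \<phi> \<le> \<rho> * 1" using assms by (intro mult_left_mono) auto
  moreover have "(1 - \<rho>)^2 > 0" using assms by simp
  ultimately show ?thesis by (simp add: power2_eq_square algebra_simps)
 qed
 have "(\<lambda>n. \<rho> ^ n / real n * cos (real n * (s - t)) + \<rho> ^ n / real n * cos (real n * (s + t))) sums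
  (- ln (1 - 2 * \<rho> * cos (s - t) + \<rho>^2) / 2 + - ln (1 - 2 * \<rho> * cos (s + t) + \<rho>^2) / 2)"
  by (intro sums_add log_cos_series assms)
 moreover have "\<rho> ^ n / real n * cos (real n * (s - t)) + \<rho> ^ n / real n * cos (real n * (s + t)) = 2 * \<rho> ^ n / real n * cheb n X * cheb n Y" for n
 proof -
  have "cos (real n * (s - t)) + cos (real n * (s + t)) = 2 * cos (real n * s) * cos (real n * t)"
   by (simp add: right_diff_distrib distrib_left cos_add cos_diff)
  thus ?thesis unfolding s(3) t(3) cheb_cos distrib_left[symmetric] by simp
 qed
 moreover have "- ln (1 - 2 * \<rho> * cos (s - t) + \<rho>^2) / 2 + - ln (1 - 2 * \<rho> * cos (s + t) + \<rho>^2) / 2 = kr \<rho> X Y"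
  unfolding kr_def s(3) t(3) kq_cos using pos[of "s - t"] pos[of "s + t"] by (simp add: ln_mult)
 ultimately show ?thesis by simp
qed

text \<open>Each of the two factors of \<open>kq\<close> is
  \<open>(1 - \<rho>)^2 + 2 * \<rho> * (1 - cos \<phi>)\<close>, hence at most 4 and at least the
  second summand. The product of the second summands is \<open>\<rho>^2\<close> times the kernel at
  \<open>\<rho> = 1\<close>; this lower bound provides the domination as \<open>\<rho>\<close> tends
  to 1.\<close>

lemma kq_bounds:
 assumes "0 < \<rho>" "\<rho> < 1" "\<bar>X\<bar> \<le> 1" "\<bar>Y\<bar> \<le> 1"
 shows "kq \<rho> X Y > 0" "kq \<rho> X Y \<le> 16" "kq \<rho> X Y \<ge> \<rho>^2 * (4 * (X - Y)^2)"
proof -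
 obtain s where s: "X = cos s" using assms by (metis cos_arccos_abs)
 obtain t where t: "Y = cos t" using assms by (metis cos_arccos_abs)
 define F where "F = (\<lambda>\<phi>. 1 - 2 * \<rho> * cos \<phi> + \<rho>^2)"
 have F1: "F \<phi> \<ge> 2 * \<rho> * (1 - cos \<phi>)" for \<phi>
  using zero_le_power2[of "1 - \<rho>"] by (simp add: F_def power2_eq_square algebra_simps)
 have F0: "F \<phi> > 0" for \<phi>
 proof -
  have "\<rho> * cos \<phi> \<le> \<rho> * 1" using assms by (intro mult_left_mono) auto
  moreover have "(1 - \<rho>)^2 > 0" using assms by simp
  ultimately show ?thesis by (simp add: F_def power2_eq_square algebra_simps)
 qed
 have F4: "F \<phi> \<le> 4" for \<phi>
 proof -
  have "\<rho> * (- cos \<phi>) \<le> \<rho> * 1" using assms cos_ge_minus_one[of \<phi>] by (intro mult_left_mono) auto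
  moreover have "\<rho>^2 \<le> 1" using assms by (simp add: power_le_one)
  ultimately show ?thesis using assms by (simp add: F_def)
 qed
 have e: "kq \<rho> X Y = F (s - t) * F (s + t)" by (simp add: s t kq_cos F_def)
 show "kq \<rho> X Y > 0" unfolding e using F0 by simp
 have "F (s - t) * F (s + t) \<le> 4 * 4" using F4 F0 by (intro mult_mono) (auto intro: less_imp_le)
 thus "kq \<rho> X Y \<le> 16" unfolding e by simp
 have "(2 * \<rho> * (1 - cos (s - t))) * (2 * \<rho> * (1 - cos (s + t))) \<le> F (s - t) * F (s + t)"
  using F1 F0 assms by (intro mult_mono) (auto intro: less_imp_le)
 also have "(2 * \<rho> * (1 - cos (s - t))) * (2 * \<rho> * (1 - cos (s + t))) = \<rho>^2 * kq 1 X Y"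
  unfolding s t kq_cos by (simp add: power2_eq_square algebra_simps)
 also have "kq 1 X Y = 4 * (X - Y)^2" by (simp add: kq_def power2_eq_square algebra_simps)
 finally show "kq \<rho> X Y \<ge> \<rho>^2 * (4 * (X - Y)^2)" by (simp add: e)
qed

lemma kr_bounds:
 assumes "0 < \<rho>" "\<rho> < 1" "\<bar>X\<bar> \<le> 1" "\<bar>Y\<bar> \<le> 1"
 shows "kr \<rho> X Y \<ge> - ln 4" "X \<noteq> Y \<Longrightarrow> kr \<rho> X Y \<le> - ln \<rho> - ln (2 * \<bar>X - Y\<bar>)"
proof -
 have "ln (kq \<rho> X Y) \<le> ln 16" using kq_bounds[OF assms] by (subst ln_le_cancel_iff) auto
 moreover have "ln (16::real) = 2 * ln 4" using ln_realpow[of 4 2] by simp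
 ultimately show "kr \<rho> X Y \<ge> - ln 4" by (simp add: kr_def)
 assume ne: "X \<noteq> Y"
 have "ln (\<rho>^2 * (4 * (X - Y)^2)) \<le> ln (kq \<rho> X Y)"
  using kq_bounds[OF assms] ne assms by (subst ln_le_cancel_iff) (auto intro!: mult_pos_pos)
 moreover have "\<rho>^2 * (4 * (X - Y)^2) = (\<rho> * (2 * \<bar>X - Y\<bar>))^2" by (simp add: power_mult_distrib)
 moreover have "ln ((\<rho> * (2 * \<bar>X - Y\<bar>))^2) = 2 * (ln \<rho> + ln (2 * \<bar>X - Y\<bar>))"
  using ne assms by (subst ln_realpow) (auto simp: ln_mult)
 ultimately show "kr \<rho> X Y \<le> - ln \<rho> - ln (2 * \<bar>X - Y\<bar>)" by (simp add: kr_def)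
qed

text \<open>Radii tending to 1; starting at 1/2 keeps \<open>- ln (rh j)\<close> bounded by
  \<open>ln 2\<close>.\<close>

definition rh :: "nat \<Rightarrow> real" where "rh j = 1 - 1 / (real j + 2)"

lemma rh: "0 < rh j" "rh j < 1" "rh j \<ge> 1/2" by (auto simp: rh_def field_simps)

lemma rh_lim: "rh \<longlonglongrightarrow> 1"
proof -
 have "(\<lambda>j. 1 / real (j + 2)) \<longlonglongrightarrow> 0" using LIMSEQ_ignore_initial_segment[OF lim_1_over_n, of 2] .
 hence "(\<lambda>j. 1 - 1 / real (j + 2)) \<longlonglongrightarrow> 1 - 0" by (intro tendsto_diff tendsto_const)
 thus ?thesis by (simp add: rh_def[abs_def] add.commute)
qed

lemma kr_limit:
 assumes "X \<noteq> Y"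
 shows "(\<lambda>j. kr (rh j) X Y) \<longlonglongrightarrow> - ln (2 * \<bar>X - Y\<bar>)"
proof -
 have "(\<lambda>j. kq (rh j) X Y) \<longlonglongrightarrow> kq 1 X Y" unfolding kq_def by (intro tendsto_intros rh_lim)
 moreover have k1: "kq 1 X Y = (2 * \<bar>X - Y\<bar>)^2" by (simp add: kq_def power2_eq_square algebra_simps abs_if)
 ultimately have "(\<lambda>j. - ln (kq (rh j) X Y) / 2) \<longlonglongrightarrow> - ln ((2 * \<bar>X - Y\<bar>)^2) / 2"
  using assms by (intro tendsto_intros) auto
 moreover have "- ln ((2 * \<bar>X - Y\<bar>)^2) / 2 = - ln (2 * \<bar>X - Y\<bar>)" using assms by (subst ln_realpow) auto
 ultimately show ?thesis by (simp add: kr_def)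
qed

lemma kr_dominated:
 assumes "\<bar>X\<bar> \<le> 1" "\<bar>Y\<bar> \<le> 1" "X \<noteq> Y"
 shows "\<bar>kr (rh j) X Y\<bar> \<le> ln 4 + \<bar>ln (2 * \<bar>X - Y\<bar>)\<bar>"
proof -
 have "- ln (rh j) \<le> ln 2" using rh[of j] ln_mono[of "1/2" "rh j"] by (simp add: ln_div)
 also have "ln (2::real) \<le> ln 4" by simp
 finally have "- ln (rh j) \<le> ln 4" .
 thus ?thesis using kr_bounds[OF rh(1,2) assms(1,2), of j] assms(3) by linarith
qed

lemma kq_measurable [measurable]: "(\<lambda>(x, y). kq \<rho> x y) \<in> borel_measurable (borel \<Otimes>\<^sub>M borel)"
 unfolding kq_def[abs_def] by measurable

lemma cheb_measurable [measurable]: "cheb n \<in> borel_measurable borel" by (rule borel_measurable_continuous_onI[OF continuous_cheb])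

subsection \<open>The arcsine distribution\<close>

text \<open>The uniform distribution of the angle; its image under \<open>cos\<close> is the arcsine
  law.\<close>

definition arcm :: "real measure" where "arcm = uniform_measure lborel {0<..<pi}"

lemma prob_arc: "prob_space arcm" unfolding arcm_def by (rule prob_space_uniform_measure) auto

lemma measure_arc_UNIV [simp]: "measure arcm UNIV = 1" using prob_space.prob_space[OF prob_arc] by (simp add: arcm_def)

lemma sets_arc [measurable_cong, simp]: "sets arcm = sets borel" by (simp add: arcm_def)

lemma space_arc [simp]: "space arcm = UNIV" by (simp add: arcm_def)

lemma AE_arc: "AE t in arcm. 0 < t \<and> t < pi" unfolding arcm_def by (rule AE_uniform_measureI) auto

lemma AE_arc_neq: "AE t in arcm. t \<noteq> c"
proof -
 have "AE t in lborel. t \<noteq> c" by (rule AE_lborel_singleton)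
 thus ?thesis unfolding arcm_def by (intro AE_uniform_measureI) auto
qed

lemma integral_cos_arc:
 assumes "n > 0"
 shows "(LINT t|arcm. cos (real n * t)) = 0"
proof -
 have "((\<lambda>t. cos (real n * t)) has_integral (sin (real n * pi) / real n - sin (real n * 0) / real n)) {0..pi}"
  using assms by (intro fundamental_theorem_of_calculus)
   (auto intro!: derivative_eq_intros simp: has_real_derivative_iff_has_vector_derivative[symmetric])
 hence hi: "((\<lambda>t. cos (real n * t)) has_integral 0) {0..pi}" by (simp add: sin_npi)
 have "set_integrable lborel {0..pi} (\<lambda>t. cos (real n * t))" by (rule borel_integrable_atLeastAtMost') (intro continuous_intros)
 hence "(LINT t:{0..pi}|lborel. cos (real n * t)) = integral {0..pi} (\<lambda>t. cos (real n * t))"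
  by (rule set_borel_integral_eq_integral)
 hence z: "(LINT t:{0..pi}|lborel. cos (real n * t)) = 0" using hi by (simp add: integral_unique)
 have "(LINT t|arcm. cos (real n * t)) = (LINT t|lborel. (indicator {0<..<pi} t / pi) * cos (real n * t))"
 proof -
  have "arcm = density lborel (\<lambda>t. ennreal (indicator {0<..<pi} t / pi))" unfolding arcm_def uniform_measure_def
   by (intro density_cong) (auto simp: divide_ennreal[of 1 pi, simplified] indicator_def)
  hence "(LINT t|arcm. cos (real n * t)) = (LINT t|density lborel (\<lambda>t. ennreal (indicator {0<..<pi} t / pi)). cos (real n * t))"
   by (rule arg_cong)
  thus ?thesis by (subst (asm) integral_density) auto
 qed
 also have "\<dots> = (LINT t|lborel. (indicator {0..pi} t * cos (real n * t)) / pi)"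
 proof (rule integral_cong_AE)
  have "AE t in lborel. t \<noteq> 0 \<and> t \<noteq> pi" using AE_lborel_singleton[of 0] AE_lborel_singleton[of pi] by eventually_elim auto
  thus "AE t in lborel. (indicator {0<..<pi} t / pi) * cos (real n * t) = (indicator {0..pi} t * cos (real n * t)) / pi"
   by eventually_elim (auto simp: indicator_def)
 qed auto
 also have "\<dots> = 0" using z by (simp add: set_lebesgue_integral_def)
 finally show ?thesis .
qed

text \<open>The Chebyshev series may be integrated term by term, and every term has mean
  zero.\<close>

lemma kr_arc:
 assumes "0 \<le> \<rho>" "\<rho> < 1" "\<bar>X\<bar> \<le> 1"
 shows "integrable arcm (\<lambda>t. kr \<rho> X (cos t))" "(LINT t|arcm. kr \<rho> X (cos t)) = 0"
proof -
 interpret prob_space arcm by (rule prob_arc)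
 define f where "f = (\<lambda>n t. 2 * \<rho> ^ n / real n * cheb n X * cos (real n * t))"
 have fb: "\<bar>f n t\<bar> \<le> 2 * \<rho> ^ n" for n t
 proof -
  have "\<bar>f n t\<bar> = (2 * \<rho> ^ n / real n) * (\<bar>cheb n X\<bar> * \<bar>cos (real n * t)\<bar>)" using assms by (simp add: f_def abs_mult)
  also have "\<dots> \<le> (2 * \<rho> ^ n) * (1 * 1)"
  proof (intro mult_mono)
   show "2 * \<rho> ^ n / real n \<le> 2 * \<rho> ^ n" 
   proof (cases "n = 0")
    case False
    hence "2 * \<rho> ^ n / real n \<le> 2 * \<rho> ^ n / 1" using assms by (intro divide_left_mono) auto
    thus ?thesis by simp
   qed (use assms in auto)
  qed (use assms cheb_abs in auto)
  finally show ?thesis by simp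
 qed
 have fi: "integrable arcm (f n)" for n by (rule integrable_const_bound[of _ "2 * \<rho> ^ n"]) (use fb in \<open>auto simp: f_def\<close>)
 have sg: "summable (\<lambda>n. 2 * \<rho> ^ n)" using assms by (intro summable_mult summable_geometric) auto
 have sm: "summable (\<lambda>n. norm (f n t))" for t by (rule summable_comparison_test'[OF sg, of 0]) (use fb in auto)
 have si: "summable (\<lambda>n. LINT t|arcm. norm (f n t))"
 proof (rule summable_comparison_test'[OF sg, of 0])
  fix n
  have "(LINT t|arcm. norm (f n t)) \<le> (LINT t|arcm. 2 * \<rho> ^ n)" using fb fi by (intro integral_mono) (auto)
  thus "norm (LINT t|arcm. norm (f n t)) \<le> 2 * \<rho> ^ n" by simp
 qed
 have eq: "(\<Sum>n. f n t) = kr \<rho> X (cos t)" if "0 < t \<and> t < pi" for t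
  using kr_series[OF assms, of "cos t"] that by (simp add: f_def cheb_cos sums_iff)
 have ae: "AE t in arcm. (\<Sum>n. f n t) = kr \<rho> X (cos t)" using AE_arc by eventually_elim (rule eq)
 have m: "(\<lambda>t. kr \<rho> X (cos t)) \<in> borel_measurable arcm" unfolding kr_def kq_def by measurable
 have i1: "integrable arcm (\<lambda>t. \<Sum>n. f n t)" by (rule integrable_suminf[OF fi _ si]) (use sm in auto)
 thus "integrable arcm (\<lambda>t. kr \<rho> X (cos t))" by (subst integrable_cong_AE[OF _ _ ae, symmetric]) (use m in auto)
 have "(LINT t|arcm. kr \<rho> X (cos t)) = (LINT t|arcm. (\<Sum>n. f n t))" by (rule integral_cong_AE[symmetric]) (use m i1 ae in auto)
 also have "\<dots> = (\<Sum>n. LINT t|arcm. f n t)" by (rule integral_suminf[OF fi _ si]) (use sm in auto)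
 also have "(\<lambda>n. LINT t|arcm. f n t) = (\<lambda>n. 0)"
 proof
  fix n show "(LINT t|arcm. f n t) = 0" using integral_cos_arc[of n] by (cases "n = 0") (auto simp: f_def)
 qed
 finally show "(LINT t|arcm. kr \<rho> X (cos t)) = 0" by simp
qed

text \<open>Fatou's lemma gives integrability, after which dominated convergence applies.\<close>

lemma log_arc:
 assumes X: "\<bar>X\<bar> \<le> 1"
 shows "integrable arcm (\<lambda>t. ln (2 * \<bar>X - cos t\<bar>))" "(LINT t|arcm. ln (2 * \<bar>X - cos t\<bar>)) = 0"
proof -
 interpret prob_space arcm by (rule prob_arc)
 have ne: "AE t in arcm. X \<noteq> cos t" using AE_arc AE_arc_neq[of "arccos X"] by eventually_elim (metis arccos_cos less_imp_le)
 define g where "g = (\<lambda>t. ln 4 - ln (2 * \<bar>X - cos t\<bar>))"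
 have gm: "g \<in> borel_measurable arcm" unfolding g_def by measurable
 have km: "(\<lambda>t. kr (rh j) X (cos t)) \<in> borel_measurable arcm" for j unfolding kr_def kq_def by measurable
 have g0: "AE t in arcm. g t \<ge> 0" using ne
 proof eventually_elim
  case (elim t)
  have "-1 \<le> X" "X \<le> 1" using X by auto
  hence "\<bar>X - cos t\<bar> \<le> 2" using cos_le_one[of t] cos_ge_minus_one[of t] unfolding abs_le_iff by linarith
  hence "2 * \<bar>X - cos t\<bar> \<le> 4" by simp
  hence "ln (2 * \<bar>X - cos t\<bar>) \<le> ln 4" using elim by (subst ln_le_cancel_iff) auto
  thus ?case by (simp add: g_def)
 qed
 have lim: "AE t in arcm. (\<lambda>j. ennreal (kr (rh j) X (cos t) + ln 4)) \<longlonglongrightarrow> ennreal (g t)" using ne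
 proof eventually_elim
  case (elim t)
  have "(\<lambda>j. kr (rh j) X (cos t) + ln 4) \<longlonglongrightarrow> g t" 
   using tendsto_add[OF kr_limit[OF elim] tendsto_const[of "ln 4"]] by (simp add: g_def)
  thus ?case by (rule tendsto_ennrealI)
 qed
 have "(\<integral>\<^sup>+t. ennreal (g t) \<partial>arcm) = (\<integral>\<^sup>+t. liminf (\<lambda>j. ennreal (kr (rh j) X (cos t) + ln 4)) \<partial>arcm)"
  by (rule nn_integral_cong_AE) (use lim in \<open>eventually_elim, simp add: lim_imp_Liminf\<close>)
 also have "\<dots> \<le> liminf (\<lambda>j. \<integral>\<^sup>+t. ennreal (kr (rh j) X (cos t) + ln 4) \<partial>arcm)"
  by (rule nn_integral_liminf) (use km in measurable)
 also have "(\<lambda>j. \<integral>\<^sup>+t. ennreal (kr (rh j) X (cos t) + ln 4) \<partial>arcm) = (\<lambda>j. ennreal (ln 4))"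
 proof
  fix j
  have "(\<integral>\<^sup>+t. ennreal (kr (rh j) X (cos t) + ln 4) \<partial>arcm) = ennreal (LINT t|arcm. kr (rh j) X (cos t) + ln 4)"
  proof (rule nn_integral_eq_integral)
   show "integrable arcm (\<lambda>t. kr (rh j) X (cos t) + ln 4)" using kr_arc(1)[of "rh j" X] rh[of j] X by auto
   have "0 \<le> kr (rh j) X (cos t) + ln 4" for t using kr_bounds(1)[OF rh(1)[of j] rh(2)[of j] X, of "cos t"] by simp
   thus "AE t in arcm. 0 \<le> kr (rh j) X (cos t) + ln 4" by simp
  qed
  also have "(LINT t|arcm. kr (rh j) X (cos t) + ln 4) = ln 4" using kr_arc[of "rh j" X] rh[of j] X by (simp add: prob_space)
  finally show "(\<integral>\<^sup>+t. ennreal (kr (rh j) X (cos t) + ln 4) \<partial>arcm) = ennreal (ln 4)" .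
 qed
 finally have "(\<integral>\<^sup>+t. ennreal (g t) \<partial>arcm) < \<infinity>" by (simp add: Liminf_const order_le_less_trans)
 hence gi: "integrable arcm g" by (intro integrableI_nonneg gm g0)
 hence "integrable arcm (\<lambda>t. ln 4 - g t)" by (intro Bochner_Integration.integrable_diff) auto
 thus i: "integrable arcm (\<lambda>t. ln (2 * \<bar>X - cos t\<bar>))" by (simp add: g_def)
 have "(\<lambda>j. LINT t|arcm. kr (rh j) X (cos t)) \<longlonglongrightarrow> (LINT t|arcm. - ln (2 * \<bar>X - cos t\<bar>))"
 proof (rule integral_dominated_convergence[where w = "\<lambda>t. ln 4 + \<bar>ln (2 * \<bar>X - cos t\<bar>)\<bar>"])
  show "integrable arcm (\<lambda>t. ln 4 + \<bar>ln (2 * \<bar>X - cos t\<bar>)\<bar>)" using i by auto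
  show "AE t in arcm. (\<lambda>j. kr (rh j) X (cos t)) \<longlonglongrightarrow> - ln (2 * \<bar>X - cos t\<bar>)"
   using ne by eventually_elim (rule kr_limit)
  show "AE t in arcm. norm (kr (rh j) X (cos t)) \<le> ln 4 + \<bar>ln (2 * \<bar>X - cos t\<bar>)\<bar>" for j
   using ne by eventually_elim (use kr_dominated[OF X] in auto)
 qed (use km i in auto)
 moreover have "(LINT t|arcm. kr (rh j) X (cos t)) = 0" for j using kr_arc(2)[of "rh j" X] rh[of j] X by simp
 ultimately have "(LINT t|arcm. - ln (2 * \<bar>X - cos t\<bar>)) = 0" using LIMSEQ_unique[OF _ tendsto_const] by fastforce
 thus "(LINT t|arcm. ln (2 * \<bar>X - cos t\<bar>)) = 0" by simp
qed

subsection \<open>Determinacy of compactly supported measures\<close>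

lemma real_distribution_eqI:
 assumes M: "real_distribution M" "real_distribution M'"
  and eq: "\<And>f :: real \<Rightarrow> real. continuous_on UNIV f \<Longrightarrow> bounded (range f) \<Longrightarrow> (LINT x|M. f x) = (LINT x|M'. f x)"
 shows "M = M'"
proof (rule Levy_uniqueness[OF M], rule ext)
 fix t
 have i: "integrable P (\<lambda>x. iexp (t * x))" if "real_distribution P" for P
  proof -
  interpret real_distribution P by fact
  show ?thesis using integrable_iexp[of "\<lambda>x. complex_of_real (t * x)"] by simp
 qed
 have c: "char P t = of_real (LINT x|P. cos (t * x)) + \<i> * of_real (LINT x|P. sin (t * x))" if "real_distribution P" for P
 proof -
  have "Re (LINT x|P. iexp (t * x)) = (LINT x|P. cos (t * x))" "Im (LINT x|P. iexp (t * x)) = (LINT x|P. sin (t * x))"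
   using integral_Re[OF i[OF that]] integral_Im[OF i[OF that]] by (simp_all add: Re_exp Im_exp)
  thus ?thesis by (simp add: char_def complex_eq_iff)
 qed
 have "bounded (range (\<lambda>x. cos (t * x)))" "bounded (range (\<lambda>x. sin (t * x)))"
  by (auto simp: bounded_iff intro!: exI[of _ 1])
 thus "char M t = char M' t" unfolding c[OF M(1)] c[OF M(2)]
  using eq[of "\<lambda>x. cos (t * x)"] eq[of "\<lambda>x. sin (t * x)"] by (simp add: continuous_intros)
qed

lemma polynomial_approx:
 fixes f :: "real \<Rightarrow> real"
 assumes "continuous_on UNIV f" "e > 0"
 obtains a n where "\<And>x. \<bar>x\<bar> \<le> R \<Longrightarrow> \<bar>f x - (\<Sum>i\<le>n. a i * x ^ i)\<bar> < e"
proof -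
 have "compact {-R..R}" "continuous_on {-R..R} f" using assms continuous_on_subset by auto
 then obtain g where g: "real_polynomial_function g" "\<And>x. x \<in> {-R..R} \<Longrightarrow> \<bar>f x - g x\<bar> < e"
  using Stone_Weierstrass_real_polynomial_function[of "{-R..R}" f e] assms(2) by auto
 then obtain a n where "g = (\<lambda>x. \<Sum>i\<le>n. a i * x ^ i)" using real_polynomial_function_iff_sum by blast
 moreover have "\<bar>f x - g x\<bar> < e" if "\<bar>x\<bar> \<le> R" for x using that by (intro g(2)) auto
 ultimately show thesis using that[of a n] by simp
qed

lemma integrable_bounded_support:
 fixes f :: "real \<Rightarrow> real"
 assumes "prob_space M" "sets M = sets borel" "AE x in M. \<bar>x\<bar> \<le> R" "continuous_on UNIV f"
 shows "integrable M f"
proof -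
 interpret prob_space M by fact
 have "compact (f ` {-R..R})" by (intro compact_continuous_image continuous_on_subset[OF assms(4)]) auto
 hence "bounded (f ` {-R..R})" by (rule compact_imp_bounded)
 then obtain B where "\<forall>y\<in>f ` {-R..R}. norm y \<le> B" unfolding bounded_iff by blast
 hence B: "\<And>x. x \<in> {-R..R} \<Longrightarrow> \<bar>f x\<bar> \<le> B" by simp
 have "f \<in> borel_measurable M" using borel_measurable_continuous_onI[OF assms(4)] assms(2) measurable_cong_sets by blast
 thus ?thesis proof (intro integrable_const_bound[of _ B])
  show "AE x in M. norm (f x) \<le> B" using assms(3) by eventually_elim (use B in \<open>auto simp: abs_le_iff\<close>)
 qed
qed

lemma moments_determine_measure:
 fixes M M' :: "real measure"
 assumes M: "prob_space M" "sets M = sets borel" "AE x in M. \<bar>x\<bar> \<le> R"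
  and M': "prob_space M'" "sets M' = sets borel" "AE x in M'. \<bar>x\<bar> \<le> R"
  and mom: "\<And>n. (LINT x|M. x ^ n) = (LINT x|M'. x ^ n)"
 shows "M = M'"
proof (rule real_distribution_eqI)
 show "real_distribution M" "real_distribution M'"
  using M M' by (auto simp: real_distribution_def real_distribution_axioms_def sets_eq_imp_space_eq[OF M(2)] sets_eq_imp_space_eq[OF M'(2)])
 fix f :: "real \<Rightarrow> real" assume f: "continuous_on UNIV f"
 have cp: "continuous_on UNIV (\<lambda>x::real. \<Sum>i\<le>n. a i * x ^ i)" for a :: "nat \<Rightarrow> real" and n by (intro continuous_intros)
 have ig: "(LINT x|P. (\<Sum>i\<le>n. a i * x ^ i)) = (\<Sum>i\<le>n. a i * (LINT x|P. x ^ i))"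
  if P: "prob_space P" "sets P = sets borel" "AE x in P. \<bar>x\<bar> \<le> R" for P a n
  using integrable_bounded_support[OF P, of "\<lambda>x. x ^ _"] by (subst Bochner_Integration.integral_sum) (auto simp: continuous_intros)
 have close: "\<bar>(LINT x|P. f x) - (LINT x|P. (\<Sum>i\<le>n. a i * x ^ i))\<bar> \<le> e"
  if P: "prob_space P" "sets P = sets borel" "AE x in P. \<bar>x\<bar> \<le> R" and a: "\<And>x. \<bar>x\<bar> \<le> R \<Longrightarrow> \<bar>f x - (\<Sum>i\<le>n. a i * x ^ i)\<bar> < e"
  for P a n e
 proof -
  interpret prob_space P by fact
  have i: "integrable P f" "integrable P (\<lambda>x. \<Sum>i\<le>n. a i * x ^ i)"
   by (rule integrable_bounded_support[OF P f], rule integrable_bounded_support[OF P cp])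
  have "\<bar>(LINT x|P. f x) - (LINT x|P. (\<Sum>i\<le>n. a i * x ^ i))\<bar> = \<bar>LINT x|P. f x - (\<Sum>i\<le>n. a i * x ^ i)\<bar>" using i by simp
  also have "\<dots> \<le> (LINT x|P. \<bar>f x - (\<Sum>i\<le>n. a i * x ^ i)\<bar>)" by (rule integral_abs_bound)
  also have "\<dots> \<le> (LINT x|P. e)" using i P(3) a by (intro integral_mono_AE) (auto elim!: eventually_mono intro: less_imp_le)
  also have "\<dots> = e" using prob_space by simp
  finally show ?thesis .
 qed
 show "(LINT x|M. f x) = (LINT x|M'. f x)"
 proof (rule ccontr)
  assume ne: "(LINT x|M. f x) \<noteq> (LINT x|M'. f x)"
  define e where "e = \<bar>(LINT x|M. f x) - (LINT x|M'. f x)\<bar> / 3"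
  have e: "e > 0" using ne by (simp add: e_def)
  obtain a n where a: "\<And>x. \<bar>x\<bar> \<le> R \<Longrightarrow> \<bar>f x - (\<Sum>i\<le>n. a i * x ^ i)\<bar> < e" using polynomial_approx[OF f e] by metis
  have "(LINT x|M. (\<Sum>i\<le>n. a i * x ^ i)) = (LINT x|M'. (\<Sum>i\<le>n. a i * x ^ i))" unfolding ig[OF M] ig[OF M'] mom ..
  hence "\<bar>(LINT x|M. f x) - (LINT x|M'. f x)\<bar> \<le> 2 * e" using close[OF M a] close[OF M' a] by linarith
  thus False using e by (simp add: e_def)
 qed
qed

text \<open>By the three-term recurrence, multiplication by \<open>x\<close> turns a Chebyshev
  polynomial into a combination of its neighbours. Induction on the power \<open>l\<close>, for all
  \<open>n\<close> at once, passes from Chebyshev coefficients to moments.\<close>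

lemma cheb_moments_determine_measure:
 fixes M M' :: "real measure"
 assumes R: "R > 0" and M: "prob_space M" "sets M = sets borel" "AE x in M. \<bar>x\<bar> \<le> R"
  and M': "prob_space M'" "sets M' = sets borel" "AE x in M'. \<bar>x\<bar> \<le> R"
  and mom: "\<And>n. (LINT x|M. cheb n (x / R)) = (LINT x|M'. cheb n (x / R))"
 shows "M = M'"
proof (rule moments_determine_measure[OF M M'])
 have cc: "continuous_on UNIV (\<lambda>x. x ^ l * cheb n (x / R))" for l n
  by (intro continuous_intros continuous_on_compose2[OF continuous_cheb[of UNIV]]) (use R in auto)
 have gen: "(LINT x|M. x ^ l * cheb n (x / R)) = (LINT x|M'. x ^ l * cheb n (x / R))" for l n
 proof (induction l arbitrary: n)
  case 0
  thus ?case using mom by simp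
 next
  case (Suc l)
  note iM = integrable_bounded_support[OF M cc] and iM' = integrable_bounded_support[OF M' cc]
  show ?case
  proof (cases n)
   case 0
   have "x ^ Suc l * cheb 0 (x / R) = R * (x ^ l * cheb 1 (x / R))" for x using R by simp
   hence e: "(\<lambda>x. x ^ Suc l * cheb 0 (x / R)) = (\<lambda>x. R * (x ^ l * cheb 1 (x / R)))" by blast
   show ?thesis unfolding 0 e integral_mult_right_zero Suc.IH[of 1] ..
  next
   case (Suc k)
   have e: "x ^ Suc l * cheb (Suc k) (x / R) = (R / 2) * (x ^ l * cheb (Suc (Suc k)) (x / R) + x ^ l * cheb k (x / R))" for x
   proof -
    have "x ^ l * cheb (Suc (Suc k)) (x / R) + x ^ l * cheb k (x / R) = x ^ l * (2 * (x / R) * cheb (Suc k) (x / R))"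
     by (simp add: algebra_simps)
    thus ?thesis using R by simp
   qed
   show ?thesis unfolding Suc e integral_mult_right_zero Bochner_Integration.integral_add[OF iM iM] Bochner_Integration.integral_add[OF iM' iM'] Suc.IH ..
  qed
 qed
 show "(LINT x|M. x ^ n) = (LINT x|M'. x ^ n)" for n using gen[of n 0] by simp
qed

subsection \<open>Energies and Chebyshev coefficients\<close>

abbreviation log_dist :: "real \<times> real \<Rightarrow> real" where
 "log_dist p \<equiv> ln \<bar>fst p - snd p\<bar>"

lemma kr_measurable: "(\<lambda>p. kr \<rho> (fst p / R) (snd p / R)) \<in> borel_measurable (borel \<Otimes>\<^sub>M borel)"
 unfolding kr_def kq_def by measurable

text \<open>The Chebyshev expansion of the kernel makes the regularised mutual energy a diagonal
  form with nonnegative weights; this is the source of positive definiteness.\<close>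

lemma energy_sums:
 fixes M M' :: "real measure"
 assumes R: "R > 0" and M: "prob_space M" "sets M = sets borel" "AE x in M. \<bar>x\<bar> \<le> R"
  and M': "prob_space M'" "sets M' = sets borel" "AE x in M'. \<bar>x\<bar> \<le> R"
  and rho: "0 \<le> \<rho>" "\<rho> < 1"
 shows "(\<lambda>n. 2 * \<rho> ^ n / real n * ((LINT x|M. cheb n (x / R)) * (LINT x|M'. cheb n (x / R)))) sums
  (LINT p|(M \<Otimes>\<^sub>M M'). kr \<rho> (fst p / R) (snd p / R))"
proof -
 interpret M: prob_space M by fact
 interpret M': prob_space M' by fact
 interpret P: pair_prob_space M M' ..
 have [measurable_cong]: "sets M = sets borel" "sets M' = sets borel" by fact+
 define f where "f = (\<lambda>n p. 2 * \<rho> ^ n / real n * (cheb n (fst p / R) * cheb n (snd p / R)))"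
 have AEP: "AE p in M \<Otimes>\<^sub>M M'. \<bar>fst p\<bar> \<le> R \<and> \<bar>snd p\<bar> \<le> R"
 proof (rule P.AE_pair_measure)
  show "{p \<in> space (M \<Otimes>\<^sub>M M'). \<bar>fst p\<bar> \<le> R \<and> \<bar>snd p\<bar> \<le> R} \<in> sets (M \<Otimes>\<^sub>M M')" by measurable
  show "AE x in M. AE y in M'. \<bar>fst (x, y)\<bar> \<le> R \<and> \<bar>snd (x, y)\<bar> \<le> R"
   using M(3) by eventually_elim (use M'(3) in \<open>auto\<close>)
 qed
 have fm: "f n \<in> borel_measurable (M \<Otimes>\<^sub>M M')" for n unfolding f_def by measurable
 have fb: "\<bar>f n p\<bar> \<le> 2 * \<rho> ^ n" if "\<bar>fst p\<bar> \<le> R \<and> \<bar>snd p\<bar> \<le> R" for n p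
 proof -
  have c: "\<bar>cheb n (fst p / R)\<bar> \<le> 1" "\<bar>cheb n (snd p / R)\<bar> \<le> 1" using that R by (auto intro!: cheb_abs simp: abs_divide)
  have "\<bar>f n p\<bar> = (2 * \<rho> ^ n / real n) * (\<bar>cheb n (fst p / R)\<bar> * \<bar>cheb n (snd p / R)\<bar>)" using rho by (simp add: f_def abs_mult)
  also have "\<dots> \<le> (2 * \<rho> ^ n) * (1 * 1)"
  proof (intro mult_mono c)
   show "2 * \<rho> ^ n / real n \<le> 2 * \<rho> ^ n"
   proof (cases "n = 0")
    case False
    hence "2 * \<rho> ^ n / real n \<le> 2 * \<rho> ^ n / 1" using rho by (intro divide_left_mono) auto
    thus ?thesis by simp
   qed (use rho in auto)
  qed (use rho in auto)
  finally show ?thesis by simp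
 qed
 have fi: "integrable (M \<Otimes>\<^sub>M M') (f n)" for n
 proof (rule P.integrable_const_bound[OF _ fm])
  show "AE p in M \<Otimes>\<^sub>M M'. norm (f n p) \<le> 2 * \<rho> ^ n" using AEP by (rule eventually_mono) (simp add: fb)
 qed
 have sg: "summable (\<lambda>n. 2 * \<rho> ^ n)" using rho by (intro summable_mult summable_geometric) auto
 have sm: "AE p in M \<Otimes>\<^sub>M M'. summable (\<lambda>n. norm (f n p))"
  using AEP by eventually_elim (rule summable_comparison_test'[OF sg, of 0], use fb in auto)
 have si: "summable (\<lambda>n. LINT p|(M \<Otimes>\<^sub>M M'). norm (f n p))"
 proof (rule summable_comparison_test'[OF sg, of 0])
  fix n
  have "(LINT p|(M \<Otimes>\<^sub>M M'). norm (f n p)) \<le> (LINT p|(M \<Otimes>\<^sub>M M'). 2 * \<rho> ^ n)"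
   proof (rule integral_mono_AE)
   show "AE p in M \<Otimes>\<^sub>M M'. norm (f n p) \<le> 2 * \<rho> ^ n" using AEP by (rule eventually_mono) (simp add: fb)
  qed (use fi in auto)
  thus "norm (LINT p|(M \<Otimes>\<^sub>M M'). norm (f n p)) \<le> 2 * \<rho> ^ n" using P.prob_space by simp
 qed
 have ae: "AE p in M \<Otimes>\<^sub>M M'. (\<Sum>n. f n p) = kr \<rho> (fst p / R) (snd p / R)" using AEP
 proof eventually_elim
  case (elim p)
  hence "\<bar>fst p / R\<bar> \<le> 1" "\<bar>snd p / R\<bar> \<le> 1" using R by auto
  from kr_series[OF rho this] show ?case by (simp add: f_def sums_iff mult.assoc)
 qed
 have prod: "(LINT p|(M \<Otimes>\<^sub>M M'). f n p) = 2 * \<rho> ^ n / real n * ((LINT x|M. cheb n (x / R)) * (LINT x|M'. cheb n (x / R)))" for n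
  proof -
  have "(LINT p|(M \<Otimes>\<^sub>M M'). f n p) = (LINT x|M. (LINT y|M'. f n (x, y)))" using P.integral_fst'[OF fi[of n]] by simp
  thus ?thesis unfolding f_def fst_conv snd_conv integral_mult_right_zero integral_mult_left_zero .
 qed
 have "(\<lambda>n. LINT p|(M \<Otimes>\<^sub>M M'). f n p) sums (LINT p|(M \<Otimes>\<^sub>M M'). (\<Sum>n. f n p))"
  by (rule sums_integral[OF fi sm si])
 moreover have "(LINT p|(M \<Otimes>\<^sub>M M'). (\<Sum>n. f n p)) = (LINT p|(M \<Otimes>\<^sub>M M'). kr \<rho> (fst p / R) (snd p / R))"
 proof (rule integral_cong_AE[OF _ _ ae])
  show "(\<lambda>p. kr \<rho> (fst p / R) (snd p / R)) \<in> borel_measurable (M \<Otimes>\<^sub>M M')"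
   using kr_measurable by (simp cong: measurable_cong_sets)
  show "(\<lambda>p. \<Sum>n. f n p) \<in> borel_measurable (M \<Otimes>\<^sub>M M')" using fm by measurable
 qed
 ultimately show ?thesis unfolding prod by simp
qed

text \<open>Dominated convergence as the radius tends to 1. Scaling the support into the unit
  interval produces the constant \<open>ln (2 / R)\<close>, which cancels in the energy of a
  difference of two probability measures.\<close>

lemma energy_limit:
 fixes M M' :: "real measure"
 assumes R: "R > 0" and M: "prob_space M" "sets M = sets borel" "AE x in M. \<bar>x\<bar> \<le> R"
  and M': "prob_space M'" "sets M' = sets borel" "AE x in M'. \<bar>x\<bar> \<le> R"
  and int: "integrable (M \<Otimes>\<^sub>M M') (\<lambda>p. log_dist p)"
  and ne: "AE p in M \<Otimes>\<^sub>M M'. fst p \<noteq> snd p"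
 shows "(\<lambda>j. LINT p|(M \<Otimes>\<^sub>M M'). kr (rh j) (fst p / R) (snd p / R)) \<longlonglongrightarrow> - (LINT p|(M \<Otimes>\<^sub>M M'). log_dist p) - ln (2 / R)"
proof -
 interpret M: prob_space M by fact
 interpret M': prob_space M' by fact
 interpret P: pair_prob_space M M' ..
 have [measurable_cong]: "sets M = sets borel" "sets M' = sets borel" by fact+
 have AEP: "AE p in M \<Otimes>\<^sub>M M'. \<bar>fst p\<bar> \<le> R \<and> \<bar>snd p\<bar> \<le> R"
 proof (rule P.AE_pair_measure)
  show "{p \<in> space (M \<Otimes>\<^sub>M M'). \<bar>fst p\<bar> \<le> R \<and> \<bar>snd p\<bar> \<le> R} \<in> sets (M \<Otimes>\<^sub>M M')" by measurable
  show "AE x in M. AE y in M'. \<bar>fst (x, y)\<bar> \<le> R \<and> \<bar>snd (x, y)\<bar> \<le> R"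
   using M(3) by eventually_elim (use M'(3) in \<open>auto\<close>)
 qed
 have eq: "ln (2 * \<bar>x / R - y / R\<bar>) = ln (2 / R) + ln \<bar>x - y\<bar>" if "x \<noteq> y" for x y
 proof -
  have "2 * \<bar>x / R - y / R\<bar> = 2 / R * \<bar>x - y\<bar>" using R by (simp add: diff_divide_distrib[symmetric] abs_divide)
  thus ?thesis using that R ln_mult[of "2 / R" "\<bar>x - y\<bar>"] by simp
 qed
 have "(\<lambda>j. LINT p|(M \<Otimes>\<^sub>M M'). kr (rh j) (fst p / R) (snd p / R)) \<longlonglongrightarrow> (LINT p|(M \<Otimes>\<^sub>M M'). - ln (2 / R) - log_dist p)"
 proof (rule integral_dominated_convergence[where w = "\<lambda>p. ln 4 + \<bar>ln (2 / R) + log_dist p\<bar>"])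
  show "integrable (M \<Otimes>\<^sub>M M') (\<lambda>p. ln 4 + \<bar>ln (2 / R) + log_dist p\<bar>)" using int by auto
  show "AE p in M \<Otimes>\<^sub>M M'. (\<lambda>j. kr (rh j) (fst p / R) (snd p / R)) \<longlonglongrightarrow> - ln (2 / R) - log_dist p"
   using ne
  proof eventually_elim
   case (elim p)
   hence "fst p / R \<noteq> snd p / R" using R by simp
   from kr_limit[OF this] show ?case using eq[OF elim] by simp
  qed
  show "AE p in M \<Otimes>\<^sub>M M'. norm (kr (rh j) (fst p / R) (snd p / R)) \<le> ln 4 + \<bar>ln (2 / R) + log_dist p\<bar>" for j
   using ne AEP
  proof eventually_elim
   case (elim p)
   have "\<bar>fst p / R\<bar> \<le> 1" "\<bar>snd p / R\<bar> \<le> 1" "fst p / R \<noteq> snd p / R" using R elim by auto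
   from kr_dominated[OF this, of j] show ?case using eq[OF elim(1)] by simp
  qed
  show "(\<lambda>p. kr (rh j) (fst p / R) (snd p / R)) \<in> borel_measurable (M \<Otimes>\<^sub>M M')" for j
   using kr_measurable by (simp cong: measurable_cong_sets)
  show "(\<lambda>p. - ln (2 / R) - log_dist p) \<in> borel_measurable (M \<Otimes>\<^sub>M M')" by measurable
 qed
 moreover have "(LINT p|(M \<Otimes>\<^sub>M M'). - ln (2 / R) - log_dist p) = - (LINT p|(M \<Otimes>\<^sub>M M'). log_dist p) - ln (2 / R)"
  using int P.prob_space by simp
 ultimately show ?thesis by simp
qed

text \<open>Differing Chebyshev coefficients would contribute strictly positive energy to the difference.\<close>

lemma equal_energy_unique:
 fixes M M' :: "real measure"
 assumes R: "R > 0" and M: "prob_space M" "sets M = sets borel" "AE x in M. \<bar>x\<bar> \<le> R"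
  and M': "prob_space M'" "sets M' = sets borel" "AE x in M'. \<bar>x\<bar> \<le> R"
  and MM: "integrable (M \<Otimes>\<^sub>M M) (\<lambda>p. log_dist p)" "AE p in M \<Otimes>\<^sub>M M. fst p \<noteq> snd p"
  and MM': "integrable (M \<Otimes>\<^sub>M M') (\<lambda>p. log_dist p)" "AE p in M \<Otimes>\<^sub>M M'. fst p \<noteq> snd p"
  and M'M': "integrable (M' \<Otimes>\<^sub>M M') (\<lambda>p. log_dist p)" "AE p in M' \<Otimes>\<^sub>M M'. fst p \<noteq> snd p"
  and le: "- (LINT p|(M \<Otimes>\<^sub>M M). log_dist p) + 2 * (LINT p|(M \<Otimes>\<^sub>M M'). log_dist p)
    - (LINT p|(M' \<Otimes>\<^sub>M M'). log_dist p) \<le> 0"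
 shows "M = M'"
proof (rule cheb_moments_determine_measure[OF R M M'])
 fix n
 define m where "m = (\<lambda>P n. LINT x|P. cheb n (x / R))"
 define I where "I = (\<lambda>P Q j. LINT p|(P \<Otimes>\<^sub>M Q). kr (rh j) (fst p / R) (snd p / R))"
 define \<delta> where "\<delta> = (\<lambda>n. m M n - m M' n)"
 have sums: "(\<lambda>n. 2 * rh j ^ n / real n * (\<delta> n)^2) sums (I M M j - 2 * I M M' j + I M' M' j)" for j
 proof -
  have r: "0 \<le> rh j" "rh j < 1" using rh[of j] by auto
  have s: "(\<lambda>n. 2 * rh j ^ n / real n * (m M n * m M n) - 2 * (2 * rh j ^ n / real n * (m M n * m M' n)) + 2 * rh j ^ n / real n * (m M' n * m M' n))
    sums (I M M j - 2 * I M M' j + I M' M' j)" unfolding m_def I_def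
   by (intro sums_add sums_diff sums_mult energy_sums[OF R M M r] energy_sums[OF R M M' r] energy_sums[OF R M' M' r])
  have "2 * rh j ^ n / real n * (m M n * m M n) - 2 * (2 * rh j ^ n / real n * (m M n * m M' n)) + 2 * rh j ^ n / real n * (m M' n * m M' n)
   = 2 * rh j ^ n / real n * (\<delta> n)^2" for n unfolding \<delta>_def power2_eq_square by (simp add: algebra_simps)
  thus ?thesis using s by simp
 qed
 have lim: "(\<lambda>j. I M M j - 2 * I M M' j + I M' M' j) \<longlonglongrightarrow>
   (- (LINT p|(M \<Otimes>\<^sub>M M). log_dist p) - ln (2 / R)) - 2 * (- (LINT p|(M \<Otimes>\<^sub>M M'). log_dist p) - ln (2 / R))
   + (- (LINT p|(M' \<Otimes>\<^sub>M M'). log_dist p) - ln (2 / R))" unfolding I_def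
  by (intro tendsto_add tendsto_diff tendsto_mult tendsto_const energy_limit[OF R M M MM] energy_limit[OF R M M' MM'] energy_limit[OF R M' M' M'M'])
 have "m M n = m M' n"
 proof (cases "n = 0")
  case True
  thus ?thesis using prob_space.prob_space[OF M(1)] prob_space.prob_space[OF M'(1)] by (simp add: m_def)
 next
  case False
  have "(\<lambda>j. 2 * rh j ^ n / real n * (\<delta> n)^2) \<longlonglongrightarrow> 2 * 1 ^ n / real n * (\<delta> n)^2"
   by (intro tendsto_intros rh_lim) (use False in auto)
  moreover have "2 * rh j ^ n / real n * (\<delta> n)^2 \<le> I M M j - 2 * I M M' j + I M' M' j" for j
  proof -
   have "(\<Sum>n\<in>{n}. 2 * rh j ^ n / real n * (\<delta> n)^2) \<le> (\<Sum>n. 2 * rh j ^ n / real n * (\<delta> n)^2)"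
    using sums[of j] rh[of j] by (intro sum_le_suminf) (auto simp: sums_iff)
   thus ?thesis using sums[of j] by (simp add: sums_iff)
  qed
  ultimately have "2 * 1 ^ n / real n * (\<delta> n)^2 \<le> (- (LINT p|(M \<Otimes>\<^sub>M M). log_dist p) - ln (2 / R)) - 2 * (- (LINT p|(M \<Otimes>\<^sub>M M'). log_dist p) - ln (2 / R))
   + (- (LINT p|(M' \<Otimes>\<^sub>M M'). log_dist p) - ln (2 / R))" using LIMSEQ_le[OF _ lim] by blast
  also have "\<dots> \<le> 0" using le by simp
  finally have "(\<delta> n)^2 \<le> 0" using False by (simp add: mult_le_0_iff divide_le_0_iff)
  thus ?thesis by (simp add: \<delta>_def)
 qed
 thus "(LINT x|M. cheb n (x / R)) = (LINT x|M'. cheb n (x / R))" by (simp add: m_def)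
qed

text \<open>The logarithm is bounded above on a bounded set, so only the part going to minus
  infinity can spoil integrability. As the kernel is infinite on the diagonal, finite energy also
  forces the diagonal to be a null set.\<close>

lemma log_energy_eq:
 assumes R: "R \<ge> 1" and M: "prob_space M" "sets M = sets borel" "AE x in M. \<bar>x\<bar> \<le> R"
 shows "integrable (M \<Otimes>\<^sub>M M) (\<lambda>p. log_dist p) \<Longrightarrow> AE p in M \<Otimes>\<^sub>M M. fst p \<noteq> snd p \<Longrightarrow>
   log_energy M = ereal (- (LINT p|(M \<Otimes>\<^sub>M M). log_dist p))"
  and "log_energy M < \<infinity> \<Longrightarrow> integrable (M \<Otimes>\<^sub>M M) (\<lambda>p. log_dist p) \<and> (AE p in M \<Otimes>\<^sub>M M. fst p \<noteq> snd p)"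
proof -
 interpret M: prob_space M by fact
 interpret P: pair_prob_space M M ..
 have [measurable_cong]: "sets M = sets borel" by fact
 define h where "h = (\<lambda>p::real\<times>real. if fst p = snd p then \<infinity> else ennreal (- log_dist p))"
 define g where "g = (\<lambda>p::real\<times>real. ennreal (log_dist p))"
 have hk: "e2ennreal (log_kernel x y) = h (x, y)" for x y by (simp add: log_kernel_def h_def e2ennreal_ereal e2ennreal_infty)
 have gk: "e2ennreal (- log_kernel x y) = g (x, y)" for x y by (simp add: log_kernel_def g_def e2ennreal_ereal e2ennreal_neg)
 have hm: "h \<in> borel_measurable (M \<Otimes>\<^sub>M M)" unfolding h_def by measurable
 have gm: "g \<in> borel_measurable (M \<Otimes>\<^sub>M M)" unfolding g_def by measurable
 have LE: "log_energy M = enn2ereal (\<integral>\<^sup>+p. h p \<partial>(M \<Otimes>\<^sub>M M)) - enn2ereal (\<integral>\<^sup>+p. g p \<partial>(M \<Otimes>\<^sub>M M))"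
  unfolding log_energy_def hk gk M.nn_integral_fst[OF hm] M.nn_integral_fst[OF gm] ..
 have AEP: "AE p in M \<Otimes>\<^sub>M M. \<bar>fst p\<bar> \<le> R \<and> \<bar>snd p\<bar> \<le> R"
 proof (rule P.AE_pair_measure)
  show "{p \<in> space (M \<Otimes>\<^sub>M M). \<bar>fst p\<bar> \<le> R \<and> \<bar>snd p\<bar> \<le> R} \<in> sets (M \<Otimes>\<^sub>M M)" by measurable
  show "AE x in M. AE y in M. \<bar>fst (x, y)\<bar> \<le> R \<and> \<bar>snd (x, y)\<bar> \<le> R"
   using M(3) by eventually_elim (use M(3) in \<open>auto\<close>)
 qed
 have gle: "(\<integral>\<^sup>+p. g p \<partial>(M \<Otimes>\<^sub>M M)) \<le> (\<integral>\<^sup>+p. ennreal (ln (2 * R)) \<partial>(M \<Otimes>\<^sub>M M))"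
 proof (rule nn_integral_mono_AE, use AEP in eventually_elim)
  fix p :: "real \<times> real" assume p: "\<bar>fst p\<bar> \<le> R \<and> \<bar>snd p\<bar> \<le> R"
  have "log_dist p \<le> ln (2 * R)"
  proof (cases "fst p = snd p")
   case False
   thus ?thesis using p R by (subst ln_le_cancel_iff) auto
  qed (use R in auto)
  thus "g p \<le> ennreal (ln (2 * R))" by (simp add: g_def ennreal_leI)
 qed
 hence gfin: "(\<integral>\<^sup>+p. g p \<partial>(M \<Otimes>\<^sub>M M)) < \<infinity>" using P.emeasure_space_1 by (simp add: order_le_less_trans)
 have lm: "(\<lambda>p. log_dist p) \<in> borel_measurable (M \<Otimes>\<^sub>M M)" by measurable
 {
  assume i: "integrable (M \<Otimes>\<^sub>M M) (\<lambda>p. log_dist p)" and ne: "AE p in M \<Otimes>\<^sub>M M. fst p \<noteq> snd p"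
  have "(\<integral>\<^sup>+p. h p \<partial>(M \<Otimes>\<^sub>M M)) = (\<integral>\<^sup>+p. ennreal (- log_dist p) \<partial>(M \<Otimes>\<^sub>M M))"
   by (rule nn_integral_cong_AE) (use ne in \<open>auto simp: h_def\<close>)
  moreover have fin: "(\<integral>\<^sup>+p. ennreal (- log_dist p) \<partial>(M \<Otimes>\<^sub>M M)) \<noteq> \<infinity>" "(\<integral>\<^sup>+p. g p \<partial>(M \<Otimes>\<^sub>M M)) \<noteq> \<infinity>"
   using i unfolding real_integrable_def g_def by auto
  moreover have "(LINT p|(M \<Otimes>\<^sub>M M). log_dist p) = enn2real (\<integral>\<^sup>+p. g p \<partial>(M \<Otimes>\<^sub>M M)) - enn2real (\<integral>\<^sup>+p. ennreal (- log_dist p) \<partial>(M \<Otimes>\<^sub>M M))"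
   using real_lebesgue_integral_def[OF i] by (simp add: g_def)
  ultimately show "log_energy M = ereal (- (LINT p|(M \<Otimes>\<^sub>M M). log_dist p))" unfolding LE
   by (cases "\<integral>\<^sup>+p. g p \<partial>(M \<Otimes>\<^sub>M M)"; cases "\<integral>\<^sup>+p. ennreal (- log_dist p) \<partial>(M \<Otimes>\<^sub>M M)") (auto simp: enn2ereal_ennreal)
 next
  assume fin: "log_energy M < \<infinity>"
  have hfin: "(\<integral>\<^sup>+p. h p \<partial>(M \<Otimes>\<^sub>M M)) \<noteq> \<infinity>"
  proof
   assume "(\<integral>\<^sup>+p. h p \<partial>(M \<Otimes>\<^sub>M M)) = \<infinity>"
   thus False using fin gfin unfolding LE
    by (cases "\<integral>\<^sup>+p. g p \<partial>(M \<Otimes>\<^sub>M M)") (auto simp: enn2ereal_ennreal)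
  qed
  have "AE p in M \<Otimes>\<^sub>M M. h p \<noteq> \<infinity>" by (rule nn_integral_PInf_AE[OF hm]) (use hfin in auto)
  hence ne: "AE p in M \<Otimes>\<^sub>M M. fst p \<noteq> snd p" by eventually_elim (auto simp: h_def split: if_splits)
  have "(\<integral>\<^sup>+p. ennreal (- log_dist p) \<partial>(M \<Otimes>\<^sub>M M)) = (\<integral>\<^sup>+p. h p \<partial>(M \<Otimes>\<^sub>M M))"
   by (rule nn_integral_cong_AE) (use ne in \<open>auto simp: h_def\<close>)
  hence "integrable (M \<Otimes>\<^sub>M M) (\<lambda>p. log_dist p)"
   unfolding real_integrable_def using hfin gfin lm by (auto simp: g_def)
  thus "integrable (M \<Otimes>\<^sub>M M) (\<lambda>p. log_dist p) \<and> (AE p in M \<Otimes>\<^sub>M M. fst p \<noteq> snd p)" using ne by simp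
 }
qed

subsection \<open>The density of states\<close>

lemma AE_arc_cos_neq: "AE t in arcm. X \<noteq> cos t" using AE_arc AE_arc_neq[of "arccos X"]
proof eventually_elim
 case (elim t)
 thus ?case using arccos_cos[of t] by auto
qed

text \<open>The real part of the geometric series of the point with modulus \<open>\<rho>\<close>
  and argument \<open>t\<close> has mean one. It equals 1/2 plus \<open>(1 - \<rho>^2) / 2\<close>
  times the integrand.\<close>

lemma poisson_arc:
 assumes "0 \<le> \<rho>" "\<rho> < 1"
 shows "(LINT t|arcm. 1 / (1 - 2 * \<rho> * cos t + \<rho>^2)) = 1 / (1 - \<rho>^2)"
  and "integrable arcm (\<lambda>t. 1 / (1 - 2 * \<rho> * cos t + \<rho>^2))"
  and "1 - 2 * \<rho> * cos t + \<rho>^2 > 0"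
proof -
 interpret prob_space arcm by (rule prob_arc)
 have Q: "1 - 2 * \<rho> * cos t + \<rho>^2 \<ge> (1 - \<rho>)^2" for t
  using mult_left_mono[of "cos t" 1 \<rho>] assms by (simp add: power2_eq_square algebra_simps)
 have p: "(1 - \<rho>)^2 > 0" using assms by simp
 show Qp: "1 - 2 * \<rho> * cos t + \<rho>^2 > 0" for t using Q[of t] p by linarith
 show int: "integrable arcm (\<lambda>t. 1 / (1 - 2 * \<rho> * cos t + \<rho>^2))"
 proof (rule integrable_const_bound[of _ "1 / (1 - \<rho>)^2"])
  have "norm (1 / (1 - 2 * \<rho> * cos t + \<rho>^2)) \<le> 1 / (1 - \<rho>)^2" for t
   using Q[of t] p Qp[of t] by (auto simp: abs_of_pos intro!: divide_left_mono mult_pos_pos)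
  thus "AE t in arcm. norm (1 / (1 - 2 * \<rho> * cos t + \<rho>^2)) \<le> 1 / (1 - \<rho>)^2" by simp
 qed measurable
 define f where "f = (\<lambda>n t. \<rho> ^ n * cos (real n * t))"
 have fb: "\<bar>f n t\<bar> \<le> \<rho> ^ n" for n t
  using mult_left_mono[of "\<bar>cos (real n * t)\<bar>" 1 "\<rho> ^ n"] assms by (simp add: f_def abs_mult)
 have fi: "integrable arcm (f n)" for n by (rule integrable_const_bound[of _ "\<rho> ^ n"]) (use fb in \<open>auto simp: f_def\<close>)
 have sg: "summable (\<lambda>n. \<rho> ^ n)" using assms by (intro summable_geometric) auto
 have sums: "(\<lambda>n. f n t) sums ((1 - \<rho> * cos t) / (1 - 2 * \<rho> * cos t + \<rho>^2))" for t
 proof -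
  define z where "z = complex_of_real \<rho> * cis t"
  have "norm z < 1" using assms by (simp add: z_def norm_mult)
  hence "(\<lambda>n. z ^ n) sums (1 / (1 - z))" by (rule geometric_sums)
  hence "(\<lambda>n. Re (z ^ n)) sums Re (1 / (1 - z))" by (rule sums_Re)
  moreover have "Re (z ^ n) = f n t" for n unfolding z_def f_def power_mult_distrib Complex.DeMoivre of_real_power[symmetric] by simp
  moreover have "Re (1 / (1 - z)) = (1 - \<rho> * cos t) / (1 - 2 * \<rho> * cos t + \<rho>^2)"
  proof -
   have "(1 - \<rho> * cos t)^2 + (\<rho> * sin t)^2 = 1 - 2 * \<rho> * cos t + \<rho>^2 * ((sin t)^2 + (cos t)^2)"
    unfolding power2_eq_square by algebra
   thus ?thesis by (simp add: z_def Re_divide)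
  qed
  ultimately show ?thesis by simp
 qed
 have "(\<lambda>n. LINT t|arcm. f n t) sums (LINT t|arcm. (\<Sum>n. f n t))"
 proof (rule sums_integral[OF fi])
  have "summable (\<lambda>n. norm (f n t))" for t by (rule summable_comparison_test'[OF sg, of 0]) (use fb in auto)
  thus "AE t in arcm. summable (\<lambda>n. norm (f n t))" by simp
  show "summable (\<lambda>n. LINT t|arcm. norm (f n t))"
  proof (rule summable_comparison_test'[OF sg, of 0])
   fix n
   have "(LINT t|arcm. norm (f n t)) \<le> (LINT t|arcm. \<rho> ^ n)" using fb fi by (intro integral_mono) auto
   thus "norm (LINT t|arcm. norm (f n t)) \<le> \<rho> ^ n" using prob_space by simp
  qed
 qed
 moreover have "(LINT t|arcm. f n t) = (if n = 0 then 1 else 0)" for n using integral_cos_arc[of n] prob_space by (auto simp: f_def)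
 ultimately have "(\<lambda>n::nat. if n = 0 then 1 else 0) sums (LINT t|arcm. (1 - \<rho> * cos t) / (1 - 2 * \<rho> * cos t + \<rho>^2))"
  using sums by (simp add: sums_iff)
 moreover have "(\<lambda>n::nat. if n = 0 then 1 else 0 :: real) sums 1" using sums_single[of 0 "\<lambda>_. 1::real"] by simp
 ultimately have "(LINT t|arcm. (1 - \<rho> * cos t) / (1 - 2 * \<rho> * cos t + \<rho>^2)) = 1" using sums_unique2 by blast
 moreover have "(1 - \<rho> * cos t) / (1 - 2 * \<rho> * cos t + \<rho>^2) = 1 / 2 + (1 - \<rho>^2) / 2 * (1 / (1 - 2 * \<rho> * cos t + \<rho>^2))" for t
 proof -
  have "1 - \<rho> * cos t = (1 - 2 * \<rho> * cos t + \<rho>^2) / 2 + (1 - \<rho>^2) / 2" by (simp add: field_simps)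
  hence "(1 - \<rho> * cos t) / (1 - 2 * \<rho> * cos t + \<rho>^2) = ((1 - 2 * \<rho> * cos t + \<rho>^2) / 2 + (1 - \<rho>^2) / 2) / (1 - 2 * \<rho> * cos t + \<rho>^2)"
   by simp
  moreover have "(q / 2 + c / 2) / q = 1 / 2 + c / 2 * (1 / q)" if "q > 0" for q c :: real using that by (simp add: field_simps)
  ultimately show ?thesis using Qp[of t] by (simp only:)
 qed
 ultimately have "1 / 2 + (1 - \<rho>^2) / 2 * (LINT t|arcm. 1 / (1 - 2 * \<rho> * cos t + \<rho>^2)) = 1"
  using int prob_space by (simp only: Bochner_Integration.integral_add integral_mult_right_zero integrable_const integrable_mult_right) simp
 moreover have "1 - \<rho>^2 \<noteq> 0" using assms by (simp add: power2_eq_1_iff)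
 ultimately show "(LINT t|arcm. 1 / (1 - 2 * \<rho> * cos t + \<rho>^2)) = 1 / (1 - \<rho>^2)" by (simp add: field_simps)
qed

context discriminant_poly
begin

definition bandpt :: "real \<Rightarrow> real \<Rightarrow> real" where "bandpt r t = xi r (2 * cos t)"

text \<open>Up to the factor \<open>1 / (real N * pi)\<close> this is the modulus of the derivative
  of \<open>arccos (D x / 2)\<close>, the angle \<open>t\<close> with
  \<open>D x = 2 cos t\<close>.\<close>

definition dos_density :: "real \<Rightarrow> real" where
 "dos_density x = (if \<bar>poly D x\<bar> < 2 then \<bar>poly (pderiv D) x\<bar> / (real N * pi * sqrt (4 - (poly D x)^2)) else 0)"

definition dos :: "real measure" where "dos = density lborel (\<lambda>x. ennreal (dos_density x))"

lemma sets_dos [measurable_cong, simp]: "sets dos = sets borel" by (simp add: dos_def)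

lemma space_dos [simp]: "space dos = UNIV" by (simp add: dos_def)

lemma dos_density_nonneg [simp]: "dos_density x \<ge> 0" using abs_le_square_iff[of "poly D x" 2] by (auto simp: dos_density_def)

lemma dos_density_pos: "x \<in> Lam \<Longrightarrow> dos_density x > 0"
proof -
 assume "x \<in> Lam"
 hence l: "\<bar>poly D x\<bar> < 2" by (simp add: Lam_def)
 hence "(poly D x)^2 < 2^2" using abs_less_iff power2_strict_mono[of "poly D x" 2] by simp
 thus ?thesis using l deriv_nonzero[OF l] N by (simp add: dos_density_def)
qed

lemma cont_poly [simp]: "continuous_on A (poly D)" "continuous_on A (poly (pderiv D))" for A :: "real set" by (intro continuous_intros)+

lemma measurable_poly [measurable]: "poly D \<in> borel_measurable borel" "poly (pderiv D) \<in> borel_measurable borel"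
 by (intro borel_measurable_continuous_onI cont_poly)+

lemma dos_density_measurable [measurable]: "dos_density \<in> borel_measurable borel" unfolding dos_density_def by measurable

lemma open_Lam: "open Lam" unfolding Lam_def by (intro open_Collect_less continuous_intros)

lemma bandpt_continuous: "r \<in> Z \<Longrightarrow> continuous_on UNIV (bandpt r)"
proof -
 assume r: "r \<in> Z"
 have "(\<lambda>t. 2 * cos t) ` UNIV \<subseteq> {-2..2::real}" using cos_le_one cos_ge_minus_one by (auto simp: image_subset_iff)
 hence "continuous_on UNIV (\<lambda>t. xi r (2 * cos t))" by (intro continuous_on_compose2[OF continuous_xi[OF r]] continuous_intros)
 thus ?thesis by (simp add: bandpt_def[abs_def])
qed

lemma bandpt_measurable: "r \<in> Z \<Longrightarrow> bandpt r \<in> borel_measurable borel"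
 by (intro borel_measurable_continuous_onI bandpt_continuous)

lemma cos_arc_range: "0 < t \<Longrightarrow> t < pi \<Longrightarrow> 2 * cos t \<in> {-2<..<2::real}"
 using cos_monotone_0_pi[of 0 t] cos_monotone_0_pi[of t pi] by auto

lemma bandpt_band: "r \<in> Z \<Longrightarrow> 0 < t \<Longrightarrow> t < pi \<Longrightarrow> bandpt r t \<in> band r"
 unfolding bandpt_def by (intro xi_band cos_arc_range)

lemma D_bandpt: "r \<in> Z \<Longrightarrow> poly D (bandpt r t) = 2 * cos t" unfolding bandpt_def by (intro xi(2)) auto

text \<open>Change of variables by \<open>arccos (D x / 2)\<close>, which on a band is injective
  with inverse \<open>bandpt r\<close>.\<close>

lemma band_measure:
 assumes r: "r \<in> Z" and B: "B \<in> sets borel" "B \<subseteq> band r"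
 shows "(\<integral>\<^sup>+x. ennreal (real N * pi * dos_density x) * indicator B x \<partial>lborel) = emeasure lborel ({0<..<pi} \<inter> bandpt r -` B)"
proof -
 define T where "T = {0<..<pi} \<inter> bandpt r -` B"
 define g where "g = (\<lambda>x. arccos (poly D x / 2))"
 define g' where "g' = (\<lambda>x. inverse (- sqrt (1 - (poly D x / 2)^2)) * (poly (pderiv D) x / 2))"
 have lt: "\<bar>poly D x\<bar> < 2" if "x \<in> B" for x using band(5)[OF r] B(2) that by blast
 have der: "(g has_field_derivative g' x) (at x within B)" if "x \<in> B" for x
 proof -
  have "-1 < poly D x / 2" "poly D x / 2 < 1" using lt[OF that] by auto
  from DERIV_chain2[OF DERIV_arccos[OF this] DERIV_cdivide[OF poly_DERIV]]
  show ?thesis unfolding g_def g'_def by (rule DERIV_subset) simp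
 qed
 have abs_g': "\<bar>g' x\<bar> = real N * pi * dos_density x" if "x \<in> B" for x
 proof -
  have "2 * sqrt (1 - (poly D x / 2)^2) = sqrt (4 * (1 - (poly D x / 2)^2))" unfolding real_sqrt_mult by simp
  also have "4 * (1 - (poly D x / 2)^2) = 4 - (poly D x)^2" by (simp add: power_divide)
  finally have s: "sqrt (4 - (poly D x)^2) = 2 * sqrt (1 - (poly D x / 2)^2)" by simp
  have "(poly D x / 2)^2 \<le> 1" using lt[OF that] by (simp add: abs_square_le_1)
  then obtain u where u: "sqrt (1 - (poly D x / 2)^2) = u" "u \<ge> 0" by simp
  have "dos_density x = \<bar>poly (pderiv D) x\<bar> / (real N * pi * (2 * u))"
   unfolding dos_density_def s u(1) using lt[OF that] by (rule if_P)
  moreover have "\<bar>g' x\<bar> = \<bar>poly (pderiv D) x\<bar> / (2 * u)"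
  proof -
   have "\<bar>inverse (- v) * (p / 2)\<bar> = \<bar>p\<bar> / (2 * v)" if "v \<ge> 0" for v p :: real
    using that by (simp add: abs_mult inverse_eq_divide)
   thus ?thesis using u(2) unfolding g'_def u(1) by blast
  qed
  moreover have "a / b = c * pi * (a / (c * pi * b))" if "c \<noteq> 0" for a b c :: real using that by simp
  ultimately show ?thesis using N by simp
 qed
 have bandsub: "band r \<subseteq> {lo r..hi r}" by (auto simp: band_def)
 have inj: "inj_on g B"
 proof (rule inj_onI)
  fix x y assume xy: "x \<in> B" "y \<in> B" "g x = g y"
  hence "cos (arccos (poly D x / 2)) = cos (arccos (poly D y / 2))" by (simp add: g_def)
  hence "poly D x = poly D y" using lt[OF xy(1)] lt[OF xy(2)] by (simp add: cos_arccos_abs)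
  thus "x = y" using inj_band[OF r] xy B(2) bandsub by (auto dest: inj_onD)
 qed
 have img: "g ` B = T"
 proof (intro equalityI subsetI)
  fix t assume "t \<in> g ` B"
  then obtain x where x: "x \<in> B" "t = arccos (poly D x / 2)" by (auto simp: g_def)
  have r1: "-1 < poly D x / 2" "poly D x / 2 < 1" using lt[OF x(1)] by auto
  have "2 * cos t = poly D x" using r1 by (simp add: x(2))
  hence "bandpt r t = x" unfolding bandpt_def using xi_D[OF r] x(1) B(2) bandsub by auto
  thus "t \<in> T" using arccos_lt_bounded[OF r1] x(1) by (simp add: T_def x(2))
 next
  fix t assume t: "t \<in> T"
  have "g (bandpt r t) = t" unfolding g_def D_bandpt[OF r] using t by (simp add: T_def arccos_cos)
  thus "t \<in> g ` B" using t by (auto simp: T_def intro!: image_eqI[of _ _ "bandpt r t"])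
 qed
 have Tb: "T \<in> sets borel" unfolding T_def using measurable_sets_borel[OF bandpt_measurable[OF r] B(1)] by auto
 have "emeasure lborel T \<le> emeasure lborel {0<..<pi}" unfolding T_def by (intro emeasure_mono) auto
 hence fin: "emeasure lborel T < \<infinity>" by (simp add: order_le_less_trans)
 hence Tl: "T \<in> lmeasurable" using Tb by (simp add: fmeasurable_def)
 have "(\<lambda>x. 1::real) absolutely_integrable_on g ` B" "integral (g ` B) (\<lambda>x. 1::real) = measure lebesgue T"
  unfolding img using Tl by (auto simp: lmeasure_integral absolutely_integrable_on_const)
 hence "(\<lambda>x. \<bar>g' x\<bar> * (\<lambda>_. 1) (g x)) absolutely_integrable_on B \<and> integral B (\<lambda>x. \<bar>g' x\<bar> * (\<lambda>_. 1) (g x)) = measure lebesgue T"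
  using has_absolute_integral_change_of_variables_1'[of B g g' "\<lambda>_. 1" "measure lebesgue T"] der inj B(1) by simp
 hence "(\<lambda>x. \<bar>g' x\<bar>) absolutely_integrable_on B" "integral B (\<lambda>x. \<bar>g' x\<bar>) = measure lebesgue T" by simp_all
 hence "((\<lambda>x. \<bar>g' x\<bar>) has_integral measure lebesgue T) B"
  using set_lebesgue_integral_eq_integral(1) by (auto simp: has_integral_iff)
 hence hi: "((\<lambda>x. real N * pi * dos_density x) has_integral measure lebesgue T) B"
  by (rule has_integral_eq[rotated]) (simp add: abs_g')
 have "(\<integral>\<^sup>+x. indicator B x * (real N * pi * dos_density x) \<partial>lborel) = measure lebesgue T"
  by (rule nn_integral_has_integral_lebesgue[OF _ hi]) simp
 moreover have "ennreal (indicator B x * (real N * pi * dos_density x)) = ennreal (real N * pi * dos_density x) * indicator B x" for x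
  by (simp split: split_indicator)
 moreover have "ennreal (measure lebesgue T) = emeasure lborel T" using fin Tb by (simp add: emeasure_eq_ennreal_measure)
 ultimately show ?thesis by (simp add: T_def)
qed

lemma band_distr:
 assumes r: "r \<in> Z"
 shows "density lborel (\<lambda>x. ennreal (real N * dos_density x * indicator (band r) x)) = distr arcm borel (bandpt r)" (is "?P = ?Q")
proof (rule measure_eqI)
 fix A assume "A \<in> sets ?P"
 hence A: "A \<in> sets borel" by simp
 have bb: "band r \<in> sets borel" by (simp add: band_def)
 have m: "bandpt r \<in> borel_measurable arcm" using bandpt_measurable[OF r] measurable_cong_sets[OF sets_arc refl] by blast
 have mb: "(\<lambda>x. ennreal (real N * dos_density x * indicator (band r) x)) \<in> borel_measurable borel" using bb by measurable
 have "ennreal (real N * dos_density x * indicator (band r) x) * indicator A x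
   = ennreal (1 / pi) * (ennreal (real N * pi * dos_density x) * indicator (A \<inter> band r) x)" for x
  by (auto simp: indicator_def ennreal_mult[symmetric] simp del: ennreal_mult')
 hence "emeasure ?P A = (\<integral>\<^sup>+x. ennreal (1 / pi) * (ennreal (real N * pi * dos_density x) * indicator (A \<inter> band r) x) \<partial>lborel)"
  using A mb by (simp add: emeasure_density)
 also have "\<dots> = ennreal (1 / pi) * emeasure lborel ({0<..<pi} \<inter> bandpt r -` (A \<inter> band r))"
  using A bb by (subst nn_integral_cmult) (auto simp: band_measure[OF r])
 also have "{0<..<pi} \<inter> bandpt r -` (A \<inter> band r) = {0<..<pi} \<inter> bandpt r -` A" using bandpt_band[OF r] by auto
 also have "ennreal (1 / pi) * emeasure lborel ({0<..<pi} \<inter> bandpt r -` A) = emeasure arcm (bandpt r -` A)"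
  unfolding arcm_def using measurable_sets_borel[OF bandpt_measurable[OF r] A]
  by (subst emeasure_uniform_measure) (auto simp: divide_ennreal_def inverse_ennreal inverse_eq_divide mult.commute)
 also have "\<dots> = emeasure ?Q A" using A m by (simp add: emeasure_distr)
 finally show "emeasure ?P A = emeasure ?Q A" .
qed simp

text \<open>Integrals against the density of states become averages over angles of sums over the
  bands. For a fixed angle the sum runs over all roots of one polynomial, where
  \<open>factorization\<close> can be used.\<close>

lemma dos_integral:
 fixes f :: "real \<Rightarrow> real"
 assumes f [measurable]: "f \<in> borel_measurable borel" and i: "\<And>r. r \<in> Z \<Longrightarrow> integrable arcm (\<lambda>t. f (bandpt r t))"
 shows "integrable dos f" "(LINT x|dos. f x) = (\<Sum>r\<in>Z. LINT t|arcm. f (bandpt r t)) / real N"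
proof -
 define d where "d = (\<lambda>r x. real N * dos_density x * indicator (band r) x)"
 have bb [measurable]: "band r \<in> sets borel" for r by (simp add: band_def)
 have dm [measurable]: "d r \<in> borel_measurable borel" for r unfolding d_def by measurable
 have d0: "d r x \<ge> 0" for r x by (simp add: d_def)
 have *: "integrable lborel (\<lambda>x. d r x * f x) \<and> (LINT x|lborel. d r x * f x) = (LINT t|arcm. f (bandpt r t))" if r: "r \<in> Z" for r
 proof -
  have m: "bandpt r \<in> measurable arcm borel" using bandpt_measurable[OF r] measurable_cong_sets[OF sets_arc refl] by blast
  have eq: "density lborel (\<lambda>x. ennreal (d r x)) = distr arcm borel (bandpt r)" unfolding d_def by (rule band_distr[OF r])
  have "integrable (distr arcm borel (bandpt r)) f" using i[OF r] integrable_distr_eq[OF m f] by simp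
  hence "integrable lborel (\<lambda>x. d r x * f x)" unfolding eq[symmetric] using d0 by (subst (asm) integrable_real_density) auto
  moreover have "(LINT x|distr arcm borel (bandpt r). f x) = (LINT t|arcm. f (bandpt r t))" by (rule integral_distr[OF m f])
  hence "(LINT x|lborel. d r x * f x) = (LINT t|arcm. f (bandpt r t))"
   unfolding eq[symmetric] using d0 by (subst (asm) integral_real_density) auto
  ultimately show ?thesis by simp
 qed
 have sum: "(\<Sum>r\<in>Z. d r x * f x) = real N * (dos_density x * f x)" for x
 proof -
  have "(\<Sum>r\<in>Z. indicator (band r) x) = (indicator (\<Union>r\<in>Z. band r) x :: real)"
   using finite_Z bands_disjoint by (intro indicator_UN_disjoint[symmetric]) (auto simp: disjoint_family_on_def)
  hence "(\<Sum>r\<in>Z. d r x) = real N * dos_density x * indicator Lam x" unfolding d_def sum_distrib_left[symmetric] Lam_eq by simp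
  moreover have "dos_density x * indicator Lam x = dos_density x" by (auto simp: dos_density_def Lam_def indicator_def)
  ultimately show ?thesis by (simp add: sum_distrib_right[symmetric] mult.assoc)
 qed
 have I: "integrable lborel (\<lambda>x. \<Sum>r\<in>Z. d r x * f x)" using * by (intro Bochner_Integration.integrable_sum) auto
 hence "integrable lborel (\<lambda>x. dos_density x * f x)" unfolding sum using N by simp
 thus "integrable dos f" unfolding dos_def by (subst integrable_real_density) auto
 have "(LINT x|dos. f x) = (LINT x|lborel. dos_density x * f x)" unfolding dos_def by (subst integral_real_density) auto
 also have "\<dots> = (LINT x|lborel. (\<Sum>r\<in>Z. d r x * f x)) / real N" unfolding sum using N by simp
 also have "(LINT x|lborel. (\<Sum>r\<in>Z. d r x * f x)) = (\<Sum>r\<in>Z. LINT t|arcm. f (bandpt r t))"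
  using * by (subst Bochner_Integration.integral_sum) auto
 finally show "(LINT x|dos. f x) = (\<Sum>r\<in>Z. LINT t|arcm. f (bandpt r t)) / real N" .
qed

lemma prob_dos: "prob_space dos"
proof
 have i: "integrable arcm (\<lambda>t. 1::real)" by (rule finite_measure.integrable_const) (simp add: prob_space.finite_measure prob_arc)
 have "integrable dos (\<lambda>_. 1::real)" "(LINT x|dos. 1::real) = (\<Sum>r\<in>Z. LINT t|arcm. 1::real) / real N"
  using dos_integral[of "\<lambda>_. 1"] i by auto
 moreover have "(LINT t|arcm. 1::real) = 1" using prob_space.prob_space[OF prob_arc] by simp
 ultimately have "(\<integral>\<^sup>+x. ennreal 1 \<partial>dos) = ennreal 1"
  using nn_integral_eq_integral[of dos "\<lambda>_. 1"] N card_Z by simp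
 thus "emeasure dos (space dos) = 1" by simp
qed

lemma AE_dos_Lam: "AE x in dos. x \<in> Lam" unfolding dos_def by (subst AE_density) (auto simp: dos_density_def Lam_def)

lemma AE_dos_neq: "AE x in dos. x \<noteq> c" unfolding dos_def using AE_lborel_singleton[of c] by (subst AE_density) auto

lemma bounded_set: "\<exists>R\<ge>1. \<forall>x. \<bar>poly D x\<bar> \<le> 2 \<longrightarrow> \<bar>x\<bar> \<le> R"
proof -
 obtain R where R: "R > 0" "\<And>x. R \<le> \<bar>x\<bar> \<Longrightarrow> \<bar>poly D x\<bar> > 2" using large_outside[of 2] by auto
 have "\<bar>x\<bar> \<le> max 1 R" if "\<bar>poly D x\<bar> \<le> 2" for x using R(2)[of x] that by (cases "R \<le> \<bar>x\<bar>") auto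
 thus ?thesis by (intro exI[of _ "max 1 R"]) auto
qed

lemma potential:
 assumes X: "\<bar>poly D x\<bar> \<le> 2"
 shows "integrable dos (\<lambda>y. ln \<bar>x - y\<bar>)" "(LINT y|dos. ln \<bar>x - y\<bar>) = - ln L / real N"
proof -
 interpret prob_space arcm by (rule prob_arc)
 obtain R where R: "R \<ge> 1" "\<And>x. \<bar>poly D x\<bar> \<le> 2 \<Longrightarrow> \<bar>x\<bar> \<le> R" using bounded_set by blast
 define h where "h = (\<lambda>r t. ln \<bar>x - bandpt r t\<bar>)"
 define G where "G = (\<lambda>t. ln (2 * \<bar>poly D x / 2 - cos t\<bar>))"
 define M where "M = ln (2 * R)"
 have M0: "M \<ge> 0" using R(1) by (simp add: M_def)
 have G: "integrable arcm G" "(LINT t|arcm. G t) = 0" unfolding G_def using log_arc[of "poly D x / 2"] X by auto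
 have hm: "h r \<in> borel_measurable arcm" if "r \<in> Z" for r
  using bandpt_measurable[OF that] unfolding h_def by (simp cong: measurable_cong_sets)
 have hM: "h r t \<le> M" if "r \<in> Z" for r t
 proof (cases "x = bandpt r t")
  case False
  have "\<bar>poly D (bandpt r t)\<bar> \<le> 2" unfolding D_bandpt[OF that] by (simp add: abs_mult)
  hence "\<bar>x - bandpt r t\<bar> \<le> 2 * R" using R(2)[OF X] R(2)[of "bandpt r t"] by linarith
  thus ?thesis unfolding h_def M_def using False R(1) by (subst ln_le_cancel_iff) auto
 qed (use M0 in \<open>simp add: h_def\<close>)
 have sum: "AE t in arcm. (\<Sum>r\<in>Z. h r t) = G t - ln L" using AE_arc AE_arc_cos_neq[of "poly D x / 2"]
 proof eventually_elim
  case (elim t)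
  have w: "2 * cos t \<in> {-2<..<2}" using elim by (intro cos_arc_range) auto
  have f: "poly D x - 2 * cos t = L * (\<Prod>r\<in>Z. x - bandpt r t)" unfolding bandpt_def by (rule factorization[OF w])
  have ne: "poly D x - 2 * cos t \<noteq> 0" using elim by auto
  hence nz: "x - bandpt r t \<noteq> 0" if "r \<in> Z" for r using f that finite_Z by auto
  have "2 * \<bar>poly D x / 2 - cos t\<bar> = \<bar>poly D x - 2 * cos t\<bar>" by (simp add: abs_if)
  also have "\<dots> = L * (\<Prod>r\<in>Z. \<bar>x - bandpt r t\<bar>)" unfolding f abs_mult abs_prod using L by simp
  finally have "G t = ln (L * (\<Prod>r\<in>Z. \<bar>x - bandpt r t\<bar>))" by (simp add: G_def)
  also have "\<dots> = ln L + ln (\<Prod>r\<in>Z. \<bar>x - bandpt r t\<bar>)" using L nz by (intro ln_mult_pos prod_pos) auto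
  also have "ln (\<Prod>r\<in>Z. \<bar>x - bandpt r t\<bar>) = (\<Sum>r\<in>Z. h r t)" unfolding h_def using finite_Z nz by (intro ln_prod) auto
  finally show ?case by simp
 qed
 \<comment> \<open>Only the sum of the \<open>h r\<close> is known to be integrable. Since each is
   bounded above by \<open>M\<close>, each is also bounded below by the sum minus a
   constant.\<close>
 have hi: "integrable arcm (h r)" if r: "r \<in> Z" for r
 proof (rule Bochner_Integration.integrable_bound[of _ "\<lambda>t. \<bar>G t\<bar> + (\<bar>ln L\<bar> + real N * M + M)"])
  show "integrable arcm (\<lambda>t. \<bar>G t\<bar> + (\<bar>ln L\<bar> + real N * M + M))" using G(1) by auto
  show "AE t in arcm. norm (h r t) \<le> norm (\<bar>G t\<bar> + (\<bar>ln L\<bar> + real N * M + M))" using sum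
  proof eventually_elim
   case (elim t)
   have "(\<Sum>s\<in>Z. h s t) = h r t + (\<Sum>s\<in>Z - {r}. h s t)" by (rule sum.remove[OF finite_Z r])
   moreover have "(\<Sum>s\<in>Z - {r}. h s t) \<le> (\<Sum>s\<in>Z - {r}. M)" by (intro sum_mono hM) auto
   moreover have "(\<Sum>s\<in>Z - {r}. M) \<le> (\<Sum>s\<in>Z. M)" using finite_Z M0 by (intro sum_mono2) auto
   moreover have "(\<Sum>s\<in>Z. M) = real N * M" by (simp add: card_Z)
   ultimately have "h r t \<ge> G t - ln L - real N * M" using elim by linarith
   moreover have "0 \<le> real N * M" using M0 by simp
   ultimately show ?case using hM[OF r, of t] M0 unfolding real_norm_def by arith
  qed
 qed (rule hm[OF r])
 have fm: "(\<lambda>y. ln \<bar>x - y\<bar>) \<in> borel_measurable borel" by measurable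
 show "integrable dos (\<lambda>y. ln \<bar>x - y\<bar>)" by (rule dos_integral(1)[OF fm]) (use hi in \<open>simp add: h_def\<close>)
 have "(LINT y|dos. ln \<bar>x - y\<bar>) = (\<Sum>r\<in>Z. LINT t|arcm. h r t) / real N"
  unfolding h_def by (rule dos_integral(2)[OF fm]) (use hi in \<open>simp add: h_def\<close>)
 also have "(\<Sum>r\<in>Z. LINT t|arcm. h r t) = (LINT t|arcm. (\<Sum>r\<in>Z. h r t))" using hi by (subst Bochner_Integration.integral_sum) auto
 also have "\<dots> = (LINT t|arcm. G t - ln L)" using sum hm G(1) by (intro integral_cong_AE) auto
 also have "\<dots> = - ln L" using G prob_space by simp
 finally show "(LINT y|dos. ln \<bar>x - y\<bar>) = - ln L / real N" .
qed

text \<open>The logarithmic derivative of the factorisation gives the sum of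
  \<open>1 / (z - xi r w)\<close> as \<open>D' / (D - w)\<close>. With \<open>w = 2 cos t\<close>,
  \<open>D z = \<nu> + 1 / \<nu>\<close> and \<open>\<rho> = 1 / \<nu>\<close> the average over
  \<open>t\<close> is that of the Poisson kernel. Real \<open>z\<close> to the right of the bands
  are enough for comparing expansions in \<open>1 / z\<close>.\<close>

lemma stieltjes_dos:
 "\<exists>R>0. (\<forall>x. \<bar>poly D x\<bar> \<le> 2 \<longrightarrow> \<bar>x\<bar> \<le> R) \<and> (\<forall>z>R. \<forall>\<nu>>1. poly D z = \<nu> + 1 / \<nu> \<longrightarrow>
   (LINT x|dos. 1 / (z - x)) = poly (pderiv D) z / (real N * (\<nu> - 1 / \<nu>))) \<and> (\<forall>z>R. poly D z > 2)"
proof -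
 obtain R where R: "R > 0" "\<And>x. R \<le> \<bar>x\<bar> \<Longrightarrow> \<bar>poly D x\<bar> > 2" using large_outside[of 2] by auto
 have R2: "\<bar>x\<bar> < R" if "\<bar>poly D x\<bar> \<le> 2" for x using R(2)[of x] that by (cases "R \<le> \<bar>x\<bar>") auto
 have xiR: "xi r w < R" if "r \<in> Z" "w \<in> {-2..2}" for r w using R2[of "xi r w"] xi(2)[OF that] that by (auto simp: abs_le_iff)
 have Dpos: "poly D z > 2" if "z > R" for z
 proof -
  have "poly D z - 0 = L * (\<Prod>r\<in>Z. z - xi r 0)" by (rule factorization) simp
  moreover have "(\<Prod>r\<in>Z. z - xi r 0) > 0" proof (intro prod_pos)
   fix r assume "r \<in> Z"
   hence "xi r 0 < R" by (intro xiR) auto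
   thus "0 < z - xi r 0" using that by simp
  qed
  ultimately have "poly D z > 0" using L by simp
  thus ?thesis using R(2)[of z] that R(1) by auto
 qed
 have log_deriv: "(\<Sum>r\<in>Z. 1 / (z - xi r w)) = poly (pderiv D) z / (poly D z - w)" if z: "z > R" and w: "w \<in> {-2<..<2}" for z w
 proof -
  have pos: "x - xi r w > 0" if "x > R" "r \<in> Z" for x r using xiR[of r w] w that by auto
  have "((\<lambda>x. ln L + (\<Sum>r\<in>Z. ln (x - xi r w))) has_field_derivative (\<Sum>r\<in>Z. 1 / (z - xi r w))) (at z)"
   using pos[OF z] by (auto intro!: derivative_eq_intros DERIV_sum simp: divide_inverse)
  hence "((\<lambda>x. ln (poly D x - w)) has_field_derivative (\<Sum>r\<in>Z. 1 / (z - xi r w))) (at z)"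
  proof (rule has_field_derivative_transform_within_open[of _ _ _ "{R<..}"])
   fix x assume x: "x \<in> {R<..}"
   have "ln (poly D x - w) = ln (L * (\<Prod>r\<in>Z. x - xi r w))" using factorization[OF w, of x] by simp
   also have "\<dots> = ln L + ln (\<Prod>r\<in>Z. x - xi r w)" using L pos x by (intro ln_mult_pos prod_pos) auto
   also have "ln (\<Prod>r\<in>Z. x - xi r w) = (\<Sum>r\<in>Z. ln (x - xi r w))" using finite_Z pos x by (intro ln_prod) auto
   finally show "ln L + (\<Sum>r\<in>Z. ln (x - xi r w)) = ln (poly D x - w)" by simp
  qed (use z in auto)
  moreover have "((\<lambda>x. ln (poly D x - w)) has_field_derivative (1 / (poly D z - w) * poly (pderiv D) z)) (at z)"
   using Dpos[OF z] w by (auto intro!: derivative_eq_intros poly_DERIV simp: divide_inverse)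
  ultimately show ?thesis using DERIV_unique by fastforce
 qed
 have main: "(LINT x|dos. 1 / (z - x)) = poly (pderiv D) z / (real N * (\<nu> - 1 / \<nu>))"
  if z: "z > R" and nu: "\<nu> > 1" "poly D z = \<nu> + 1 / \<nu>" for z \<nu>
 proof -
  interpret prob_space arcm by (rule prob_arc)
  define \<rho> where "\<rho> = 1 / \<nu>"
  have rho: "0 \<le> \<rho>" "\<rho> < 1" "\<rho> \<noteq> 0" using nu by (auto simp: \<rho>_def)
  have i: "integrable arcm (\<lambda>t. 1 / (z - bandpt r t))" if r: "r \<in> Z" for r
  proof (rule integrable_const_bound[of _ "1 / (z - R)"])
   have b: "bandpt r t < R" for t unfolding bandpt_def using r by (intro xiR) auto
   have "norm (1 / (z - bandpt r t)) \<le> 1 / (z - R)" for t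
    using b[of t] z by (auto simp: abs_of_pos intro!: divide_left_mono mult_pos_pos)
   thus "AE t in arcm. norm (1 / (z - bandpt r t)) \<le> 1 / (z - R)" by simp
   show "(\<lambda>t. 1 / (z - bandpt r t)) \<in> borel_measurable arcm"
    using bandpt_measurable[OF r] by (simp cong: measurable_cong_sets)
  qed
  have "(LINT x|dos. 1 / (z - x)) = (\<Sum>r\<in>Z. LINT t|arcm. 1 / (z - bandpt r t)) / real N" by (rule dos_integral(2)) (use i in auto)
  also have "(\<Sum>r\<in>Z. LINT t|arcm. 1 / (z - bandpt r t)) = (LINT t|arcm. (\<Sum>r\<in>Z. 1 / (z - bandpt r t)))"
   using i by (subst Bochner_Integration.integral_sum) auto
  also have "\<dots> = (LINT t|arcm. poly (pderiv D) z * \<rho> * (1 / (1 - 2 * \<rho> * cos t + \<rho>^2)))"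
  proof (rule integral_cong_AE)
   show "(\<lambda>t. \<Sum>r\<in>Z. 1 / (z - bandpt r t)) \<in> borel_measurable arcm" using i by (intro borel_measurable_sum) auto
   show "AE t in arcm. (\<Sum>r\<in>Z. 1 / (z - bandpt r t)) = poly (pderiv D) z * \<rho> * (1 / (1 - 2 * \<rho> * cos t + \<rho>^2))"
    using AE_arc
   proof eventually_elim
    case (elim t)
    have "(\<Sum>r\<in>Z. 1 / (z - bandpt r t)) = poly (pderiv D) z / (poly D z - 2 * cos t)"
     unfolding bandpt_def using elim by (intro log_deriv[OF z] cos_arc_range) auto
    also have "poly D z - 2 * cos t = (1 - 2 * \<rho> * cos t + \<rho>^2) / \<rho>"
     using nu rho unfolding nu(2) \<rho>_def by (simp add: field_simps power2_eq_square)
    finally show ?case using rho by simp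
   qed
  qed measurable
  also have "\<dots> = poly (pderiv D) z * \<rho> * (1 / (1 - \<rho>^2))"
   unfolding integral_mult_right_zero poisson_arc(1)[OF rho(1,2)] ..
  finally have "(LINT x|dos. 1 / (z - x)) = poly (pderiv D) z * (\<rho> * (1 / (1 - \<rho>^2))) / real N" by (simp only: mult.assoc)
  also have "\<rho> * (1 / (1 - \<rho>^2)) = 1 / (\<nu> - 1 / \<nu>)" using nu by (simp add: \<rho>_def field_simps power2_eq_square)
  finally show ?thesis by (simp add: mult.commute)
 qed
 show ?thesis using R(1) R2 main Dpos by (intro exI[of _ R]) (auto intro: less_imp_le)
qed

end

section \<open>The equilibrium measure and its density\<close>

context discriminant_poly
begin

text \<open>The potential is constant on \<open>\<bar>poly D x\<bar> \<le> 2\<close>, so the mutual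
  energy with any probability measure living there is that constant. This replaces the variational
  characterisation of equilibrium measures.\<close>

lemma product_energy:
 assumes M: "prob_space M" "sets M = sets borel" "AE x in M. \<bar>poly D x\<bar> \<le> 2"
 shows "integrable (M \<Otimes>\<^sub>M dos) (\<lambda>p. log_dist p)"
  and "AE p in M \<Otimes>\<^sub>M dos. fst p \<noteq> snd p"
  and "(LINT p|(M \<Otimes>\<^sub>M dos). log_dist p) = - ln L / real N"
proof -
 interpret M: prob_space M by fact
 interpret E: prob_space dos by (rule prob_dos)
 interpret P: pair_prob_space M dos ..
 have [measurable_cong]: "sets M = sets borel" by fact
 obtain R where R: "R \<ge> 1" "\<And>x. \<bar>poly D x\<bar> \<le> 2 \<Longrightarrow> \<bar>x\<bar> \<le> R" using bounded_set by blast
 define B where "B = ln (2 * R)"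
 have B0: "B \<ge> 0" using R(1) by (simp add: B_def)
 have lnB: "ln \<bar>x - y\<bar> \<le> B" if "\<bar>poly D x\<bar> \<le> 2" "\<bar>poly D y\<bar> \<le> 2" for x y
 proof (cases "x = y")
  case False
  have "\<bar>x - y\<bar> \<le> 2 * R" using R(2)[OF that(1)] R(2)[OF that(2)] by linarith
  thus ?thesis unfolding B_def using False R(1) by (subst ln_le_cancel_iff) auto
 qed (use B0 in simp)
 \<comment> \<open>A number \<open>l \<le> B\<close> with \<open>B \<ge> 0\<close> satisfies
   \<open>\<bar>l\<bar> \<le> 2 * B - l\<close>. The one-sided bound and the known integral thus
   control the integral of the modulus, as Fubini requires.\<close>
 have abs_le: "AE y in dos. \<bar>ln \<bar>x - y\<bar>\<bar> \<le> 2 * B - ln \<bar>x - y\<bar>" if "\<bar>poly D x\<bar> \<le> 2" for x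
  using AE_dos_Lam
 proof eventually_elim
  case (elim y)
  thus ?case using lnB[OF that, of y] B0 by (auto simp: Lam_def abs_if)
 qed
 have lm: "(\<lambda>p. log_dist p) \<in> borel_measurable (M \<Otimes>\<^sub>M dos)" by measurable
 have bound: "(LINT y|dos. \<bar>ln \<bar>x - y\<bar>\<bar>) \<le> 2 * B + ln L / real N" if "\<bar>poly D x\<bar> \<le> 2" for x
 proof -
  have "(LINT y|dos. \<bar>ln \<bar>x - y\<bar>\<bar>) \<le> (LINT y|dos. 2 * B - ln \<bar>x - y\<bar>)"
   using abs_le[OF that] potential(1)[OF that] by (intro integral_mono_AE) auto
  also have "\<dots> = 2 * B + ln L / real N" using potential[OF that] E.prob_space by simp
  finally show ?thesis .
 qed
 have i: "integrable (M \<Otimes>\<^sub>M dos) (case_prod (\<lambda>x y. ln \<bar>x - y\<bar>))"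
 proof (rule P.Fubini_integrable)
  show "case_prod (\<lambda>x y. ln \<bar>x - y\<bar>) \<in> borel_measurable (M \<Otimes>\<^sub>M dos)" by measurable
  show "AE x in M. integrable dos (\<lambda>y. case (x, y) of (x, y) \<Rightarrow> ln \<bar>x - y\<bar>)"
   using M(3) by eventually_elim (use potential(1) in simp)
  show "integrable M (\<lambda>x. LINT y|dos. norm (case (x, y) of (x, y) \<Rightarrow> ln \<bar>x - y\<bar>))"
  proof (rule M.integrable_const_bound[of _ "2 * B + ln L / real N"])
   show "AE x in M. norm (LINT y|dos. norm (case (x, y) of (x, y) \<Rightarrow> ln \<bar>x - y\<bar>)) \<le> 2 * B + ln L / real N"
    using M(3) by eventually_elim (use bound in \<open>simp add: abs_of_nonneg\<close>)
  qed measurable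
 qed
 thus int: "integrable (M \<Otimes>\<^sub>M dos) (\<lambda>p. log_dist p)" by (simp add: case_prod_beta')
 show "AE p in M \<Otimes>\<^sub>M dos. fst p \<noteq> snd p"
 proof (rule P.AE_pair_measure)
  show "{p \<in> space (M \<Otimes>\<^sub>M dos). fst p \<noteq> snd p} \<in> sets (M \<Otimes>\<^sub>M dos)" by measurable
  have "AE y in dos. x \<noteq> y" for x using AE_dos_neq[of x] by eventually_elim auto
  thus "AE x in M. AE y in dos. fst (x, y) \<noteq> snd (x, y)" by simp
 qed
 have "(LINT p|(M \<Otimes>\<^sub>M dos). log_dist p) = (LINT x|M. (LINT y|dos. ln \<bar>x - y\<bar>))"
  using P.integral_fst'[OF int] by simp
 also have "\<dots> = (LINT x|M. - ln L / real N)"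
 proof (rule integral_cong_AE)
  show "AE x in M. (LINT y|dos. ln \<bar>x - y\<bar>) = - ln L / real N" using M(3) by eventually_elim (rule potential(2))
 qed measurable
 finally show "(LINT p|(M \<Otimes>\<^sub>M dos). log_dist p) = - ln L / real N" using M.prob_space by simp
qed

lemma finite_level: "finite {x. \<bar>poly D x\<bar> = 2}"
proof -
 have "D - [:c:] \<noteq> 0" for c using deg N by (metis degree_pCons_0 diff_eq_eq add_0 not_one_le_zero)
 hence "finite {x. poly (D - [:2:]) x = 0}" "finite {x. poly (D - [:-2:]) x = 0}" by (intro poly_roots_finite; blast)+
 moreover have "{x. \<bar>poly D x\<bar> = 2} = {x. poly (D - [:2:]) x = 0} \<union> {x. poly (D - [:-2:]) x = 0}" by auto
 ultimately show ?thesis by simp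
qed

text \<open>Finite energy excludes atoms, so \<open>\<omega>\<close> does not charge
  \<open>V\<close> and \<open>product_energy\<close> applies to it. Since \<open>\<omega>\<close>
  minimises, the energy of the difference of \<open>\<omega>\<close> and \<open>dos\<close> is at
  most zero, and \<open>equal_energy_unique\<close> gives equality.\<close>

lemma equilibrium_unique:
 assumes F: "Lam \<subseteq> F" "F \<subseteq> {x. \<bar>poly D x\<bar> \<le> 2} \<union> V" and V: "finite V"
  and eq: "equilibrium_measure F \<omega>"
 shows "\<omega> = dos"
proof -
 have om: "prob_space \<omega>" "sets \<omega> = sets borel" "emeasure \<omega> (- F) = 0"
  and min: "\<And>M. prob_space M \<Longrightarrow> sets M = sets borel \<Longrightarrow> emeasure M (- F) = 0 \<Longrightarrow> log_energy \<omega> \<le> log_energy M"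
  using eq by (auto simp: equilibrium_measure_def prob_measures_on_def)
 interpret O: prob_space \<omega> by fact
 interpret E: prob_space dos by (rule prob_dos)
 interpret P: pair_prob_space \<omega> \<omega> ..
 have [measurable_cong]: "sets \<omega> = sets borel" by fact
 have Fb: "F \<in> sets borel"
 proof -
  have "F - Lam \<subseteq> {x. \<bar>poly D x\<bar> = 2} \<union> V" using F by (auto simp: Lam_def)
  hence "finite (F - Lam)" using finite_level V finite_subset by blast
  hence "Lam \<union> (F - Lam) \<in> sets borel" using open_Lam by (intro sets.Un borel_open borel_closed finite_imp_closed)
  moreover have "Lam \<union> (F - Lam) = F" using F(1) by auto
  ultimately show ?thesis by simp
 qed
 have AEF: "AE x in \<omega>. x \<in> F"
  by (rule AE_I[of _ _ "- F"]) (use om Fb in \<open>auto simp: sets_eq_imp_space_eq[OF om(2)]\<close>)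
 have "emeasure dos (- F) = 0"
 proof -
  have "AE x in dos. x \<notin> - F" using AE_dos_Lam by eventually_elim (use F(1) in auto)
  thus ?thesis using Fb AE_iff_null_sets[of "- F" dos] by (auto simp: null_setsD1)
 qed
 hence le: "log_energy \<omega> \<le> log_energy dos" using min prob_dos by simp
 obtain R0 where R0: "R0 \<ge> 1" "\<And>x. \<bar>poly D x\<bar> \<le> 2 \<Longrightarrow> \<bar>x\<bar> \<le> R0" using bounded_set by blast
 define T where "T = (\<Sum>v\<in>V. \<bar>v\<bar>)"
 define R where "R = R0 + T"
 have s0: "T \<ge> 0" unfolding T_def by (intro sum_nonneg) auto
 have R: "R \<ge> 1" using R0(1) s0 by (simp add: R_def)
 have FR: "\<bar>x\<bar> \<le> R" if "x \<in> F" for x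
 proof (cases "x \<in> V")
  case True
  hence "\<bar>x\<bar> \<le> T" unfolding T_def using V by (intro member_le_sum) auto
  thus ?thesis using R0(1) by (simp add: R_def)
 next
  case False
  hence "\<bar>x\<bar> \<le> R0" using that F(2) by (intro R0(2)) auto
  thus ?thesis using s0 by (simp add: R_def)
 qed
 have oR: "AE x in \<omega>. \<bar>x\<bar> \<le> R" using AEF by eventually_elim (rule FR)
 have eR: "AE x in dos. \<bar>x\<bar> \<le> R" using AE_dos_Lam by eventually_elim (use FR F(1) in blast)
 have eD: "AE x in dos. \<bar>poly D x\<bar> \<le> 2" using AE_dos_Lam by eventually_elim (simp add: Lam_def)
 note dd = product_energy[OF prob_dos sets_dos eD]
 have Ed: "log_energy dos = ereal (ln L / real N)" using log_energy_eq(1)[OF R prob_dos sets_dos eR dd(1,2)] dd(3) by simp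
 hence fin: "log_energy \<omega> < \<infinity>" using le by (auto simp: order_le_less_trans)
 from log_energy_eq(2)[OF R om(1,2) oR fin]
 have oo: "integrable (\<omega> \<Otimes>\<^sub>M \<omega>) (\<lambda>p. log_dist p)" "AE p in \<omega> \<Otimes>\<^sub>M \<omega>. fst p \<noteq> snd p" by auto
 have Eo: "log_energy \<omega> = ereal (- (LINT p|(\<omega> \<Otimes>\<^sub>M \<omega>). log_dist p))"
  by (rule log_energy_eq(1)[OF R om(1,2) oR oo])
 \<comment> \<open>An atom at \<open>v\<close> would give positive mass to the point
   \<open>(v, v)\<close> of the diagonal.\<close>
 have single: "AE x in \<omega>. x \<noteq> v" for v
 proof (rule ccontr)
  assume n: "\<not> (AE x in \<omega>. x \<noteq> v)"
  have ae: "AE x in \<omega>. AE y in \<omega>. x \<noteq> y" using P.AE_pair[OF oo(2)] by simp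
  have "AE x in \<omega>. x \<noteq> v" using ae
  proof eventually_elim
   case (elim x)
   show ?case
   proof
    assume "x = v"
    hence "AE y in \<omega>. y \<noteq> v" using elim by (simp add: eq_commute)
    thus False using n by blast
   qed
  qed
  thus False using n by blast
 qed
 have "AE x in \<omega>. \<forall>v\<in>V. x \<noteq> v" using V single by (simp add: AE_finite_all)
 hence oD: "AE x in \<omega>. \<bar>poly D x\<bar> \<le> 2" using AEF by eventually_elim (use F(2) in auto)
 note od = product_energy[OF om(1,2) oD]
 show ?thesis
 proof (rule equal_energy_unique[OF _ om(1,2) oR prob_dos sets_dos eR oo od(1,2) dd(1,2)])
  show "R > 0" using R by simp
  show "- (LINT p|(\<omega> \<Otimes>\<^sub>M \<omega>). log_dist p) + 2 * (LINT p|(\<omega> \<Otimes>\<^sub>M dos). log_dist p)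
    - (LINT p|(dos \<Otimes>\<^sub>M dos). log_dist p) \<le> 0" using le unfolding Ed Eo od(3) dd(3) by simp
 qed
qed

text \<open>At a closed gap \<open>4 - D^2\<close> has a zero of order at least two, so the quotient of
 \<open>D'^2\<close> by it stays bounded and has a limit.\<close>

lemma dos_density_limit:
 assumes x0: "\<bar>poly D x0\<bar> = 2" and nb: "\<forall>\<^sub>F x in nhds x0. \<bar>poly D x\<bar> \<le> 2"
 shows "\<exists>l. dos_density \<midarrow>x0\<rightarrow> l"
proof -
 define P where "P = [:4:] - D^2"
 have "(poly D x0)^2 = 4" using power2_abs[of "poly D x0"] unfolding x0 by simp
 hence P0: "poly P x0 = 0" by (simp add: P_def)
 have Pnz: "P \<noteq> 0"
 proof
  assume "P = 0"
  hence "D^2 = [:4:]" by (simp add: P_def)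
  hence "degree (D^2) = 0" by simp
  moreover have "degree (D^2) = 2 * N" using deg N by (subst degree_power_eq) auto
  ultimately show False using N by simp
 qed
 have Pnn: "\<forall>\<^sub>F x in nhds x0. poly P x \<ge> 0" using nb
 proof eventually_elim
  case (elim x)
  thus ?case using abs_le_square_iff[of "poly D x" 2] by (simp add: P_def power2_eq_square)
 qed
 have dP: "poly (pderiv P) x = - 2 * poly D x * poly (pderiv D) x" for x by (simp add: P_def pderiv_diff pderiv_power pderiv_pCons)
 define k where "k = order x0 P"
 obtain q where q: "P = [:- x0, 1:] ^ k * q" "\<not> [:- x0, 1:] dvd q" using order_decomp[OF Pnz] unfolding k_def by blast
 have q0: "poly q x0 \<noteq> 0" using q(2) by (simp add: poly_eq_0_iff_dvd)
 have k1: "k \<noteq> 0" using P0 q q0 by auto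
 \<comment> \<open>\<open>P\<close> vanishes at \<open>x0\<close> and is nonnegative nearby, so
   \<open>x0\<close> is a local minimum; this excludes a simple zero.\<close>
 have dP0: "poly (pderiv P) x0 = 0"
 proof -
  obtain e where e: "e > 0" "\<And>y. \<bar>x0 - y\<bar> < e \<Longrightarrow> poly P y \<ge> 0"
   using Pnn unfolding eventually_nhds_metric by (auto simp: dist_real_def abs_minus_commute)
  hence "\<forall>y. \<bar>x0 - y\<bar> < e \<longrightarrow> poly P x0 \<le> poly P y" using P0 by simp
  thus ?thesis using DERIV_local_min[OF poly_DERIV e(1)] by blast
 qed
 have "k \<noteq> 1"
 proof
  assume k: "k = 1"
  have "poly (pderiv P) x0 = poly q x0" unfolding q(1) k power_one_right pderiv_mult poly_add poly_mult by (simp add: pderiv_pCons)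
  thus False using dP0 q0 by simp
 qed
 then obtain m where m: "k = Suc (Suc m)" using k1 by (cases k; cases "k - 1") auto
 \<comment> \<open>This is the square of the derivative of \<open>P\<close> divided by
   \<open>P\<close>, with the common powers of \<open>x - x0\<close> cancelled, hence continuous at
   \<open>x0\<close>.\<close>
 define Q where "Q = (\<lambda>x. (x - x0) ^ m * (real k * poly q x + (x - x0) * poly (pderiv q) x)^2 / poly q x)"
 have Pe: "poly P x = (x - x0) ^ k * poly q x" for x by (simp add: q(1) poly_power)
 have dPe: "poly (pderiv P) x = (x - x0) ^ Suc m * (real k * poly q x + (x - x0) * poly (pderiv q) x)" for x
  unfolding q(1) m pderiv_mult pderiv_power_Suc poly_add poly_mult poly_power poly_smult by (simp add: pderiv_pCons algebra_simps)
 have Qc: "isCont Q x0" unfolding Q_def using q0 by (intro continuous_intros) auto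
 define f where "f = (\<lambda>x. sqrt (Q x) / (2 * \<bar>poly D x\<bar> * (real N * pi)))"
 have "isCont f x0" unfolding f_def using x0 N by (intro continuous_intros Qc) auto
 hence fl: "f \<midarrow>x0\<rightarrow> f x0" by (simp add: isCont_def)
 have "\<forall>\<^sub>F x in at x0. x \<notin> {x. \<bar>poly D x\<bar> = 2}"
  using islimpt_finite[OF finite_level] islimpt_iff_eventually by blast
 hence "\<forall>\<^sub>F x in at x0. \<bar>poly D x\<bar> \<noteq> 2" by simp
 moreover have "\<forall>\<^sub>F x in at x0. \<bar>poly D x\<bar> \<le> 2" using nb by (auto simp: eventually_at_filter elim: eventually_mono)
 moreover have "\<forall>\<^sub>F x in at x0. poly D x \<noteq> 0"
 proof -
  have "(poly D \<longlongrightarrow> poly D x0) (at x0)" using poly_isCont[of x0 D] by (simp add: isCont_def)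
  thus ?thesis by (rule tendsto_imp_eventually_ne) (use x0 in auto)
 qed
 ultimately have "\<forall>\<^sub>F x in at x0. f x = dos_density x"
 proof eventually_elim
  case (elim x)
  hence lt: "\<bar>poly D x\<bar> < 2" by simp
  have Pp: "poly P x = 4 - (poly D x)^2" by (simp add: P_def)
  have P_pos: "poly P x > 0" using lt power2_strict_mono[of "poly D x" 2] by (simp add: Pp)
  hence nz: "x - x0 \<noteq> 0" "poly q x \<noteq> 0" using Pe[of x] m by auto
  have "Q x = (poly (pderiv P) x)^2 / poly P x"
  proof -
   have "y ^ m * e^2 / p = (y ^ Suc m * e)^2 / (y ^ Suc (Suc m) * p)" if "y \<noteq> 0" "p \<noteq> 0" for y e p :: real
    using that by (simp add: power2_eq_square)
   from this[OF nz] show ?thesis unfolding Q_def Pe dPe m .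
  qed
  hence "sqrt (Q x) = \<bar>poly (pderiv P) x\<bar> / sqrt (poly P x)" by (simp add: real_sqrt_divide)
  also have "\<dots> = 2 * \<bar>poly D x\<bar> * \<bar>poly (pderiv D) x\<bar> / sqrt (poly P x)" by (simp add: dP abs_mult)
  finally have "f x = (2 * \<bar>poly D x\<bar>) * (\<bar>poly (pderiv D) x\<bar> / sqrt (poly P x)) / ((2 * \<bar>poly D x\<bar>) * (real N * pi))"
   by (simp add: f_def)
  also have "\<dots> = (\<bar>poly (pderiv D) x\<bar> / sqrt (poly P x)) / (real N * pi)" using elim by (subst mult_divide_mult_cancel_left) auto
  also have "\<dots> = dos_density x" using lt by (simp add: dos_density_def Pp)
  finally show ?case .
 qed
 thus ?thesis using fl by (auto intro: Lim_transform_eventually)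
qed

lemma isCont_dos_density:
 assumes x: "x \<in> Lam"
 shows "isCont dos_density x"
proof -
 define f where "f = (\<lambda>x. \<bar>poly (pderiv D) x\<bar> / (real N * pi * sqrt (4 - (poly D x)^2)))"
 have "(poly D x)^2 < 4" using x power2_strict_mono[of "poly D x" 2] by (simp add: Lam_def)
 hence "isCont f x" unfolding f_def using N by (intro continuous_intros) auto
 moreover have "\<forall>\<^sub>F y in nhds x. y \<in> Lam" by (rule eventually_nhds_in_open[OF open_Lam x])
 hence "\<forall>\<^sub>F y in nhds x. f y = dos_density y" by eventually_elim (simp add: f_def dos_density_def Lam_def)
 ultimately show ?thesis using isCont_cong by blast
qed

text \<open>As \<open>V\<close> is finite, the interior of \<open>F\<close> lies in
  \<open>\<bar>poly D x\<bar> \<le> 2\<close>, but it may contain closed gaps, where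
  \<open>dos_density\<close> is 0 by definition. There \<open>f\<close> takes the limit instead;
  finitely many points do not change the measure.\<close>

lemma dos_continuous_density:
 assumes F: "Lam \<subseteq> F" "F \<subseteq> {x. \<bar>poly D x\<bar> \<le> 2} \<union> V" and V: "finite V"
 shows "\<exists>f. is_continuous_density dos (interior F) f \<and> (\<forall>x\<in>Lam. f x = dos_density x)"
proof -
 define f where "f = (\<lambda>x. if x \<in> Lam then dos_density x else Lim (at x) dos_density)"
 have nb: "\<forall>\<^sub>F y in nhds x. \<bar>poly D y\<bar> \<le> 2" if x: "x \<in> interior F" for x
 proof -
  have cl: "closed {x. \<bar>poly D x\<bar> \<le> 2}" by (intro closed_Collect_le continuous_intros)
  have "open (- {x. \<bar>poly D x\<bar> \<le> 2} \<inter> interior F)" using cl by (intro open_Int) auto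
  moreover have "finite (- {x. \<bar>poly D x\<bar> \<le> 2} \<inter> interior F)"
   by (rule finite_subset[OF _ V]) (use F(2) interior_subset[of F] in auto)
  ultimately have "- {x. \<bar>poly D x\<bar> \<le> 2} \<inter> interior F = {}" using finite_imp_not_open by blast
  hence "y \<in> interior F \<Longrightarrow> \<bar>poly D y\<bar> \<le> 2" for y by auto
  moreover have "\<forall>\<^sub>F y in nhds x. y \<in> interior F" by (rule eventually_nhds_in_open[OF open_interior x])
  ultimately show ?thesis by (auto elim: eventually_mono)
 qed
 have near: "\<forall>\<^sub>F y in at x. f y = dos_density y" if x: "x \<in> interior F" for x
 proof -
  have "finite ({x. \<bar>poly D x\<bar> = 2} - {x})" using finite_level by simp
  hence "open (- ({x. \<bar>poly D x\<bar> = 2} - {x}))" by (intro open_Compl finite_imp_closed)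
  hence "\<forall>\<^sub>F y in nhds x. y \<in> - ({x. \<bar>poly D x\<bar> = 2} - {x})" by (rule eventually_nhds_in_open) simp
  with nb[OF x] have "\<forall>\<^sub>F y in nhds x. y \<noteq> x \<longrightarrow> f y = dos_density y"
   by eventually_elim (auto simp: f_def Lam_def)
  thus ?thesis by (simp add: eventually_at_filter)
 qed
 have lim: "dos_density \<midarrow>x\<rightarrow> f x" if x: "x \<in> interior F" for x
 proof (cases "x \<in> Lam")
  case True
  thus ?thesis using isCont_dos_density[OF True] by (simp add: f_def isCont_def)
 next
  case False
  have "\<bar>poly D x\<bar> \<le> 2" using nb[OF x] by (rule eventually_nhds_x_imp_x)
  hence "\<bar>poly D x\<bar> = 2" using False by (simp add: Lam_def)
  then obtain l where "dos_density \<midarrow>x\<rightarrow> l" using dos_density_limit[OF _ nb[OF x]] by blast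
  thus ?thesis using tendsto_Lim[of "at x" dos_density l] False by (simp add: f_def)
 qed
 have cont: "isCont f x" if x: "x \<in> interior F" for x unfolding isCont_def
 proof (rule Lim_transform_eventually[OF lim[OF x]])
  show "\<forall>\<^sub>F y in at x. dos_density y = f y" using near[OF x] by eventually_elim simp
 qed
 have "is_continuous_density dos (interior F) f" unfolding is_continuous_density_def
 proof (intro conjI ballI impI)
  show "continuous_on (interior F) f" using cont by (simp add: continuous_at_imp_continuous_on)
  fix x assume x: "x \<in> interior F"
  show "f x \<ge> 0" by (rule tendsto_lowerbound[OF lim[OF x]]) auto
 next
  fix B :: "real set" assume B: "B \<in> sets borel" "B \<subseteq> interior F"
  have "emeasure dos B = (\<integral>\<^sup>+x\<in>B. ennreal (dos_density x) \<partial>lborel)"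
   unfolding dos_def using B(1) by (subst emeasure_density) auto
  also have "\<dots> = (\<integral>\<^sup>+x\<in>B. ennreal (f x) \<partial>lborel)"
  proof (rule nn_integral_cong_AE)
   have "AE x in lborel. \<forall>c\<in>{x. \<bar>poly D x\<bar> = 2}. x \<noteq> c" unfolding AE_finite_all[OF finite_level] using AE_lborel_singleton by blast
   thus "AE x in lborel. ennreal (dos_density x) * indicator B x = ennreal (f x) * indicator B x"
   proof eventually_elim
    case (elim x)
    show ?case
    proof (cases "x \<in> B")
     case True
     hence "x \<in> interior F" using B(2) by blast
     hence "\<bar>poly D x\<bar> \<le> 2" by (rule eventually_nhds_x_imp_x[OF nb])
     hence "x \<in> Lam" using elim by (auto simp: Lam_def order_less_le)
     thus ?thesis by (simp add: f_def)
    qed simp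
   qed
  qed
  finally show "emeasure dos B = (\<integral>\<^sup>+x\<in>B. ennreal (f x) \<partial>lborel)" .
 qed
 thus ?thesis by (intro exI[of _ f]) (simp add: f_def)
qed

end

subsection \<open>Powers of Jacobi matrices\<close>

text \<open>Entries of the \<open>l\<close>-th power of the periodic matrix on the whole line, with
  row \<open>i\<close> and column \<open>j\<close>; \<open>hpow\<close> is the analogue for the
  half-line matrix.\<close>

primrec jpow :: "(int \<Rightarrow> real) \<Rightarrow> (int \<Rightarrow> real) \<Rightarrow> nat \<Rightarrow> int \<Rightarrow> int \<Rightarrow> real" where
 "jpow \<alpha> \<beta> 0 i j = (if i = j then 1 else 0)"
| "jpow \<alpha> \<beta> (Suc l) i j = \<alpha> (i - 1) * jpow \<alpha> \<beta> l (i - 1) j + \<beta> i * jpow \<alpha> \<beta> l i j + \<alpha> i * jpow \<alpha> \<beta> l (i + 1) j"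

primrec hpow :: "(nat \<Rightarrow> real) \<Rightarrow> (nat \<Rightarrow> real) \<Rightarrow> nat \<Rightarrow> nat \<Rightarrow> nat \<Rightarrow> real" where
 "hpow a b 0 n m = (if n = m then 1 else 0)"
| "hpow a b (Suc l) n m = (if n = 0 then 0 else a (n - 1) * hpow a b l (n - 1) m) + b n * hpow a b l n m + a n * hpow a b l (Suc n) m"

lemma three_term_bound:
 fixes a b c u v w M B :: real
 assumes "\<bar>a\<bar> \<le> M" "\<bar>b\<bar> \<le> M" "\<bar>c\<bar> \<le> M" "\<bar>u\<bar> \<le> B" "\<bar>v\<bar> \<le> B" "\<bar>w\<bar> \<le> B"
 shows "\<bar>a * u + b * v + c * w\<bar> \<le> 3 * M * B"
proof -
 have "\<bar>a * u\<bar> \<le> M * B" "\<bar>b * v\<bar> \<le> M * B" "\<bar>c * w\<bar> \<le> M * B"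
  unfolding abs_mult using assms by (auto intro!: mult_mono)
 thus ?thesis by linarith
qed

lemma jpow_bound:
 assumes "\<And>i. \<bar>\<alpha> i\<bar> \<le> M" "\<And>i. \<bar>\<beta> i\<bar> \<le> M"
 shows "\<bar>jpow \<alpha> \<beta> l i j\<bar> \<le> (3 * M) ^ l"
proof (induction l arbitrary: i)
 case (Suc l)
 show ?case using three_term_bound[OF assms(1)[of "i - 1"] assms(2)[of i] assms(1)[of i] Suc.IH[of "i - 1"] Suc.IH[of i] Suc.IH[of "i + 1"]]
  by (simp add: mult.assoc)
qed simp

lemma hpow_bound:
 assumes "\<And>i. \<bar>a i\<bar> \<le> M" "\<And>i. \<bar>b i\<bar> \<le> M"
 shows "\<bar>hpow a b l n m\<bar> \<le> (3 * M) ^ l"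
proof (induction l arbitrary: n)
 case (Suc l)
 have M: "M \<ge> 0" using assms(1)[of 0] by simp
 define c where "c = (if n = 0 then 0 else a (n - 1))"
 have "\<bar>c\<bar> \<le> M" using assms(1)[of "n - 1"] M by (simp add: c_def)
 from three_term_bound[OF this assms(2)[of n] assms(1)[of n] Suc.IH[of "n - 1"] Suc.IH[of n] Suc.IH[of "Suc n"]]
 show ?case by (simp add: c_def mult.assoc split: if_splits)
qed simp

text \<open>Stieltjes transforms are compared only on a real half-line, so only positive
  \<open>w\<close> are available; continuity of the power series at 0 from the right
  suffices.\<close>

lemma powser_vanishing_0:
 fixes c :: "nat \<Rightarrow> real"
 assumes "r > 0" "\<And>w. 0 < w \<Longrightarrow> w < r \<Longrightarrow> (\<lambda>l. c l * w ^ l) sums 0"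
 shows "c 0 = 0"
proof -
 define F where "F = (\<lambda>w. \<Sum>n. c n * w ^ n)"
 have "summable (\<lambda>n. c n * (r / 2) ^ n)" using assms(2)[of "r / 2"] assms(1) by (simp add: sums_iff)
 hence "isCont F 0" unfolding F_def by (rule isCont_powser) (use assms(1) in simp)
 hence "(F \<longlongrightarrow> F 0) (at_right 0)" unfolding isCont_def by (rule filterlim_mono) (simp_all add: at_le)
 moreover have "\<forall>\<^sub>F w in at_right 0. F w = 0"
  using eventually_at_right_real[OF assms(1)] by eventually_elim (use assms(2) in \<open>simp add: F_def sums_iff\<close>)
 hence "(F \<longlongrightarrow> 0) (at_right 0)" by (simp add: tendsto_eventually)
 ultimately have "F 0 = 0" using tendsto_unique trivial_limit_at_right_real by blast
 moreover have "F 0 = c 0" unfolding F_def by (rule powser_zero)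
 ultimately show ?thesis by simp
qed

lemma powser_vanishing:
 fixes c :: "nat \<Rightarrow> real"
 assumes r: "r > 0" and "\<And>w. 0 < w \<Longrightarrow> w < r \<Longrightarrow> (\<lambda>l. c l * w ^ l) sums 0"
 shows "c l = 0" using assms(2)
proof (induction l arbitrary: c)
 case 0
 thus ?case by (rule powser_vanishing_0[OF r])
next
 case (Suc l)
 have c0: "c 0 = 0" by (rule powser_vanishing_0[OF r Suc.prems])
 show ?case
 proof (rule Suc.IH[of "\<lambda>l. c (Suc l)"])
  fix w :: real assume w: "0 < w" "w < r"
  have "(\<lambda>l. c (Suc l) * w ^ Suc l) sums 0" using Suc.prems[OF w] c0 by (subst sums_Suc_iff) simp
  hence "(\<lambda>l. (c (Suc l) * w ^ Suc l) / w) sums (0 / w)" by (rule sums_divide)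
  thus "(\<lambda>l. c (Suc l) * w ^ l) sums 0" using w by simp
 qed
qed

text \<open>The characteristic roots are \<open>\<nu>\<close> and \<open>1 / \<nu>\<close>. The
  combination \<open>e\<close> eliminates the decaying solution and is multiplied by
  \<open>\<nu>\<close> at every step, so for a bounded sequence it must vanish.\<close>

lemma bounded_recurrence_decay:
 fixes y :: "nat \<Rightarrow> real"
 assumes "\<nu> > 1" and rec: "\<And>m. y (Suc (Suc m)) = (\<nu> + 1 / \<nu>) * y (Suc m) - y m" and bd: "\<And>m. \<bar>y m\<bar> \<le> B"
 shows "y 1 = y 0 / \<nu>"
proof (rule ccontr)
 define e where "e = (\<lambda>m. y (Suc m) - y m / \<nu>)"
 assume "y 1 \<noteq> y 0 / \<nu>"
 hence e0: "\<bar>e 0\<bar> > 0" by (simp add: e_def)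
 have "e (Suc m) = \<nu> * e m" for m using assms(1) by (simp add: e_def rec field_simps)
 hence em: "e m = \<nu> ^ m * e 0" for m by (induction m) simp_all
 obtain m where m: "2 * B / \<bar>e 0\<bar> < \<nu> ^ m" using real_arch_pow[OF assms(1)] by blast
 have "\<bar>y m / \<nu>\<bar> \<le> \<bar>y m\<bar>" using assms(1) mult_left_mono[of 1 \<nu> "\<bar>y m\<bar>"] by (simp add: abs_divide pos_divide_le_eq)
 hence "\<bar>e m\<bar> \<le> 2 * B" using bd[of m] bd[of "Suc m"] unfolding e_def by linarith
 moreover have "\<bar>e m\<bar> = \<nu> ^ m * \<bar>e 0\<bar>" unfolding em[of m] abs_mult using assms(1) by simp
 moreover have "2 * B < \<nu> ^ m * \<bar>e 0\<bar>" using m e0 by (simp add: pos_divide_less_eq)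
 ultimately show False by linarith
qed

context periodic_jacobi
begin

abbreviation "Jp \<equiv> jpow \<alpha> \<beta>"

lemma per_mod: "periodic_seq N \<gamma> \<Longrightarrow> \<gamma> n = \<gamma> (int (nat (n mod int N)))"
proof -
 assume p: "periodic_seq N \<gamma>"
 have r: "int (nat (n mod int N)) = n mod int N" using N by simp
 have d: "n = n mod int N + (n div int N) * int N" by simp
 show ?thesis
 proof (cases "n div int N \<ge> 0")
  case True
  thus ?thesis using periodic_seq_mult[OF p, of "n mod int N" "nat (n div int N)"] d r by simp
 next
  case False
  hence "n + int (nat (- (n div int N))) * int N = n mod int N" by (simp add: minus_div_mult_eq_mod)
  thus ?thesis using periodic_seq_mult[OF p, of n "nat (- (n div int N))"] r by simp
 qed
qed

lemma entries_bounded: "\<exists>M>0. (\<forall>i. \<bar>\<alpha> i\<bar> \<le> M) \<and> (\<forall>i. \<bar>\<beta> i\<bar> \<le> M)"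
proof -
 define M where "M = 1 + (\<Sum>k<N. \<bar>\<alpha> (int k)\<bar> + \<bar>\<beta> (int k)\<bar>)"
 have s: "\<bar>\<alpha> (int k)\<bar> + \<bar>\<beta> (int k)\<bar> \<le> (\<Sum>k<N. \<bar>\<alpha> (int k)\<bar> + \<bar>\<beta> (int k)\<bar>)" if "k < N" for k
  using that by (intro member_le_sum) auto
 have lt: "nat (i mod int N) < N" for i using N by (simp add: nat_less_iff)
 have "\<bar>\<alpha> i\<bar> \<le> M" "\<bar>\<beta> i\<bar> \<le> M" for i
  using s[OF lt[of i]] per_mod[OF per(1), of i] per_mod[OF per(2), of i] unfolding M_def by linarith+
 moreover have "M > 0" unfolding M_def by (intro add_pos_nonneg sum_nonneg) auto
 ultimately show ?thesis by blast
qed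

lemma perkN: "\<alpha> (i + int k * int N) = \<alpha> i" "\<beta> (i + int k * int N) = \<beta> i"
 using periodic_seq_mult[OF per(1)] periodic_seq_mult[OF per(2)] by auto

lemma jpow_periodic: "Jp l (i + int k * int N) (j + int k * int N) = Jp l i j"
proof (induction l arbitrary: i)
 case (Suc l)
 have "i + int k * int N - 1 = (i - 1) + int k * int N" "i + int k * int N + 1 = (i + 1) + int k * int N" by auto
 thus ?case by (simp only: jpow.simps Suc.IH perkN)
qed simp

lemma homogeneous_per_sol:
 fixes u :: "int \<Rightarrow> real"
 assumes "\<And>k. k < n \<Longrightarrow> \<alpha> (i + 1 + int k) * u (i + 1 + int k + 1) = (x - \<beta> (i + 1 + int k)) * u (i + 1 + int k) - \<alpha> (i + int k) * u (i + int k)"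
  and "m \<le> Suc n"
 shows "u (i + int m) = sol (i + 1) x (u i) (u (i + 1)) m" using assms(2)
proof (induction m rule: induct_nat_012)
 case (ge2 m)
 have eq1: "\<alpha> (i + 1 + int m) * u (i + 1 + int m + 1) = (x - \<beta> (i + 1 + int m)) * u (i + 1 + int m) - \<alpha> (i + int m) * u (i + int m)"
  by (rule assms(1)) (use ge2 in simp)
 have "u (i + 1 + int m + 1) = (x - \<beta> (i + 1 + int m)) / \<alpha> (i + 1 + int m) * u (i + 1 + int m) - \<alpha> (i + int m) / \<alpha> (i + 1 + int m) * u (i + int m)"
 proof -
  have gen: "p = (x - q) / c * s - v / c * w" if "c * p = (x - q) * s - v * w" "c \<noteq> 0" for c p q s v w :: real
  proof -
   have "p = (c * p) / c" using that(2) by simp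
   thus ?thesis unfolding that(1) by (simp add: diff_divide_distrib left_diff_distrib)
  qed
  show ?thesis by (rule gen[OF eq1 nz])
 qed
 moreover have "i + int (Suc (Suc m)) = i + 1 + int m + 1" "i + int (Suc m) = i + 1 + int m" by auto
 moreover have "per_q \<alpha> (i + 1) m = \<alpha> (i + int m) / \<alpha> (i + 1 + int m)" by (simp add: per_q_def add.commute add.left_commute)
 moreover have "per_p \<alpha> \<beta> (i + 1) x m = (x - \<beta> (i + 1 + int m)) / \<alpha> (i + 1 + int m)" by (simp add: per_p_def)
 ultimately show ?case using ge2 by (simp only: per_sol_rec)
qed simp_all

lemma homogeneous_period:
 fixes u :: "int \<Rightarrow> real"
 assumes "\<And>k. k < 2 * N - 1 \<Longrightarrow> \<alpha> (i + 1 + int k) * u (i + 1 + int k + 1) = (x - \<beta> (i + 1 + int k)) * u (i + 1 + int k) - \<alpha> (i + int k) * u (i + int k)"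
 shows "u (i + int N + int N) = Dis x * u (i + int N) - u i"
proof -
 have "u (i + int (N + N)) = sol (i + 1) x (u i) (u (i + 1)) (N + N)"
  by (rule homogeneous_per_sol[OF assms]) (use N in auto)
 moreover have "u (i + int N) = sol (i + 1) x (u i) (u (i + 1)) N"
  by (rule homogeneous_per_sol[OF assms]) (use N in auto)
 ultimately show ?thesis using per_sol_cayley_hamilton[of "i + 1" x "u i" "u (i + 1)"] by (simp add: add.assoc)
qed

text \<open>On either side of \<open>j\<close> a bounded Green function solves the homogeneous
  equation and is multiplied by \<open>1 / \<nu>\<close> over one period away from \<open>j\<close>.
  Writing both facts with \<open>R\<close> and \<open>S\<close> based at \<open>j + 1\<close> and
  subtracting leaves only the jump at \<open>j\<close>.\<close>

lemma green_diagonal: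
 fixes g :: "int \<Rightarrow> real"
 assumes nu: "\<nu> > 1" "Dis z = \<nu> + 1 / \<nu>"
  and bd: "\<And>i. \<bar>g i\<bar> \<le> B"
  and eq: "\<And>i. z * g i = (if i = j then 1 else 0) + \<alpha> (i - 1) * g (i - 1) + \<beta> i * g i + \<alpha> i * g (i + 1)"
 shows "S (j + 1) z N / \<alpha> j = (\<nu> - 1 / \<nu>) * g j"
proof -
 have hom: "\<alpha> i * g (i + 1) = (z - \<beta> i) * g i - \<alpha> (i - 1) * g (i - 1)" if "i \<noteq> j" for i
  using eq[of i] that by (simp add: algebra_simps)
 \<comment> \<open>The value at \<open>j + 1\<close> with which the left part would satisfy the
   equation at \<open>j\<close> without its source.\<close>
 define e where "e = g (j + 1) + 1 / \<alpha> j"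
 have homj: "\<alpha> j * e = (z - \<beta> j) * g j - \<alpha> (j - 1) * g (j - 1)"
  using eq[of j] nz[of j] by (simp add: e_def algebra_simps)
 define v where "v = (\<lambda>i. if i \<le> j then g i else if i = j + 1 then e else 0)"
 have homv: "\<alpha> i * v (i + 1) = (z - \<beta> i) * v i - \<alpha> (i - 1) * v (i - 1)" if "i \<le> j" for i
  using that hom[of i] homj by (cases "i = j") (auto simp: v_def)
 have bv: "\<bar>v i\<bar> \<le> B + \<bar>e\<bar>" for i using bd[of i] bd[of 0] by (auto simp: v_def)
 have gN: "g (j + int N) = g j / \<nu>"
 proof -
  define y where "y = (\<lambda>m. g (j + int m * int N))"
  have "y 1 = y 0 / \<nu>"
  proof (rule bounded_recurrence_decay[OF nu(1)])
   fix m
   have "g (j + int m * int N + int N + int N) = Dis z * g (j + int m * int N + int N) - g (j + int m * int N)"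
   proof (rule homogeneous_period)
    fix k
    have "j + int m * int N + 1 + int k \<noteq> j" by (smt (verit) of_nat_0_le_iff mult_nonneg_nonneg)
    from hom[OF this] show "\<alpha> (j + int m * int N + 1 + int k) * g (j + int m * int N + 1 + int k + 1) =
     (z - \<beta> (j + int m * int N + 1 + int k)) * g (j + int m * int N + 1 + int k) - \<alpha> (j + int m * int N + int k) * g (j + int m * int N + int k)"
     by (simp add: algebra_simps)
   qed
   thus "y (Suc (Suc m)) = (\<nu> + 1 / \<nu>) * y (Suc m) - y m" by (simp add: y_def nu(2) algebra_simps)
   show "\<bar>y m\<bar> \<le> B" by (simp add: y_def bd)
  qed
  thus ?thesis by (simp add: y_def)
 qed
 have vN: "v (i - int N) = v i / \<nu>" if i: "i \<le> j + 1" for i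
 proof -
  define y where "y = (\<lambda>m. v (i - int m * int N))"
  have "y 1 = y 0 / \<nu>"
  proof (rule bounded_recurrence_decay[OF nu(1)])
   fix m
   define i' where "i' = i - int m * int N - int N - int N"
   have "v (i' + int N + int N) = Dis z * v (i' + int N) - v i'"
   proof (rule homogeneous_period)
    fix k assume k: "k < 2 * N - 1"
    have "0 \<le> int m * int N" by simp
    hence "i' + 1 + int k \<le> j" using k i unfolding i'_def by linarith
    from homv[OF this] show "\<alpha> (i' + 1 + int k) * v (i' + 1 + int k + 1) = (z - \<beta> (i' + 1 + int k)) * v (i' + 1 + int k) - \<alpha> (i' + int k) * v (i' + int k)"
     by (simp add: algebra_simps)
   qed
   thus "y (Suc (Suc m)) = (\<nu> + 1 / \<nu>) * y (Suc m) - y m" by (simp add: y_def i'_def nu(2) algebra_simps)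
   show "\<bar>y m\<bar> \<le> B + \<bar>e\<bar>" by (simp add: y_def bv)
  qed
  thus ?thesis by (simp add: y_def)
 qed
 have "g (j + int N) = sol (j + 1) z (g j) (g (j + 1)) N"
 proof (rule homogeneous_per_sol[of "N - 1"])
  fix k
  from hom[of "j + 1 + int k"] show "\<alpha> (j + 1 + int k) * g (j + 1 + int k + 1) = (z - \<beta> (j + 1 + int k)) * g (j + 1 + int k) - \<alpha> (j + int k) * g (j + int k)"
   by (simp add: algebra_simps)
 qed (use N in simp)
 hence right: "g j / \<nu> = g j * R (j + 1) z N + g (j + 1) * S (j + 1) z N" unfolding gN by (subst (asm) per_sol_linear)
 have "v (j - int N + int N) = sol (j - int N + 1) z (v (j - int N)) (v (j - int N + 1)) N"
 proof (rule homogeneous_per_sol[of "N - 1"])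
  fix k assume "k < N - 1"
  hence "j - int N + 1 + int k \<le> j" by linarith
  from homv[OF this] show "\<alpha> (j - int N + 1 + int k) * v (j - int N + 1 + int k + 1) = (z - \<beta> (j - int N + 1 + int k)) * v (j - int N + 1 + int k) - \<alpha> (j - int N + int k) * v (j - int N + int k)"
   by (simp add: algebra_simps)
 qed (use N in simp)
 moreover have "sol (j - int N + 1) z c d N = sol (j + 1) z c d N" for c d
  using per_solN[of "j - int N + 1" z c d N] by simp
 moreover have "v (j - int N) = g j / \<nu>" using vN[of j] by (simp add: v_def)
 moreover have "v (j - int N + 1) = e / \<nu>" using vN[of "j + 1"] by (simp add: v_def algebra_simps)
 moreover have "v (j - int N + int N) = g j" by (simp add: v_def)
 ultimately have "g j = sol (j + 1) z (g j / \<nu>) (e / \<nu>) N" by simp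
 hence "g j = g j / \<nu> * R (j + 1) z N + e / \<nu> * S (j + 1) z N" by (subst (asm) per_sol_linear)
 hence "\<nu> * g j = g j * R (j + 1) z N + e * S (j + 1) z N" using nu(1) by (simp add: field_simps)
 hence "(\<nu> - 1 / \<nu>) * g j = (e - g (j + 1)) * S (j + 1) z N" using right by (simp add: algebra_simps)
 thus ?thesis by (simp add: e_def)
qed

text \<open>Neumann series: \<open>jpow_bound\<close> makes it converge for
  \<open>z > 3 * M\<close>. Its sum is bounded and solves the Green equation, so
  \<open>green_diagonal\<close> evaluates it on the diagonal.\<close>

lemma trace_resolvent:
 assumes M: "M > 0" "\<And>i. \<bar>\<alpha> i\<bar> \<le> M" "\<And>i. \<bar>\<beta> i\<bar> \<le> M" and z: "z > 3 * M"
  and nu: "\<nu> > 1" "Dis z = \<nu> + 1 / \<nu>"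
 shows "(\<lambda>l. (\<Sum>j<N. Jp l (int j) (int j)) / z ^ Suc l) sums (dsum z / (\<nu> - 1 / \<nu>))"
proof -
 define g where "g = (\<lambda>i j. \<Sum>l. Jp l i j / z ^ Suc l)"
 have z0: "z > 0" using M z by simp
 have gs: "summable (\<lambda>l. 1 / z * (3 * M / z) ^ l)" using M z by (intro summable_mult summable_geometric) simp
 have le: "\<bar>Jp l i j / z ^ Suc l\<bar> \<le> 1 / z * (3 * M / z) ^ l" for l i j
 proof -
  have "\<bar>Jp l i j / z ^ Suc l\<bar> \<le> (3 * M) ^ l / z ^ Suc l"
   using z0 divide_right_mono[OF jpow_bound[OF M(2,3), where l = l and i = i and j = j], of "z ^ Suc l"] by (simp add: abs_divide)
  thus ?thesis using z0 by (simp add: power_divide)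
 qed
 have sm: "summable (\<lambda>l. Jp l i j / z ^ Suc l)" for i j
  by (rule summable_comparison_test'[OF gs, of 0]) (use le in auto)
 have bd: "\<bar>g i j\<bar> \<le> (\<Sum>l. 1 / z * (3 * M / z) ^ l)" for i j
 proof -
  have s: "summable (\<lambda>l. \<bar>Jp l i j / z ^ Suc l\<bar>)"
   by (rule summable_comparison_test'[OF gs, of 0]) (use le in auto)
  have "\<bar>g i j\<bar> \<le> (\<Sum>l. \<bar>Jp l i j / z ^ Suc l\<bar>)" unfolding g_def by (rule summable_rabs[OF s])
  also have "\<dots> \<le> (\<Sum>l. 1 / z * (3 * M / z) ^ l)" by (rule suminf_le[OF le s gs])
  finally show ?thesis .
 qed
 have eq: "z * g i j = (if i = j then 1 else 0) + \<alpha> (i - 1) * g (i - 1) j + \<beta> i * g i j + \<alpha> i * g (i + 1) j" for i j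
 proof -
  have "(\<lambda>l. Jp l i j / z ^ Suc l) sums g i j" for i j unfolding g_def using sm by (rule summable_sums)
  note sg = this
  have "(\<lambda>l. \<alpha> (i - 1) * (Jp l (i - 1) j / z ^ Suc l) + \<beta> i * (Jp l i j / z ^ Suc l) + \<alpha> i * (Jp l (i + 1) j / z ^ Suc l))
   sums (\<alpha> (i - 1) * g (i - 1) j + \<beta> i * g i j + \<alpha> i * g (i + 1) j)" by (intro sums_add sums_mult sg)
  moreover have "\<alpha> (i - 1) * (Jp l (i - 1) j / z ^ Suc l) + \<beta> i * (Jp l i j / z ^ Suc l) + \<alpha> i * (Jp l (i + 1) j / z ^ Suc l)
    = z * (Jp (Suc l) i j / z ^ Suc (Suc l))" for l
  proof -
   have "a * (p / s) + b * (q / s) + c * (r / s) = z * ((a * p + b * q + c * r) / (z * s))" for a b c p q r s :: real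
    using z0 by (simp add: add_divide_distrib distrib_left)
   thus ?thesis unfolding jpow.simps power_Suc[of z "Suc l"] .
  qed
  ultimately have 1: "(\<lambda>l. z * (Jp (Suc l) i j / z ^ Suc (Suc l))) sums (\<alpha> (i - 1) * g (i - 1) j + \<beta> i * g i j + \<alpha> i * g (i + 1) j)"
   by (simp only:)
  have "(\<lambda>l. z * (Jp l i j / z ^ Suc l)) sums (z * g i j)" by (intro sums_mult sg)
  hence "(\<lambda>l. z * (Jp (Suc l) i j / z ^ Suc (Suc l))) sums (z * g i j - z * (Jp 0 i j / z ^ Suc 0))"
   by (subst sums_Suc_iff) simp
  hence "z * g i j - z * (Jp 0 i j / z ^ Suc 0) = \<alpha> (i - 1) * g (i - 1) j + \<beta> i * g i j + \<alpha> i * g (i + 1) j"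
   using 1 sums_unique2 by blast
  thus ?thesis using z0 by (auto split: if_splits)
 qed
 have pos: "\<nu> - 1 / \<nu> \<noteq> 0"
 proof -
  have "1 / \<nu> < 1" using nu(1) by simp
  thus ?thesis using nu(1) by linarith
 qed
 have "S (int j + 1) z N / \<alpha> (int j) = (\<nu> - 1 / \<nu>) * g (int j) (int j)" for j
  by (rule green_diagonal[OF nu, of "\<lambda>i. g i (int j)"]) (use bd eq in auto)
 hence "dsum z = (\<nu> - 1 / \<nu>) * (\<Sum>j<N. g (int j) (int j))" by (simp add: dsum_def sum_distrib_left)
 hence "dsum z / (\<nu> - 1 / \<nu>) = (\<Sum>j<N. g (int j) (int j))" using pos by simp
 moreover have "(\<lambda>l. \<Sum>j<N. Jp l (int j) (int j) / z ^ Suc l) sums (\<Sum>j<N. g (int j) (int j))"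
  by (intro sums_sum) (unfold g_def, rule summable_sums[OF sm])
 ultimately show ?thesis by (simp add: sum_divide_distrib)
qed

text \<open>The Stieltjes transform of \<open>P\<close> and the normalised trace of the resolvent
  are the same function for large \<open>z\<close>; comparing coefficients in \<open>1 / z\<close>
  identifies the moments.\<close>

lemma stieltjes_moments:
 fixes P :: "real measure"
 assumes P: "prob_space P" "sets P = sets borel" "AE x in P. \<bar>x\<bar> \<le> Q"
  and st: "\<And>z. z > Q \<Longrightarrow> \<exists>\<nu>>1. Dis z = \<nu> + 1 / \<nu> \<and> (LINT x|P. 1 / (z - x)) = dsum z / (real N * (\<nu> - 1 / \<nu>))"
 shows "(LINT x|P. x ^ l) = (\<Sum>j<N. Jp l (int j) (int j)) / real N"
proof -
 interpret prob_space P by fact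
 have [measurable_cong]: "sets P = sets borel" by fact
 obtain M where M: "M > 0" "\<And>i. \<bar>\<alpha> i\<bar> \<le> M" "\<And>i. \<bar>\<beta> i\<bar> \<le> M" using entries_bounded by blast
 define T where "T = (\<lambda>l. \<Sum>j<N. Jp l (int j) (int j))"
 define m where "m = (\<lambda>l. LINT x|P. x ^ l)"
 define Z where "Z = max (3 * M) \<bar>Q\<bar>"
 have Z: "Z > 0" "Z \<ge> 3 * M" "Z \<ge> Q" "Z \<ge> \<bar>Q\<bar>" using M(1) by (auto simp: Z_def)
 have xZ: "AE x in P. \<bar>x\<bar> \<le> Z" using P(3) by eventually_elim (use Z in linarith)
 have "T l / real N - m l = 0"
 proof (rule powser_vanishing[of "1 / Z" "\<lambda>l. T l / real N - m l"])
  show "1 / Z > 0" using Z by simp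
  fix w :: real assume w: "0 < w" "w < 1 / Z"
  define z where "z = 1 / w"
  have z: "z > Z" using w Z by (simp add: z_def field_simps)
  have z0: "z > 0" using z Z by simp
  from st[of z] z Z obtain \<nu> where nu: "\<nu> > 1" "Dis z = \<nu> + 1 / \<nu>" "(LINT x|P. 1 / (z - x)) = dsum z / (real N * (\<nu> - 1 / \<nu>))"
   by auto
  have "(\<lambda>l. T l / z ^ Suc l) sums (dsum z / (\<nu> - 1 / \<nu>))" unfolding T_def
   by (rule trace_resolvent[OF M _ nu(1,2)]) (use z Z in simp)
  hence "(\<lambda>l. T l / z ^ Suc l / real N) sums (dsum z / (\<nu> - 1 / \<nu>) / real N)" by (rule sums_divide)
  hence 1: "(\<lambda>l. T l / real N / z ^ Suc l) sums (LINT x|P. 1 / (z - x))" unfolding nu(3) by (simp add: mult.commute)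
  have i: "integrable P (\<lambda>x. x ^ l / z ^ Suc l)" for l
   using integrable_bounded_support[OF P, of "\<lambda>x. x ^ l / z ^ Suc l"] z0 by (simp add: continuous_intros)
  have le: "\<bar>x ^ l / z ^ Suc l\<bar> \<le> 1 / z * (Z / z) ^ l" if "\<bar>x\<bar> \<le> Z" for x l
  proof -
   have "\<bar>x\<bar> ^ l \<le> Z ^ l" using that by (intro power_mono) auto
   hence "\<bar>x\<bar> ^ l / z ^ Suc l \<le> Z ^ l / z ^ Suc l" using z0 by (intro divide_right_mono) auto
   thus ?thesis using z0 by (simp add: abs_divide power_abs power_divide)
  qed
  have gs: "summable (\<lambda>l. 1 / z * (Z / z) ^ l)" using Z z by (intro summable_mult summable_geometric) simp
  have sx: "(\<lambda>l. x ^ l / z ^ Suc l) sums (1 / (z - x))" if "\<bar>x\<bar> \<le> Z" for x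
  proof -
   have "norm (x / z) < 1" using that z z0 by (simp add: abs_divide)
   hence "(\<lambda>l. 1 / z * (x / z) ^ l) sums (1 / z * (1 / (1 - x / z)))" by (intro sums_mult geometric_sums)
   moreover have "1 / z * (1 / (1 - x / z)) = 1 / (z - x)" using z0 that z by (simp add: field_simps)
   ultimately show ?thesis using z0 by (simp add: power_divide)
  qed
  have "(\<lambda>l. LINT x|P. x ^ l / z ^ Suc l) sums (LINT x|P. (\<Sum>l. x ^ l / z ^ Suc l))"
  proof (rule sums_integral[OF i])
   show "AE x in P. summable (\<lambda>l. norm (x ^ l / z ^ Suc l))" using xZ
   proof eventually_elim
    case (elim x)
    show ?case by (rule summable_comparison_test'[OF gs, of 0]) (use le[OF elim] in auto)
   qed
   show "summable (\<lambda>l. LINT x|P. norm (x ^ l / z ^ Suc l))"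
   proof (rule summable_comparison_test'[OF gs, of 0])
    fix l
    have "(LINT x|P. norm (x ^ l / z ^ Suc l)) \<le> (LINT x|P. 1 / z * (Z / z) ^ l)"
    proof (rule integral_mono_AE)
     show "AE x in P. norm (x ^ l / z ^ Suc l) \<le> 1 / z * (Z / z) ^ l" using xZ by (rule eventually_mono) (use le in auto)
     show "integrable P (\<lambda>x. norm (x ^ l / z ^ Suc l))" by (rule integrable_norm[OF i])
    qed auto
    moreover have "(LINT x|P. norm (x ^ l / z ^ Suc l)) \<ge> 0" by (rule Bochner_Integration.integral_nonneg) auto
    ultimately show "norm (LINT x|P. norm (x ^ l / z ^ Suc l)) \<le> 1 / z * (Z / z) ^ l" using prob_space by simp
   qed
  qed
  moreover have "(LINT x|P. (\<Sum>l. x ^ l / z ^ Suc l)) = (LINT x|P. 1 / (z - x))"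
  proof (rule integral_cong_AE)
   show "AE x in P. (\<Sum>l. x ^ l / z ^ Suc l) = 1 / (z - x)"
    using xZ by (rule eventually_mono) (use sx in \<open>simp add: sums_iff\<close>)
  qed measurable
  ultimately have 2: "(\<lambda>l. m l / z ^ Suc l) sums (LINT x|P. 1 / (z - x))" by (simp add: m_def)
  have "(\<lambda>l. z * (T l / real N / z ^ Suc l - m l / z ^ Suc l)) sums (z * ((LINT x|P. 1 / (z - x)) - (LINT x|P. 1 / (z - x))))"
   by (intro sums_mult sums_diff 1 2)
  moreover have "z * (T l / real N / z ^ Suc l - m l / z ^ Suc l) = (T l / real N - m l) * w ^ l" for l
  proof -
   have wz: "w = 1 / z" by (simp add: z_def)
   have "z * (p / z ^ Suc l - q / z ^ Suc l) = (p - q) * w ^ l" for p q :: real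
    unfolding wz using z0 by (simp add: power_divide diff_divide_distrib right_diff_distrib)
   thus ?thesis .
  qed
  ultimately show "(\<lambda>l. (T l / real N - m l) * w ^ l) sums 0" by simp
 qed
 thus ?thesis by (simp add: T_def m_def)
qed

end

subsection \<open>Weak convergence of the Christoffel--Darboux measures\<close>

lemma orth_poly_mult:
 assumes "\<And>n. a n > 0"
 shows "x * orth_poly a b n x = (if n = 0 then 0 else a (n - 1) * orth_poly a b (n - 1) x) + b n * orth_poly a b n x + a n * orth_poly a b (Suc n) x"
proof (cases n)
 case 0
 thus ?thesis using assms[of 0] by simp
next
 case (Suc k)
 thus ?thesis using assms[of "Suc k"] by (simp add: field_simps)
qed

text \<open>In the orthonormal polynomials, multiplication by \<open>x\<close> acts as the Jacobi
  matrix, so its powers yield the moments.\<close>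

lemma moments_hpow:
 assumes a: "\<And>n. a n > 0" and mu: "orthonormality_measure a b \<mu>"
 shows "integrable \<mu> (\<lambda>x. x ^ l * (orth_poly a b n x * orth_poly a b m x)) \<and>
  (LINT x|\<mu>. x ^ l * (orth_poly a b n x * orth_poly a b m x)) = hpow a b l n m"
proof (induction l arbitrary: n)
 case 0
 thus ?case using mu by (simp add: orthonormality_measure_def)
next
 case (Suc l)
 define c where "c = (if n = 0 then 0 else a (n - 1))"
 define f where "f = (\<lambda>n x. x ^ l * (orth_poly a b n x * orth_poly a b m x))"
 have i: "integrable \<mu> (f n)" "(LINT x|\<mu>. f n x) = hpow a b l n m" for n using Suc.IH[of n] by (simp_all add: f_def)
 have e: "x ^ Suc l * (orth_poly a b n x * orth_poly a b m x) = c * f (n - 1) x + b n * f n x + a n * f (Suc n) x" for x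
 proof -
  have "x ^ Suc l * (orth_poly a b n x * orth_poly a b m x) = x ^ l * ((x * orth_poly a b n x) * orth_poly a b m x)" by simp
  also have "x * orth_poly a b n x = c * orth_poly a b (n - 1) x + b n * orth_poly a b n x + a n * orth_poly a b (Suc n) x"
   using orth_poly_mult[OF a, where b = b and n = n and x = x] by (simp add: c_def)
  also have "x ^ l * ((c * orth_poly a b (n - 1) x + b n * orth_poly a b n x + a n * orth_poly a b (Suc n) x) * orth_poly a b m x)
   = c * f (n - 1) x + b n * f n x + a n * f (Suc n) x" unfolding f_def distrib_left distrib_right by (simp only: mult_ac)
  finally show ?thesis .
 qed
 have "hpow a b (Suc l) n m = c * hpow a b l (n - 1) m + b n * hpow a b l n m + a n * hpow a b l (Suc n) m" by (simp add: c_def)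
 thus ?case unfolding e using i by simp
qed

lemma Lim_null_mult_bounded:
 fixes X Y :: "nat \<Rightarrow> real"
 assumes "X \<longlonglongrightarrow> 0" "\<And>n. \<bar>Y n\<bar> \<le> B"
 shows "(\<lambda>n. X n * Y n) \<longlonglongrightarrow> 0"
proof (rule Lim_null_comparison)
 show "\<forall>\<^sub>F n in sequentially. norm (X n * Y n) \<le> \<bar>X n\<bar> * B"
  using assms(2) by (intro always_eventually allI) (simp add: abs_mult mult_left_mono)
 show "(\<lambda>n. \<bar>X n\<bar> * B) \<longlonglongrightarrow> 0" using assms(1) by (intro tendsto_mult_left_zero tendsto_rabs_zero)
qed

lemma shift_filterlim: "filterlim (\<lambda>n. nat (int n + d)) at_top sequentially" unfolding filterlim_at_top
proof
 fix Z :: nat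
 show "\<forall>\<^sub>F n in sequentially. Z \<le> nat (int n + d)"
  using eventually_ge_at_top[of "Z + nat \<bar>d\<bar>"] by eventually_elim linarith
qed

lemma shifted_limit:
 fixes a :: "nat \<Rightarrow> real" and \<alpha> :: "int \<Rightarrow> real"
 assumes "(\<lambda>n. a n - \<alpha> (int n)) \<longlonglongrightarrow> 0"
 shows "(\<lambda>n. a (nat (int n + d)) - \<alpha> (int n + d)) \<longlonglongrightarrow> 0"
proof (rule Lim_transform_eventually)
 show "(\<lambda>n. a (nat (int n + d)) - \<alpha> (int (nat (int n + d)))) \<longlonglongrightarrow> 0"
  by (rule filterlim_compose[OF assms shift_filterlim])
 show "\<forall>\<^sub>F n in sequentially. a (nat (int n + d)) - \<alpha> (int (nat (int n + d))) = a (nat (int n + d)) - \<alpha> (int n + d)"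
  using eventually_ge_at_top[of "nat \<bar>d\<bar>"]
 proof eventually_elim
  case (elim n)
  hence "0 \<le> int n + d" by linarith
  thus ?case by simp
 qed
qed

text \<open>An entry of the \<open>l\<close>-th power involves only coefficients within distance
  \<open>l\<close> of its row, and for large \<open>n\<close> the end of the half-line is not
  reached. The offset \<open>d\<close> is carried along because the induction moves the row while
  the column stays at \<open>n\<close>.\<close>

lemma hpow_jpow_limit:
 assumes la: "(\<lambda>n. a n - \<alpha> (int n)) \<longlonglongrightarrow> 0" and lb: "(\<lambda>n. b n - \<beta> (int n)) \<longlonglongrightarrow> 0"
  and Ma: "\<And>i. \<bar>\<alpha> i\<bar> \<le> M" "\<And>i. \<bar>\<beta> i\<bar> \<le> M" and Mb: "\<And>i. \<bar>a i\<bar> \<le> M'" "\<And>i. \<bar>b i\<bar> \<le> M'"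
 shows "(\<lambda>n. hpow a b l (nat (int n + d)) n - jpow \<alpha> \<beta> l (int n + d) (int n)) \<longlonglongrightarrow> 0"
proof (induction l arbitrary: d)
 case 0
 show ?case
 proof (rule Lim_transform_eventually[OF tendsto_const])
  show "\<forall>\<^sub>F n in sequentially. 0 = hpow a b 0 (nat (int n + d)) n - jpow \<alpha> \<beta> 0 (int n + d) (int n)"
   using eventually_ge_at_top[of "nat \<bar>d\<bar>"] by eventually_elim auto
 qed
next
 case (Suc l)
 define h where "h = (\<lambda>d n. hpow a b l (nat (int n + d)) n)"
 define j where "j = (\<lambda>d n. jpow \<alpha> \<beta> l (int n + d) (int n))"
 have prod: "(\<lambda>n. c (nat (int n + d)) * h e n - \<gamma> (int n + d) * j e n) \<longlonglongrightarrow> 0"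
  if c: "(\<lambda>n. c n - \<gamma> (int n)) \<longlonglongrightarrow> 0" "\<And>i. \<bar>\<gamma> i\<bar> \<le> M" for c :: "nat \<Rightarrow> real" and \<gamma> :: "int \<Rightarrow> real" and d e
 proof -
  have "(\<lambda>n. (c (nat (int n + d)) - \<gamma> (int n + d)) * h e n + (h e n - j e n) * \<gamma> (int n + d)) \<longlonglongrightarrow> 0 + 0"
  proof (intro tendsto_add)
   show "(\<lambda>n. (c (nat (int n + d)) - \<gamma> (int n + d)) * h e n) \<longlonglongrightarrow> 0"
    by (rule Lim_null_mult_bounded[OF shifted_limit[OF c(1)]]) (unfold h_def, rule hpow_bound[OF Mb])
   show "(\<lambda>n. (h e n - j e n) * \<gamma> (int n + d)) \<longlonglongrightarrow> 0"
    by (rule Lim_null_mult_bounded[OF _ c(2)]) (unfold h_def j_def, rule Suc.IH)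
  qed
  thus ?thesis by (simp add: algebra_simps)
 qed
 have "(\<lambda>n. (a (nat (int n + (d - 1))) * h (d - 1) n - \<alpha> (int n + (d - 1)) * j (d - 1) n)
   + (b (nat (int n + d)) * h d n - \<beta> (int n + d) * j d n)
   + (a (nat (int n + d)) * h (d + 1) n - \<alpha> (int n + d) * j (d + 1) n)) \<longlonglongrightarrow> 0 + 0 + 0"
  by (intro tendsto_add prod la lb Ma)
 hence L: "(\<lambda>n. (a (nat (int n + (d - 1))) * h (d - 1) n - \<alpha> (int n + (d - 1)) * j (d - 1) n)
   + (b (nat (int n + d)) * h d n - \<beta> (int n + d) * j d n)
   + (a (nat (int n + d)) * h (d + 1) n - \<alpha> (int n + d) * j (d + 1) n)) \<longlonglongrightarrow> 0" by simp
 show ?case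
 proof (rule Lim_transform_eventually[OF L])
  show "\<forall>\<^sub>F n in sequentially. (a (nat (int n + (d - 1))) * h (d - 1) n - \<alpha> (int n + (d - 1)) * j (d - 1) n)
    + (b (nat (int n + d)) * h d n - \<beta> (int n + d) * j d n)
    + (a (nat (int n + d)) * h (d + 1) n - \<alpha> (int n + d) * j (d + 1) n)
    = hpow a b (Suc l) (nat (int n + d)) n - jpow \<alpha> \<beta> (Suc l) (int n + d) (int n)"
   using eventually_ge_at_top[of "nat \<bar>d\<bar> + 2"]
  proof eventually_elim
   case (elim n)
   have 1: "nat (int n + (d - 1)) = nat (int n + d) - 1" "nat (int n + (d + 1)) = Suc (nat (int n + d))" "nat (int n + d) \<noteq> 0"
    using elim by linarith+
   have 2: "int n + (d - 1) = int n + d - 1" "int n + (d + 1) = int n + d + 1" by auto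
   show ?case unfolding h_def j_def 1(1,2) unfolding 2 using 1(3) by simp
  qed
 qed
qed

text \<open>Markov's inequality for the moment of order \<open>2 * k\<close> bounds the mass where
  \<open>\<bar>x\<bar> \<ge> c\<close> by \<open>(B / c) ^ (2 * k)\<close>, which tends to zero when
  \<open>c > B\<close>.\<close>

lemma moments_support:
 assumes pM: "prob_space M" and M: "sets M = sets borel" and B: "B > 0"
  and i: "\<And>l. integrable M (\<lambda>x::real. x ^ l)" and le: "\<And>l. (LINT x|M. x ^ l) \<le> B ^ l"
 shows "AE x in M. \<bar>x\<bar> \<le> B"
proof -
 interpret prob_space M by fact
 have [measurable_cong]: "sets M = sets borel" by fact
 have sp: "space M = UNIV" using sets_eq_imp_space_eq[OF M] by simp
 have "AE x in M. \<bar>x\<bar> < B + 1 / real (Suc n)" for n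
 proof -
  define c where "c = B + 1 / real (Suc n)"
  have c: "c > B" "c > 0" using B by (auto simp: c_def add_pos_pos)
  define A where "A = {x::real. c \<le> \<bar>x\<bar>}"
  have A: "A \<in> sets M" unfolding A_def M by measurable
  have "measure M A \<le> (B / c) ^ (2 * k)" for k
  proof -
   have "(LINT x|M. c ^ (2 * k) * indicator A x) \<le> (LINT x|M. x ^ (2 * k))"
   proof (rule integral_mono)
    show "integrable M (\<lambda>x. c ^ (2 * k) * indicator A x)" using A by (intro integrable_mult_right integrable_real_indicator) (auto simp: emeasure_eq_measure)
    fix x
    show "c ^ (2 * k) * indicator A x \<le> x ^ (2 * k)"
    proof (cases "x \<in> A")
     case True
     hence "c ^ (2 * k) \<le> \<bar>x\<bar> ^ (2 * k)" using c by (intro power_mono) (auto simp: A_def)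
     thus ?thesis using True by (simp add: power_even_abs)
    qed simp
   qed (rule i)
   also have "\<dots> \<le> B ^ (2 * k)" by (rule le)
   finally have "c ^ (2 * k) * measure M A \<le> B ^ (2 * k)" using A by simp
   thus ?thesis using c by (simp add: power_divide pos_le_divide_eq mult.commute)
  qed
  moreover have "(\<lambda>k. (B / c) ^ (2 * k)) \<longlonglongrightarrow> 0"
  proof -
   have "(\<lambda>k. ((B / c)^2) ^ k) \<longlonglongrightarrow> 0" using B c power_strict_mono[of "B / c" 1 2] by (intro LIMSEQ_realpow_zero) auto
   thus ?thesis by (simp add: power_mult)
  qed
  ultimately have "measure M A \<le> 0" using LIMSEQ_le_const by blast
  hence "emeasure M A = 0" using measure_nonneg[of M A] by (simp add: emeasure_eq_measure)
  thus ?thesis using A by (intro AE_I[of _ _ A]) (auto simp: A_def c_def sp)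
 qed
 hence "AE x in M. \<forall>n. \<bar>x\<bar> < B + 1 / real (Suc n)" by (simp add: AE_all_countable)
 thus ?thesis
 proof eventually_elim
  case (elim x)
  show ?case
  proof (rule ccontr)
   assume "\<not> \<bar>x\<bar> \<le> B"
   then obtain n where "inverse (real (Suc n)) < \<bar>x\<bar> - B" using reals_Archimedean[of "\<bar>x\<bar> - B"] by auto
   thus False using elim[rule_format, of n] by (simp add: inverse_eq_divide)
  qed
 qed
qed

lemma orth_poly_measurable [measurable]: "orth_poly a b n \<in> borel_measurable borel"
 by (rule borel_measurable_continuous_onI) (rule continuous_orth_poly)

text \<open>Polynomials are dense, so convergence of moments suffices.\<close>

lemma (in periodic_jacobi) CD_weak_limit:
 fixes P \<mu> :: "real measure"
 assumes a: "\<And>n. a n > 0" and la: "(\<lambda>n. a n - \<alpha> (int n)) \<longlonglongrightarrow> 0" and lb: "(\<lambda>n. b n - \<beta> (int n)) \<longlonglongrightarrow> 0"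
  and mu: "orthonormality_measure a b \<mu>"
  and P: "prob_space P" "sets P = sets borel" "AE x in P. \<bar>x\<bar> \<le> Q"
  and st: "\<And>z. z > Q \<Longrightarrow> \<exists>\<nu>>1. discr \<alpha> \<beta> N 0 z = \<nu> + 1 / \<nu> \<and> (LINT x|P. 1 / (z - x)) = dsum z / (real N * (\<nu> - 1 / \<nu>))"
  and f: "continuous_on UNIV f"
 shows "(\<lambda>n. LINT x|\<mu>. f x * (CD_kernel a b n x x / real (Suc n))) \<longlonglongrightarrow> (LINT x|P. f x)"
  and "integrable \<mu> (\<lambda>x. f x * (CD_kernel a b n x x / real (Suc n)))"
proof -
 have mup: "prob_space \<mu>" "sets \<mu> = sets borel" using mu by (auto simp: orthonormality_measure_def)
 interpret mu: prob_space \<mu> by fact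
 interpret P: prob_space P by fact
 have [measurable_cong]: "sets \<mu> = sets borel" "sets P = sets borel" by fact+
 obtain M where M: "M > 0" "\<And>i. \<bar>\<alpha> i\<bar> \<le> M" "\<And>i. \<bar>\<beta> i\<bar> \<le> M" using entries_bounded by blast
 have "Bseq (\<lambda>n. a n - \<alpha> (int n))" "Bseq (\<lambda>n. b n - \<beta> (int n))" using la lb convergentI convergent_imp_Bseq by blast+
 then obtain A B where AB: "\<And>n. \<bar>a n - \<alpha> (int n)\<bar> \<le> A" "\<And>n. \<bar>b n - \<beta> (int n)\<bar> \<le> B" unfolding Bseq_def by auto
 define M' where "M' = M + \<bar>A\<bar> + \<bar>B\<bar>"
 have M'0: "M' > 0" using M(1) by (simp add: M'_def)
 have M': "\<bar>a n\<bar> \<le> M'" "\<bar>b n\<bar> \<le> M'" for n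
  using AB(1)[of n] AB(2)[of n] M(2)[of "int n"] M(3)[of "int n"] unfolding M'_def by linarith+
 define W where "W = (\<lambda>n x. CD_kernel a b n x x / real (Suc n))"
 have W0: "W n x \<ge> 0" for n x unfolding W_def CD_kernel_def by (intro divide_nonneg_nonneg sum_nonneg) auto
 have Wm [measurable]: "W n \<in> borel_measurable borel" for n unfolding W_def CD_kernel_def by measurable
 have xW: "x ^ l * W n x = (\<Sum>j\<le>n. x ^ l * (orth_poly a b j x * orth_poly a b j x)) / real (Suc n)" for l n x
  by (simp add: W_def CD_kernel_def sum_distrib_left)
 have mom: "integrable \<mu> (\<lambda>x. x ^ l * W n x)" "(LINT x|\<mu>. x ^ l * W n x) = (\<Sum>j\<le>n. hpow a b l j j) / real (Suc n)" for l n
  unfolding xW using moments_hpow[OF a mu] by (auto simp: Bochner_Integration.integral_sum)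
 have int1: "integrable \<mu> (\<lambda>x. x ^ l)" and mom1: "(LINT x|\<mu>. x ^ l) = hpow a b l 0 0" for l
  using moments_hpow[OF a mu, where l = l and n = 0 and m = 0] by simp_all
 have sup: "AE x in \<mu>. \<bar>x\<bar> \<le> 3 * M'"
 proof (rule moments_support[OF mup])
  show "3 * M' > 0" using M'0 by simp
  show "(LINT x|\<mu>. x ^ l) \<le> (3 * M') ^ l" for l using hpow_bound[where a = a and b = b and l = l and n = 0 and m = 0, OF M'] mom1[of l] by linarith
 qed (rule int1)
 define t where "t = (\<lambda>l. (\<Sum>j<N. jpow \<alpha> \<beta> l (int j) (int j)) / real N)"
 have avg: "(\<lambda>n. (\<Sum>j\<le>n. hpow a b l j j) / real (Suc n)) \<longlonglongrightarrow> t l" for l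
 proof -
  \<comment> \<open>Adding \<open>C\<close> makes the diagonal entries nonnegative, as
    \<open>block_average\<close> demands; it is subtracted again from the average.\<close>
  define C where "C = (3 * M') ^ l"
  define H where "H = (\<lambda>i. jpow \<alpha> \<beta> l (int i) (int i) + C)"
  have hC: "\<bar>hpow a b l n n\<bar> \<le> C" for n unfolding C_def by (rule hpow_bound[OF M'])
  \<comment> \<open>Uniform convergence on a one-point set is convergence of a scalar
    sequence.\<close>
  have "ulim UNIV (\<lambda>n x. (\<Sum>j\<le>n. hpow a b l j j + C) / real (Suc n)) (\<lambda>x::unit. (\<Sum>i<N. H i) / real N)"
  proof (rule block_average[OF N])
   show "0 \<le> hpow a b l n n + C" for n using hC[of n] by linarith
   fix i assume "i < N"
   have "(\<lambda>n. hpow a b l n n - jpow \<alpha> \<beta> l (int n) (int n)) \<longlonglongrightarrow> 0"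
    using hpow_jpow_limit[where a = a and b = b and \<alpha> = \<alpha> and \<beta> = \<beta> and l = l and d = 0, OF la lb M(2,3) M'] by simp
   moreover have "filterlim (\<lambda>k. k * N + i) at_top sequentially"
    by (rule filterlim_at_top_mono[OF filterlim_ident]) (use N in \<open>auto intro!: always_eventually simp: trans_le_add1\<close>)
   ultimately have "(\<lambda>k. hpow a b l (k * N + i) (k * N + i) - jpow \<alpha> \<beta> l (int (k * N + i)) (int (k * N + i))) \<longlonglongrightarrow> 0"
    by (rule filterlim_compose)
   moreover have "jpow \<alpha> \<beta> l (int (k * N + i)) (int (k * N + i)) = jpow \<alpha> \<beta> l (int i) (int i)" for k
    using jpow_periodic[of l "int i" k "int i"] by (simp add: add.commute)
   ultimately have "(\<lambda>k. hpow a b l (k * N + i) (k * N + i) - jpow \<alpha> \<beta> l (int i) (int i)) \<longlonglongrightarrow> 0" by simp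
   hence "(\<lambda>k. hpow a b l (k * N + i) (k * N + i) - jpow \<alpha> \<beta> l (int i) (int i) + H i) \<longlonglongrightarrow> 0 + H i"
    by (intro tendsto_add tendsto_const)
   hence "(\<lambda>k. hpow a b l (k * N + i) (k * N + i) + C) \<longlonglongrightarrow> H i" by (simp add: H_def)
   hence "ulim (UNIV :: unit set) (\<lambda>k x. hpow a b l (k * N + i) (k * N + i) + C) (\<lambda>x. H i)" by (rule ulim_constx)
   hence "uniform_limit (UNIV :: unit set) (\<lambda>n x. (\<Sum>k<n. hpow a b l (k * N + i) (k * N + i) + C) / of_nat n) (\<lambda>x. H i) sequentially"
    by (rule uniform_cesaro) auto
   thus "ulim (UNIV :: unit set) (\<lambda>n x. (\<Sum>k<n. hpow a b l (k * N + i) (k * N + i) + C) / real n) (\<lambda>x. H i)"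
    by (simp add: ulim_def)
  qed
  from tendsto_uniform_limitI[OF ulim_uniform_limit[OF this], of "()"]
  have "(\<lambda>n. (\<Sum>j\<le>n. hpow a b l j j + C) / real (Suc n)) \<longlonglongrightarrow> (\<Sum>i<N. H i) / real N" by simp
  hence "(\<lambda>n. (\<Sum>j\<le>n. hpow a b l j j + C) / real (Suc n) - C) \<longlonglongrightarrow> (\<Sum>i<N. H i) / real N - C"
   by (intro tendsto_diff tendsto_const)
  moreover have "(\<Sum>j\<le>n. hpow a b l j j + C) / real (Suc n) - C = (\<Sum>j\<le>n. hpow a b l j j) / real (Suc n)" for n
   by (simp add: sum.distrib field_simps)
  moreover have "(\<Sum>i<N. H i) / real N - C = t l" using N by (simp add: H_def t_def sum.distrib field_simps)
  ultimately show ?thesis by simp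
 qed
 have tP: "(LINT x|P. x ^ l) = t l" for l unfolding t_def by (rule stieltjes_moments[OF P st])
 define R where "R = max Q (3 * M')"
 have supR: "AE x in \<mu>. \<bar>x\<bar> \<le> R" using sup by eventually_elim (simp add: R_def)
 have PR: "AE x in P. \<bar>x\<bar> \<le> R" using P(3) by eventually_elim (simp add: R_def)
 have intW: "integrable \<mu> (\<lambda>x. g x * W n x)" if g: "continuous_on UNIV g" for g n
 proof -
  have "compact (g ` {-R..R})" by (intro compact_continuous_image continuous_on_subset[OF g]) auto
  hence "bounded (g ` {-R..R})" by (rule compact_imp_bounded)
  then obtain B where "\<forall>y\<in>g ` {-R..R}. norm y \<le> B" unfolding bounded_iff by blast
  hence B: "\<And>x. x \<in> {-R..R} \<Longrightarrow> \<bar>g x\<bar> \<le> B" by simp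
  have gm: "g \<in> borel_measurable borel" by (rule borel_measurable_continuous_onI[OF g])
  show ?thesis
  proof (rule Bochner_Integration.integrable_bound[of _ "\<lambda>x. B * W n x"])
   show "integrable \<mu> (\<lambda>x. B * W n x)" using mom(1)[of 0 n] by simp
   show "(\<lambda>x. g x * W n x) \<in> borel_measurable \<mu>" using gm by measurable
   show "AE x in \<mu>. norm (g x * W n x) \<le> norm (B * W n x)" using supR
   proof eventually_elim
    case (elim x)
    hence "\<bar>g x\<bar> \<le> B" by (intro B) (auto simp: abs_le_iff)
    hence "\<bar>g x\<bar> \<le> \<bar>B\<bar>" by linarith
    thus ?case by (simp add: abs_mult mult_right_mono)
   qed
  qed
 qed
 show "integrable \<mu> (\<lambda>x. f x * (CD_kernel a b n x x / real (Suc n)))" using intW[OF f, of n] by (simp add: W_def)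
 have W1: "(LINT x|\<mu>. W n x) = 1" "integrable \<mu> (W n)" for n using mom[of 0 n] by simp_all
 have "(\<lambda>n. LINT x|\<mu>. f x * W n x) \<longlonglongrightarrow> (LINT x|P. f x)"
 proof (rule LIMSEQ_I)
  fix e :: real assume e: "e > 0"
  hence e4: "e / 4 > 0" by simp
  obtain q k where q: "\<And>x. \<bar>x\<bar> \<le> R \<Longrightarrow> \<bar>f x - (\<Sum>i\<le>k. q i * x ^ i)\<bar> < e / 4"
   using polynomial_approx[OF f e4] by metis
  define p where "p = (\<lambda>x. \<Sum>i\<le>k. q i * x ^ i)"
  have pc: "continuous_on UNIV p" unfolding p_def by (intro continuous_intros)
  have pW: "p x * W n x = (\<Sum>i\<le>k. q i * (x ^ i * W n x))" for n x by (simp add: p_def sum_distrib_right mult.assoc)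
  have "(LINT x|\<mu>. p x * W n x) = (\<Sum>i\<le>k. q i * ((\<Sum>j\<le>n. hpow a b i j j) / real (Suc n)))" for n
   unfolding pW using mom by (subst Bochner_Integration.integral_sum) auto
  moreover have "(\<lambda>n. \<Sum>i\<le>k. q i * ((\<Sum>j\<le>n. hpow a b i j j) / real (Suc n))) \<longlonglongrightarrow> (\<Sum>i\<le>k. q i * t i)"
   by (intro tendsto_sum tendsto_mult tendsto_const avg)
  moreover have "(LINT x|P. p x) = (\<Sum>i\<le>k. q i * t i)"
   unfolding p_def using integrable_bounded_support[OF P, of "\<lambda>x. x ^ _"]
   by (subst Bochner_Integration.integral_sum) (auto simp: tP continuous_intros)
  ultimately have "(\<lambda>n. LINT x|\<mu>. p x * W n x) \<longlonglongrightarrow> (LINT x|P. p x)" by simp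
  then obtain n0 where n0: "\<And>n. n \<ge> n0 \<Longrightarrow> \<bar>(LINT x|\<mu>. p x * W n x) - (LINT x|P. p x)\<bar> < e / 4"
   using LIMSEQ_D[OF _ e4] by fastforce
  have 1: "\<bar>(LINT x|\<mu>. f x * W n x) - (LINT x|\<mu>. p x * W n x)\<bar> \<le> e / 4" for n
  proof -
   have "\<bar>(LINT x|\<mu>. f x * W n x) - (LINT x|\<mu>. p x * W n x)\<bar> = \<bar>LINT x|\<mu>. f x * W n x - p x * W n x\<bar>"
    using intW[OF f, of n] intW[OF pc, of n] by simp
   also have "\<dots> \<le> (LINT x|\<mu>. \<bar>f x * W n x - p x * W n x\<bar>)" by (rule integral_abs_bound)
   also have "\<dots> \<le> (LINT x|\<mu>. e / 4 * W n x)"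
   proof (rule integral_mono_AE)
    show "integrable \<mu> (\<lambda>x. \<bar>f x * W n x - p x * W n x\<bar>)" using intW[OF f, of n] intW[OF pc, of n] by simp
    show "integrable \<mu> (\<lambda>x. e / 4 * W n x)" using W1(2)[of n] by simp
    show "AE x in \<mu>. \<bar>f x * W n x - p x * W n x\<bar> \<le> e / 4 * W n x" using supR
    proof eventually_elim
     case (elim x)
     have "\<bar>f x * W n x - p x * W n x\<bar> = \<bar>f x - p x\<bar> * W n x"
      unfolding left_diff_distrib[symmetric] abs_mult using W0[of n x] by simp
     also have "\<dots> \<le> e / 4 * W n x" using q[OF elim] W0[of n x] by (intro mult_right_mono) (auto simp: p_def)
     finally show ?case .
    qed
   qed
   also have "\<dots> = e / 4" unfolding integral_mult_right_zero W1(1) by simp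
   finally show ?thesis .
  qed
  have 2: "\<bar>(LINT x|P. f x) - (LINT x|P. p x)\<bar> \<le> e / 4"
  proof -
   have i: "integrable P f" "integrable P p" by (rule integrable_bounded_support[OF P f], rule integrable_bounded_support[OF P pc])
   have ae: "AE x in P. \<bar>f x - p x\<bar> \<le> e / 4" using PR by eventually_elim (use q in \<open>auto simp: p_def intro: less_imp_le\<close>)
   have "\<bar>(LINT x|P. f x) - (LINT x|P. p x)\<bar> = \<bar>LINT x|P. f x - p x\<bar>" using i by simp
   also have "\<dots> \<le> (LINT x|P. \<bar>f x - p x\<bar>)" by (rule integral_abs_bound)
   also have "\<dots> \<le> (LINT x|P. e / 4)" by (rule integral_mono_AE) (use i ae in auto)
   finally show ?thesis using P.prob_space by simp
  qed
  have "norm ((LINT x|\<mu>. f x * W n x) - (LINT x|P. f x)) < e" if "n \<ge> n0" for n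
   using 1[of n] 2 n0[OF that] e unfolding real_norm_def by linarith
  thus "\<exists>no. \<forall>n\<ge>no. norm ((LINT x|\<mu>. f x * W n x) - (LINT x|P. f x)) < e" by blast
 qed
 thus "(\<lambda>n. LINT x|\<mu>. f x * (CD_kernel a b n x x / real (Suc n))) \<longlonglongrightarrow> (LINT x|P. f x)" by (simp add: W_def)
qed

subsection \<open>Identification of the densities\<close>

text \<open>Both densities have the same primitive from \<open>c\<close>. Differentiating within the
  closed interval gives equality at the end points as well.\<close>

lemma continuous_density_unique:
 assumes f: "is_continuous_density \<mu> S f" and g: "is_continuous_density \<mu> S' g"
  and cd: "c < d" "{c..d} \<subseteq> S" "{c..d} \<subseteq> S'" and x: "x \<in> {c..d}"
 shows "f x = g x"
proof -
 have I: "ennreal (integral {c..u} h) = emeasure \<mu> {c..u}" "integral {c..u} h \<ge> 0"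
  if h: "is_continuous_density \<mu> T h" and T: "{c..d} \<subseteq> T" and u: "u \<in> {c..d}" for h T u
 proof -
  have cu: "{c..u} \<subseteq> T" using T u by auto
  have nn: "\<And>x. x \<in> {c..u} \<Longrightarrow> 0 \<le> h x" using h cu by (auto simp: is_continuous_density_def)
  have "continuous_on {c..u} h" using h cu continuous_on_subset by (auto simp: is_continuous_density_def)
  hence hi: "(h has_integral integral {c..u} h) {c..u}" by (intro integrable_integral integrable_continuous_real)
  have "emeasure \<mu> {c..u} = (\<integral>\<^sup>+x\<in>{c..u}. ennreal (h x) \<partial>lborel)"
   using h cu by (auto simp: is_continuous_density_def)
  also have "\<dots> = (\<integral>\<^sup>+x. ennreal (indicator {c..u} x * h x) \<partial>lborel)"
   by (intro nn_integral_cong) (auto split: split_indicator)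
  also have "\<dots> = ennreal (integral {c..u} h)" by (rule nn_integral_has_integral_lebesgue[OF nn hi])
  finally show "ennreal (integral {c..u} h) = emeasure \<mu> {c..u}" by simp
  show "integral {c..u} h \<ge> 0" by (rule integral_nonneg[OF has_integral_integrable[OF hi]]) (use nn in auto)
 qed
 have eq: "integral {c..u} f = integral {c..u} g" if u: "u \<in> {c..d}" for u
 proof -
  have "ennreal (integral {c..u} f) = ennreal (integral {c..u} g)" unfolding I(1)[OF f cd(2) u] I(1)[OF g cd(3) u] ..
  thus ?thesis using ennreal_inj[OF I(2)[OF f cd(2) u] I(2)[OF g cd(3) u]] by simp
 qed
 have cf: "continuous_on {c..d} f" by (rule continuous_on_subset[OF _ cd(2)]) (use f in \<open>simp add: is_continuous_density_def\<close>)
 have cg: "continuous_on {c..d} g" by (rule continuous_on_subset[OF _ cd(3)]) (use g in \<open>simp add: is_continuous_density_def\<close>)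
 note d = integral_has_vector_derivative[OF cf x] integral_has_vector_derivative[OF cg x]
 have "((\<lambda>u. integral {c..u} f) has_vector_derivative g x) (at x within {c..d})"
  by (rule has_vector_derivative_transform[OF x _ d(2)]) (use eq in auto)
 thus ?thesis
  using vector_derivative_unique_within_closed_interval[OF cd(1), of x "\<lambda>u. integral {c..u} f" "f x" "g x"] x d(1) by simp
qed

text \<open>The two measures are compared only by functions supported in the larger interval.
  Multiplying both by a bump that equals one on \<open>{c..d}\<close> and normalising gives
  probability measures that agree on all bounded continuous functions. The positive mass of
  \<open>{c..d}\<close> makes the normalising constant nonzero.\<close>

lemma localized_density:
 fixes \<mu> P :: "real measure"
 assumes mu: "prob_space \<mu>" "sets \<mu> = sets borel" and P: "prob_space P" "sets P = sets borel"
  and cd: "c' < c" "c < d" "d < d'"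
  and H: "continuous_on UNIV H" "\<And>x. 0 < H x" "\<And>x. H x \<le> C"
  and eq: "\<And>f. continuous_on UNIV f \<Longrightarrow> (\<And>x. x \<notin> {c'..d'} \<Longrightarrow> f x = 0) \<Longrightarrow> (LINT x|\<mu>. f x * H x) = (LINT x|P. f x)"
  and pos: "measure P {c..d} > 0" and B: "B \<in> sets borel" "B \<subseteq> {c..d}"
 shows "(\<integral>\<^sup>+x. ennreal (H x) * indicator B x \<partial>\<mu>) = emeasure P B"
proof -
 interpret mu: prob_space \<mu> by fact
 interpret P: prob_space P by fact
 have [measurable_cong]: "sets \<mu> = sets borel" "sets P = sets borel" by fact+
 have sp: "space \<mu> = UNIV" "space P = UNIV" using sets_eq_imp_space_eq[OF mu(2)] sets_eq_imp_space_eq[OF P(2)] by simp_all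
 \<comment> \<open>The ramps of the bump have this width, so they fit into the margins on both
   sides.\<close>
 define \<eta> where "\<eta> = min (c - c') (d' - d)"
 have eta: "\<eta> > 0" "\<eta> \<le> c - c'" "\<eta> \<le> d' - d" using cd by (auto simp: \<eta>_def)
 define bump where "bump = (\<lambda>x. max 0 (1 - (max 0 (c - x) + max 0 (x - d)) / \<eta>))"
 have ch_cont: "continuous_on UNIV bump" unfolding bump_def by (intro continuous_intros) (use eta in auto)
 have ch0: "bump x \<ge> 0" for x by (simp add: bump_def)
 have ch1: "bump x \<le> 1" for x using eta by (simp add: bump_def)
 have chB: "bump x = 1" if "x \<in> {c..d}" for x using that by (simp add: bump_def)
 have chout: "bump x = 0" if "x \<notin> {c'..d'}" for x
 proof -
  have "\<eta> \<le> max 0 (c - x) + max 0 (x - d)" using that eta by (auto simp: max_def)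
  hence "1 \<le> (max 0 (c - x) + max 0 (x - d)) / \<eta>" using eta(1) by (simp add: pos_le_divide_eq)
  thus ?thesis unfolding bump_def by simp
 qed
 have [measurable]: "bump \<in> borel_measurable borel" "H \<in> borel_measurable borel"
  by (intro borel_measurable_continuous_onI ch_cont H(1))+
 have chH: "\<bar>bump x * H x\<bar> \<le> C" for x using mult_mono[OF ch1[of x] H(3)[of x]] H(2)[of x] ch0[of x] by (simp add: abs_mult)
 have i1: "integrable \<mu> (\<lambda>x. bump x * H x)" by (rule mu.integrable_const_bound[of _ C]) (use chH in auto)
 have i2: "integrable P bump" by (rule P.integrable_const_bound[of _ 1]) (use ch0 ch1 in auto)
 define m where "m = (LINT x|P. bump x)"
 have m1: "(LINT x|\<mu>. bump x * H x) = m" unfolding m_def by (rule eq[OF ch_cont chout])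
 have "(LINT x|P. indicator {c..d} x) \<le> m" unfolding m_def
 proof (rule integral_mono)
  show "indicator {c..d} x \<le> bump x" for x using chB[of x] ch0[of x] by (auto split: split_indicator)
  show "integrable P (\<lambda>x. indicator {c..d} x :: real)" by (intro integrable_real_indicator) (auto simp: P.emeasure_eq_measure)
 qed (rule i2)
 hence m: "m > 0" using pos by simp
 define M1 where "M1 = density \<mu> (\<lambda>x. ennreal (bump x * H x / m))"
 define M2 where "M2 = density P (\<lambda>x. ennreal (bump x / m))"
 have n1: "bump x * H x / m \<ge> 0" and n2: "bump x / m \<ge> 0" for x using ch0[of x] H(2)[of x] m by simp_all
 have "emeasure M1 (space M1) = (\<integral>\<^sup>+x. ennreal (bump x * H x / m) \<partial>\<mu>)"
  unfolding M1_def by (subst emeasure_density) (auto simp: sp intro!: nn_integral_cong)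
 also have "\<dots> = ennreal (LINT x|\<mu>. bump x * H x / m)" using i1 n1 by (intro nn_integral_eq_integral) auto
 also have "(LINT x|\<mu>. bump x * H x / m) = 1" using m1 m by simp
 finally have p1: "prob_space M1" by (intro prob_spaceI) simp
 have "emeasure M2 (space M2) = (\<integral>\<^sup>+x. ennreal (bump x / m) \<partial>P)"
  unfolding M2_def by (subst emeasure_density) (auto simp: sp intro!: nn_integral_cong)
 also have "\<dots> = ennreal (LINT x|P. bump x / m)" using i2 n2 by (intro nn_integral_eq_integral) auto
 also have "(LINT x|P. bump x / m) = 1" using m by (simp add: m_def)
 finally have p2: "prob_space M2" by (intro prob_spaceI) simp
 have "M1 = M2"
 proof (rule real_distribution_eqI)
  show "real_distribution M1" "real_distribution M2"
   using p1 p2 mu(2) P(2) by (auto simp: real_distribution_def real_distribution_axioms_def M1_def M2_def)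
  fix f :: "real \<Rightarrow> real" assume f: "continuous_on UNIV f"
  have [measurable]: "f \<in> borel_measurable borel" by (rule borel_measurable_continuous_onI[OF f])
  have "(LINT x|M1. f x) = (LINT x|\<mu>. bump x * H x / m * f x)" unfolding M1_def using n1 by (subst integral_real_density) auto
  also have "\<dots> = (LINT x|\<mu>. (f x * bump x) * H x / m)" by (simp add: mult_ac)
  also have "\<dots> = (LINT x|\<mu>. (f x * bump x) * H x) / m" by simp
  also have "(LINT x|\<mu>. (f x * bump x) * H x) = (LINT x|P. f x * bump x)"
   by (rule eq) (use chout in \<open>auto intro!: continuous_intros f ch_cont\<close>)
  also have "(LINT x|P. f x * bump x) / m = (LINT x|P. bump x / m * f x)" by (simp add: mult_ac)
  also have "\<dots> = (LINT x|M2. f x)" unfolding M2_def using n2 by (subst integral_real_density) auto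
  finally show "(LINT x|M1. f x) = (LINT x|M2. f x)" .
 qed
 hence e: "emeasure M1 B = emeasure M2 B" by simp
 have "(\<integral>\<^sup>+x. ennreal (H x) * indicator B x \<partial>\<mu>) = (\<integral>\<^sup>+x. ennreal m * (ennreal (bump x * H x / m) * indicator B x) \<partial>\<mu>)"
 proof (rule nn_integral_cong)
  fix x
  show "ennreal (H x) * indicator B x = ennreal m * (ennreal (bump x * H x / m) * indicator B x)"
  proof (cases "x \<in> B")
   case True
   hence "bump x = 1" using chB B(2) by blast
   hence e1: "m * (bump x * H x / m) = H x" using m by simp
   have "ennreal (H x) = ennreal m * ennreal (bump x * H x / m)" using ennreal_mult[OF less_imp_le[OF m] n1[of x]] unfolding e1 .
   thus ?thesis using True by simp
  qed simp
 qed
 also have "\<dots> = ennreal m * emeasure M1 B"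
  unfolding M1_def using B(1) mu(2) by (subst emeasure_density) (auto intro!: nn_integral_cmult)
 also have "\<dots> = ennreal m * emeasure M2 B" by (simp only: e)
 also have "\<dots> = (\<integral>\<^sup>+x. ennreal m * (ennreal (bump x / m) * indicator B x) \<partial>P)"
  unfolding M2_def using B(1) P(2) by (subst emeasure_density) (auto intro!: nn_integral_cmult[symmetric])
 also have "\<dots> = (\<integral>\<^sup>+x. indicator B x \<partial>P)"
 proof (rule nn_integral_cong)
  fix x
  show "ennreal m * (ennreal (bump x / m) * indicator B x) = indicator B x"
  proof (cases "x \<in> B")
   case True
   hence "bump x = 1" using chB B(2) by blast
   moreover have "ennreal m * ennreal (1 / m) = 1" using m by (subst ennreal_mult[symmetric]) auto
   ultimately show ?thesis using True by simp
  qed simp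
 qed
 also have "\<dots> = emeasure P B" using B(1) P(2) by simp
 finally show ?thesis .
qed

text \<open>The identity is known only for sets inside \<open>{c..d}\<close>. Restricting both
  densities to that interval turns it into an equality of measures, against which
  \<open>1 / H\<close> can be integrated.\<close>

lemma density_divide:
 fixes \<mu> :: "real measure"
 assumes mu: "sets \<mu> = sets borel"
  and H [measurable]: "H \<in> borel_measurable borel" and Hp: "\<And>x. 0 < H x"
  and w [measurable]: "w \<in> borel_measurable borel" and w0: "\<And>x. 0 \<le> w x"
  and eq: "\<And>B. B \<in> sets borel \<Longrightarrow> B \<subseteq> {c..d} \<Longrightarrow> (\<integral>\<^sup>+x. ennreal (H x) * indicator B x \<partial>\<mu>) = (\<integral>\<^sup>+x. ennreal (w x) * indicator B x \<partial>lborel)"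
  and B: "B \<in> sets borel" "B \<subseteq> {c..d}"
 shows "emeasure \<mu> B = (\<integral>\<^sup>+x. ennreal (w x / H x) * indicator B x \<partial>lborel)"
proof -
 have [measurable_cong]: "sets \<mu> = sets borel" by fact
 have [measurable]: "B \<in> sets borel" by fact
 have d: "density \<mu> (\<lambda>x. ennreal (H x) * indicator {c..d} x) = density lborel (\<lambda>x. ennreal (w x) * indicator {c..d} x)" (is "?M1 = ?M2")
 proof (rule measure_eqI)
  fix A assume "A \<in> sets ?M1"
  hence [measurable]: "A \<in> sets borel" using mu by simp
  have "emeasure ?M1 A = (\<integral>\<^sup>+x. ennreal (H x) * indicator (A \<inter> {c..d}) x \<partial>\<mu>)"
   by (subst emeasure_density) (auto simp: mu intro!: nn_integral_cong split: split_indicator)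
  also have "\<dots> = (\<integral>\<^sup>+x. ennreal (w x) * indicator (A \<inter> {c..d}) x \<partial>lborel)" by (rule eq) auto
  also have "\<dots> = emeasure ?M2 A" by (subst emeasure_density) (auto intro!: nn_integral_cong split: split_indicator)
  finally show "emeasure ?M1 A = emeasure ?M2 A" .
 qed (simp add: mu)
 have "emeasure \<mu> B = (\<integral>\<^sup>+x. indicator B x \<partial>\<mu>)" using mu by simp
 also have "\<dots> = (\<integral>\<^sup>+x. (ennreal (H x) * indicator {c..d} x) * (ennreal (1 / H x) * indicator B x) \<partial>\<mu>)"
 proof (rule nn_integral_cong)
  fix x
  have "ennreal (H x) * ennreal (1 / H x) = 1" using Hp[of x] by (subst ennreal_mult[symmetric]) auto
  thus "indicator B x = (ennreal (H x) * indicator {c..d} x) * (ennreal (1 / H x) * indicator B x)"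
   using B(2) by (auto split: split_indicator)
 qed
 also have "\<dots> = (\<integral>\<^sup>+x. ennreal (1 / H x) * indicator B x \<partial>?M1)" by (subst nn_integral_density) auto
 also have "\<dots> = (\<integral>\<^sup>+x. ennreal (1 / H x) * indicator B x \<partial>?M2)" by (simp only: d)
 also have "\<dots> = (\<integral>\<^sup>+x. (ennreal (w x) * indicator {c..d} x) * (ennreal (1 / H x) * indicator B x) \<partial>lborel)"
  by (subst nn_integral_density) auto
 also have "\<dots> = (\<integral>\<^sup>+x. ennreal (w x / H x) * indicator B x \<partial>lborel)"
 proof (rule nn_integral_cong)
  fix x
  have "ennreal (w x) * ennreal (1 / H x) = ennreal (w x / H x)" using Hp[of x] w0[of x] by (subst ennreal_mult[symmetric]) auto
  thus "(ennreal (w x) * indicator {c..d} x) * (ennreal (1 / H x) * indicator B x) = ennreal (w x / H x) * indicator B x"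
   using B(2) by (auto split: split_indicator)
 qed
 finally show ?thesis .
qed

lemma uniform_limit_integral:
 fixes \<mu> :: "real measure" and f H :: "real \<Rightarrow> real"
 assumes mu: "prob_space \<mu>" "sets \<mu> = sets borel"
  and ul: "uniform_limit {c..d} W H sequentially" and H: "continuous_on UNIV H" "\<And>x. \<bar>H x\<bar> \<le> C"
  and f: "continuous_on UNIV f" "\<And>x. x \<notin> {c..d} \<Longrightarrow> f x = 0"
  and i: "\<And>n. integrable \<mu> (\<lambda>x. f x * W n x)"
 shows "(\<lambda>n. LINT x|\<mu>. f x * W n x) \<longlonglongrightarrow> (LINT x|\<mu>. f x * H x)"
proof (rule LIMSEQ_I)
 interpret prob_space \<mu> by fact
 have [measurable_cong]: "sets \<mu> = sets borel" by fact
 have [measurable]: "f \<in> borel_measurable borel" "H \<in> borel_measurable borel" by (intro borel_measurable_continuous_onI f H)+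
 have "compact (f ` {c..d})" by (intro compact_continuous_image continuous_on_subset[OF f(1)]) auto
 hence "bounded (f ` {c..d})" by (rule compact_imp_bounded)
 then obtain F0 where F0: "\<forall>y\<in>f ` {c..d}. norm y \<le> F0" unfolding bounded_iff by blast
 define F where "F = \<bar>F0\<bar> + 1"
 have F: "F > 0" "\<bar>f x\<bar> \<le> F" for x
 proof -
  show "F > 0" by (simp add: F_def)
  show "\<bar>f x\<bar> \<le> F"
  proof (cases "x \<in> {c..d}")
   case True
   hence "\<bar>f x\<bar> \<le> F0" using F0 by simp
   thus ?thesis by (simp add: F_def)
  qed (simp add: f(2) F_def)
 qed
 have iH: "integrable \<mu> (\<lambda>x. f x * H x)"
 proof (rule integrable_const_bound[of _ "F * C"])
  show "AE x in \<mu>. norm (f x * H x) \<le> F * C"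
   unfolding real_norm_def abs_mult using F(1) by (intro always_eventually allI mult_mono F(2) H(2)) auto
 qed measurable
 fix e :: real assume e: "e > 0"
 have "\<forall>\<^sub>F n in sequentially. \<forall>x\<in>{c..d}. dist (W n x) (H x) < e / (2 * F)"
  using ul e F(1) unfolding uniform_limit_iff by simp
 then obtain n0 where n0: "\<And>n x. n \<ge> n0 \<Longrightarrow> x \<in> {c..d} \<Longrightarrow> \<bar>W n x - H x\<bar> < e / (2 * F)"
  unfolding eventually_sequentially dist_real_def by blast
 have "norm ((LINT x|\<mu>. f x * W n x) - (LINT x|\<mu>. f x * H x)) < e" if n: "n \<ge> n0" for n
 proof -
  have "\<bar>(LINT x|\<mu>. f x * W n x) - (LINT x|\<mu>. f x * H x)\<bar> = \<bar>LINT x|\<mu>. f x * W n x - f x * H x\<bar>" using i iH by simp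
  also have "\<dots> \<le> (LINT x|\<mu>. \<bar>f x * W n x - f x * H x\<bar>)" by (rule integral_abs_bound)
  also have "\<dots> \<le> (LINT x|\<mu>. e / 2)"
  proof (rule integral_mono)
   show "integrable \<mu> (\<lambda>x. \<bar>f x * W n x - f x * H x\<bar>)" using i[of n] iH by simp
   show "integrable \<mu> (\<lambda>x. e / 2)" by simp
   fix x
   show "\<bar>f x * W n x - f x * H x\<bar> \<le> e / 2"
   proof (cases "x \<in> {c..d}")
    case True
    have "\<bar>f x * W n x - f x * H x\<bar> = \<bar>f x\<bar> * \<bar>W n x - H x\<bar>" unfolding right_diff_distrib[symmetric] abs_mult ..
    also have "\<dots> \<le> F * (e / (2 * F))" using F n0[OF n True] by (intro mult_mono) auto
    also have "\<dots> = e / 2" using F(1) by simp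
    finally show ?thesis .
   qed (use f(2) e in simp)
  qed
  also have "\<dots> = e / 2" using prob_space by simp
  finally show ?thesis using e by simp
 qed
 thus "\<exists>no. \<forall>n\<ge>no. norm ((LINT x|\<mu>. f x * W n x) - (LINT x|\<mu>. f x * H x)) < e" by blast
qed

lemma ereal_scaled_SUP_tendsto_0:
 fixes E :: "nat \<Rightarrow> real \<Rightarrow> real"
 assumes K: "K \<noteq> {}" and \<rho>: "\<And>n. \<rho> n > 0"
  and small: "\<And>e. e > 0 \<Longrightarrow> \<forall>\<^sub>F n in sequentially. \<forall>x\<in>K. \<bar>E n x\<bar> \<le> e * \<rho> n"
 shows "(\<lambda>n. ereal (1 / \<rho> n) * (SUP x\<in>K. ereal \<bar>E n x\<bar>)) \<longlonglongrightarrow> 0"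
proof (rule order_tendstoI)
 have nn: "0 \<le> ereal (1 / \<rho> n) * (SUP x\<in>K. ereal \<bar>E n x\<bar>)" for n
 proof (rule ereal_0_le_mult)
  obtain c where c: "c \<in> K" using K by blast
  have "0 \<le> ereal \<bar>E n c\<bar>" by simp
  also have "\<dots> \<le> (SUP x\<in>K. ereal \<bar>E n x\<bar>)" by (rule SUP_upper[OF c])
  finally show "0 \<le> (SUP x\<in>K. ereal \<bar>E n x\<bar>)" .
  show "0 \<le> ereal (1 / \<rho> n)" using \<rho>[of n] by simp
 qed
 fix a :: ereal
 {
  assume "a < 0"
  thus "\<forall>\<^sub>F n in sequentially. a < ereal (1 / \<rho> n) * (SUP x\<in>K. ereal \<bar>E n x\<bar>)"
   using nn by (intro always_eventually allI) (rule less_le_trans)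
 next
  assume "0 < a"
  then obtain e where e: "0 < ereal e" "ereal e < a" using ereal_dense2 by blast
  show "\<forall>\<^sub>F n in sequentially. ereal (1 / \<rho> n) * (SUP x\<in>K. ereal \<bar>E n x\<bar>) < a" using small[of e]
  proof (rule eventually_mono)
   show "0 < e" using e by simp
   fix n assume n: "\<forall>x\<in>K. \<bar>E n x\<bar> \<le> e * \<rho> n"
   have "(SUP x\<in>K. ereal \<bar>E n x\<bar>) \<le> ereal (e * \<rho> n)" by (rule SUP_least) (use n in auto)
   hence "ereal (1 / \<rho> n) * (SUP x\<in>K. ereal \<bar>E n x\<bar>) \<le> ereal (1 / \<rho> n) * ereal (e * \<rho> n)"
    by (rule ereal_mult_left_mono) (use \<rho>[of n] in simp)
   also have "\<dots> = ereal e" using \<rho>[of n] by simp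
   finally show "ereal (1 / \<rho> n) * (SUP x\<in>K. ereal \<bar>E n x\<bar>) < a" using e(2) by simp
  qed
 }
qed

section \<open>The limit function as a quotient of densities\<close>

context periodic_jacobi
begin

text \<open>Since the \<open>\<alpha>\<close> are bounded below,
  \<open>a n / \<alpha> (int n)\<close> tends to 1. This is what allows \<open>\<rho> n\<close> to
  replace \<open>Suc n\<close> as normalisation of the kernel.\<close>

lemma ratio_average:
 assumes a: "\<And>n. a n > 0" and la: "(\<lambda>n. a n - \<alpha> (int n)) \<longlonglongrightarrow> 0"
 shows "(\<lambda>n. (\<Sum>j\<le>n. \<alpha> (int j) / a j) / real (Suc n)) \<longlonglongrightarrow> 1"
proof -
 define B where "B = (\<Sum>k<N. 1 / \<alpha> (int k))"
 have bd: "\<bar>1 / \<alpha> (int n)\<bar> \<le> B" for n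
 proof -
  have lt: "nat (int n mod int N) < N" using N by (simp add: nat_less_iff)
  have "1 / \<alpha> (int (nat (int n mod int N))) \<le> B" unfolding B_def using lt pos by (intro member_le_sum) (auto simp: less_imp_le)
  thus ?thesis using per_mod[OF per(1), of "int n"] pos[of "int n"] by (simp add: less_imp_le)
 qed
 have "(\<lambda>n. (a n - \<alpha> (int n)) * (1 / \<alpha> (int n)) + 1) \<longlonglongrightarrow> 0 + 1"
  by (intro tendsto_add tendsto_const Lim_null_mult_bounded[OF la bd])
 moreover have "(a n - \<alpha> (int n)) * (1 / \<alpha> (int n)) + 1 = a n / \<alpha> (int n)" for n
  using pos[of "int n"] by (simp add: field_simps)
 ultimately have "(\<lambda>n. a n / \<alpha> (int n)) \<longlonglongrightarrow> 1" by simp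
 hence "(\<lambda>n. inverse (a n / \<alpha> (int n))) \<longlonglongrightarrow> inverse 1" by (rule tendsto_inverse) simp
 hence "(\<lambda>n. \<alpha> (int n) / a n) \<longlonglongrightarrow> 1" by (simp add: inverse_eq_divide)
 hence "ulim (UNIV :: unit set) (\<lambda>n x. \<alpha> (int n) / a n) (\<lambda>x. 1)" by (rule ulim_constx)
 hence "uniform_limit (UNIV :: unit set) (\<lambda>n x. (\<Sum>k<n. \<alpha> (int k) / a k) / of_nat n) (\<lambda>x. 1) sequentially"
  by (rule uniform_cesaro) auto
 hence "(\<lambda>n. (\<Sum>k<n. \<alpha> (int k) / a k) / real n) \<longlonglongrightarrow> 1" by (rule tendsto_uniform_limitI) simp
 hence "(\<lambda>n. (\<Sum>k<Suc n. \<alpha> (int k) / a k) / real (Suc n)) \<longlonglongrightarrow> 1" by (rule LIMSEQ_Suc)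
 thus ?thesis by (simp only: lessThan_Suc_atMost)
qed

abbreviation "DP \<equiv> discr_poly \<alpha> \<beta> N :: real poly"
abbreviation "LP \<equiv> \<Prod>i<N. 1 / \<alpha> (int i)"

lemma poly_pderiv_discr: "poly (pderiv DP) x = dsum x"
proof -
 have "poly DP = (\<lambda>x. Dis x)" by (simp add: poly_discr_poly fun_eq_iff)
 hence "(poly DP has_field_derivative dsum x) (at x)" using discr_deriv[of x] by simp
 thus ?thesis using DERIV_unique[OF poly_DERIV] by blast
qed

lemma discriminant_poly: "discriminant_poly DP N LP"
proof
 show "N \<ge> 1" by (rule N)
 show "degree DP = N" by (rule degree_discr_poly)
 show "coeff DP N = LP" using coeff_discr_poly[where 'a = real] by simp
 show "LP > 0" using pos by (intro prod_pos) auto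
 show "card {x. poly DP x = 0} = N" using card_discr_zeros by (simp add: poly_discr_poly)
 show "poly (pderiv DP) x \<noteq> 0" if "\<bar>poly DP x\<bar> < 2" for x
  unfolding poly_pderiv_discr using that dsum_nonzero by (simp add: poly_discr_poly)
qed

sublocale DP: discriminant_poly DP N LP by (rule discriminant_poly)

lemma stieltjes_discr:
 "\<exists>Q. (AE x in DP.dos. \<bar>x\<bar> \<le> Q) \<and> (\<forall>z>Q. \<exists>\<nu>>1. Dis z = \<nu> + 1 / \<nu> \<and>
   (LINT x|DP.dos. 1 / (z - x)) = dsum z / (real N * (\<nu> - 1 / \<nu>)))"
proof -
 obtain R where R: "\<And>x. \<bar>poly DP x\<bar> \<le> 2 \<Longrightarrow> \<bar>x\<bar> \<le> R"
  "\<And>z \<nu>. z > R \<Longrightarrow> \<nu> > 1 \<Longrightarrow> poly DP z = \<nu> + 1 / \<nu> \<Longrightarrow> (LINT x|DP.dos. 1 / (z - x)) = poly (pderiv DP) z / (real N * (\<nu> - 1 / \<nu>))"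
  "\<And>z. z > R \<Longrightarrow> poly DP z > 2" using DP.stieltjes_dos by blast
 have "AE x in DP.dos. \<bar>x\<bar> \<le> R" using DP.AE_dos_Lam by eventually_elim (use R(1) in \<open>simp add: DP.Lam_def\<close>)
 moreover have "\<exists>\<nu>>1. Dis z = \<nu> + 1 / \<nu> \<and> (LINT x|DP.dos. 1 / (z - x)) = dsum z / (real N * (\<nu> - 1 / \<nu>))"
  if z: "z > R" for z
 proof -
  define \<Delta> where "\<Delta> = poly DP z"
  have D: "\<Delta> > 2" unfolding \<Delta>_def by (rule R(3)[OF z])
  have "\<Delta>^2 > 2^2" using D by (intro power_strict_mono) auto
  then obtain s where s: "s^2 = \<Delta>^2 - 4" "s > 0" using that[of "sqrt (\<Delta>^2 - 4)"] by simp
  define \<nu> where "\<nu> = (\<Delta> + s) / 2"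
  have nu: "\<nu> > 1" using D s(2) by (simp add: \<nu>_def)
  have "4 * (\<nu>^2 - \<Delta> * \<nu> + 1) = s^2 - \<Delta>^2 + 4" by (simp add: \<nu>_def power2_eq_square field_simps)
  hence "\<nu>^2 - \<Delta> * \<nu> + 1 = 0" using s(1) by simp
  hence "\<Delta> = \<nu> + 1 / \<nu>" using nu by (simp add: field_simps power2_eq_square)
  thus ?thesis using R(2)[OF z nu] nu by (auto simp: \<Delta>_def poly_discr_poly poly_pderiv_discr)
 qed
 ultimately show ?thesis by blast
qed

text \<open>The measures \<open>CD_kernel / Suc n\<close> times \<open>\<mu>\<close> converge weakly
  to the density of states, while near \<open>{c..d}\<close> the factor converges uniformly to
  \<open>H0\<close>. Locally \<open>H0\<close> times \<open>\<mu>\<close> is therefore the density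
  of states, and \<open>H0 > 0\<close> permits division.\<close>

lemma density_quotient:
 assumes a: "\<And>n. a n > 0" and la: "(\<lambda>n. a n - \<alpha> (int n)) \<longlonglongrightarrow> 0" and lb: "(\<lambda>n. b n - \<beta> (int n)) \<longlonglongrightarrow> 0"
  and mu: "orthonormality_measure a b \<mu>"
  and cd: "c' < c" "c < d" "d < d'" and sub: "{c..d} \<subseteq> DP.Lam"
  and ul: "uniform_limit {c'..d'} (\<lambda>n x. CD_kernel a b n x x / real (Suc n)) H0 sequentially"
  and H0: "\<And>x. x \<in> {c'..d'} \<Longrightarrow> H0 x > 0"
 shows "is_continuous_density \<mu> {c..d} (\<lambda>x. DP.dos_density x / H0 x)"
proof -
 have mup: "prob_space \<mu>" "sets \<mu> = sets borel" using mu by (auto simp: orthonormality_measure_def)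
 interpret P: prob_space DP.dos by (rule DP.prob_dos)
 have CDc: "continuous_on T (\<lambda>x. CD_kernel a b n x x / real (Suc n))" for n T
  unfolding CD_kernel_def by (intro continuous_intros continuous_orth_poly) auto
 have H0c: "continuous_on {c'..d'} H0" by (rule uniform_limit_theorem[OF _ ul]) (use CDc in auto)
 \<comment> \<open>Clamping to \<open>{c'..d'}\<close> extends \<open>H0\<close> to a positive
   bounded continuous function on the whole line without changing it on the interval.\<close>
 define cl where "cl = (\<lambda>x. max c' (min d' x))"
 have cl: "cl x \<in> {c'..d'}" for x using cd by (auto simp: cl_def)
 have cl_id: "cl x = x" if "x \<in> {c'..d'}" for x using that by (auto simp: cl_def)
 define H where "H = (\<lambda>x. H0 (cl x))"
 have Hc: "continuous_on UNIV H"
  unfolding H_def by (rule continuous_on_compose2[OF H0c]) (use cl in \<open>auto simp: cl_def intro!: continuous_intros\<close>)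
 have Hp: "H x > 0" for x unfolding H_def by (rule H0[OF cl])
 have "bounded (H0 ` {c'..d'})" by (intro compact_imp_bounded compact_continuous_image H0c) auto
 then obtain C where "\<forall>y\<in>H0 ` {c'..d'}. norm y \<le> C" unfolding bounded_iff by blast
 hence HC: "\<bar>H x\<bar> \<le> C" for x using cl[of x] by (simp add: H_def)
 have HC': "H x \<le> C" for x using HC[of x] by linarith
 have ulH: "uniform_limit {c'..d'} (\<lambda>n x. CD_kernel a b n x x / real (Suc n)) H sequentially"
  using ul by (rule uniform_limit_cong'[THEN iffD1, rotated 2]) (auto simp: H_def cl_id)
 obtain Q where Q: "AE x in DP.dos. \<bar>x\<bar> \<le> Q" "\<And>z. z > Q \<Longrightarrow> \<exists>\<nu>>1. Dis z = \<nu> + 1 / \<nu> \<and>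
   (LINT x|DP.dos. 1 / (z - x)) = dsum z / (real N * (\<nu> - 1 / \<nu>))" using stieltjes_discr by blast
 have eq: "(LINT x|\<mu>. f x * H x) = (LINT x|DP.dos. f x)" if f: "continuous_on UNIV f" "\<And>x. x \<notin> {c'..d'} \<Longrightarrow> f x = 0" for f
 proof -
  note wl = CD_weak_limit[OF a la lb mu DP.prob_dos DP.sets_dos Q(1) Q(2) f(1)]
  have "(\<lambda>n. LINT x|\<mu>. f x * (CD_kernel a b n x x / real (Suc n))) \<longlonglongrightarrow> (LINT x|\<mu>. f x * H x)"
   by (rule uniform_limit_integral[OF mup ulH Hc HC f]) (assumption | rule wl(2))+
  thus ?thesis using LIMSEQ_unique wl(1) by blast
 qed
 have dp: "measure DP.dos {c..d} > 0"
 proof (rule ccontr)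
  assume "\<not> measure DP.dos {c..d} > 0"
  hence "emeasure DP.dos {c..d} = 0" using measure_nonneg[of DP.dos "{c..d}"] by (simp add: P.emeasure_eq_measure)
  hence "(\<integral>\<^sup>+x. ennreal (DP.dos_density x) * indicator {c..d} x \<partial>lborel) = 0"
   unfolding DP.dos_def by (subst (asm) emeasure_density) auto
  hence "AE x in lborel. ennreal (DP.dos_density x) * indicator {c..d} x = 0" by (subst (asm) nn_integral_0_iff_AE) auto
  hence "AE x in lborel. x \<notin> {c..d}"
  proof eventually_elim
   case (elim x)
   show ?case
   proof
    assume "x \<in> {c..d}"
    thus False using elim DP.dos_density_pos[of x] sub by (auto simp: ennreal_eq_0_iff)
   qed
  qed
  hence "emeasure lborel {c..d} = 0" by (subst (asm) AE_iff_null_sets[symmetric]) auto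
  thus False using cd by (simp add: emeasure_lborel_Icc)
 qed
 have loc: "(\<integral>\<^sup>+x. ennreal (H x) * indicator B x \<partial>\<mu>) = (\<integral>\<^sup>+x. ennreal (DP.dos_density x) * indicator B x \<partial>lborel)"
  if B: "B \<in> sets borel" "B \<subseteq> {c..d}" for B
 proof -
  have "(\<integral>\<^sup>+x. ennreal (H x) * indicator B x \<partial>\<mu>) = emeasure DP.dos B"
   by (rule localized_density[OF mup DP.prob_dos DP.sets_dos cd Hc Hp HC' eq dp B])
  also have "\<dots> = (\<integral>\<^sup>+x. ennreal (DP.dos_density x) * indicator B x \<partial>lborel)"
   unfolding DP.dos_def using B(1) by (subst emeasure_density) auto
  finally show ?thesis .
 qed
 have Hm: "H \<in> borel_measurable borel" by (rule borel_measurable_continuous_onI[OF Hc])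
 have K2: "x \<in> {c'..d'}" if "x \<in> {c..d}" for x using that cd by auto
 show ?thesis unfolding is_continuous_density_def
 proof (intro conjI ballI impI)
  show "continuous_on {c..d} (\<lambda>x. DP.dos_density x / H0 x)"
  proof (intro continuous_on_divide)
   show "continuous_on {c..d} DP.dos_density" using DP.isCont_dos_density sub by (intro continuous_at_imp_continuous_on) auto
   show "continuous_on {c..d} H0" by (rule continuous_on_subset[OF H0c]) (use K2 in blast)
   show "\<forall>x\<in>{c..d}. H0 x \<noteq> 0" using H0 K2 by (metis less_irrefl)
  qed
  show "DP.dos_density x / H0 x \<ge> 0" if "x \<in> {c..d}" for x using H0[OF K2[OF that]] by simp
  fix B :: "real set" assume B: "B \<in> sets borel" "B \<subseteq> {c..d}"
  have "emeasure \<mu> B = (\<integral>\<^sup>+x. ennreal (DP.dos_density x / H x) * indicator B x \<partial>lborel)"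
   by (rule density_divide[OF mup(2) Hm Hp _ _ loc B]) auto
  also have "\<dots> = (\<integral>\<^sup>+x\<in>B. ennreal (DP.dos_density x / H0 x) \<partial>lborel)"
   by (rule nn_integral_cong) (use B(2) K2 cl_id in \<open>auto simp: H_def split: split_indicator\<close>)
  finally show "emeasure \<mu> B = (\<integral>\<^sup>+x\<in>B. ennreal (DP.dos_density x / H0 x) \<partial>lborel)" .
 qed
qed

end

theorem theorem4p7:
  fixes N r :: nat
    and a b :: "nat \<Rightarrow> real"
    and \<alpha> \<beta> :: "int \<Rightarrow> real"
    and \<mu> \<omega> :: "real measure"
    and K \<Lambda> F :: "real set"
    and \<rho> :: "nat \<Rightarrow> real"
    and \<mu>' \<omega>' :: "real \<Rightarrow> real"
  assumes "N \<ge> 1"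
    and "\<And>n. a n > 0"
    and "asymptotically_periodic N a b \<alpha> \<beta>"
    and "r \<ge> 1"
    and "\<And>i. i < N \<Longrightarrow> (\<lambda>k. a (Suc k * N + i - 1) / a (Suc k * N + i)) \<in> stolz_class r"
    and "\<And>i. i < N \<Longrightarrow> (\<lambda>k. b (Suc k * N + i) / a (Suc k * N + i)) \<in> stolz_class r"
    and "\<And>i. i < N \<Longrightarrow> (\<lambda>k. 1 / a (Suc k * N + i)) \<in> stolz_class r"
    and "orthonormality_measure a b \<mu>"
    and "\<Lambda> = {x. \<bar>trace (transfer_prod \<alpha> \<beta> N 0 x)\<bar> < 2}"
    and "\<exists>c d. c < d \<and> K = {c..d}"
    and "K \<subseteq> \<Lambda>"
    and "F = essential_spectrum (jacobi_matrix (\<lambda>n. \<alpha> (int n)) (\<lambda>n. \<beta> (int n)))"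
    and "equilibrium_measure F \<omega>"
    and "\<mu>' = continuous_density \<mu> K"
    and "\<omega>' = continuous_density \<omega> (interior F)"
    and "\<And>n. \<rho> n = (\<Sum>j\<le>n. \<alpha> (int j) / a j)"
  shows "\<exists>E :: nat \<Rightarrow> real \<Rightarrow> real.
     (\<forall>n. \<forall>x\<in>K. CD_kernel a b n x x = \<omega>' x / \<mu>' x * \<rho> n + E n x) \<and>
     (\<lambda>n. ereal (1 / \<rho> n) * (SUP x\<in>K. ereal \<bar>E n x\<bar>)) \<longlonglongrightarrow> 0"
proof -
 have per: "periodic_seq N \<alpha>" "periodic_seq N \<beta>" "\<And>n. \<alpha> n > 0"
  and la: "(\<lambda>n. a n - \<alpha> (int n)) \<longlonglongrightarrow> 0" and lb: "(\<lambda>n. b n - \<beta> (int n)) \<longlonglongrightarrow> 0"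
  using assms(3) by (auto simp: asymptotically_periodic_def tendsto_rabs_zero_iff)
 interpret periodic_jacobi N \<alpha> \<beta> by unfold_locales (use assms(1) per in auto)
 have Lam: "\<Lambda> = DP.Lam" unfolding assms(9) DP.Lam_def trace_transfer_prod poly_discr_poly ..
 obtain c d where cd: "c < d" "K = {c..d}" using assms(10) by blast
 have KL: "K \<subseteq> DP.Lam" using assms(11) Lam by simp
 \<comment> \<open>The margin on both sides of \<open>K\<close> leaves room for the bump in
   \<open>localized_density\<close>; it exists because \<open>\<Lambda>\<close> is open.\<close>
 obtain c' d' where cd': "c' < c" "d < d'" "{c'..d'} \<subseteq> DP.Lam"
 proof -
  have "c \<in> DP.Lam" "d \<in> DP.Lam" using KL cd by auto
  then obtain e1 e2 where e: "e1 > 0" "ball c e1 \<subseteq> DP.Lam" "e2 > 0" "ball d e2 \<subseteq> DP.Lam"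
   using DP.open_Lam unfolding open_contains_ball by blast
  have "{c - e1 / 2..d + e2 / 2} \<subseteq> DP.Lam"
  proof
   fix x assume x: "x \<in> {c - e1 / 2..d + e2 / 2}"
   consider "x < c" | "x \<in> {c..d}" | "x > d" by force
   thus "x \<in> DP.Lam"
   proof cases
    case 1
    hence "x \<in> ball c e1" using x e(1) by (auto simp: dist_real_def)
    thus ?thesis using e(2) by blast
   next
    case 2
    thus ?thesis using KL cd by blast
   next
    case 3
    hence "x \<in> ball d e2" using x e(3) by (auto simp: dist_real_def)
    thus ?thesis using e(4) by blast
   qed
  qed
  thus thesis using that[of "c - e1 / 2" "d + e2 / 2"] e by simp
 qed
 have cK: "compact {c'..d'}" "\<And>x. x \<in> {c'..d'} \<Longrightarrow> \<bar>trace (transfer_prod \<alpha> \<beta> N 0 x)\<bar> < 2"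
  using cd'(3) Lam assms(9) by auto
 obtain H where H: "uniform_limit {c'..d'} (\<lambda>n x. CD_kernel a b n x x / real (Suc n)) H sequentially"
  "\<And>x. x \<in> {c'..d'} \<Longrightarrow> H x > 0" by (rule CD_kernel_uniform_limit[OF assms(1-7) cK]) auto
 have K2: "{c..d} \<subseteq> {c'..d'}" using cd' by auto
 obtain V where V: "finite V" "closure {x. \<bar>discr \<alpha> \<beta> N 0 (x::real)\<bar> < 2} \<subseteq> F" "F \<subseteq> {x. \<bar>discr \<alpha> \<beta> N 0 x\<bar> \<le> 2} \<union> V"
  unfolding assms(12) by (rule essential_spectrum_bounds)
 have F: "DP.Lam \<subseteq> F" "F \<subseteq> {x. \<bar>poly DP x\<bar> \<le> 2} \<union> V"
 proof -
  have "DP.Lam = {x. \<bar>discr \<alpha> \<beta> N 0 (x::real)\<bar> < 2}" by (simp add: DP.Lam_def poly_discr_poly)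
  thus "DP.Lam \<subseteq> F" using order_trans[OF closure_subset V(2)] by simp
  show "F \<subseteq> {x. \<bar>poly DP x\<bar> \<le> 2} \<union> V" using V(3) by (simp add: poly_discr_poly)
 qed
 have om: "\<omega> = DP.dos" by (rule DP.equilibrium_unique[OF F V(1) assms(13)])
 obtain f where f: "is_continuous_density DP.dos (interior F) f" "\<And>x. x \<in> DP.Lam \<Longrightarrow> f x = DP.dos_density x"
  using DP.dos_continuous_density[OF F V(1)] by blast
 have KF: "{c..d} \<subseteq> interior F" using KL cd(2) F(1) DP.open_Lam interior_maximal by blast
 \<comment> \<open>\<open>continuous_density\<close> is a choice, so a witness must be exhibited
   before anything can be said about it. The same is done for \<open>\<mu>'\<close> below, and on
   \<open>K\<close> uniqueness makes each choice agree with its witness.\<close>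
 have "is_continuous_density DP.dos (interior F) \<omega>'" unfolding assms(15) om continuous_density_def
  by (rule someI[where P = "is_continuous_density DP.dos (interior F)", OF f(1)])
 note od = this
 have om': "\<omega>' x = DP.dos_density x" if "x \<in> K" for x
 proof -
  have "\<omega>' x = f x" by (rule continuous_density_unique[OF od f(1) cd(1) KF KF]) (use that cd(2) in simp)
  thus ?thesis using f(2) KL that by auto
 qed
 have mq: "is_continuous_density \<mu> K (\<lambda>x. DP.dos_density x / H x)"
  unfolding cd(2) by (rule density_quotient[OF assms(2) la lb assms(8) cd'(1) cd(1) cd'(2) _ H]) (use KL cd(2) in auto)
 have md: "is_continuous_density \<mu> K \<mu>'" unfolding assms(14) continuous_density_def
  by (rule someI[where P = "is_continuous_density \<mu> K", OF mq])
 have mu': "\<mu>' x = DP.dos_density x / H x" if "x \<in> K" for x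
  by (rule continuous_density_unique[OF md mq cd(1)]) (use cd(2) that in auto)
 \<comment> \<open>The density of states is positive on \<open>K\<close> and cancels; otherwise the
   quotient would be zero by convention.\<close>
 have quot: "\<omega>' x / \<mu>' x = H x" if "x \<in> K" for x
 proof -
  have "DP.dos_density x > 0" using KL that by (intro DP.dos_density_pos) auto
  moreover have "H x > 0" using that cd(2) K2 by (intro H(2)) auto
  ultimately show ?thesis using om'[OF that] mu'[OF that] by simp
 qed
 have rho: "\<rho> n > 0" for n unfolding assms(16) using assms(2) pos by (intro sum_pos) auto
 have rlim: "(\<lambda>n. \<rho> n / real (Suc n)) \<longlonglongrightarrow> 1" unfolding assms(16) by (rule ratio_average[OF assms(2) la])
 have "(\<lambda>n. inverse (\<rho> n / real (Suc n))) \<longlonglongrightarrow> inverse 1" by (intro tendsto_inverse rlim) simp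
 hence rlim': "(\<lambda>n. real (Suc n) / \<rho> n) \<longlonglongrightarrow> 1" by (simp add: inverse_eq_divide)
 have ulK: "uniform_limit K (\<lambda>n x. CD_kernel a b n x x / real (Suc n)) H sequentially"
  using H(1) K2 unfolding cd(2) by (rule uniform_limit_on_subset)
 have CDc: "continuous_on T (\<lambda>x. CD_kernel a b n x x / real (Suc n))" for n T
  unfolding CD_kernel_def by (intro continuous_intros continuous_orth_poly) auto
 have "continuous_on K H" by (rule uniform_limit_theorem[OF _ ulK]) (use CDc in auto)
 hence "bounded (H ` K)" unfolding cd(2) by (intro compact_imp_bounded compact_continuous_image) auto
 hence "ulim K (\<lambda>n x. CD_kernel a b n x x / real (Suc n)) H" using ulK by (simp add: ulim_def)
 hence "ulim K (\<lambda>n x. CD_kernel a b n x x / real (Suc n) * (real (Suc n) / \<rho> n)) (\<lambda>x. H x * 1)"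
  by (rule ulim_mult) (rule ulim_constx[OF rlim'])
 hence ul: "uniform_limit K (\<lambda>n x. CD_kernel a b n x x / \<rho> n) H sequentially" by (simp add: ulim_def)
 define E where "E = (\<lambda>n x. CD_kernel a b n x x - \<omega>' x / \<mu>' x * \<rho> n)"
 have "(\<lambda>n. ereal (1 / \<rho> n) * (SUP x\<in>K. ereal \<bar>E n x\<bar>)) \<longlonglongrightarrow> 0"
 proof (rule ereal_scaled_SUP_tendsto_0)
  show "K \<noteq> {}" using cd by simp
  show "\<rho> n > 0" for n by (rule rho)
  fix e :: real assume e: "e > 0"
  have "\<forall>\<^sub>F n in sequentially. \<forall>x\<in>K. dist (CD_kernel a b n x x / \<rho> n) (H x) < e"
   using ul e unfolding uniform_limit_iff by blast
  thus "\<forall>\<^sub>F n in sequentially. \<forall>x\<in>K. \<bar>E n x\<bar> \<le> e * \<rho> n"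
  proof eventually_elim
   case (elim n)
   show ?case
   proof
    fix x assume x: "x \<in> K"
    have "E n x = (CD_kernel a b n x x / \<rho> n - H x) * \<rho> n"
     unfolding E_def quot[OF x] using rho[of n] by (simp add: left_diff_distrib)
    hence "\<bar>E n x\<bar> = \<bar>CD_kernel a b n x x / \<rho> n - H x\<bar> * \<rho> n" using rho[of n] by (simp add: abs_mult)
    also have "\<dots> \<le> e * \<rho> n" using elim x rho[of n] by (intro mult_right_mono) (auto simp: dist_real_def less_imp_le)
    finally show "\<bar>E n x\<bar> \<le> e * \<rho> n" .
   qed
  qed
 qed
 thus ?thesis by (intro exI[of _ E]) (simp add: E_def)
qed

end
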